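(* Let $\phi:\mathbb{C}\to[-\infty,\infty)$ be a radial subharmonic function whose Laplacian $\nu=\Delta\phi$ is a doubling measure with $\nu(\mathbb{C})=+\infty$. Let $\rho=\rho_\phi$ be the associated radius function, and let $\Lambda_\phi^M$ be the associated hybrid (mixed) point process. Then $$\mathbb{P}\bigl(\Lambda_\phi^M\ \text{is separated}\bigr)=\begin{cases}1 & \text{if } \displaystyle\int_{\mathbb{C}}\frac{dm(z)}{\rho^4(z)}<+\infty,\\[2mm] 0 & \text{if } \displaystyle\int_{\mathbb{C}}\frac{dm(z)}{\rho^4(z)}=+\infty.\end{cases}$$
   Context: $m$ denotes Lebesgue measure on $\mathbb{C}$ and $D(z,r)$ the open disk with center $z$ and radius $r$. The measure $\nu=\Delta\phi$ (distributional Laplacian, a nonzero positive locally finite measure) is doubling if there is $C>0$ with $\nu(D(z,2r))\le C\,\nu(D(z,r))$ for all $z\in\mathbb{C}$, $r>0$. Radius function: for $z\in\mathbb{C}$, $\rho(z)=\rho_\phi(z)>0$ is the radius such that $\nu(D(z,\rho(z)))=1$. Fock space: let $d\mu_\phi(z)=e^{-2\phi(z)}\frac{dm(z)}{\rho^2(z)}$ and let $\mathcal{F}_\phi$ be the space of entire functions $f$ with $\int_{\mathbb{C}}|f|^2\,d\mu_\phi<\infty$, with the inner product of $L^2(\mu_\phi)$. It is a reproducing kernel Hilbert space; its reproducing kernel is denoted $K_\phi(z,\zeta)$. Determinantal process: $\Lambda_\phi=\{\lambda_k\}_{k\ge1}$ is the (simple) determinantal point process in $\mathbb{C}$ with kernel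 $K_\phi$ and background measure $\mu_\phi$, i.e. for all $n$ and all pairwise disjoint bounded Borel sets $B_1,\dots,B_n\subset\mathbb{C}$, $$\mathbb{E}\Bigl[\prod_{k=1}^n\#(B_k\cap\Lambda_\phi)\Bigr]=\int_{B_1}\cdots\int_{B_n}\det\bigl(K_\phi(z_i,z_j)\bigr)_{1\le i,j\le n}\,d\mu_\phi(z_1)\cdots d\mu_\phi(z_n).$$ Hybrid process: $\Lambda_\phi^M=\{|\lambda_k|e^{i\theta_k}\}_{k\ge1}$, where $\{\lambda_k\}_{k\ge1}=\Lambda_\phi$ and the $\theta_k$ are i.i.d. uniform on $[0,2\pi)$, independent of $\Lambda_\phi$. A sequence $\{\lambda_k\}_{k\ge1}\subset\mathbb{C}$ is separated if $\inf_{j\ne k}|\lambda_k-\lambda_j|>0$. *)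

theory Defs
  imports
    "HOL-Probability.Probability"
    "Jordan_Normal_Form.Determinant"
begin

definition radial :: "(complex \<Rightarrow> 'a) \<Rightarrow> bool" where
  "radial f \<longleftrightarrow> (\<forall>z w. cmod z = cmod w \<longrightarrow> f z = f w)"

text \<open>The extended mean over a circle, positive part minus negative part
  (\<^const>\<open>e2ennreal\<close> sends negative numbers to 0).
  For an upper semicontinuous function with values in \<open>[-\<infinity>, \<infinity>)\<close> the positive part is bounded
  on the circle, so the difference is never \<open>\<infinity> - \<infinity>\<close>.\<close>

definition circle_mean :: "(complex \<Rightarrow> ereal) \<Rightarrow> complex \<Rightarrow> real \<Rightarrow> ereal" where
  "circle_mean \<phi> z r =
     (let C = (\<lambda>t. z + of_real r * cis t); U = uniform_measure lborel {0..<2 * pi}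
      in enn2ereal (\<integral>\<^sup>+ t. e2ennreal (\<phi> (C t)) \<partial>U) - enn2ereal (\<integral>\<^sup>+ t. e2ennreal (- \<phi> (C t)) \<partial>U))"

definition subharmonic :: "(complex \<Rightarrow> ereal) \<Rightarrow> bool" where
  "subharmonic \<phi> \<longleftrightarrow>
     (\<forall>z. \<phi> z < \<infinity>) \<and> (\<exists>z. \<phi> z \<noteq> - \<infinity>) \<and>
     (\<forall>a. open {z. \<phi> z < a}) \<and>
     (\<forall>z. \<forall>r>0. \<phi> z \<le> circle_mean \<phi> z r)"

definition partial_x :: "(complex \<Rightarrow> real) \<Rightarrow> complex \<Rightarrow> real" where
  "partial_x \<psi> z = deriv (\<lambda>t. \<psi> (z + of_real t)) 0"

definition partial_y :: "(complex \<Rightarrow> real) \<Rightarrow> complex \<Rightarrow> real" where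
  "partial_y \<psi> z = deriv (\<lambda>t. \<psi> (z + \<i> * of_real t)) 0"

definition laplacian :: "(complex \<Rightarrow> real) \<Rightarrow> complex \<Rightarrow> real" where
  "laplacian \<psi> z = partial_x (partial_x \<psi>) z + partial_y (partial_y \<psi>) z"

text \<open>Being \<open>k\<close> times differentiable; as \<open>k\<close> is arbitrary in \<open>test_function\<close>,
  continuity of the partial derivatives need not be demanded separately.\<close>

primrec times_differentiable :: "nat \<Rightarrow> (complex \<Rightarrow> real) \<Rightarrow> bool" where
  "times_differentiable 0 \<psi> \<longleftrightarrow> True"
| "times_differentiable (Suc k) \<psi> \<longleftrightarrow>
     (\<forall>z. \<psi> differentiable (at z)) \<and>
     times_differentiable k (partial_x \<psi>) \<and> times_differentiable k (partial_y \<psi>)"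

definition test_function :: "(complex \<Rightarrow> real) \<Rightarrow> bool" where
  "test_function \<psi> \<longleftrightarrow> (\<forall>k. times_differentiable k \<psi>) \<and> compact (closure {z. \<psi> z \<noteq> 0})"

definition locally_finite_borel_measure :: "complex measure \<Rightarrow> bool" where
  "locally_finite_borel_measure \<nu> \<longleftrightarrow>
     sets \<nu> = sets borel \<and> (\<forall>K. compact K \<longrightarrow> emeasure \<nu> K < \<infinity>)"

text \<open>\<open>\<nu> = \<Delta>\<phi>\<close> in the sense of distributions, without a normalising factor \<open>1 / (2\<pi>)\<close>.
  A subharmonic function is \<open>-\<infinity>\<close> only on a null set and is locally integrable, so neither the
  value of \<^const>\<open>real_of_ereal\<close> at \<open>-\<infinity>\<close> nor that of the integral of a non-integrable
  function plays a role.\<close>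

definition distributional_laplacian :: "(complex \<Rightarrow> ereal) \<Rightarrow> complex measure \<Rightarrow> bool" where
  "distributional_laplacian \<phi> \<nu> \<longleftrightarrow>
     locally_finite_borel_measure \<nu> \<and>
     (\<forall>\<psi>. test_function \<psi> \<longrightarrow>
        (LINT z|\<nu>. \<psi> z) = (LINT z|lborel. real_of_ereal (\<phi> z) * laplacian \<psi> z))"

definition doubling :: "complex measure \<Rightarrow> bool" where
  "doubling \<nu> \<longleftrightarrow>
     locally_finite_borel_measure \<nu> \<and> emeasure \<nu> UNIV \<noteq> 0 \<and>
     (\<exists>C>0. \<forall>z. \<forall>r>0. emeasure \<nu> (ball z (2 * r)) \<le> ennreal C * emeasure \<nu> (ball z r))"

text \<open>A doubling measure gives positive mass to every disk and none to any circle, so when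
  moreover its total mass is infinite there is exactly one such radius at every point.\<close>

definition radius_function :: "complex measure \<Rightarrow> complex \<Rightarrow> real" where
  "radius_function \<nu> z = (THE r. r > 0 \<and> emeasure \<nu> (ball z r) = 1)"

definition exp_minus_twice :: "ereal \<Rightarrow> ennreal" where
  "exp_minus_twice x =
     (if x = - \<infinity> then \<infinity> else if x = \<infinity> then 0 else ennreal (exp (- 2 * real_of_ereal x)))"

definition fock_measure :: "(complex \<Rightarrow> ereal) \<Rightarrow> (complex \<Rightarrow> real) \<Rightarrow> complex measure" where
  "fock_measure \<phi> \<rho> = density lborel (\<lambda>z. exp_minus_twice (\<phi> z) * ennreal (1 / (\<rho> z)\<^sup>2))"

definition fock_space :: "complex measure \<Rightarrow> (complex \<Rightarrow> complex) set" where
  "fock_space \<mu> = {f. f holomorphic_on UNIV \<and> (\<integral>\<^sup>+ z. ennreal ((cmod (f z))\<^sup>2) \<partial>\<mu>) < \<infinity>}"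

definition reproducing_kernel ::
  "(complex \<Rightarrow> complex) set \<Rightarrow> complex measure \<Rightarrow> (complex \<Rightarrow> complex \<Rightarrow> complex) \<Rightarrow> bool" where
  "reproducing_kernel F \<mu> K \<longleftrightarrow>
     (\<forall>\<zeta>. (\<lambda>z. K z \<zeta>) \<in> F \<and> (\<forall>f\<in>F. f \<zeta> = (LINT z|\<mu>. f z * cnj (K z \<zeta>))))"

definition num_points :: "(nat \<Rightarrow> 'a \<Rightarrow> complex) \<Rightarrow> complex set \<Rightarrow> 'a \<Rightarrow> ennreal" where
  "num_points X B \<omega> = emeasure (count_space UNIV) {k. X k \<omega> \<in> B}"

text \<open>A point process is given by a measurable enumeration of its points, indexed from 0; it is
  simple if almost surely no point is repeated. The kernel is meant to be a reproducing kernel,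
  hence Hermitian and positive semidefinite, so that the determinants are nonnegative reals and
  nothing is lost in \<open>ennreal (Re _)\<close>. The \<open>n\<close> points are numbered from 0 to \<open>n - 1\<close>.\<close>

definition determinantal_process ::
  "'a measure \<Rightarrow> (nat \<Rightarrow> 'a \<Rightarrow> complex) \<Rightarrow> (complex \<Rightarrow> complex \<Rightarrow> complex) \<Rightarrow> complex measure \<Rightarrow> bool"
where
  "determinantal_process M X K \<mu> \<longleftrightarrow>
     (\<forall>k. X k \<in> borel_measurable M) \<and>
     (AE \<omega> in M. inj (\<lambda>k. X k \<omega>)) \<and>
     (\<forall>n B. (\<forall>i<n. B i \<in> sets borel \<and> bounded (B i)) \<and> disjoint_family_on B {..<n} \<longrightarrow>
        (\<integral>\<^sup>+ \<omega>. (\<Prod>i<n. num_points X (B i) \<omega>) \<partial>M) =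
        (\<integral>\<^sup>+ z \<in> PiE {..<n} B.
           ennreal (Re (Determinant.det (Matrix.mat n n (\<lambda>(i, j). K (z i) (z j)))))
           \<partial>PiM {..<n} (\<lambda>_. \<mu>)))"

definition iid_uniform_angles :: "'a measure \<Rightarrow> (nat \<Rightarrow> 'a \<Rightarrow> real) \<Rightarrow> bool" where
  "iid_uniform_angles M \<theta> \<longleftrightarrow>
     prob_space.indep_vars M (\<lambda>_. borel) \<theta> UNIV \<and>
     (\<forall>k. distr M borel (\<theta> k) = uniform_measure lborel {0..<2 * pi})"

definition independent_sequences ::
  "'a measure \<Rightarrow> (nat \<Rightarrow> 'a \<Rightarrow> complex) \<Rightarrow> (nat \<Rightarrow> 'a \<Rightarrow> real) \<Rightarrow> bool" where
  "independent_sequences M X \<theta> \<longleftrightarrow>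
     prob_space.indep_var M (PiM UNIV (\<lambda>_. borel)) (\<lambda>\<omega> k. X k \<omega>) (PiM UNIV (\<lambda>_. borel)) (\<lambda>\<omega> k. \<theta> k \<omega>)"

definition hybrid :: "(nat \<Rightarrow> 'a \<Rightarrow> complex) \<Rightarrow> (nat \<Rightarrow> 'a \<Rightarrow> real) \<Rightarrow> nat \<Rightarrow> 'a \<Rightarrow> complex" where
  "hybrid X \<theta> k \<omega> = of_real (cmod (X k \<omega>)) * cis (\<theta> k \<omega>)"

definition separated :: "(nat \<Rightarrow> complex) \<Rightarrow> bool" where
  "separated s \<longleftrightarrow> (INF (j, k) \<in> {(j, k). j \<noteq> k}. cmod (s k - s j)) > 0"

end

theory Submission
  imports Defs "HOL-Complex_Analysis.Complex_Analysis" "HOL-Real_Asymp.Real_Asymp"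
begin

text \<open>Averaging the Laplacian over circles shows that \<open>\<nu>\<close> is radial and that
  \<open>\<phi>(z) = U(|z|)\<close> almost everywhere, where \<open>t \<mapsto> U (exp t)\<close> is convex with
  slope \<open>\<nu>(D(0, exp t)) / (2\<pi>)\<close>. Hence the monomials are orthogonal, \<open>K(z, w)\<close> is the series
  of \<open>(z cnj w)\<^sup>k / c\<^sub>k\<close> with \<open>c\<^sub>k = \<integral> |z|\<^bsup>2k\<^esup> d\<mu>\<close>, and doubling localises the \<open>k\<close>-th term near
  the circle where the slope is \<open>k\<close>. So \<open>K(z, z) exp (-2\<phi>(z))\<close> is comparable to \<open>1\<close> for large
  \<open>z\<close>, and a thin annulus of radius \<open>b\<close> and width \<open>w\<close> contains about \<open>w b / \<rho>(b)\<^sup>2\<close> points.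

  After resampling the angles two points of the annulus collide at scale \<open>w\<close> with probability
  about \<open>w / b\<close>. If \<open>\<integral> \<rho>\<^bsup>-4\<^esup>\<close> is finite, the expected number of pairs at distance at most \<open>1\<close> is
  finite, since by Cauchy-Schwarz an annulus of width \<open>2\<close> contributes at most its share of the
  integral; Borel-Cantelli leaves finitely many close pairs.
  If the integral is infinite, the expected number of collisions in finitely many annuli is
  unbounded for every scale. The collision events of distinct pairs are pairwise independent given
  the moduli, and the factorial moments of the process are dominated by products of moments of
  lower order, so the second moment method makes collisions almost sure at every scale.\<close>

text \<open>Closeness is discretised in two ways. Finiteness of close pairs only needs an event
  containing them, so \<open>near\<close> admits the same or an adjacent arc. Almost sure collisions
  need an event contained in closeness with exactly known probabilities; lying in one arc has the
  product probability even for two pairs sharing a point. The obstacle is that the number of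
  available pairs is itself random. The second moment bound given the moduli is therefore centred at
  the unconditional mean: it is then a quadratic polynomial in the random count and can be
  integrated, which costs factorial moments up to order four. On rotation-invariant sets the kernel
  is diagonal in the monomials, so that these moments are limits of sums over distinct modes of
  products of eigenvalues \<open>a k B\<close>; dropping distinctness constraints gives all upper
  bounds. The local estimates hold for annuli thinner than \<open>R b / 2\<close>, although
  \<open>R\<close> may come near 0 far out; there a single annulus already yields enough collisions.
  The potential is studied in s = |z|^2: the Laplacian of g(s) is 4 (s g')' and area has constant
  density, so the centre of symmetry causes no singularity.\<close>

no_notation Matrix.scalar_prod (infix "\<bullet>" 70)
no_notation Matrix.vec_index (infixl "$" 100)

lemma borel_basic_sets[measurable]:
  "ball (z :: 'a :: metric_space) r \<in> sets borel" "cball z r \<in> sets borel"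
  "{a<..} \<in> sets borel" "{a<..<b} \<in> sets borel" "{a..b} \<in> sets borel" "{a..<b :: real} \<in> sets borel" "{..<a} \<in> sets borel"
  by auto

lemma cnj_borel_measurable[measurable]: "cnj \<in> borel_measurable borel"
  by (intro borel_measurable_continuous_onI continuous_intros)

section \<open>Rotation invariance of planar Lebesgue measure and polar coordinates\<close>

lemma vec2_bij: "linear (\<lambda>z. vector [Re z, Im z] :: real^2)"
  by (rule linearI) (auto simp: Finite_Cartesian_Product.vec_eq_iff forall_2)

text \<open>Invariance under orthogonal maps is obtained in \<open>real^2\<close> and carried over
  to the complex plane; boxes correspond to boxes with the same side lengths, which determines the
  image measure.\<close>

lemma distr_lborel_vec2:
  "distr lborel borel (\<lambda>z::complex. vector [Re z, Im z] :: real^2) = lborel"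
proof (rule lborel_eqI[symmetric])
  fix l u :: "real^2"
  assume le: "\<And>b. b \<in> Basis \<Longrightarrow> l \<bullet> b \<le> u \<bullet> b"
  let ?f = "\<lambda>z::complex. vector [Re z, Im z] :: real^2"
  have m: "?f \<in> borel_measurable borel"
    using vec2_bij linear_continuous_on linear_conv_bounded_linear
    by (intro borel_measurable_continuous_onI) blast
  have le1: "l$1 \<le> u$1" and le2: "l$2 \<le> u$2"
    using le[of "axis 1 1"] le[of "axis 2 1"] by (auto simp: inner_axis)
  have v: "?f -` box l u = box (Complex (l$1) (l$2)) (Complex (u$1) (u$2))"
    by (auto simp: box_def mem_box_cart Basis_complex_def forall_2 Basis_vec_def)
       (auto simp: inner_axis)
  have B: "(\<Prod>b\<in>Basis. (u - l) \<bullet> b) = (u$1 - l$1) * (u$2 - l$2)"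
  proof -
    have B2: "(Basis :: (real^2) set) = {axis 1 1, axis 2 1}" by (auto simp: Basis_vec_def UNIV_2)
    have "axis 1 1 \<noteq> (axis 2 1 :: real^2)" by (simp add: axis_eq_axis)
    then show ?thesis unfolding B2 by (simp add: inner_axis)
  qed
  have "emeasure (distr lborel borel ?f) (box l u) = emeasure lborel (box (Complex (l$1) (l$2)) (Complex (u$1) (u$2)))"
    using m by (subst emeasure_distr) (auto simp: v)
  also have "\<dots> = ennreal ((u$1 - l$1) * (u$2 - l$2))"
    using le1 le2 by (subst emeasure_lborel_box) (auto simp: Basis_complex_def)
  finally show "emeasure (distr lborel borel ?f) (box l u) = (\<Prod>b\<in>Basis. (u - l) \<bullet> b)"
    by (simp add: B)
qed simp

lemma cis_mult_vec2: "vector [Re (cis \<alpha> * z), Im (cis \<alpha> * z)] =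
   (vector [vector [cos \<alpha>, - sin \<alpha>], vector [sin \<alpha>, cos \<alpha>]] :: real^2^2) *v vector [Re z, Im z]"
  by (simp add: Finite_Cartesian_Product.vec_eq_iff forall_2 matrix_vector_mult_def sum_2)

lemma orthogonal_rot2: "orthogonal_matrix (vector [vector [cos \<alpha>, - sin \<alpha>], vector [sin \<alpha>, cos \<alpha>]] :: real^2^2)"
  by (auto simp: orthogonal_matrix Finite_Cartesian_Product.vec_eq_iff forall_2 matrix_matrix_mult_def sum_2 transpose_def Finite_Cartesian_Product.mat_def
     simp flip: power2_eq_square)

text \<open>The preimage of a box is its image under the inverse map, which is again orthogonal and
  so preserves volume.\<close>

lemma distr_orthogonal_lborel:
  fixes f :: "real^'n::{finite,wellorder} \<Rightarrow> real^'n::_"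
  assumes f: "orthogonal_transformation f"
  shows "distr lborel borel f = lborel"
proof (rule lborel_eqI[symmetric])
  fix l u :: "real^'n::{finite,wellorder}"
  assume le: "\<And>b. b \<in> Basis \<Longrightarrow> l \<bullet> b \<le> u \<bullet> b"
  have lin: "linear f" using f by (simp add: orthogonal_transformation_linear)
  have m: "f \<in> borel_measurable borel"
    using lin by (intro borel_measurable_continuous_onI linear_continuous_on) (simp add: linear_conv_bounded_linear)
  have inv: "orthogonal_transformation ((inv_into UNIV f))" using f by (rule orthogonal_transformation_inv)
  have vi: "f -` box l u = (inv_into UNIV f) ` box l u"
    using f by (simp add: bij_vimage_eq_inv_image orthogonal_transformation_bij)
  have "(inv_into UNIV f) ` box l u \<in> lmeasurable"
    using inv by (intro measurable_linear_image) (auto simp: orthogonal_transformation_linear)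
  then have fin: "emeasure lebesgue ((inv_into UNIV f) ` box l u) = ennreal (measure lebesgue ((inv_into UNIV f) ` box l u))"
    by (simp add: emeasure_eq_measure2)
  have "emeasure (distr lborel borel f) (box l u) = emeasure lborel (f -` box l u)"
    using m by (subst emeasure_distr) auto
  also have "\<dots> = emeasure lebesgue ((inv_into UNIV f) ` box l u)"
    using measurable_sets[OF m, of "box l u"] by (simp add: vi)
  also have "\<dots> = ennreal (measure lebesgue (box l u))"
    unfolding fin using inv by (simp add: measure_orthogonal_image)
  also have "\<dots> = ennreal (\<Prod>b\<in>Basis. (u - l) \<bullet> b)"
    using le by (simp add: measure_lborel_box)
  finally show "emeasure (distr lborel borel f) (box l u) = (\<Prod>b\<in>Basis. (u - l) \<bullet> b)" .
qed simp

lemma distr_lborel_rotation: "distr lborel borel (\<lambda>z. cis \<alpha> * z) = (lborel :: complex measure)"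
proof -
  let ?f = "\<lambda>z::complex. vector [Re z, Im z] :: real^2"
  let ?g = "\<lambda>v::real^2. Complex (v$1) (v$2)"
  let ?R = "\<lambda>v. (vector [vector [cos \<alpha>, - sin \<alpha>], vector [sin \<alpha>, cos \<alpha>]] :: real^2^2) *v v"
  have fm[measurable]: "?f \<in> borel_measurable borel"
    using vec2_bij linear_continuous_on linear_conv_bounded_linear
    by (intro borel_measurable_continuous_onI) blast
  have gm[measurable]: "?g \<in> borel_measurable borel"
    unfolding Complex_eq
    by (intro borel_measurable_continuous_onI continuous_intros)
  have R: "orthogonal_transformation ?R"
    using orthogonal_rot2[of \<alpha>] by (simp add: orthogonal_transformation_matrix)
  have Rm[measurable]: "?R \<in> borel_measurable borel"
    by (intro borel_measurable_continuous_onI continuous_intros)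
  have gf: "?g (?f z) = z" for z by (simp add: complex_eq_iff)
  have eq: "cis \<alpha> * z = ?g (?R (?f z))" for z
    by (simp only: cis_mult_vec2[symmetric] gf)
  have "distr lborel borel (\<lambda>z. cis \<alpha> * z) = distr (distr (distr lborel borel ?f) borel ?R) borel ?g"
    by (simp add: distr_distr eq comp_def)
  also have "\<dots> = distr (distr lborel borel ?f) borel ?g"
    by (simp add: distr_lborel_vec2 distr_orthogonal_lborel[OF R])
  also have "\<dots> = distr lborel borel (\<lambda>z. z)"
    by (simp add: distr_distr comp_def gf)
  also have "\<dots> = lborel" by (simp add: distr_id2)
  finally show ?thesis .
qed

lemma nn_integral_rotation:
  fixes F :: "complex \<Rightarrow> ennreal"
  assumes [measurable]: "F \<in> borel_measurable borel"
  shows "(\<integral>\<^sup>+z. F (cis \<alpha> * z) \<partial>lborel) = (\<integral>\<^sup>+z. F z \<partial>lborel)"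
  by (subst (2) distr_lborel_rotation[of \<alpha>, symmetric], subst nn_integral_distr) auto

lemma lborel_integral_rotation:
  fixes F :: "complex \<Rightarrow> 'a :: {banach, second_countable_topology}"
  assumes [measurable]: "F \<in> borel_measurable borel"
  shows "(LINT z|lborel. F (cis \<alpha> * z)) = (LINT z|lborel. F z)"
  by (subst (2) distr_lborel_rotation[of \<alpha>, symmetric], subst integral_distr) auto

lemma nn_integral_2pi_x: assumes "0 \<le> s" shows
  "(\<integral>\<^sup>+r\<in>{..<s}. ennreal (2*pi*r) * indicator {0<..} r \<partial>lborel) = ennreal (pi * s\<^sup>2)"
proof -
  have "(\<integral>\<^sup>+r. ennreal (2*pi*r) * indicator {0..s} r \<partial>lborel) = ennreal (pi * s\<^sup>2 - pi * 0\<^sup>2)"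
    by (rule nn_integral_FTC_Icc[where F="\<lambda>r. pi * r\<^sup>2"])
       (use assms in \<open>auto intro!: derivative_eq_intros\<close>)
  moreover have "(\<integral>\<^sup>+r\<in>{..<s}. ennreal (2*pi*r) * indicator {0<..} r \<partial>lborel) = (\<integral>\<^sup>+r. ennreal (2*pi*r) * indicator {0..s} r \<partial>lborel)"
  proof (rule nn_integral_cong_AE)
    have "AE r in lborel. r \<noteq> s" "AE r in lborel. r \<noteq> (0::real)" by (simp_all add: AE_lborel_singleton)
    then show "AE r in lborel. ennreal (2*pi*r) * indicator {0<..} r * indicator {..<s} r = ennreal (2*pi*r) * indicator {0..s} r"
      by eventually_elim (auto simp: indicator_def)
  qed
  ultimately show ?thesis by simp
qed

lemma lessThan_Int_lessThan_min: "{..<a} \<inter> {..<b} = {..<min a (b::real)}"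
  by auto

text \<open>Half-lines generate the Borel sets, and both measures give \<open>{..<s}\<close> the
  area of a disk of radius s. This yields polar integration of radial functions with no change of
  variables in the plane.\<close>

lemma distr_lborel_cmod:
  "distr lborel borel cmod = density lborel (\<lambda>r. ennreal (2*pi*r) * indicator {0<..} r)"
  (is "?A = ?B")
proof (rule measure_eqI_generator_eq[where E="range lessThan" and \<Omega>=UNIV and A="\<lambda>i. {..<real i}"])
  show "Int_stable (range lessThan :: real set set)"
    unfolding Int_stable_def by (auto simp: lessThan_Int_lessThan_min)
  show "sets ?A = sigma_sets UNIV (range lessThan)" "sets ?B = sigma_sets UNIV (range lessThan)"
    by (simp_all add: borel_eq_lessThan eucl_less_def lessThan_def)
  have A: "emeasure ?A {..<s} = ennreal (pi * (max 0 s)\<^sup>2)" for s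
  proof (cases "s > 0")
    case True
    have "emeasure ?A {..<s} = emeasure lborel (ball (0::complex) s)"
      by (subst emeasure_distr) (auto intro!: arg_cong[where f="emeasure lborel"])
    also have "\<dots> = ennreal (pi * s\<^sup>2)"
      using True by (subst emeasure_ball) (auto simp: eval_unit_ball_vol)
    finally show ?thesis using True by simp
  next
    case False
    then have "cmod -` {..<s} \<inter> space lborel = {}" by (auto simp: not_less) (meson norm_not_less_zero order_less_le_trans)
    then show ?thesis using False by (subst emeasure_distr) auto
  qed
  have B: "emeasure ?B {..<s} = ennreal (pi * (max 0 s)\<^sup>2)" for s
  proof (cases "s > 0")
    case True
    then show ?thesis by (subst emeasure_density) (auto simp: nn_integral_2pi_x)
  next
    case False
    have "emeasure ?B {..<s} = (\<integral>\<^sup>+r. 0 \<partial>(lborel::real measure))"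
      by (subst emeasure_density, simp, simp, rule nn_integral_cong) (use False in \<open>auto simp: indicator_def\<close>)
    then show ?thesis using False by simp
  qed
  show "emeasure ?A X = emeasure ?B X" if "X \<in> range lessThan" for X
    using that A B by auto
  show "(\<Union>i. {..<real i}) = UNIV" by (auto intro: reals_Archimedean2)
  show "emeasure ?A {..<real i} \<noteq> \<infinity>" for i by (simp add: A)
qed auto

lemma nn_integral_radial:
  assumes [measurable]: "f \<in> borel_measurable borel"
  shows "(\<integral>\<^sup>+z. f (cmod z) \<partial>lborel) = (\<integral>\<^sup>+r. ennreal (2*pi*r) * indicator {0<..} r * f r \<partial>lborel)"
proof -
  have "(\<integral>\<^sup>+z. f (cmod z) \<partial>lborel) = (\<integral>\<^sup>+r. f r \<partial>(distr lborel borel cmod))"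
    by (subst nn_integral_distr) auto
  then show ?thesis unfolding distr_lborel_cmod by (subst (asm) nn_integral_density) auto
qed

section \<open>Radial test functions\<close>

text \<open>The derivative is an existential witness, so that closure under sums, products and
  affine substitution follows by induction with explicit derivatives. Continuity of derivatives
  comes for free once all orders are required.\<close>

primrec diffn :: "nat \<Rightarrow> (real \<Rightarrow> real) \<Rightarrow> bool" where
  "diffn 0 g \<longleftrightarrow> True"
| "diffn (Suc n) g \<longleftrightarrow> (\<exists>g'. (\<forall>x. (g has_real_derivative g' x) (at x)) \<and> diffn n g')"

definition smooth :: "(real \<Rightarrow> real) \<Rightarrow> bool" where
  "smooth g \<longleftrightarrow> (\<forall>n. diffn n g)"

lemma diffn_Suc_D: "diffn (Suc n) g \<Longrightarrow> diffn n g"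
  by (induction n arbitrary: g) auto

lemma diffn_const: "diffn n (\<lambda>_. c)"
proof (induction n arbitrary: c)
  case (Suc n) then show ?case by (auto intro!: exI[of _ "\<lambda>_. 0"])
qed auto

lemma diffn_add: "diffn n f \<Longrightarrow> diffn n g \<Longrightarrow> diffn n (\<lambda>x. f x + g x)"
proof (induction n arbitrary: f g)
  case (Suc n)
  then obtain f' g' where "\<forall>x. (f has_real_derivative f' x) (at x)" "diffn n f'"
    "\<forall>x. (g has_real_derivative g' x) (at x)" "diffn n g'" by auto
  with Suc.IH[of f' g'] show ?case
    by (auto intro!: exI[of _ "\<lambda>x. f' x + g' x"] derivative_eq_intros)
qed auto

lemma diffn_mult: "diffn n f \<Longrightarrow> diffn n g \<Longrightarrow> diffn n (\<lambda>x. f x * g x)"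
proof (induction n arbitrary: f g)
  case (Suc n)
  then obtain f' g' where *: "\<forall>x. (f has_real_derivative f' x) (at x)" "diffn n f'"
    "\<forall>x. (g has_real_derivative g' x) (at x)" "diffn n g'" by auto
  have "diffn n (\<lambda>x. f' x * g x + f x * g' x)"
    using Suc.IH[OF *(2) diffn_Suc_D[OF Suc.prems(2)]] Suc.IH[OF diffn_Suc_D[OF Suc.prems(1)] *(4)]
    by (rule diffn_add)
  with * show ?case
    by (auto intro!: exI[of _ "\<lambda>x. f' x * g x + f x * g' x"] derivative_eq_intros)
qed auto

lemma diffn_affine: "diffn n g \<Longrightarrow> diffn n (\<lambda>x. g (a * x + b))"
proof (induction n arbitrary: g)
  case (Suc n)
  then obtain g' where *: "\<forall>x. (g has_real_derivative g' x) (at x)" "diffn n g'" by auto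
  have "((\<lambda>x. g (a * x + b)) has_real_derivative a * g' (a * x + b)) (at x)" for x
  proof -
    have "((\<lambda>x. a * x + b) has_real_derivative a) (at x)"
      by (auto intro!: derivative_eq_intros)
    from DERIV_chain2[OF *(1)[rule_format] this] show ?thesis by (simp add: mult.commute)
  qed
  moreover have "diffn n (\<lambda>x. a * g' (a * x + b))"
    using Suc.IH[OF *(2)] diffn_const diffn_mult by blast
  ultimately show ?case by (auto intro!: exI[of _ "\<lambda>x. a * g' (a * x + b)"])
qed auto

text \<open>Differentiating a quotient by \<open>x ^ j\<close> produces a quotient by
  \<open>x ^ Suc j\<close>, hence the induction with \<open>j\<close> arbitrary. Vanishing of
  \<open>k\<close> to the left of the positive number \<alpha> removes the pole at 0.\<close>

lemma diffn_divide_power: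
  assumes "diffn n k" "\<And>x. x < \<alpha> \<Longrightarrow> k x = 0" "0 < \<alpha>"
  shows "diffn n (\<lambda>x. k x / x ^ j)"
  using assms(1,2)
proof (induction n arbitrary: k j)
  case (Suc n)
  then obtain k' where k': "\<forall>x. (k has_real_derivative k' x) (at x)" "diffn n k'" by auto
  have z: "k' x = 0" if "x < \<alpha>" for x
  proof -
    have "((\<lambda>_. 0) has_real_derivative k' x) (at x)"
      using k'(1)[rule_format, of x]
      by (rule has_field_derivative_transform_within_open[of _ _ _ "{..<\<alpha>}"]) (use that Suc.prems in auto)
    then show ?thesis using DERIV_unique DERIV_const by blast
  qed
  have "((\<lambda>x. k x / x ^ j) has_real_derivative k' x / x ^ j + (- real j) * (k x / x ^ (Suc j))) (at x)" for x
  proof (cases "x > 0")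
    case True
    have "((\<lambda>x. x ^ j) has_real_derivative real j * x ^ (j - 1)) (at x)"
      using DERIV_pow[of j x] by simp
    from DERIV_divide[OF k'(1)[rule_format] this]
    have "((\<lambda>x. k x / x ^ j) has_real_derivative
        (k' x * x ^ j - k x * (real j * x ^ (j - 1))) / (x ^ j * x ^ j)) (at x)"
      using True by simp
    moreover have "(k' x * x ^ j - k x * (real j * x ^ (j - 1))) / (x ^ j * x ^ j)
        = k' x / x ^ j + (- real j) * (k x / x ^ Suc j)"
      using True by (cases j) (auto simp: field_simps)
    ultimately show ?thesis by simp
  next
    case False
    have "((\<lambda>_. 0) has_real_derivative 0) (at x)" by simp
    then have "((\<lambda>x. k x / x ^ j) has_real_derivative 0) (at x)"
      by (rule has_field_derivative_transform_within_open[of _ _ _ "{..<\<alpha>}"]) (use False assms(3) Suc.prems in auto)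
    then show ?thesis using False z[of x] assms(3) Suc.prems(2)[of x] by simp
  qed
  moreover have "diffn n (\<lambda>x. k' x / x ^ j + (- real j) * (k x / x ^ (Suc j)))"
    using Suc.IH[OF k'(2) z] Suc.IH[OF diffn_Suc_D[OF Suc.prems(1)] Suc.prems(2)]
    by (intro diffn_add diffn_mult diffn_const)
  ultimately show ?case unfolding diffn.simps
    by (intro exI[of _ "\<lambda>x. k' x / x ^ j + (- real j) * (k x / x ^ (Suc j))"]) auto
qed auto

text \<open>This family contains exp(-1/x) and is closed under differentiation: the derivative
  replaces the polynomial p by X^2 (p - p'). Smoothness of the standard cutoff is then a plain
  induction.\<close>

definition exp_poly :: "real poly \<Rightarrow> real \<Rightarrow> real" where
  "exp_poly p x = (if x > 0 then poly p (1 / x) * exp (- (1 / x)) else 0)"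

lemma poly_exp_tendsto_0: "((\<lambda>y. poly p y * exp (- y)) \<longlongrightarrow> (0::real)) at_top"
proof -
  have "((\<lambda>y. \<Sum>i\<le>degree p. coeff p i * (y ^ i / exp y)) \<longlongrightarrow> (\<Sum>i\<le>degree p. coeff p i * 0)) at_top"
    by (intro tendsto_intros tendsto_power_div_exp_0)
  then show ?thesis
    by (simp add: poly_altdef sum_distrib_right sum_divide_distrib exp_minus field_simps)
qed

lemma exp_poly_DERIV:
  "(exp_poly p has_real_derivative exp_poly ([:0,0,1:] * (p - pderiv p)) x) (at x)"
proof -
  consider "x > 0" | "x < 0" | "x = 0" by linarith
  then show ?thesis
  proof cases
    case 1
    have "((\<lambda>x. poly p (1 / x) * exp (- (1 / x))) has_real_derivative
        exp_poly ([:0,0,1:] * (p - pderiv p)) x) (at x)"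
      using 1 by (auto intro!: derivative_eq_intros DERIV_chain2[OF poly_DERIV] simp: exp_poly_def field_simps power2_eq_square)
    then show ?thesis
      by (rule has_field_derivative_transform_within_open[of _ _ _ "{0<..}"]) (use 1 in \<open>auto simp: exp_poly_def\<close>)
  next
    case 2
    have "((\<lambda>_. 0) has_real_derivative 0) (at x)" by simp
    then have "(exp_poly p has_real_derivative 0) (at x)"
      by (rule has_field_derivative_transform_within_open[of _ _ _ "{..<0}"]) (use 2 in \<open>auto simp: exp_poly_def\<close>)
    then show ?thesis using 2 by (simp add: exp_poly_def)
  next
    case 3
    \<comment> \<open>The difference quotient at 0 from the right is
      \<open>exp_poly p h / h\<close>, which in y = 1/h is y p(y) exp(-y).\<close>
    have "((\<lambda>y. poly (pCons 0 p) y * exp (- y)) \<longlongrightarrow> 0) at_top" by (rule poly_exp_tendsto_0)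
    then have "((\<lambda>h. poly (pCons 0 p) (inverse h) * exp (- inverse h)) \<longlongrightarrow> (0::real)) (at_right 0)"
      by (rule filterlim_compose) (rule filterlim_inverse_at_top_right)
    then have r: "((\<lambda>h. exp_poly p h / h) \<longlongrightarrow> 0) (at_right 0)"
      by (rule Lim_transform_eventually) (auto simp: eventually_at_right_less exp_poly_def field_simps intro!: eventually_at_rightI[of 0 1])
    have l: "((\<lambda>h. exp_poly p h / h) \<longlongrightarrow> 0) (at_left 0)"
      by (rule Lim_transform_eventually[OF tendsto_const]) (auto simp: exp_poly_def intro!: eventually_at_leftI[of "-1"])
    from l r have "((\<lambda>h. exp_poly p h / h) \<longlongrightarrow> 0) (at 0)" by (simp add: filterlim_split_at)
    then show ?thesis using 3 by (simp add: DERIV_def exp_poly_def)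
  qed
qed

lemma diffn_exp_poly: "diffn n (exp_poly p)"
  by (induction n arbitrary: p) (auto intro!: exI exp_poly_DERIV simp del: mult_pCons_left)

definition cutoff :: "real \<Rightarrow> real" where "cutoff x = (if x > 0 then exp (- (1 / x)) else 0)"

lemma smooth_cutoff: "smooth cutoff"
  using diffn_exp_poly[of _ 1] by (simp add: smooth_def cutoff_def[abs_def] exp_poly_def[abs_def] cong: if_cong)

text \<open>The parameter \<open>n\<close> steepens the two flanks, so the bumps tend to the
  indicator of the open interval; identities for bumps thereby pass to intervals.\<close>

definition bump :: "real \<Rightarrow> real \<Rightarrow> nat \<Rightarrow> real \<Rightarrow> real" where
  "bump \<alpha> \<beta> n x = cutoff (real n * (x - \<alpha>)) * cutoff (real n * (\<beta> - x))"

lemma smooth_bump: "smooth (bump \<alpha> \<beta> n)"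
proof -
  have "diffn m (\<lambda>x. cutoff (real n * x + (- real n * \<alpha>)) * cutoff ((- real n) * x + real n * \<beta>))" for m
    using smooth_cutoff by (intro diffn_mult diffn_affine) (auto simp: smooth_def)
  then show ?thesis by (simp add: smooth_def bump_def[abs_def] algebra_simps)
qed

lemma cutoff_bounds: "0 \<le> cutoff x" "cutoff x \<le> 1"
  by (auto simp: cutoff_def)

lemma bump_bounds: "0 \<le> bump \<alpha> \<beta> n x" "bump \<alpha> \<beta> n x \<le> 1"
  using cutoff_bounds by (auto simp: bump_def intro!: mult_le_one)

lemma bump_pos: "n > 0 \<Longrightarrow> \<alpha> < x \<Longrightarrow> x < \<beta> \<Longrightarrow> 0 < bump \<alpha> \<beta> n x"
  by (auto simp: bump_def cutoff_def)

lemma bump_eq_0: "\<not> (\<alpha> < x \<and> x < \<beta>) \<Longrightarrow> bump \<alpha> \<beta> n x = 0"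
  by (auto simp: bump_def cutoff_def zero_less_mult_iff)

lemma cutoff_LIMSEQ: "(\<lambda>n. cutoff (real n * x)) \<longlonglongrightarrow> (if x > 0 then 1 else 0)"
proof (cases "x > 0")
  case True
  have "(\<lambda>n. exp (- (1 / x) * (1 / real n))) \<longlonglongrightarrow> exp (- (1 / x) * 0)"
    by (intro tendsto_intros lim_1_over_n)
  then have "(\<lambda>n. cutoff (real n * x)) \<longlonglongrightarrow> exp (- (1 / x) * 0)"
    by (rule Lim_transform_eventually)
      (use True in \<open>auto simp: cutoff_def field_simps zero_less_mult_iff intro!: eventually_mono[OF eventually_gt_at_top[of 0]]\<close>)
  then show ?thesis using True by simp
next
  case False
  then have "\<not> real n * x > 0" for n by (simp add: zero_less_mult_iff)
  then show ?thesis using False by (simp add: cutoff_def)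
qed

lemma bump_LIMSEQ: "(\<lambda>n. bump \<alpha> \<beta> n x) \<longlonglongrightarrow> indicator {\<alpha><..<\<beta>} x"
proof -
  have "(\<lambda>n. bump \<alpha> \<beta> n x) \<longlonglongrightarrow> (if x - \<alpha> > 0 then 1 else 0) * (if \<beta> - x > 0 then 1 else 0)"
    unfolding bump_def by (intro tendsto_mult cutoff_LIMSEQ)
  then show ?thesis by (simp add: indicator_def split: if_splits)
qed

lemma smooth_deriv:
  assumes "smooth g" "\<And>x. (g has_real_derivative g' x) (at x)"
  shows "smooth g'"
  unfolding smooth_def
proof
  fix n
  have "diffn (Suc n) g" using assms(1) by (simp add: smooth_def del: diffn.simps)
  then obtain k where "\<forall>x. (g has_real_derivative k x) (at x)" "diffn n k" by auto
  moreover from this assms(2) have "k = g'" using DERIV_unique by blast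
  ultimately show "diffn n g'" by simp
qed

lemma smooth_obtain_deriv:
  assumes "smooth g"
  obtains g' where "smooth g'" "\<And>x. (g has_real_derivative g' x) (at x)"
proof -
  have "diffn (Suc 0) g" using assms by (simp add: smooth_def del: diffn.simps)
  then obtain g' where g': "\<forall>x. (g has_real_derivative g' x) (at x)" by auto
  with smooth_deriv[OF assms] that show thesis by blast
qed

lemma smooth_antideriv:
  assumes "smooth g'" "\<And>x. (g has_real_derivative g' x) (at x)"
  shows "smooth g"
  unfolding smooth_def
proof
  fix n
  have "diffn n g'" using assms(1) by (simp add: smooth_def)
  with assms(2) have "diffn (Suc n) g" by auto
  then show "diffn n g" by (rule diffn_Suc_D)
qed

lemma smooth_continuous: "smooth g \<Longrightarrow> continuous_on A g"
  by (erule smooth_obtain_deriv) (auto intro: continuous_at_imp_continuous_on DERIV_isCont)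

lemma smooth_measurable: "smooth g \<Longrightarrow> g \<in> borel_measurable borel"
  by (intro borel_measurable_continuous_onI smooth_continuous)

lemma partial_x_eq:
  assumes "(f has_derivative D) (at z)" shows "partial_x f z = D 1"
proof -
  have "((\<lambda>t. f (z + of_real t)) has_derivative (\<lambda>t. D (of_real t))) (at 0)"
    by (rule has_derivative_compose[where f="\<lambda>t. z + of_real t"]) (use assms in \<open>auto intro!: derivative_eq_intros\<close>)
  moreover have "D (of_real t) = D 1 * t" for t
    using has_derivative_bounded_linear[OF assms] linear_simps(5)[of D t 1] by (simp add: scaleR_conv_of_real mult.commute)
  ultimately have "((\<lambda>t. f (z + of_real t)) has_real_derivative D 1) (at 0)"
    by (simp add: has_field_derivative_def)
  then show ?thesis unfolding partial_x_def by (rule DERIV_imp_deriv)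
qed

lemma partial_y_eq:
  assumes "(f has_derivative D) (at z)" shows "partial_y f z = D \<i>"
proof -
  have "((\<lambda>t. f (z + \<i> * of_real t)) has_derivative (\<lambda>t. D (\<i> * of_real t))) (at 0)"
    by (rule has_derivative_compose[where f="\<lambda>t. z + \<i> * of_real t"]) (use assms in \<open>auto intro!: derivative_eq_intros\<close>)
  moreover have "D (\<i> * of_real t) = D \<i> * t" for t
    using has_derivative_bounded_linear[OF assms] linear_simps(5)[of D t \<i>] by (simp add: scaleR_conv_of_real mult.commute)
  ultimately have "((\<lambda>t. f (z + \<i> * of_real t)) has_real_derivative D \<i>) (at 0)"
    by (simp add: has_field_derivative_def)
  then show ?thesis unfolding partial_y_def by (rule DERIV_imp_deriv)
qed

lemma times_differentiable_Suc_D: "times_differentiable (Suc n) f \<Longrightarrow> times_differentiable n f"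
proof (induction n arbitrary: f)
  case (Suc n)
  then show ?case
    unfolding times_differentiable.simps(2)[of "Suc n"] times_differentiable.simps(2)[of n f] by blast
qed simp

lemma times_differentiable_const: "times_differentiable n (\<lambda>_. c)"
proof (induction n arbitrary: c)
  case (Suc n)
  have "partial_x (\<lambda>_. c) = (\<lambda>_. 0)" "partial_y (\<lambda>_. c) = (\<lambda>_. 0)"
    by (auto simp: partial_x_def partial_y_def)
  with Suc[of 0] show ?case by auto
qed auto

lemma times_differentiable_add:
  "times_differentiable n f \<Longrightarrow> times_differentiable n g \<Longrightarrow> times_differentiable n (\<lambda>z. f z + g z)"
proof (induction n arbitrary: f g)
  case (Suc n)
  have D: "(f has_derivative frechet_derivative f (at z)) (at z)" "(g has_derivative frechet_derivative g (at z)) (at z)" for z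
    using Suc.prems by (auto simp: frechet_derivative_works[symmetric])
  have "partial_x (\<lambda>z. f z + g z) = (\<lambda>z. partial_x f z + partial_x g z)"
    "partial_y (\<lambda>z. f z + g z) = (\<lambda>z. partial_y f z + partial_y g z)"
    using partial_x_eq[OF has_derivative_add[OF D]] partial_y_eq[OF has_derivative_add[OF D]]
      partial_x_eq[OF D(1)] partial_x_eq[OF D(2)] partial_y_eq[OF D(1)] partial_y_eq[OF D(2)]
    by (auto simp: fun_eq_iff)
  with Suc show ?case by auto
qed auto

lemma times_differentiable_mult:
  "times_differentiable n f \<Longrightarrow> times_differentiable n g \<Longrightarrow> times_differentiable n (\<lambda>z. f z * g z)"
proof (induction n arbitrary: f g)
  case (Suc n)
  have D: "(f has_derivative frechet_derivative f (at z)) (at z)" "(g has_derivative frechet_derivative g (at z)) (at z)" for z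
    using Suc.prems by (auto simp: frechet_derivative_works[symmetric])
  have "partial_x (\<lambda>z. f z * g z) = (\<lambda>z. f z * partial_x g z + partial_x f z * g z)"
    "partial_y (\<lambda>z. f z * g z) = (\<lambda>z. f z * partial_y g z + partial_y f z * g z)"
    using partial_x_eq[OF has_derivative_mult[OF D]] partial_y_eq[OF has_derivative_mult[OF D]]
      partial_x_eq[OF D(1)] partial_x_eq[OF D(2)] partial_y_eq[OF D(1)] partial_y_eq[OF D(2)]
    by (auto simp: fun_eq_iff)
  moreover have "times_differentiable n f" "times_differentiable n g"
    using Suc.prems times_differentiable_Suc_D by blast+
  ultimately show ?case using Suc by (auto intro!: times_differentiable_add)
qed auto

lemma has_derivative_radial:
  assumes "\<And>x. (g has_real_derivative g' x) (at x)"
  shows "((\<lambda>z. g ((cmod (z - a))\<^sup>2)) has_derivative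
     (\<lambda>h. g' ((cmod (z - a))\<^sup>2) * (2 * (Re (z - a) * Re h + Im (z - a) * Im h)))) (at z)"
proof -
  have "((\<lambda>z. (Re (z - a))\<^sup>2 + (Im (z - a))\<^sup>2) has_derivative
      (\<lambda>h. 2 * (Re (z - a) * Re h + Im (z - a) * Im h))) (at z)"
    by (auto intro!: derivative_eq_intros simp: fun_eq_iff algebra_simps)
  then have "((\<lambda>z. g ((Re (z - a))\<^sup>2 + (Im (z - a))\<^sup>2)) has_derivative
     (\<lambda>h. (2 * (Re (z - a) * Re h + Im (z - a) * Im h)) * g' ((Re (z - a))\<^sup>2 + (Im (z - a))\<^sup>2))) (at z)"
    by (rule DERIV_compose_FDERIV[OF assms])
  then show ?thesis by (simp add: cmod_power2 mult.commute)
qed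

lemma partial_radial:
  assumes "\<And>x. (g has_real_derivative g' x) (at x)"
  shows "partial_x (\<lambda>z. g ((cmod (z - a))\<^sup>2)) = (\<lambda>z. g' ((cmod (z - a))\<^sup>2) * (2 * (Re (z - a))))"
    "partial_y (\<lambda>z. g ((cmod (z - a))\<^sup>2)) = (\<lambda>z. g' ((cmod (z - a))\<^sup>2) * (2 * (Im (z - a))))"
  using partial_x_eq[OF has_derivative_radial[OF assms]] partial_y_eq[OF has_derivative_radial[OF assms]]
  by (auto simp: fun_eq_iff)

lemma times_differentiable_coord:
  "times_differentiable n (\<lambda>z. 2 * Re (z - a))" "times_differentiable n (\<lambda>z. 2 * Im (z - a))"
proof -
  have D: "((\<lambda>z. 2 * Re (z - a)) has_derivative (\<lambda>h. 2 * Re h)) (at z)"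
    "((\<lambda>z. 2 * Im (z - a)) has_derivative (\<lambda>h. 2 * Im h)) (at z)" for z
    by (auto intro!: derivative_eq_intros)
  have "partial_x (\<lambda>z. 2 * Re (z - a)) = (\<lambda>_. 2)" "partial_y (\<lambda>z. 2 * Re (z - a)) = (\<lambda>_. 0)"
    "partial_x (\<lambda>z. 2 * Im (z - a)) = (\<lambda>_. 0)" "partial_y (\<lambda>z. 2 * Im (z - a)) = (\<lambda>_. 2)"
    using partial_x_eq[OF D(1)] partial_y_eq[OF D(1)] partial_x_eq[OF D(2)] partial_y_eq[OF D(2)] by auto
  with D times_differentiable_const show "times_differentiable n (\<lambda>z. 2 * Re (z - a))" "times_differentiable n (\<lambda>z. 2 * Im (z - a))"
    by (cases n; fastforce simp: differentiable_def)+
qed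

text \<open>The profile is a function of the squared distance, a polynomial in the coordinates. A
  partial derivative is then again a radial function of this form times an affine coordinate, with
  no singularity at the centre, and the induction closes.\<close>

lemma times_differentiable_radial:
  "smooth g \<Longrightarrow> times_differentiable n (\<lambda>z. g ((cmod (z - a))\<^sup>2))"
proof (induction n arbitrary: g)
  case (Suc n)
  obtain g' where g': "smooth g'" "\<And>x. (g has_real_derivative g' x) (at x)"
    using smooth_obtain_deriv[OF Suc.prems] by metis
  show ?case
    unfolding times_differentiable.simps partial_radial[OF g'(2)]
    using times_differentiable_mult[OF Suc.IH[OF g'(1)] times_differentiable_coord(1)]
      times_differentiable_mult[OF Suc.IH[OF g'(1)] times_differentiable_coord(2)]
      has_derivative_radial[OF g'(2)]
    unfolding differentiable_def by blast
qed auto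

text \<open>With s the squared distance, the right-hand side is 4 d/ds (s g'(s)), a total derivative
  in s.\<close>

lemma laplacian_radial:
  assumes "\<And>x. (g has_real_derivative g' x) (at x)" "\<And>x. (g' has_real_derivative g'' x) (at x)"
  shows "laplacian (\<lambda>z. g ((cmod (z - a))\<^sup>2)) z =
     4 * g' ((cmod (z - a))\<^sup>2) + 4 * (cmod (z - a))\<^sup>2 * g'' ((cmod (z - a))\<^sup>2)"
proof -
  let ?s = "(cmod (z - a))\<^sup>2"
  have D: "((\<lambda>z. 2 * Re (z - a)) has_derivative (\<lambda>h. 2 * Re h)) (at z)"
    "((\<lambda>z. 2 * Im (z - a)) has_derivative (\<lambda>h. 2 * Im h)) (at z)" for z
    by (auto intro!: derivative_eq_intros)
  note R = has_derivative_radial[OF assms(2), of a z]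
  have "partial_x (partial_x (\<lambda>z. g ((cmod (z - a))\<^sup>2))) z = g' ?s * 2 + g'' ?s * (2 * Re (z - a)) * (2 * Re (z - a))"
    unfolding partial_radial[OF assms(1)] using partial_x_eq[OF has_derivative_mult[OF R D(1)]] by simp
  moreover have "partial_y (partial_y (\<lambda>z. g ((cmod (z - a))\<^sup>2))) z = g' ?s * 2 + g'' ?s * (2 * Im (z - a)) * (2 * Im (z - a))"
    unfolding partial_radial[OF assms(1)] using partial_y_eq[OF has_derivative_mult[OF R D(2)]] by simp
  moreover have "?s = (Re (z - a))\<^sup>2 + (Im (z - a))\<^sup>2" by (simp add: cmod_power2)
  moreover have "G * 2 + H * (2 * x) * (2 * x) + (G * 2 + H * (2 * y) * (2 * y)) = 4 * G + 4 * (x\<^sup>2 + y\<^sup>2) * H"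
    for G H x y :: real by (simp add: power2_eq_square algebra_simps)
  ultimately show ?thesis unfolding laplacian_def by metis
qed

lemma test_function_radial:
  assumes "smooth g" "\<And>s. R \<le> s \<Longrightarrow> g s = 0"
  shows "test_function (\<lambda>z. g ((cmod (z - a))\<^sup>2))"
  unfolding test_function_def
proof
  show "\<forall>k. times_differentiable k (\<lambda>z. g ((cmod (z - a))\<^sup>2))"
    using assms(1) times_differentiable_radial by blast
  have "{z. g ((cmod (z - a))\<^sup>2) \<noteq> 0} \<subseteq> cball a (sqrt (max R 0))"
  proof (clarsimp simp: dist_norm)
    fix z assume "g ((cmod (z - a))\<^sup>2) \<noteq> 0"
    then have "(cmod (z - a))\<^sup>2 \<le> max R 0" using assms(2)[of "(cmod (z - a))\<^sup>2"] by linarith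
    then show "cmod (a - z) \<le> sqrt (max R 0)" by (simp add: norm_minus_commute real_le_rsqrt)
  qed
  then show "compact (closure {z. g ((cmod (z - a))\<^sup>2) \<noteq> 0})"
    using bounded_subset[OF bounded_cball] compact_closure by blast
qed

section \<open>Doubling measures in the plane\<close>

lemma mono_isCont_from_sequences:
  fixes f :: "real \<Rightarrow> real"
  assumes "mono f"
    and l: "(\<lambda>n. f (r - 1 / real (Suc n))) \<longlonglongrightarrow> f r"
    and u: "(\<lambda>n. f (r + 1 / real (Suc n))) \<longlonglongrightarrow> f r"
  shows "isCont f r"
  unfolding continuous_at_eps_delta
proof (intro allI impI)
  fix e :: real assume e: "e > 0"
  from l e have "eventually (\<lambda>n. dist (f (r - 1 / real (Suc n))) (f r) < e) sequentially"
    by (rule tendstoD)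
  moreover from u e have "eventually (\<lambda>n. dist (f (r + 1 / real (Suc n))) (f r) < e) sequentially"
    by (rule tendstoD)
  ultimately have "eventually (\<lambda>n. dist (f (r - 1 / real (Suc n))) (f r) < e \<and> dist (f (r + 1 / real (Suc n))) (f r) < e) sequentially"
    by (rule eventually_conj)
  then obtain n where n: "dist (f (r - 1 / real (Suc n))) (f r) < e" "dist (f (r + 1 / real (Suc n))) (f r) < e"
    using eventually_happens'[OF sequentially_bot] by fastforce
  show "\<exists>d>0. \<forall>x. dist x r < d \<longrightarrow> dist (f x) (f r) < e"
  proof (intro exI conjI allI impI)
    show "0 < 1 / real (Suc n)" by simp
    fix x assume "dist x r < 1 / real (Suc n)"
    then have "r - 1 / real (Suc n) \<le> x" "x \<le> r + 1 / real (Suc n)"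
      unfolding dist_real_def by linarith+
    then have "f (r - 1 / real (Suc n)) \<le> f x" "f x \<le> f (r + 1 / real (Suc n))"
      using \<open>mono f\<close> by (auto simp: mono_def)
    then show "dist (f x) (f r) < e" using n by (auto simp: dist_real_def)
  qed
qed

lemma norm_cis_diff_le: "cmod (cis a - cis b) \<le> \<bar>a - b\<bar>"
proof (rule power2_le_imp_le)
  have "(cmod (cis a - cis b))\<^sup>2 = 2 - 2 * cos (a - b)"
    using sin_cos_squared_add[of a] sin_cos_squared_add[of b]
    by (simp add: cmod_power2 cos_diff power2_diff algebra_simps)
  also have "\<dots> = (2 * sin ((a - b) / 2))\<^sup>2"
  proof -
    have e: "a - b = 2 * ((a - b) / 2)" by simp
    have "cos (a - b) = 1 - 2 * (sin ((a - b) / 2))\<^sup>2" by (subst e, rule cos_double_sin)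
    then show ?thesis by (simp add: power_mult_distrib)
  qed
  also have "\<dots> \<le> (a - b)\<^sup>2"
    using abs_sin_x_le_abs_x[of "(a - b) / 2"] by (intro abs_le_square_iff[THEN iffD1]) (simp add: abs_mult)
  finally show "(cmod (cis a - cis b))\<^sup>2 \<le> \<bar>a - b\<bar>\<^sup>2" by simp
qed simp

locale doubling_plane =
  fixes \<nu> :: "complex measure" and C :: real
  assumes sets_\<nu>[measurable_cong, simp]: "sets \<nu> = sets borel"
    and finite_compact: "compact K \<Longrightarrow> emeasure \<nu> K < \<infinity>"
    and nonzero: "emeasure \<nu> UNIV \<noteq> 0"
    and C_pos: "C > 0"
    and doubling_emeasure: "r > 0 \<Longrightarrow> emeasure \<nu> (ball z (2 * r)) \<le> ennreal C * emeasure \<nu> (ball z r)"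
begin

definition m :: "complex \<Rightarrow> real \<Rightarrow> real" where "m z r = measure \<nu> (ball z r)"

lemma space_\<nu>[simp]: "space \<nu> = UNIV"
  using sets_eq_imp_space_eq[OF sets_\<nu>] by simp

lemma finite_cball: "emeasure \<nu> (cball z r) < \<infinity>"
  by (rule finite_compact) simp

lemma finite_subset_cball: "A \<subseteq> cball z r \<Longrightarrow> emeasure \<nu> A < \<infinity>"
  using emeasure_mono[of A "cball z r" \<nu>] finite_cball[of z r] by (simp add: le_less_trans)

lemma fm_subset_cball: "A \<in> sets borel \<Longrightarrow> A \<subseteq> cball z r \<Longrightarrow> A \<in> fmeasurable \<nu>"
  using finite_subset_cball by (auto intro!: fmeasurableI)

lemma finite_ball: "emeasure \<nu> (ball z r) < \<infinity>"
  using ball_subset_cball by (rule finite_subset_cball)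

lemma emeasure_ball_m: "emeasure \<nu> (ball z r) = ennreal (m z r)"
  unfolding m_def using finite_ball by (simp add: emeasure_eq_ennreal_measure less_top)

lemma m_nonneg: "0 \<le> m z r" by (simp add: m_def)

lemma measure_mono_bounded:
  "A \<in> sets borel \<Longrightarrow> B \<in> sets borel \<Longrightarrow> A \<subseteq> B \<Longrightarrow> B \<subseteq> cball z r \<Longrightarrow> measure \<nu> A \<le> measure \<nu> B"
  using fm_subset_cball[of B z r] by (intro measure_mono_fmeasurable) auto

lemma m_mono: "ball z r \<subseteq> ball w s \<Longrightarrow> m z r \<le> m w s"
  unfolding m_def by (rule measure_mono_bounded[of _ _ w s]) auto

lemma m_mono_dist: "dist z w + r \<le> s \<Longrightarrow> m z r \<le> m w s"
proof (rule m_mono, rule subsetI)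
  fix x assume "dist z w + r \<le> s" "x \<in> ball z r"
  then show "x \<in> ball w s" using dist_triangle[of w x z] by (auto simp: dist_commute)
qed

lemma m_mono_radius: "r \<le> s \<Longrightarrow> m z r \<le> m z s"
  by (rule m_mono_dist) simp

lemma m_doubling: "r > 0 \<Longrightarrow> m z (2 * r) \<le> C * m z r"
  using doubling_emeasure[of r z] C_pos
  by (simp add: emeasure_ball_m m_nonneg flip: ennreal_mult)

lemma m_doubling_iter: "r > 0 \<Longrightarrow> m z (2 ^ j * r) \<le> C ^ j * m z r"
proof (induction j)
  case (Suc j)
  have "m z (2 ^ Suc j * r) \<le> C * m z (2 ^ j * r)"
    using m_doubling[of "2 ^ j * r" z] Suc.prems by (simp add: mult.assoc)
  also have "\<dots> \<le> C * (C ^ j * m z r)" using Suc C_pos by (intro mult_left_mono) auto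
  finally show ?case by simp
qed simp

text \<open>A null disk would have null dilates by doubling, and these exhaust the plane.\<close>

lemma m_pos: assumes "r > 0" shows "m z r > 0"
proof (rule ccontr)
  assume "\<not> m z r > 0"
  then have "m z r = 0" using m_nonneg[of z r] by linarith
  then have z0: "m z (2 ^ j * r) = 0" for j
    using m_doubling_iter[OF assms, of z j] m_nonneg[of z "2 ^ j * r"] by simp
  have "UNIV = (\<Union>j. ball z (2 ^ j * r))"
  proof (intro equalityI subsetI)
    fix w
    obtain j where "dist z w / r < 2 ^ j" using real_arch_pow[of 2 "dist z w / r"] by auto
    then show "w \<in> (\<Union>j. ball z (2 ^ j * r))" using assms by (auto simp: field_simps)
  qed auto
  moreover have "emeasure \<nu> (\<Union>j. ball z (2 ^ j * r)) = 0"
    by (intro emeasure_UN_eq_0) (auto simp: emeasure_ball_m z0)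
  ultimately show False using nonzero by simp
qed

lemma m_disjoint: "dist z w \<ge> r + s \<Longrightarrow> dist z a + r \<le> t \<Longrightarrow> dist w a + s \<le> t \<Longrightarrow> m z r + m w s \<le> m a t"
proof -
  assume a: "dist z w \<ge> r + s" "dist z a + r \<le> t" "dist w a + s \<le> t"
  have disj: "ball z r \<inter> ball w s = {}"
  proof (rule equals0I)
    fix x assume "x \<in> ball z r \<inter> ball w s"
    then show False using a(1) dist_triangle[of z w x] by (auto simp: dist_commute)
  qed
  have "measure \<nu> (ball z r \<union> ball w s) = m z r + m w s"
    unfolding m_def using disj fm_subset_cball[of "ball z r" z r] fm_subset_cball[of "ball w s" w s]
    by (intro measure_Union) (auto simp: fmeasurable_def)
  moreover have "measure \<nu> (ball z r \<union> ball w s) \<le> m a t"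
    unfolding m_def
  proof (rule measure_mono_bounded[of _ _ a t])
    show "ball z r \<union> ball w s \<subseteq> ball a t"
    proof
      fix x assume "x \<in> ball z r \<union> ball w s"
      then show "x \<in> ball a t"
        using a(2,3) dist_triangle[of a x z] dist_triangle[of a x w] by (auto simp: dist_commute)
    qed
  qed auto
  ultimately show ?thesis by simp
qed

text \<open>The disk of radius r/2 centred at distance 3r/2 lies in the larger disk and misses the
  smaller one. Three doublings blow it up to radius 4r, enough to cover the smaller disk, so its
  mass is a fixed fraction. Mass thus grows at least geometrically under dilation.\<close>

lemma m_reverse_doubling: assumes "r > 0" shows "(1 + 1 / C ^ 3) * m z r \<le> m z (2 * r)"
proof -
  let ?w = "z + of_real (3 / 2 * r)"
  have d: "dist ?w z = 3 / 2 * r" "dist z ?w = 3 / 2 * r" using assms by (auto simp: dist_norm)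
  have "m z r \<le> m ?w (2 ^ 3 * (r / 2))" by (rule m_mono_dist) (use assms d in auto)
  also have "\<dots> \<le> C ^ 3 * m ?w (r / 2)" using assms by (intro m_doubling_iter) auto
  finally have "m z r / C ^ 3 \<le> m ?w (r / 2)" using C_pos by (simp add: field_simps)
  moreover have "m z r + m ?w (r / 2) \<le> m z (2 * r)"
    by (rule m_disjoint) (use assms d in auto)
  ultimately show ?thesis by (simp add: algebra_simps)
qed

text \<open>By Vitali, finitely many disjoint disks of radius e centred on the circle cover it after
  dilation by 5. Each contains a disk of radius e/4 lying in the outer annulus of width e, and five
  doublings compare the two masses. So the circle has at most \<open>C ^ 5\<close> times the mass of
  that annulus, and the annuli shrink to the empty set.\<close>

lemma sphere_null: "measure \<nu> (sphere a r) = 0"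
proof (cases "r < 0")
  case False
  then have r: "r \<ge> 0" by simp
  define A where "A e = {w. r < dist a w \<and> dist a w < r + e}" for e
  have A_sets: "A e \<in> sets borel" for e unfolding A_def by measurable
  have key: "measure \<nu> (sphere a r) \<le> C ^ 5 * measure \<nu> (A e)" if e: "e > 0" for e
  proof -
    have "sphere a r \<subseteq> (\<Union>x\<in>sphere a r. ball x e)" using e by auto
    then obtain D where D: "D \<subseteq> sphere a r" "pairwise (\<lambda>x y. disjnt (ball x e) (ball y e)) D"
      "sphere a r \<subseteq> (\<Union>x\<in>D. ball x (5 * e))"
      by (rule Vitali_covering_lemma_balls[where a="\<lambda>x. x" and r="\<lambda>_. e" and B=e]) (use e in auto)
    obtain T where T: "T \<subseteq> D" "finite T" "sphere a r \<subseteq> (\<Union>x\<in>T. ball x (5 * e))"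
      using compactE_image[OF compact_sphere _ D(3)] by (metis open_ball)
    \<comment> \<open>The centre is pushed outwards by e/2 along its radius; for r = 0 the circle is
      a point and any direction serves.\<close>
    define y where "y x = x + of_real (e / 2) * (if r = 0 then 1 else (x - a) / of_real r)" for x
    have y1: "dist x (y x) = e / 2" and y2: "dist a (y x) = r + e / 2" if "x \<in> T" for x
    proof -
      have x: "cmod (x - a) = r" using that T(1) D(1) by (auto simp: dist_norm norm_minus_commute)
      show "dist x (y x) = e / 2" using x e r by (auto simp: dist_norm y_def norm_mult norm_divide)
      show "dist a (y x) = r + e / 2"
      proof (cases "r = 0")
        case True then show ?thesis using x e by (simp add: dist_norm y_def norm_divide)
      next
        case False
        then have "a - y x = - of_real (1 + e / 2 / r) * (x - a)" by (simp add: y_def field_simps)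
        then have "cmod (a - y x) = \<bar>1 + e / 2 / r\<bar> * r"
          by (simp only: norm_mult x norm_minus_cancel norm_of_real)
        also have "\<dots> = r + e / 2" using False r e by (simp add: field_simps)
        finally show ?thesis by (simp add: dist_norm)
      qed
    qed
    have sub: "ball (y x) (e / 4) \<subseteq> A e" "ball (y x) (e / 4) \<subseteq> ball x e" if "x \<in> T" for x
    proof -
      show "ball (y x) (e / 4) \<subseteq> A e"
      proof
        fix w assume "w \<in> ball (y x) (e / 4)"
        then show "w \<in> A e" using y2[OF that] e dist_triangle[of a w "y x"] dist_triangle[of a "y x" w]
          by (auto simp: A_def dist_commute)
      qed
      show "ball (y x) (e / 4) \<subseteq> ball x e"
      proof
        fix w assume "w \<in> ball (y x) (e / 4)"
        then show "w \<in> ball x e" using y1[OF that] e dist_triangle[of x w "y x"] by (auto simp: dist_commute)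
      qed
    qed
    have disj: "disjoint_family_on (\<lambda>x. ball (y x) (e / 4)) T"
      unfolding disjoint_family_on_def
    proof (intro ballI impI)
      fix x z assume "x \<in> T" "z \<in> T" "x \<noteq> z"
      then have "disjnt (ball x e) (ball z e)" using D(2) T(1) by (auto simp: pairwise_def)
      then show "ball (y x) (e / 4) \<inter> ball (y z) (e / 4) = {}"
        using sub(2)[OF \<open>x \<in> T\<close>] sub(2)[OF \<open>z \<in> T\<close>] by (auto simp: disjnt_def)
    qed
    have bd: "A e \<subseteq> cball a (r + e)" by (auto simp: A_def)
    have "measure \<nu> (sphere a r) \<le> measure \<nu> (\<Union>x\<in>T. ball x (5 * e))"
    proof (rule measure_mono_fmeasurable[OF T(3)])
      show "(\<Union>x\<in>T. ball x (5 * e)) \<in> fmeasurable \<nu>"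
        using T(2) finite_ball by (intro fmeasurable.finite_UN) (auto intro!: fmeasurableI)
    qed auto
    also have "\<dots> \<le> (\<Sum>x\<in>T. measure \<nu> (ball x (5 * e)))"
      using T(2) finite_ball by (intro measure_UNION_le) auto
    also have "\<dots> \<le> (\<Sum>x\<in>T. C ^ 5 * measure \<nu> (ball (y x) (e / 4)))"
    proof (rule sum_mono)
      fix x assume "x \<in> T"
      have "m x (5 * e) \<le> m (y x) (2 ^ 5 * (e / 4))"
        by (rule m_mono_dist) (use y1[OF \<open>x \<in> T\<close>] e in auto)
      also have "\<dots> \<le> C ^ 5 * m (y x) (e / 4)" using e by (intro m_doubling_iter) auto
      finally show "measure \<nu> (ball x (5 * e)) \<le> C ^ 5 * measure \<nu> (ball (y x) (e / 4))" by (simp add: m_def)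
    qed
    also have "\<dots> = C ^ 5 * measure \<nu> (\<Union>x\<in>T. ball (y x) (e / 4))"
      using T(2) disj finite_ball
      by (subst measure_finite_Union) (auto simp: sum_distrib_left less_top)
    also have "\<dots> \<le> C ^ 5 * measure \<nu> (A e)"
      using borel_open[OF open_UN[of T "\<lambda>x. ball (y x) (e / 4)"]] sub(1) bd C_pos A_sets by (intro mult_left_mono measure_mono_bounded[of _ _ a "r + e"]) auto
    finally show ?thesis .
  qed
  have "(\<lambda>n. measure \<nu> (A (1 / real (Suc n)))) \<longlonglongrightarrow> measure \<nu> (\<Inter>n. A (1 / real (Suc n)))"
  proof (rule Lim_measure_decseq)
    show "decseq (\<lambda>n. A (1 / real (Suc n)))"
      unfolding decseq_def A_def by (auto simp: frac_le elim!: less_le_trans)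
    fix n show "emeasure \<nu> (A (1 / real (Suc n))) \<noteq> \<infinity>"
    proof -
      have "A (1 / real (Suc n)) \<subseteq> cball a (r + 1 / real (Suc n))" by (auto simp: A_def)
      from finite_subset_cball[OF this] show ?thesis by auto
    qed
  qed (use A_sets in auto)
  moreover have "(\<Inter>n. A (1 / real (Suc n))) = {}"
  proof (rule equals0I)
    fix w assume w: "w \<in> (\<Inter>n. A (1 / real (Suc n)))"
    then have "dist a w - r > 0" by (auto simp: A_def)
    then obtain n where "inverse (real (Suc n)) < dist a w - r" using reals_Archimedean by blast
    moreover have "w \<in> A (1 / real (Suc n))" using w by blast
    ultimately show False by (auto simp: A_def inverse_eq_divide)
  qed
  ultimately have "(\<lambda>n. C ^ 5 * measure \<nu> (A (1 / real (Suc n)))) \<longlonglongrightarrow> C ^ 5 * 0"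
    by (intro tendsto_intros) simp
  then have "measure \<nu> (sphere a r) \<le> C ^ 5 * 0"
    by (rule LIMSEQ_le_const) (use key in auto)
  then show ?thesis using measure_nonneg[of \<nu> "sphere a r"] by linarith
qed simp

lemma measure_cball: "measure \<nu> (cball a r) = m a r"
proof -
  have "measure \<nu> (ball a r \<union> sphere a r) = measure \<nu> (ball a r) + measure \<nu> (sphere a r)"
    using fm_subset_cball[of "ball a r" a r] fm_subset_cball[of "sphere a r" a r]
    by (intro measure_Union) (auto simp: fmeasurable_def)
  moreover have "ball a r \<union> sphere a r = cball a r" by auto
  ultimately show ?thesis by (simp add: sphere_null m_def)
qed

lemma m_left_limit: "(\<lambda>n. m a (r - 1 / real (Suc n))) \<longlonglongrightarrow> m a r"
proof -
  have "(\<lambda>n. measure \<nu> (ball a (r - 1 / real (Suc n)))) \<longlonglongrightarrow> measure \<nu> (\<Union>n. ball a (r - 1 / real (Suc n)))"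
  proof (rule Lim_measure_incseq)
    show "incseq (\<lambda>n. ball a (r - 1 / real (Suc n)))"
      by (auto simp: incseq_def frac_le elim!: less_le_trans)
    show "emeasure \<nu> (\<Union>n. ball a (r - 1 / real (Suc n))) \<noteq> \<infinity>"
    proof -
      have "ball a (r - 1 / real (Suc n)) \<subseteq> cball a r" for n
        by (rule order_trans[OF ball_subset_cball subset_cball]) simp
      then show ?thesis
        using finite_subset_cball[of "\<Union>n. ball a (r - 1 / real (Suc n))" a r] by (auto simp: less_top[symmetric])
    qed
  qed auto
  moreover have "(\<Union>n. ball a (r - 1 / real (Suc n))) = ball a r"
  proof (intro equalityI subsetI)
    fix w assume "w \<in> ball a r"
    then have "r - dist a w > 0" by simp
    then obtain n where "inverse (real (Suc n)) < r - dist a w" using reals_Archimedean by blast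
    then show "w \<in> (\<Union>n. ball a (r - 1 / real (Suc n)))" by (auto simp: inverse_eq_divide intro!: exI[of _ n])
  next
    fix w assume "w \<in> (\<Union>n. ball a (r - 1 / real (Suc n)))"
    then obtain n where "dist a w < r - 1 / real (Suc n)" by auto
    also have "\<dots> \<le> r" by simp
    finally show "w \<in> ball a r" by simp
  qed
  ultimately show ?thesis by (simp add: m_def)
qed

text \<open>Open disks increase to an open disk, closed disks decrease to a closed one; the two
  limits agree because circles are null.\<close>

lemma isCont_m: "isCont (m a) r"
proof (rule mono_isCont_from_sequences)
  show "mono (m a)" by (auto simp: mono_def m_mono_radius)
  show "(\<lambda>n. m a (r - 1 / real (Suc n))) \<longlonglongrightarrow> m a r" by (rule m_left_limit)
  have "(\<lambda>n. measure \<nu> (cball a (r + 1 / real (Suc n)))) \<longlonglongrightarrow> measure \<nu> (\<Inter>n. cball a (r + 1 / real (Suc n)))"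
  proof (rule Lim_measure_decseq)
    show "decseq (\<lambda>n. cball a (r + 1 / real (Suc n)))"
      by (auto simp: decseq_def frac_le elim!: order_trans)
    show "emeasure \<nu> (cball a (r + 1 / real (Suc n))) \<noteq> \<infinity>" for n
      using finite_cball[of a "r + 1 / real (Suc n)"] by (simp add: less_top[symmetric])
  qed auto
  moreover have "(\<Inter>n. cball a (r + 1 / real (Suc n))) = cball a r"
  proof (intro equalityI subsetI)
    fix w assume w: "w \<in> (\<Inter>n. cball a (r + 1 / real (Suc n)))"
    show "w \<in> cball a r"
    proof (rule ccontr)
      assume "w \<notin> cball a r"
      then have "dist a w - r > 0" by simp
      then obtain n where "inverse (real (Suc n)) < dist a w - r" using reals_Archimedean by blast
      moreover have "w \<in> cball a (r + 1 / real (Suc n))" using w by blast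
      ultimately show False by (auto simp: inverse_eq_divide)
    qed
  next
    fix w assume "w \<in> cball a r"
    then have w: "dist a w \<le> r" by simp
    have "dist a w \<le> r + 1 / real (Suc n)" for n by (rule order_trans[OF w]) simp
    then show "w \<in> (\<Inter>n. cball a (r + 1 / real (Suc n)))" by auto
  qed
  ultimately show "(\<lambda>n. m a (r + 1 / real (Suc n))) \<longlonglongrightarrow> m a r"
    by (simp add: measure_cball)
qed

lemma m_0: "m a r = 0" if "r \<le> 0"
  using that by (simp add: m_def ball_empty)

lemma m_strict_mono: assumes "0 \<le> r" "r < s" shows "m a r < m a s"
proof -
  let ?w = "a + of_real ((r + s) / 2)"
  have d: "dist a ?w = (r + s) / 2" "dist ?w a = (r + s) / 2"
    using assms by (auto simp: dist_norm simp flip: of_real_add of_real_divide)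
  have "m a r + m ?w ((s - r) / 2) \<le> m a s"
    by (rule m_disjoint) (use assms d in \<open>auto simp: field_simps\<close>)
  moreover have "m ?w ((s - r) / 2) > 0" using assms by (intro m_pos) auto
  ultimately show ?thesis by linarith
qed

end

lemma exp_i_Arg2pi: "z = of_real (cmod z) * cis (Arg2pi z)"
  using Arg2pi[of z] by (simp add: is_Arg_def cis_conv_exp)

section \<open>The radius function of a doubling measure of infinite mass\<close>

locale infinite_doubling = doubling_plane +
  assumes infinite: "emeasure \<nu> UNIV = \<infinity>"
begin

abbreviation \<rho> :: "complex \<Rightarrow> real" where "\<rho> \<equiv> radius_function \<nu>"

lemma m_unbounded: "\<exists>R>0. m z R > B"
proof (rule ccontr)
  assume "\<not> (\<exists>R>0. m z R > B)"
  then have le: "m z (real (Suc n)) \<le> B" for n using of_nat_0_less_iff not_less by blast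
  have "(\<lambda>n. emeasure \<nu> (ball z (real (Suc n)))) \<longlonglongrightarrow> emeasure \<nu> (\<Union>n. ball z (real (Suc n)))"
    by (rule Lim_emeasure_incseq) (auto simp: incseq_def elim!: less_le_trans)
  moreover have "(\<Union>n. ball z (real (Suc n))) = UNIV"
  proof (intro equalityI subsetI)
    fix w obtain n where "dist z w < real n" using reals_Archimedean2 by blast
    then have "w \<in> ball z (real (Suc n))" by simp
    then show "w \<in> (\<Union>n. ball z (real (Suc n)))" by blast
  qed simp
  ultimately have "(\<lambda>n. ennreal (m z (real (Suc n)))) \<longlonglongrightarrow> \<infinity>" by (simp only: emeasure_ball_m infinite)
  then have "\<infinity> \<le> ennreal B"
    by (rule LIMSEQ_le_const2) (use le in \<open>auto intro!: ennreal_leI\<close>)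
  then show False by (simp add: top_unique)
qed

lemma radius_unique_existence: "\<exists>!r. r > 0 \<and> emeasure \<nu> (ball z r) = 1"
proof -
  obtain R where R: "R > 0" "m z R > 1" using m_unbounded by blast
  have "\<exists>r\<ge>0. r \<le> R \<and> m z r = 1"
    by (rule IVT) (use R isCont_m m_0[of 0] in auto)
  then obtain r where r: "r \<ge> 0" "m z r = 1" by blast
  then have "r > 0" using m_0[of 0 z] by (cases "r = 0") auto
  show ?thesis
  proof (rule ex1I[of _ r])
    show "r > 0 \<and> emeasure \<nu> (ball z r) = 1" using r \<open>r > 0\<close> by (simp add: emeasure_ball_m)
    fix s assume s: "s > 0 \<and> emeasure \<nu> (ball z s) = 1"
    then have "m z s = 1" by (simp add: emeasure_ball_m)
    then show "s = r" using m_strict_mono[of r s z] m_strict_mono[of s r z] r \<open>r > 0\<close> s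
      by (cases s r rule: linorder_cases) auto
  qed
qed

lemma \<rho>_pos: "\<rho> z > 0" and m_\<rho>: "m z (\<rho> z) = 1"
proof -
  have "\<rho> z > 0 \<and> emeasure \<nu> (ball z (\<rho> z)) = 1"
    unfolding radius_function_def by (rule theI') (rule radius_unique_existence)
  then show "\<rho> z > 0" "m z (\<rho> z) = 1" by (auto simp: emeasure_ball_m)
qed

lemma \<rho>_ge: "m z r \<le> 1 \<Longrightarrow> r \<le> \<rho> z"
  using m_strict_mono[of "\<rho> z" r z] \<rho>_pos[of z] m_\<rho>[of z] by fastforce

lemma \<rho>_le: "1 \<le> m z r \<Longrightarrow> \<rho> z \<le> r"
  using m_strict_mono[of r "\<rho> z" z] m_0[of r z] m_\<rho>[of z] by (cases "r \<ge> 0") fastforce+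

text \<open>A disk about w of this radius fits into the disk of mass 1 about z.\<close>

lemma \<rho>_lipschitz: "\<rho> z - dist z w \<le> \<rho> w"
proof (rule \<rho>_ge)
  have "m w (\<rho> z - dist z w) \<le> m z (\<rho> z)" by (rule m_mono_dist) (simp add: dist_commute)
  then show "m w (\<rho> z - dist z w) \<le> 1" by (simp add: m_\<rho>)
qed

lemma \<rho>_lipschitz': "\<bar>\<rho> z - \<rho> w\<bar> \<le> dist z w"
  using \<rho>_lipschitz[of z w] \<rho>_lipschitz[of w z] by (simp add: dist_commute)

lemma continuous_\<rho>: "continuous_on A \<rho>"
proof (rule continuous_on_subset[of UNIV])
  show "continuous_on UNIV \<rho>"
    unfolding continuous_on_iff
  proof (intro ballI allI impI)
    fix x e assume "(0::real) < e"
    then show "\<exists>d>0. \<forall>x'\<in>UNIV. dist x' x < d \<longrightarrow> dist (\<rho> x') (\<rho> x) < e"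
      using \<rho>_lipschitz' by (intro exI[of _ e]) (auto simp: dist_real_def intro: le_less_trans)
  qed
qed simp

lemma \<rho>_measurable[measurable]: "\<rho> \<in> borel_measurable borel"
  by (intro borel_measurable_continuous_onI continuous_\<rho>)

lemma reverse_iter: "(1 + 1 / C ^ 3) ^ j * m z r \<le> m z (2 ^ j * r)" if "r > 0"
proof (induction j)
  case (Suc j)
  have "(1 + 1 / C ^ 3) ^ Suc j * m z r \<le> (1 + 1 / C ^ 3) * m z (2 ^ j * r)"
    unfolding power_Suc mult.assoc using Suc C_pos by (intro mult_left_mono) (auto intro: add_nonneg_nonneg)
  also have "\<dots> \<le> m z (2 * (2 ^ j * r))" using that by (intro m_reverse_doubling) simp
  finally show ?case by (simp add: mult.assoc)
qed simp

text \<open>Put X = 1 + |z - w| / \<rho>(z). The disk about w of radius X \<rho>(z) lies in a dilate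
  of the unit-mass disk about z by 2^j with 2^j at most 4X, so its mass is at most C^j. Reverse
  doubling about w converts this mass bound into a bound for X \<rho>(z) / \<rho>(w), polynomial in
  X. Integrals of negative powers of the radius function can then be beaten by polynomial
  decay.\<close>

lemma \<rho>_ratio_bound:
  obtains K P where "K > 0" "\<And>z w. \<rho> z \<le> K * (1 + dist z w / \<rho> z) ^ P * \<rho> w"
proof -
  have c: "1 + 1 / C ^ 3 > 1" using C_pos by simp
  \<comment> \<open>The exponent a translates one factor C of doubling growth into a steps of
    reverse-doubling growth; it becomes the degree P, and 4X in place of 2^j accounts for the
    constant.\<close>
  obtain a where a: "C < (1 + 1 / C ^ 3) ^ a" using real_arch_pow[OF c] by blast
  show thesis
  proof (rule that[of "2 * 4 ^ a" a])
    fix z w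
    define R where "R = dist z w + \<rho> z"
    define X where "X = 1 + dist z w / \<rho> z"
    have X1: "X \<ge> 1" using \<rho>_pos[of z] by (simp add: X_def)
    have RX: "R = X * \<rho> z" using \<rho>_pos[of z] by (simp add: R_def X_def field_simps)
    have Rpos: "R > 0" using \<rho>_pos[of z] by (simp add: R_def add_nonneg_pos)
    define j where "j = nat \<lceil>log 2 (2 * X)\<rceil>"
    have l0: "log 2 (2 * X) \<ge> 0" using X1 by simp
    have "log 2 (2 * X) \<le> real j" unfolding j_def using l0 by linarith
    then have j1: "2 * X \<le> 2 ^ j" using X1 by (simp add: log_le_iff powr_realpow)
    have "real j \<le> log 2 (2 * X) + 1" unfolding j_def using l0 by linarith
    then have "2 powr real j \<le> 2 powr (log 2 (2 * X) + 1)" by simp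
    also have "\<dots> = 4 * X" using X1 by (simp add: powr_add powr_log_cancel)
    finally have j2: "2 ^ j \<le> 4 * X" by (simp add: powr_realpow)
    have "m w R \<le> m z (2 ^ j * \<rho> z)"
    proof (rule m_mono_dist)
      have "dist w z + R \<le> 2 * R" using \<rho>_pos[of z] by (simp add: R_def dist_commute)
      also have "\<dots> = 2 * X * \<rho> z" by (simp add: RX)
      also have "\<dots> \<le> 2 ^ j * \<rho> z" using j1 \<rho>_pos[of z] by (intro mult_right_mono) auto
      finally show "dist w z + R \<le> 2 ^ j * \<rho> z" .
    qed
    also have "\<dots> \<le> C ^ j * m z (\<rho> z)" by (rule m_doubling_iter) (rule \<rho>_pos)
    also have "\<dots> \<le> ((1 + 1 / C ^ 3) ^ a) ^ j" using a C_pos by (simp add: m_\<rho> power_mono)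
    finally have mR: "m w R \<le> (1 + 1 / C ^ 3) ^ (a * j)" by (simp add: power_mult)
    have "R < 2 ^ (a * j + 1) * \<rho> w"
    proof (rule ccontr)
      assume "\<not> R < 2 ^ (a * j + 1) * \<rho> w"
      then have "m w (2 ^ (a * j + 1) * \<rho> w) \<le> m w R" by (intro m_mono_radius) simp
      with reverse_iter[OF \<rho>_pos, of "a * j + 1" w w] mR
      have "(1 + 1 / C ^ 3) ^ (a * j + 1) \<le> (1 + 1 / C ^ 3) ^ (a * j)" by (simp add: m_\<rho>)
      then show False using c power_strict_increasing[of "a*j" "a*j+1" "1 + 1 / C ^ 3"] by simp
    qed
    also have "2 ^ (a * j + 1) = 2 * ((2::real) ^ j) ^ a" by (simp add: power_mult mult.commute flip: power_mult)
    finally have "R \<le> 2 * ((2::real) ^ j) ^ a * \<rho> w" by simp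
    also have "\<dots> \<le> 2 * (4 * X) ^ a * \<rho> w"
      using j2 \<rho>_pos[of w] by (intro mult_right_mono mult_left_mono power_mono) auto
    finally have "R \<le> 2 * 4 ^ a * X ^ a * \<rho> w" by (simp add: power_mult_distrib)
    moreover have "\<rho> z \<le> R" by (simp add: R_def)
    ultimately show "\<rho> z \<le> 2 * 4 ^ a * (1 + dist z w / \<rho> z) ^ a * \<rho> w" by (simp add: X_def)
  qed simp
qed

text \<open>Infinite mass makes D(0, |z|) heavier than C^j for large z. The disk of radius
  \<epsilon> |z| about z covers D(0, |z|) after j doublings, so its own mass is at least 1.\<close>

lemma \<rho>_sublinear: assumes "\<epsilon> > 0" obtains R where "R > 0" "\<And>z. cmod z \<ge> R \<Longrightarrow> \<rho> z \<le> \<epsilon> * cmod z"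
proof -
  obtain j where j: "2 / \<epsilon> < 2 ^ j" using real_arch_pow[of 2 "2 / \<epsilon>"] by auto
  obtain R where R: "R > 0" "m 0 R > C ^ j" using m_unbounded by blast
  show thesis
  proof (rule that[OF R(1)])
    fix z assume z: "cmod z \<ge> R"
    have "C ^ j < m 0 (cmod z)" using R(2) m_mono_radius[OF z, of 0] by linarith
    also have "\<dots> \<le> m z (2 ^ j * (\<epsilon> * cmod z))"
    proof (rule m_mono_dist)
      have "2 * cmod z \<le> 2 ^ j * \<epsilon> * cmod z"
        using j assms by (intro mult_right_mono) (auto simp: field_simps)
      then show "dist 0 z + cmod z \<le> 2 ^ j * (\<epsilon> * cmod z)" by (simp add: mult.assoc)
    qed
    also have "\<dots> \<le> C ^ j * m z (\<epsilon> * cmod z)"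
      using assms R z by (intro m_doubling_iter mult_pos_pos) auto
    finally have "1 \<le> m z (\<epsilon> * cmod z)" using C_pos by simp
    then show "\<rho> z \<le> \<epsilon> * cmod z" by (rule \<rho>_le)
  qed
qed

end

section \<open>Mass of annuli of width comparable to the radius function\<close>

locale radial_doubling = infinite_doubling +
  assumes radial_m: "cmod a = cmod b \<Longrightarrow> m a r = m b r"
begin

lemma \<rho>_radial: "cmod a = cmod b \<Longrightarrow> \<rho> a = \<rho> b"
  unfolding radius_function_def by (simp add: emeasure_ball_m radial_m[of a b])

definition R :: "real \<Rightarrow> real" where "R r = \<rho> (of_real r)"

lemma R_cmod: "\<rho> z = R (cmod z)"
  unfolding R_def by (rule \<rho>_radial) simp

lemma R_pos: "R r > 0" by (simp add: R_def \<rho>_pos)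

lemma R_lipschitz: "\<bar>R r - R s\<bar> \<le> \<bar>r - s\<bar>"
  using \<rho>_lipschitz'[of "of_real r" "of_real s"] by (simp add: R_def dist_norm flip: of_real_diff)

lemma R_measurable[measurable]: "R \<in> borel_measurable borel"
  unfolding R_def[abs_def] by measurable

text \<open>Equally spaced points on the circle of radius r, at angular distance at most
  \<open>R r / r\<close>, come within \<open>2 * R r\<close> of every point of the annulus. By
  radial symmetry each covering disk of radius \<open>4 * R r\<close> has mass at most C^2.\<close>

lemma annulus_upper:
  assumes "0 < r" "R r \<le> r"
  shows "m 0 (r + R r) - m 0 (r - R r) \<le> 8 * C ^ 2 * (r / R r)"
proof -
  define J where "J = nat \<lceil>2 * pi * r / R r\<rceil>"
  define z where "z j = of_real r * cis (2 * pi * real j / real J)" for j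
  have Jge: "2 * pi * r / R r \<le> real J" unfolding J_def using assms R_pos[of r] by linarith
  have Jpos: "J > 0"
  proof -
    have "0 < 2 * pi * r / R r" using assms R_pos[of r] by simp
    with Jge show ?thesis by linarith
  qed
  \<comment> \<open>Rounding up costs 1, at most \<open>r / R r\<close> by assumption, and 2 pi + 1
    is below 8.\<close>
  have Jle: "real J \<le> 8 * (r / R r)"
  proof -
    have "0 \<le> 2 * pi * r / R r" using assms R_pos[of r] by simp
    then have "real J \<le> 2 * pi * r / R r + 1" unfolding J_def by linarith
    also have "\<dots> \<le> (2 * pi) * (r / R r) + r / R r" using assms R_pos[of r] by simp
    also have "\<dots> \<le> 8 * (r / R r)"
    proof -
      have "(2 * pi + 1) * (r / R r) \<le> 8 * (r / R r)"
        using pi_less_4 assms R_pos[of r] pi_approx(2) by (intro mult_right_mono) auto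
      then show ?thesis by (simp add: algebra_simps)
    qed
    finally show ?thesis .
  qed
  have cover: "ball 0 (r + R r) - ball 0 (r - R r) \<subseteq> (\<Union>j<J. ball (z j) (4 * R r))"
  proof
    fix w :: complex assume w: "w \<in> ball 0 (r + R r) - ball 0 (r - R r)"
    then have s: "\<bar>cmod w - r\<bar> \<le> R r" by auto
    define t where "t = Arg2pi w"
    have t: "0 \<le> t" "t < 2 * pi" using Arg2pi[of w] by (auto simp: t_def)
    define j where "j = nat \<lfloor>t * real J / (2 * pi)\<rfloor>"
    have j0: "0 \<le> t * real J / (2 * pi)" using t by simp
    have j1: "real j \<le> t * real J / (2 * pi)" "t * real J / (2 * pi) < real j + 1"
      unfolding j_def using j0 by linarith+
    have "t * real J / (2 * pi) < real J" using t Jpos by (simp add: field_simps)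
    then have jJ: "j < J" using j1 by linarith
    have "\<bar>t - 2 * pi * real j / real J\<bar> \<le> 2 * pi / real J"
    proof -
      have "2 * pi * real j / real J \<le> t" "t \<le> 2 * pi * real j / real J + 2 * pi / real J"
        using j1 Jpos by (auto simp: field_simps)
      then show ?thesis by linarith
    qed
    also have "2 * pi / real J \<le> R r / r"
      using Jge Jpos assms R_pos[of r] by (simp add: field_simps)
    finally have tj: "\<bar>t - 2 * pi * real j / real J\<bar> \<le> R r / r" .
    have "w - z j = of_real (cmod w - r) * cis t + of_real r * (cis t - cis (2 * pi * real j / real J))"
      using exp_i_Arg2pi[of w] by (simp add: z_def t_def algebra_simps)
    then have "cmod (w - z j) \<le> \<bar>cmod w - r\<bar> + r * cmod (cis t - cis (2 * pi * real j / real J))"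
      using assms norm_triangle_ineq[of "of_real (cmod w - r) * cis t" "of_real r * (cis t - cis (2 * pi * real j / real J))"]
      by (simp add: norm_mult del: of_real_diff)
    also have "r * cmod (cis t - cis (2 * pi * real j / real J)) \<le> r * (R r / r)"
      using assms tj order_trans[OF norm_cis_diff_le] by (intro mult_left_mono) auto
    finally have "cmod (w - z j) \<le> 2 * R r" using s assms by simp
    then have "w \<in> ball (z j) (4 * R r)" using R_pos[of r] by (simp add: dist_norm norm_minus_commute)
    then show "w \<in> (\<Union>j<J. ball (z j) (4 * R r))" using jJ by blast
  qed
  have "m 0 (r + R r) - m 0 (r - R r) = measure \<nu> (ball 0 (r + R r) - ball 0 (r - R r))"
    unfolding m_def using R_pos[of r] fm_subset_cball[of "ball 0 (r + R r)" 0 "r + R r"]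
    by (subst measurable_measure_Diff) (auto intro!: fmeasurableI subset_ball)
  also have "\<dots> \<le> measure \<nu> (\<Union>j<J. ball (z j) (4 * R r))"
  proof (rule measure_mono_fmeasurable[OF cover])
    show "(\<Union>j<J. ball (z j) (4 * R r)) \<in> fmeasurable \<nu>"
      using finite_ball by (intro fmeasurable.finite_UN) (auto intro!: fmeasurableI)
  qed auto
  also have "\<dots> \<le> (\<Sum>j<J. m (z j) (4 * R r))"
    unfolding m_def using finite_ball by (intro measure_UNION_le) auto
  also have "\<dots> \<le> (\<Sum>j<J. C ^ 2)"
  proof (rule sum_mono)
    fix j
    have "m (z j) (4 * R r) = m (of_real r) (2 ^ 2 * \<rho> (of_real r))"
      unfolding R_def using assms by (subst radial_m[of _ "of_real r"]) (auto simp: z_def norm_mult)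
    also have "\<dots> \<le> C ^ 2 * m (of_real r) (\<rho> (of_real r))" by (rule m_doubling_iter) (rule \<rho>_pos)
    finally show "m (z j) (4 * R r) \<le> C ^ 2" by (simp add: m_\<rho>)
  qed
  also have "\<dots> = real J * C ^ 2" by simp
  also have "\<dots> \<le> 8 * (r / R r) * C ^ 2" using Jle C_pos by (intro mult_right_mono) auto
  finally show ?thesis by (simp add: mult_ac)
qed

text \<open>On one radian, which is less than pi/3, cos is at least 1/2, so sin alone already
  separates the points.\<close>

lemma cis_separation:
  assumes "a \<in> {0..1}" "b \<in> {0..1}"
  shows "\<bar>a - b\<bar> / 2 \<le> cmod (cis a - cis b)"
proof -
  have *: "(y - x) / 2 \<le> sin y - sin x" if "x \<le> y" "0 \<le> x" "y \<le> 1" for x y :: real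
  proof -
    have "\<exists>d. ((\<lambda>u. sin u - u / 2) has_real_derivative d) (at u) \<and> 0 \<le> d" if "x \<le> u" "u \<le> y" for u
    proof (intro exI conjI)
      show "((\<lambda>u. sin u - u / 2) has_real_derivative (cos u - 1 / 2)) (at u)"
        by (auto intro!: derivative_eq_intros)
      have "cos (pi / 3) \<le> cos u"
        by (rule cos_monotone_0_pi_le) (use that \<open>0 \<le> x\<close> \<open>y \<le> 1\<close> pi_gt3 in auto)
      then show "0 \<le> cos u - 1 / 2" by (simp add: cos_60)
    qed
    then have "sin x - x / 2 \<le> sin y - y / 2"
      by (rule DERIV_nonneg_imp_nondecreasing[OF that(1)])
    then show ?thesis by (simp add: field_simps)
  qed
  have "\<bar>a - b\<bar> / 2 \<le> \<bar>sin a - sin b\<bar>"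
    using *[of a b] *[of b a] assms by (cases "a \<le> b") auto
  also have "\<dots> \<le> cmod (cis a - cis b)" using abs_Im_le_cmod[of "cis a - cis b"] by simp
  finally show ?thesis .
qed

text \<open>More than \<open>r / R r\<close> disjoint disks of radius \<open>R r / 8\<close> fit
  with centres on one radian of the circle of radius b. Four doublings give radius
  \<open>2 * R r\<close>, which covers a unit-mass disk centred at r, so each has mass at least
  C^(-4). The two choices b = r + R/2 and b = r - R/2 treat the outer and the inner half of an
  annulus around r.\<close>

lemma annulus_lower:
  assumes "0 < r" "R r \<le> r" "\<bar>b - r\<bar> = R r / 2"
  shows "r / R r / C ^ 4 \<le> m 0 (b + R r / 2) - m 0 (b - R r / 2)"
proof -
  have b: "b \<ge> r / 2" using assms R_pos[of r] by linarith
  define J where "J = nat \<lfloor>r / R r\<rfloor>"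
  have Jb: "real J \<le> r / R r" "r / R r < real J + 1"
    unfolding J_def using assms R_pos[of r] by (auto simp: of_nat_nat)
  define z where "z j = of_real b * cis (real j * R r / r)" for j
  have ang: "real j * R r / r \<in> {0..1}" if "j \<le> J" for j
  proof -
    have "real j \<le> r / R r" using that Jb by linarith
    then show ?thesis using assms R_pos[of r] by (simp add: field_simps)
  qed
  have cz: "cmod (z j) = b" for j using b assms by (simp add: z_def norm_mult)
  have disj: "disjoint_family_on (\<lambda>j. ball (z j) (R r / 8)) {..J}"
    unfolding disjoint_family_on_def
  proof (intro ballI impI equals0I)
    fix i j x assume ij: "i \<in> {..J}" "j \<in> {..J}" "i \<noteq> j" and x: "x \<in> ball (z i) (R r / 8) \<inter> ball (z j) (R r / 8)"
    have "\<bar>real i - real j\<bar> \<ge> 1" using ij by linarith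
    then have "1 * (R r / r) \<le> \<bar>real i - real j\<bar> * (R r / r)"
      using assms R_pos[of r] by (intro mult_right_mono) auto
    then have "R r / r \<le> \<bar>real i - real j\<bar> * (R r / r)" by simp
    also have "\<dots> = \<bar>real i * R r / r - real j * R r / r\<bar>"
      using assms R_pos[of r] by (simp add: abs_mult flip: left_diff_distrib diff_divide_distrib)
    finally have "R r / r / 2 \<le> cmod (cis (real i * R r / r) - cis (real j * R r / r))"
      using cis_separation[OF ang[of i] ang[of j]] ij by simp
    then have "b * (R r / r / 2) \<le> b * cmod (cis (real i * R r / r) - cis (real j * R r / r))"
      using b assms by (intro mult_left_mono) auto
    also have "\<dots> = dist (z i) (z j)"
      using b assms by (simp add: z_def dist_norm norm_mult flip: right_diff_distrib)
    also have "\<dots> < R r / 4"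
      using x dist_triangle[of "z i" "z j" x] by (auto simp: dist_commute)
    finally have "b * (R r / r / 2) < R r / 4" .
    moreover have "R r / 4 \<le> b * (R r / r / 2)"
      using b assms R_pos[of r] by (simp add: field_simps)
    ultimately show False by simp
  qed
  have sub: "ball (z j) (R r / 8) \<subseteq> ball 0 (b + R r / 2) - ball 0 (b - R r / 2)" for j
  proof
    fix w assume "w \<in> ball (z j) (R r / 8)"
    then have "cmod (z j - w) < R r / 8" by (simp add: dist_norm)
    then have "\<bar>b - cmod w\<bar> < R r / 8" using norm_triangle_ineq3[of "z j" w] by (simp add: cz)
    then have "cmod w < b + R r / 2" "b - R r / 2 \<le> cmod w" using R_pos[of r] by linarith+
    then show "w \<in> ball 0 (b + R r / 2) - ball 0 (b - R r / 2)" by simp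
  qed
  have mass: "1 / C ^ 4 \<le> m (z j) (R r / 8)" for j
  proof -
    have "1 = m (of_real r) (R r)" by (simp add: R_def m_\<rho>)
    also have "\<dots> \<le> m (of_real b) (2 ^ 4 * (R r / 8))"
    proof (rule m_mono_dist)
      have "\<bar>r - b\<bar> \<le> R r" using assms(3) R_pos[of r] by linarith
      then show "dist (complex_of_real r) (of_real b) + R r \<le> 2 ^ 4 * (R r / 8)"
        by (simp add: dist_norm flip: of_real_diff)
    qed
    also have "\<dots> \<le> C ^ 4 * m (of_real b) (R r / 8)" by (rule m_doubling_iter) (simp add: R_pos)
    also have "m (of_real b) (R r / 8) = m (z j) (R r / 8)"
      using b assms by (intro radial_m) (simp add: cz)
    finally show ?thesis using C_pos by (simp add: field_simps)
  qed
  have "r / R r * (1 / C ^ 4) \<le> (real J + 1) * (1 / C ^ 4)" using Jb C_pos by (intro mult_right_mono) auto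
  then have "r / R r / C ^ 4 \<le> (real J + 1) * (1 / C ^ 4)" by simp
  also have "\<dots> = (\<Sum>j\<le>J. 1 / C ^ 4)" by simp
  also have "\<dots> \<le> (\<Sum>j\<le>J. measure \<nu> (ball (z j) (R r / 8)))" using mass by (intro sum_mono) (simp add: m_def)
  also have "\<dots> = measure \<nu> (\<Union>j\<le>J. ball (z j) (R r / 8))"
    using disj finite_ball by (subst measure_finite_Union) (auto simp: less_top)
  also have "\<dots> \<le> measure \<nu> (ball 0 (b + R r / 2) - ball 0 (b - R r / 2))"
    using sub borel_open[OF open_UN[of "{..J}" "\<lambda>j. ball (z j) (R r / 8)"]]
    by (intro measure_mono_bounded[of _ _ 0 "b + R r / 2"]) auto
  also have "\<dots> = m 0 (b + R r / 2) - m 0 (b - R r / 2)"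
    unfolding m_def using R_pos[of r] fm_subset_cball[of "ball 0 (b + R r / 2)" 0 "b + R r / 2"]
    by (subst measurable_measure_Diff) (auto intro!: fmeasurableI subset_ball)
  finally show ?thesis .
qed

end

section \<open>Radial potentials with doubling Laplacian\<close>

lemma nn_integral_cis_shift:
  fixes F :: "complex \<Rightarrow> ennreal"
  assumes [measurable]: "F \<in> borel_measurable borel" and \<beta>: "0 \<le> \<beta>" "\<beta> < 2 * pi"
  shows "(\<integral>\<^sup>+t\<in>{0..<2*pi}. F (cis (t + \<beta>)) \<partial>lborel) = (\<integral>\<^sup>+t\<in>{0..<2*pi}. F (cis t) \<partial>lborel)"
proof -
  have [measurable]: "cis \<in> borel_measurable borel"
    by (intro borel_measurable_continuous_onI continuous_intros)
  have "(\<integral>\<^sup>+t\<in>{0..<2*pi}. F (cis (t + \<beta>)) \<partial>lborel) = (\<integral>\<^sup>+t. F (cis t) * indicator {\<beta>..<\<beta> + 2*pi} t \<partial>lborel)"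
    by (subst (2) nn_integral_real_affine[where c=1 and t=\<beta>])
       (auto intro!: nn_integral_cong simp: add.commute indicator_def)
  also have "\<dots> = (\<integral>\<^sup>+t. (F (cis t) * indicator {\<beta>..<2*pi} t + F (cis t) * indicator {2*pi..<\<beta> + 2*pi} t) \<partial>lborel)"
    using \<beta> by (intro nn_integral_cong) (auto simp: indicator_def)
  also have "\<dots> = (\<integral>\<^sup>+t. F (cis t) * indicator {\<beta>..<2*pi} t \<partial>lborel) + (\<integral>\<^sup>+t. F (cis t) * indicator {2*pi..<\<beta> + 2*pi} t \<partial>lborel)"
    by (rule nn_integral_add) auto
  also have "(\<integral>\<^sup>+t. F (cis t) * indicator {2*pi..<\<beta> + 2*pi} t \<partial>lborel) = (\<integral>\<^sup>+t. F (cis t) * indicator {0..<\<beta>} t \<partial>lborel)"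
    by (subst nn_integral_real_affine[where c=1 and t="2*pi"])
       (auto intro!: nn_integral_cong simp: indicator_def cis_mult[symmetric])
  also have "(\<integral>\<^sup>+t. F (cis t) * indicator {\<beta>..<2*pi} t \<partial>lborel) + (\<integral>\<^sup>+t. F (cis t) * indicator {0..<\<beta>} t \<partial>lborel)
     = (\<integral>\<^sup>+t. (F (cis t) * indicator {\<beta>..<2*pi} t + F (cis t) * indicator {0..<\<beta>} t) \<partial>lborel)"
    by (rule nn_integral_add[symmetric]) auto
  also have "\<dots> = (\<integral>\<^sup>+t\<in>{0..<2*pi}. F (cis t) \<partial>lborel)"
    using \<beta> by (intro nn_integral_cong) (auto simp: indicator_def)
  finally show ?thesis .
qed

lemma subharmonic_measurable:
  assumes "subharmonic \<phi>" shows "\<phi> \<in> borel_measurable borel"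
  using assms by (intro borel_measurableI_less) (auto simp: subharmonic_def)

lemma subharmonic_bounded_above:
  assumes "subharmonic \<phi>"
  obtains B where "B \<ge> 0" "\<And>z. z \<in> cball z0 r \<Longrightarrow> \<phi> z \<le> ereal B"
proof -
  have cov: "cball z0 r \<subseteq> (\<Union>n\<in>UNIV. {z. \<phi> z < ereal (real n)})"
  proof
    fix z
    have "\<phi> z < \<infinity>" using assms by (simp add: subharmonic_def)
    then obtain n where "\<phi> z \<le> ereal (real n)"
      by (cases "\<phi> z") (use real_arch_simple in auto)
    then have "\<phi> z < ereal (real (Suc n))" by (rule le_less_trans) simp
    then show "z \<in> (\<Union>n\<in>UNIV. {z. \<phi> z < ereal (real n)})" by blast
  qed
  have op: "open {z. \<phi> z < ereal (real n)}" for n using assms by (simp add: subharmonic_def)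
  obtain T where T: "finite T" "cball z0 r \<subseteq> (\<Union>n\<in>T. {z. \<phi> z < ereal (real n)})"
    by (rule compactE_image[OF compact_cball _ cov]) (use op in auto)
  show thesis
  proof (rule that[of "real (Max (insert 0 T))"])
    fix z assume "z \<in> cball z0 r"
    then obtain n where n: "n \<in> T" "\<phi> z < ereal (real n)" using T by blast
    then have "n \<le> Max (insert 0 T)" using T(1) by simp
    then show "\<phi> z \<le> ereal (real (Max (insert 0 T)))" using n(2) by (auto intro: order_trans[OF less_imp_le])
  qed simp
qed

lemma prob_space_uniform_circle: "prob_space (uniform_measure lborel {0..<2*pi})"
  by (rule prob_space_uniform_measure) auto

text \<open>About a point z0 where \<phi> is finite, the submean inequality bounds the circle mean
  of the negative part by B - \<phi>(z0), where B bounds \<phi> above on a disk. This holds for all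
  radii in the range, and the circle means integrate to the area integral.\<close>

lemma subharmonic_nn_integral_neg:
  assumes sub: "subharmonic \<phi>"
  shows "(\<integral>\<^sup>+z\<in>ball 0 r. e2ennreal (- \<phi> z) \<partial>lborel) < \<infinity>"
proof -
  have [measurable]: "\<phi> \<in> borel_measurable borel" by (rule subharmonic_measurable[OF sub])
  have [measurable]: "cis \<in> borel_measurable borel"
    by (intro borel_measurable_continuous_onI continuous_intros)
  let ?U = "uniform_measure lborel {0..<2*pi}"
  interpret U: prob_space ?U by (rule prob_space_uniform_circle)
  obtain z0 where "\<phi> z0 \<noteq> -\<infinity>" "\<phi> z0 < \<infinity>" using sub by (auto simp: subharmonic_def)
  then obtain c where c: "\<phi> z0 = ereal c" by (cases "\<phi> z0") auto
  define R where "R = \<bar>r\<bar> + cmod z0 + 1"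
  have R: "R > 0" by (simp add: R_def add_nonneg_pos)
  obtain B where B: "B \<ge> 0" "\<And>z. z \<in> cball z0 R \<Longrightarrow> \<phi> z \<le> ereal B"
    using subharmonic_bounded_above[OF sub] by blast
  have Q: "(\<integral>\<^sup>+t. e2ennreal (- \<phi> (z0 + of_real s * cis t)) \<partial>?U) \<le> ennreal (B - c)" if s: "0 < s" "s < R" for s
  proof -
    define P where "P = (\<integral>\<^sup>+t. e2ennreal (\<phi> (z0 + of_real s * cis t)) \<partial>?U)"
    define Q where "Q = (\<integral>\<^sup>+t. e2ennreal (- \<phi> (z0 + of_real s * cis t)) \<partial>?U)"
    have "P \<le> (\<integral>\<^sup>+t. ennreal B \<partial>?U)" unfolding P_def
    proof (rule nn_integral_mono)
      fix t have "\<phi> (z0 + of_real s * cis t) \<le> ereal B"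
        using s by (intro B(2)) (simp add: dist_norm norm_mult)
      then show "e2ennreal (\<phi> (z0 + of_real s * cis t)) \<le> ennreal B"
        using e2ennreal_mono by fastforce
    qed
    also have "\<dots> = ennreal B" by (simp add: U.emeasure_space_1 del: space_uniform_measure)
    finally have P: "P \<le> ennreal B" .
    have "ereal c \<le> enn2ereal P - enn2ereal Q"
      using sub s c unfolding subharmonic_def circle_mean_def P_def Q_def Let_def by metis
    then show ?thesis using P B(1) unfolding Q_def[symmetric]
      by (cases P; cases Q) (auto simp: enn2ereal_ennreal ennreal_leI top_unique)
  qed
  define G where "G z = e2ennreal (- \<phi> z) * indicator (ball z0 R) z" for z
  have [measurable]: "G \<in> borel_measurable borel" unfolding G_def by measurable
  have inner: "(\<integral>\<^sup>+t. G (z0 + cis t * w) \<partial>?U) \<le> ennreal (B - c) * indicator (ball 0 R) w" if w: "w \<noteq> 0" for w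
  proof (cases "cmod w < R")
    case True
    define \<beta> where "\<beta> = Arg2pi w"
    have \<beta>: "0 \<le> \<beta>" "\<beta> < 2 * pi" using Arg2pi[of w] by (auto simp: \<beta>_def)
    have w': "cis t * w = of_real (cmod w) * cis (t + \<beta>)" for t
      by (subst exp_i_Arg2pi[of w]) (simp add: \<beta>_def cis_mult[symmetric])
    have "(\<integral>\<^sup>+t. G (z0 + cis t * w) \<partial>?U) = (\<integral>\<^sup>+t. e2ennreal (- \<phi> (z0 + of_real (cmod w) * cis (t + \<beta>))) \<partial>?U)"
      using True by (intro nn_integral_cong) (simp add: w' G_def dist_norm norm_mult)
    also have "\<dots> = (\<integral>\<^sup>+t. e2ennreal (- \<phi> (z0 + of_real (cmod w) * cis t)) \<partial>?U)"
      using nn_integral_cis_shift[OF _ \<beta>, of "\<lambda>v. e2ennreal (- \<phi> (z0 + of_real (cmod w) * v))"]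
      by (subst (1 2) nn_integral_uniform_measure) auto
    also have "\<dots> \<le> ennreal (B - c)" using True w by (intro Q) auto
    finally show ?thesis using True by simp
  next
    case False
    then have "G (z0 + cis t * w) = 0" for t by (simp add: G_def dist_norm norm_mult)
    then show ?thesis by simp
  qed
  have "(\<integral>\<^sup>+z\<in>ball 0 r. e2ennreal (- \<phi> z) \<partial>lborel) \<le> (\<integral>\<^sup>+z. G z \<partial>lborel)"
  proof (rule nn_integral_mono)
    fix z
    have "z \<in> ball z0 R" if "z \<in> ball 0 r"
      using that norm_triangle_ineq4[of z0 z] by (simp add: R_def dist_norm)
    then show "e2ennreal (- \<phi> z) * indicator (ball 0 r) z \<le> G z" by (auto simp: G_def indicator_def)
  qed
  also have "\<dots> = (\<integral>\<^sup>+w. G (z0 + w) \<partial>lborel)"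
    by (subst lborel_distr_plus[of z0, symmetric], subst nn_integral_distr) auto
  \<comment> \<open>Averaging over all rotations about z0 leaves the integral unchanged; after
    Fubini the inner integral over the angle is a circle mean.\<close>
  also have "\<dots> = (\<integral>\<^sup>+t. (\<integral>\<^sup>+w. G (z0 + cis t * w) \<partial>lborel) \<partial>?U)"
    using nn_integral_rotation[of "\<lambda>w. G (z0 + w)"] by (simp add: U.emeasure_space_1 del: space_uniform_measure)
  also have "\<dots> = (\<integral>\<^sup>+w. (\<integral>\<^sup>+t. G (z0 + cis t * w) \<partial>?U) \<partial>lborel)"
  proof -
    interpret pair_sigma_finite lborel ?U ..
    have "(\<lambda>x. G (z0 + cis (snd x) * fst x)) \<in> borel_measurable (borel \<Otimes>\<^sub>M borel)" by measurable
    then show ?thesis by (intro Fubini') (simp add: split_beta' cong: measurable_cong_sets)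
  qed
  also have "\<dots> \<le> (\<integral>\<^sup>+(w::complex). ennreal (B - c) * indicator (ball 0 R) w \<partial>lborel)"
  proof -
    have "AE w in lborel. w \<noteq> (0::complex)" by (rule AE_lborel_singleton)
    then have "AE w in lborel. (\<integral>\<^sup>+t. G (z0 + cis t * w) \<partial>?U) \<le> ennreal (B - c) * indicator (ball 0 R) w"
      by eventually_elim (rule inner)
    then show ?thesis by (rule nn_integral_mono_AE)
  qed
  also have "\<dots> = ennreal (B - c) * emeasure lborel (ball (0::complex) R)" by (simp add: nn_integral_cmult_indicator)
  also have "\<dots> < \<infinity>" using R by (simp add: emeasure_ball ennreal_mult_less_top)
  finally show ?thesis .
qed

lemma subharmonic_AE_finite:
  assumes sub: "subharmonic \<phi>"
  shows "AE z in lborel. \<phi> z = ereal (real_of_ereal (\<phi> z))"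
proof -
  have [measurable]: "\<phi> \<in> borel_measurable borel" by (rule subharmonic_measurable[OF sub])
  have "AE z in lborel. \<forall>n. e2ennreal (- \<phi> z) * indicator (ball 0 (real n)) z \<noteq> \<infinity>"
    unfolding AE_all_countable
  proof
    fix n
    have "(\<lambda>z. e2ennreal (- \<phi> z) * indicator (ball 0 (real n)) z) \<in> borel_measurable lborel" by measurable
    then show "AE z in lborel. e2ennreal (- \<phi> z) * indicator (ball 0 (real n)) z \<noteq> \<infinity>"
      by (rule nn_integral_PInf_AE) (use subharmonic_nn_integral_neg[OF sub, of n] in auto)
  qed
  then show ?thesis
  proof eventually_elim
    case (elim z)
    obtain n where "cmod z < real n" using reals_Archimedean2 by blast
    with elim have "e2ennreal (- \<phi> z) \<noteq> \<infinity>" by (auto simp: indicator_def split: if_splits dest!: spec[of _ n])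
    moreover have "\<phi> z < \<infinity>" using sub by (simp add: subharmonic_def)
    ultimately show ?case by (cases "\<phi> z") (auto simp: e2ennreal_infty)
  qed
qed

lemma subharmonic_set_integrable:
  assumes sub: "subharmonic \<phi>"
  shows "set_integrable lborel (ball 0 r) (\<lambda>z. real_of_ereal (\<phi> z))"
proof -
  have [measurable]: "\<phi> \<in> borel_measurable borel" by (rule subharmonic_measurable[OF sub])
  obtain B where B: "B \<ge> 0" "\<And>z. z \<in> cball 0 r \<Longrightarrow> \<phi> z \<le> ereal B"
    using subharmonic_bounded_above[OF sub] by blast
  have "(\<integral>\<^sup>+z. ennreal (norm (indicator (ball 0 r) z *\<^sub>R real_of_ereal (\<phi> z))) \<partial>lborel)
     \<le> (\<integral>\<^sup>+z. ennreal B * indicator (ball 0 r) z + e2ennreal (- \<phi> z) * indicator (ball 0 r) z \<partial>lborel)"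
  proof (rule nn_integral_mono)
    fix z
    have "ennreal \<bar>real_of_ereal (\<phi> z)\<bar> \<le> ennreal B + e2ennreal (- \<phi> z)" if "z \<in> ball 0 r"
    proof (cases "\<phi> z")
      case (real x)
      then have "x \<le> B" using B(2)[of z] that by simp
      have "ennreal \<bar>x\<bar> \<le> ennreal (B + max 0 (- x))" using \<open>x \<le> B\<close> B(1) by (intro ennreal_leI) auto
      also have "\<dots> = ennreal B + ennreal (- x)" using B(1) by (subst ennreal_plus) (auto simp: max_def ennreal_neg)
      finally show ?thesis using real by simp
    qed (use B(2)[of z] that in auto)
    then show "ennreal (norm (indicator (ball 0 r) z *\<^sub>R real_of_ereal (\<phi> z))) \<le> ennreal B * indicator (ball 0 r) z + e2ennreal (- \<phi> z) * indicator (ball 0 r) z"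
      by (auto simp: indicator_def)
  qed
  also have "\<dots> = ennreal B * emeasure lborel (ball (0::complex) r) + (\<integral>\<^sup>+z\<in>ball 0 r. e2ennreal (- \<phi> z) \<partial>lborel)"
    by (subst nn_integral_add, measurable) (simp add: nn_integral_cmult_indicator)
  also have "\<dots> < \<infinity>" using subharmonic_nn_integral_neg[OF sub, of r]
    by (cases "r \<ge> 0") (auto simp: emeasure_ball ennreal_mult_less_top ball_empty)
  finally show ?thesis unfolding set_integrable_def by (intro integrableI_bounded) auto
qed

text \<open>The preimage of \<open>{..<s}\<close> is a disk of area pi s, linear in s. In this
  variable the weak form of the Laplace equation carries no weight.\<close>

lemma distr_lborel_cmod_sq:
  "distr lborel borel (\<lambda>z::complex. (cmod z)\<^sup>2) = density lborel (\<lambda>s. ennreal pi * indicator {0<..} s)"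
  (is "?A = ?B")
proof (rule measure_eqI_generator_eq[where E="range lessThan" and \<Omega>=UNIV and A="\<lambda>i. {..<real i}"])
  show "Int_stable (range lessThan :: real set set)"
    unfolding Int_stable_def by (auto simp: lessThan_Int_lessThan_min)
  show "sets ?A = sigma_sets UNIV (range lessThan)" "sets ?B = sigma_sets UNIV (range lessThan)"
    by (simp_all add: borel_eq_lessThan eucl_less_def lessThan_def)
  have A: "emeasure ?A {..<s} = ennreal (pi * max 0 s)" for s
  proof (cases "s > 0")
    case True
    have "(\<lambda>z::complex. (cmod z)\<^sup>2) -` {..<s} = ball 0 (sqrt s)"
      using True by (auto simp: real_less_rsqrt) (metis norm_ge_zero real_sqrt_less_iff real_sqrt_unique real_sqrt_abs abs_norm_cancel real_sqrt_pow2_iff less_imp_le power2_less_imp_less real_sqrt_pow2)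
    then have "emeasure ?A {..<s} = emeasure lborel (ball (0::complex) (sqrt s))"
      by (subst emeasure_distr) auto
    also have "\<dots> = ennreal (pi * s)"
      using True by (subst emeasure_ball) (auto simp: eval_unit_ball_vol)
    finally show ?thesis using True by simp
  next
    case False
    then have "(\<lambda>z::complex. (cmod z)\<^sup>2) -` {..<s} \<inter> space lborel = {}"
      by (auto simp: not_less) (meson less_le_trans not_sum_power2_lt_zero zero_le_power2 not_less)
    then show ?thesis using False by (subst emeasure_distr) auto
  qed
  have B: "emeasure ?B {..<s} = ennreal (pi * max 0 s)" for s
  proof -
    have "emeasure ?B {..<s} = (\<integral>\<^sup>+r. ennreal pi * indicator {0<..<s} r \<partial>lborel)"
      by (subst emeasure_density) (auto intro!: nn_integral_cong simp: indicator_def)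
    also have "\<dots> = ennreal (pi * max 0 s)"
      by (simp add: nn_integral_cmult_indicator ennreal_mult max_def)
    finally show ?thesis .
  qed
  show "emeasure ?A X = emeasure ?B X" if "X \<in> range lessThan" for X
    using that A B by auto
  show "(\<Union>i. {..<real i}) = UNIV" by (auto intro: reals_Archimedean2)
  show "emeasure ?A {..<real i} \<noteq> \<infinity>" for i by (simp add: A)
qed auto

lemma lborel_integral_cmod_sq:
  fixes f :: "real \<Rightarrow> real"
  assumes [measurable]: "f \<in> borel_measurable borel"
  shows "(LINT z|lborel. f ((cmod z)\<^sup>2)) = pi * (LINT s|lborel. indicator {0<..} s * f s)"
    and "integrable lborel (\<lambda>z::complex. f ((cmod z)\<^sup>2)) \<longleftrightarrow> integrable lborel (\<lambda>s. indicator {0<..} s * f s)"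
proof -
  have *: "(\<lambda>s::real. ennreal pi * indicator {0<..} s) \<in> borel_measurable lborel" "(\<lambda>s::real. ennreal (pi * indicator {0<..} s)) \<in> borel_measurable lborel"
    by measurable
  have d: "density lborel (\<lambda>s::real. ennreal pi * indicator {0<..} s) = density lborel (\<lambda>s. ennreal (pi * indicator {0<..} s))"
    by (rule density_cong[OF *]) (auto split: split_indicator)
  have "(LINT z|lborel. f ((cmod z)\<^sup>2)) = integral\<^sup>L (distr lborel borel (\<lambda>z::complex. (cmod z)\<^sup>2)) f"
    by (subst integral_distr) auto
  also have "\<dots> = (LINT s|lborel. (pi * indicator {0<..} s) * f s)"
    unfolding distr_lborel_cmod_sq d by (subst integral_density) auto
  finally show "(LINT z|lborel. f ((cmod z)\<^sup>2)) = pi * (LINT s|lborel. indicator {0<..} s * f s)"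
    by (simp add: mult.assoc)
  have "integrable lborel (\<lambda>z::complex. f ((cmod z)\<^sup>2)) \<longleftrightarrow> integrable (distr lborel borel (\<lambda>z::complex. (cmod z)\<^sup>2)) f"
    by (subst integrable_distr_eq) auto
  also have "\<dots> \<longleftrightarrow> integrable lborel (\<lambda>s. (pi * indicator {0<..} s) * f s)"
    unfolding distr_lborel_cmod_sq d by (subst integrable_density) auto
  finally show "integrable lborel (\<lambda>z::complex. f ((cmod z)\<^sup>2)) \<longleftrightarrow> integrable lborel (\<lambda>s. indicator {0<..} s * f s)"
    by (simp add: mult.assoc)
qed

lemma continuous_antiderivative:
  fixes f :: "real \<Rightarrow> real"
  assumes "continuous_on UNIV f"
  obtains F where "\<And>x. (F has_real_derivative f x) (at x)"
proof -
  have "\<exists>F. \<forall>x :: real. -\<infinity> < ereal x \<longrightarrow> ereal x < \<infinity> \<longrightarrow> (F has_vector_derivative f x) (at x)"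
    by (rule einterval_antiderivative) (use assms in \<open>auto simp: continuous_on_eq_continuous_at\<close>)
  then show thesis using that by (auto simp: has_real_derivative_iff_has_vector_derivative)
qed

lemma bump_nn_integral_bounds:
  assumes "0 \<le> \<alpha>" "\<alpha> < \<beta>"
  shows "0 < (\<integral>\<^sup>+s. ennreal (bump \<alpha> \<beta> 1 s) \<partial>lborel)" "(\<integral>\<^sup>+s. ennreal (bump \<alpha> \<beta> 1 s) \<partial>lborel) < \<infinity>"
proof -
  have [measurable]: "bump \<alpha> \<beta> 1 \<in> borel_measurable borel" by (rule smooth_measurable[OF smooth_bump])
  have "(\<integral>\<^sup>+s. ennreal (bump \<alpha> \<beta> 1 s) \<partial>lborel) \<le> (\<integral>\<^sup>+s. indicator {\<alpha>..\<beta>} s \<partial>lborel)"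
    using bump_bounds[of \<alpha> \<beta> 1] bump_eq_0[of \<alpha> _ \<beta> 1]
    by (intro nn_integral_mono) (auto simp: indicator_def)
  also have "\<dots> < \<infinity>" using assms by simp
  finally show "(\<integral>\<^sup>+s. ennreal (bump \<alpha> \<beta> 1 s) \<partial>lborel) < \<infinity>" .
  have "(\<integral>\<^sup>+s. ennreal (bump \<alpha> \<beta> 1 s) \<partial>lborel) \<noteq> 0"
  proof
    assume "(\<integral>\<^sup>+s. ennreal (bump \<alpha> \<beta> 1 s) \<partial>lborel) = 0"
    moreover have meas: "(\<lambda>s. ennreal (bump \<alpha> \<beta> 1 s)) \<in> borel_measurable lborel" by measurable
    ultimately have "AE s in lborel. ennreal (bump \<alpha> \<beta> 1 s) = 0" by (simp only: nn_integral_0_iff_AE[OF meas])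
    then have "AE s in lborel. s \<notin> {\<alpha><..<\<beta>}"
      by eventually_elim (use bump_pos[of 1 \<alpha> _ \<beta>] in \<open>auto simp: ennreal_eq_0_iff dest!: leD\<close>)
    then have "emeasure lborel {\<alpha><..<\<beta>} = 0" by (subst (asm) AE_iff_measurable[of "{\<alpha><..<\<beta>}"]) auto
    then show False using assms by simp
  qed
  then show "0 < (\<integral>\<^sup>+s. ennreal (bump \<alpha> \<beta> 1 s) \<partial>lborel)" by (simp add: zero_less_iff_neq_zero)
qed

section \<open>The weak Laplace equation tested on radial bumps, and radiality of the
  measure\<close>

locale fock_potential = infinite_doubling +
  fixes \<phi> :: "complex \<Rightarrow> ereal"
  assumes radial_\<phi>: "radial \<phi>" and sub_\<phi>: "subharmonic \<phi>" and lap_\<phi>: "distributional_laplacian \<phi> \<nu>"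
begin

definition p :: "complex \<Rightarrow> real" where "p z = real_of_ereal (\<phi> z)"

lemma p_measurable[measurable]: "p \<in> borel_measurable borel"
  using subharmonic_measurable[OF sub_\<phi>] unfolding p_def[abs_def] by measurable

lemma p_radial: "cmod z = cmod w \<Longrightarrow> p z = p w"
  using radial_\<phi> unfolding radial_def p_def by metis

lemma sigma_finite_\<nu>: "sigma_finite_measure \<nu>"
proof
  show "\<exists>A. countable A \<and> A \<subseteq> sets \<nu> \<and> \<Union> A = space \<nu> \<and> (\<forall>a\<in>A. emeasure \<nu> a \<noteq> \<infinity>)"
  proof (intro exI[of _ "range (\<lambda>n. cball 0 (real n))"] conjI)
    show "\<Union> (range (\<lambda>n. cball (0::complex) (real n))) = space \<nu>"
      by (auto intro: real_arch_simple)
    show "\<forall>a\<in>range (\<lambda>n. cball 0 (real n)). emeasure \<nu> a \<noteq> \<infinity>"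
      using finite_cball by (auto simp: less_top)
  qed auto
qed

text \<open>Take g with g' = -h and g = 0 beyond \<beta>; then g(|z - a|^2) is a test function.
  Writing g(s) as the integral of h over (s, \<infinity>) and applying Tonelli turns its
  \<nu>-integral into an average of disk masses about a, while \<open>laplacian_radial\<close> gives
  the other side. Keeping h nonnegative allows the exchange in extended reals with no integrability
  question.\<close>

lemma test_identity:
  assumes h: "smooth h" "\<And>s. 0 \<le> h s" and h': "\<And>x. (h has_real_derivative h' x) (at x)"
    and \<alpha>\<beta>: "0 \<le> \<alpha>" "\<And>s. \<not> (\<alpha> < s \<and> s < \<beta>) \<Longrightarrow> h s = 0"
  shows "enn2real (\<integral>\<^sup>+s. ennreal (h s) * ennreal (m a (sqrt s)) \<partial>lborel) =
     - 4 * (LINT z|lborel. p z * (h ((cmod (z - a))\<^sup>2) + (cmod (z - a))\<^sup>2 * h' ((cmod (z - a))\<^sup>2)))"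
proof -
  have [measurable]: "h \<in> borel_measurable borel" using h(1) by (rule smooth_measurable)
  obtain F where F: "\<And>x. (F has_real_derivative h x) (at x)"
    using continuous_antiderivative[OF smooth_continuous[OF h(1)]] by blast
  define g where "g s = F \<beta> - F s" for s
  have g': "(g has_real_derivative - h s) (at s)" for s
    unfolding g_def[abs_def] by (auto intro!: derivative_eq_intros F)
  have g'': "((\<lambda>s. - h s) has_real_derivative - h' s) (at s)" for s
    by (auto intro!: derivative_eq_intros h')
  have "diffn n (\<lambda>s. (- 1) * h s)" for n
    using h(1) by (intro diffn_mult diffn_const) (simp add: smooth_def)
  then have "smooth (\<lambda>s. - h s)" by (simp add: smooth_def)
  then have sg: "smooth g" by (rule smooth_antideriv) (rule g')
  have g0: "g s = 0" if "\<beta> \<le> s" for s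
  proof (cases "\<beta> = s")
    case False
    with that have "\<beta> < s" by simp
    then obtain z where "z > \<beta>" "F s - F \<beta> = (s - \<beta>) * h z" using MVT2[of \<beta> s F h] F by blast
    then show ?thesis using \<alpha>\<beta>(2)[of z] by (simp add: g_def)
  qed (simp add: g_def)
  have gnn: "ennreal (g s) = (\<integral>\<^sup>+\<sigma>. ennreal (h \<sigma>) * indicator {s<..} \<sigma> \<partial>lborel)" for s
  proof (cases "s \<le> \<beta>")
    case True
    have "(\<integral>\<^sup>+\<sigma>. ennreal (h \<sigma>) * indicator {s..\<beta>} \<sigma> \<partial>lborel) = ennreal (F \<beta> - F s)"
      by (rule nn_integral_FTC_Icc[OF _ _ _ True])
         (use F h(2) in \<open>auto intro: has_field_derivative_at_within\<close>)
    moreover have "(\<integral>\<^sup>+\<sigma>. ennreal (h \<sigma>) * indicator {s..\<beta>} \<sigma> \<partial>lborel) = (\<integral>\<^sup>+\<sigma>. ennreal (h \<sigma>) * indicator {s<..} \<sigma> \<partial>lborel)"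
    proof (rule nn_integral_cong_AE)
      have "AE \<sigma> in lborel. \<sigma> \<noteq> s" by (rule AE_lborel_singleton)
      then show "AE \<sigma> in lborel. ennreal (h \<sigma>) * indicator {s..\<beta>} \<sigma> = ennreal (h \<sigma>) * indicator {s<..} \<sigma>"
        by eventually_elim (use \<alpha>\<beta>(2) in \<open>auto simp: indicator_def\<close>)
    qed
    ultimately show ?thesis by (simp add: g_def)
  next
    case False
    then have z: "ennreal (h \<sigma>) * indicator {s<..} \<sigma> = 0" for \<sigma>
      using \<alpha>\<beta>(2)[of \<sigma>] by (auto simp: indicator_def)
    have "(\<integral>\<^sup>+\<sigma>. ennreal (h \<sigma>) * indicator {s<..} \<sigma> \<partial>lborel) = (\<integral>\<^sup>+\<sigma>. 0 \<partial>(lborel :: real measure))"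
      by (rule nn_integral_cong) (rule z)
    then show ?thesis using False g0[of s] by simp
  qed
  have gpos: "0 \<le> g s" for s
  proof (cases "s \<le> \<beta>")
    case True
    then show ?thesis unfolding g_def
      using DERIV_nonneg_imp_nondecreasing[of s \<beta> F] F h(2) by (simp add: le_diff_eq) blast
  qed (use g0 in auto)
  let ?\<psi> = "\<lambda>z. g ((cmod (z - a))\<^sup>2)"
  have [measurable]: "g \<in> borel_measurable borel" using sg by (rule smooth_measurable)
  interpret \<nu>: sigma_finite_measure \<nu> by (rule sigma_finite_\<nu>)
  interpret P: pair_sigma_finite \<nu> lborel ..
  have "(LINT z|\<nu>. ?\<psi> z) = (LINT z|lborel. p z * laplacian ?\<psi> z)"
    using lap_\<phi> test_function_radial[OF sg g0, where a=a] by (simp add: distributional_laplacian_def p_def)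
  also have "\<dots> = (LINT z|lborel. - 4 * (p z * (h ((cmod (z - a))\<^sup>2) + (cmod (z - a))\<^sup>2 * h' ((cmod (z - a))\<^sup>2))))"
    by (intro Bochner_Integration.integral_cong) (auto simp: laplacian_radial[OF g' g''] algebra_simps)
  also have "\<dots> = - 4 * (LINT z|lborel. p z * (h ((cmod (z - a))\<^sup>2) + (cmod (z - a))\<^sup>2 * h' ((cmod (z - a))\<^sup>2)))"
    by (rule integral_mult_right_zero)
  finally have 1: "(LINT z|\<nu>. ?\<psi> z) = - 4 * (LINT z|lborel. p z * (h ((cmod (z - a))\<^sup>2) + (cmod (z - a))\<^sup>2 * h' ((cmod (z - a))\<^sup>2)))" .
  have "(LINT z|\<nu>. ?\<psi> z) = enn2real (\<integral>\<^sup>+z. ennreal (?\<psi> z) \<partial>\<nu>)"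
    by (rule integral_eq_nn_integral) (auto simp: gpos)
  also have "(\<integral>\<^sup>+z. ennreal (?\<psi> z) \<partial>\<nu>) = (\<integral>\<^sup>+z. (\<integral>\<^sup>+\<sigma>. ennreal (h \<sigma>) * indicator {\<sigma>. (cmod (z - a))\<^sup>2 < \<sigma>} \<sigma> \<partial>lborel) \<partial>\<nu>)"
    by (simp add: gnn greaterThan_def)
  also have "\<dots> = (\<integral>\<^sup>+\<sigma>. (\<integral>\<^sup>+z. ennreal (h \<sigma>) * indicator {\<sigma>. (cmod (z - a))\<^sup>2 < \<sigma>} \<sigma> \<partial>\<nu>) \<partial>lborel)"
  proof (rule P.Fubini'[symmetric])
    have "(\<lambda>x. ennreal (h (snd x)) * indicator {x. (cmod (fst x - a))\<^sup>2 < snd x} x) \<in> borel_measurable (borel \<Otimes>\<^sub>M borel)"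
      by measurable
    then show "(\<lambda>(x, y). ennreal (h y) * indicator {\<sigma>. (cmod (x - a))\<^sup>2 < \<sigma>} y) \<in> borel_measurable (\<nu> \<Otimes>\<^sub>M lborel)"
      by (simp add: split_beta' indicator_def cong: measurable_cong_sets)
  qed
  also have "\<dots> = (\<integral>\<^sup>+\<sigma>. ennreal (h \<sigma>) * ennreal (m a (sqrt \<sigma>)) \<partial>lborel)"
  proof (rule nn_integral_cong)
    fix \<sigma> :: real
    show "(\<integral>\<^sup>+z. ennreal (h \<sigma>) * indicator {\<sigma>. (cmod (z - a))\<^sup>2 < \<sigma>} \<sigma> \<partial>\<nu>) = ennreal (h \<sigma>) * ennreal (m a (sqrt \<sigma>))"
    proof (cases "\<sigma> > 0")
      case True
      have "(cmod (z - a))\<^sup>2 < \<sigma> \<longleftrightarrow> z \<in> ball a (sqrt \<sigma>)" for z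
      proof
        assume "(cmod (z - a))\<^sup>2 < \<sigma>"
        then show "z \<in> ball a (sqrt \<sigma>)" by (simp add: dist_norm norm_minus_commute real_less_rsqrt)
      next
        assume "z \<in> ball a (sqrt \<sigma>)"
        then have "(cmod (z - a))\<^sup>2 < (sqrt \<sigma>)\<^sup>2"
          by (intro power_strict_mono) (auto simp: dist_norm norm_minus_commute)
        then show "(cmod (z - a))\<^sup>2 < \<sigma>" using True by simp
      qed
      then have "(\<integral>\<^sup>+z. ennreal (h \<sigma>) * indicator {\<sigma>. (cmod (z - a))\<^sup>2 < \<sigma>} \<sigma> \<partial>\<nu>) = (\<integral>\<^sup>+z. ennreal (h \<sigma>) * indicator (ball a (sqrt \<sigma>)) z \<partial>\<nu>)"
        by (intro nn_integral_cong) (auto simp: indicator_def)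
      also have "\<dots> = ennreal (h \<sigma>) * emeasure \<nu> (ball a (sqrt \<sigma>))"
        by (rule nn_integral_cmult_indicator) simp
      finally show ?thesis by (simp add: emeasure_ball_m)
    next
      case False
      then have "h \<sigma> = 0" using \<alpha>\<beta> by auto
      then show ?thesis by simp
    qed
  qed
  finally show ?thesis using 1 by simp
qed

lemma m_measurable[measurable]: "m a \<in> borel_measurable borel"
  by (intro borel_measurable_continuous_onI continuous_at_imp_continuous_on) (simp add: isCont_m)

text \<open>The right-hand side of \<open>test_identity\<close> is the same for a and b by a
  rotation, as the potential is radial. If a disk about a were strictly heavier, left continuity
  would leave a smaller radius q about a still heavier than radius r about b, and a bump supported
  on (q^2, r^2) would give different averages.\<close>

lemma m_radial_le:
  assumes "cmod a = cmod b" shows "m a r \<le> m b r"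
proof (rule ccontr)
  assume "\<not> m a r \<le> m b r"
  then have lt: "m b r < m a r" by simp
  have "eventually (\<lambda>n. m b r < m a (r - 1 / real (Suc n))) sequentially"
    by (rule order_tendstoD(1)[OF m_left_limit lt])
  then obtain n where n: "m b r < m a (r - 1 / real (Suc n))" using eventually_happens'[OF sequentially_bot] by fastforce
  define q where "q = r - 1 / real (Suc n)"
  have q: "q < r" "m b r < m a q" using n by (auto simp: q_def)
  then have q0: "q > 0" using m_0[of q a] m_nonneg[of b r] by (cases "q > 0") auto
  obtain t where t: "b = cis t * a"
  proof (cases "a = 0")
    case True then show thesis using assms that[of 0] by simp
  next
    case False
    then have "cmod b \<noteq> 0" using assms by (metis norm_eq_zero)
    then have "cmod (b / a) = 1" using assms by (simp add: norm_divide)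
    then obtain t where t: "b / a = cis t" using complex_norm_eq_1_exp cis_conv_exp by metis
    have "b = b / a * a" using False by simp
    then show thesis using that[of t] unfolding t by simp
  qed
  define h where "h = bump (q\<^sup>2) (r\<^sup>2) 1"
  have sm: "smooth h" unfolding h_def by (rule smooth_bump)
  have [measurable]: "h \<in> borel_measurable borel" using sm by (rule smooth_measurable)
  obtain h' where h': "smooth h'" "\<And>x. (h has_real_derivative h' x) (at x)" using smooth_obtain_deriv[OF sm] by metis
  have [measurable]: "h' \<in> borel_measurable borel" using h'(1) by (rule smooth_measurable)
  have h0: "h s = 0" if "\<not> (q\<^sup>2 < s \<and> s < r\<^sup>2)" for s using that bump_eq_0 by (simp add: h_def)
  have hpos: "0 \<le> h s" for s by (simp add: h_def bump_bounds)
  have q2: "q\<^sup>2 < r\<^sup>2" using q q0 by (intro power_strict_mono) auto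
  define I where "I = (\<integral>\<^sup>+s. ennreal (h s) \<partial>lborel)"
  have I: "0 < I" "I < \<infinity>" unfolding I_def h_def using bump_nn_integral_bounds[of "q\<^sup>2" "r\<^sup>2"] q2 by auto
  define A where "A a = (\<integral>\<^sup>+s. ennreal (h s) * ennreal (m a (sqrt s)) \<partial>lborel)" for a
  have upper: "A a \<le> ennreal (m a r) * I" for a
  proof -
    have "A a \<le> (\<integral>\<^sup>+s. ennreal (m a r) * ennreal (h s) \<partial>lborel)" unfolding A_def
    proof (rule nn_integral_mono)
      fix s show "ennreal (h s) * ennreal (m a (sqrt s)) \<le> ennreal (m a r) * ennreal (h s)"
      proof (cases "q\<^sup>2 < s \<and> s < r\<^sup>2")
        case True
        then have "sqrt s \<le> r" using q q0 by (intro real_le_lsqrt) auto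
        then show ?thesis by (subst mult.commute) (intro mult_right_mono ennreal_leI m_mono_radius, auto)
      qed (simp add: h0)
    qed
    then show ?thesis by (simp add: I_def nn_integral_cmult)
  qed
  have lower: "ennreal (m a q) * I \<le> A a"
  proof -
    have "(\<integral>\<^sup>+s. ennreal (m a q) * ennreal (h s) \<partial>lborel) \<le> A a" unfolding A_def
    proof (rule nn_integral_mono)
      fix s show "ennreal (m a q) * ennreal (h s) \<le> ennreal (h s) * ennreal (m a (sqrt s))"
      proof (cases "q\<^sup>2 < s \<and> s < r\<^sup>2")
        case True
        then have "q \<le> sqrt s" using q q0 by (intro real_le_rsqrt) auto
        then show ?thesis by (subst (2) mult.commute) (intro mult_right_mono ennreal_leI m_mono_radius, auto)
      qed (simp add: h0)
    qed
    then show ?thesis by (simp add: I_def nn_integral_cmult)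
  qed
  define L where "L a z = p z * (h ((cmod (z - a))\<^sup>2) + (cmod (z - a))\<^sup>2 * h' ((cmod (z - a))\<^sup>2))" for a z
  have E: "enn2real (A a) = - 4 * (LINT z|lborel. L a z)" for a
    unfolding A_def L_def by (rule test_identity[OF sm hpos h'(2) _ h0]) auto
  have Lm: "L b \<in> borel_measurable borel" unfolding L_def[abs_def] by measurable
  have "(LINT z|lborel. L b z) = (LINT z|lborel. L b (cis t * z))" using lborel_integral_rotation[OF Lm] by simp
  also have "\<dots> = (LINT z|lborel. L a z)"
  proof (intro Bochner_Integration.integral_cong refl)
    fix z
    have "cis t * z - b = cis t * (z - a)" by (simp add: t algebra_simps)
    then have "cmod (cis t * z - b) = cmod (z - a)" by (simp add: norm_mult)
    moreover have "p (cis t * z) = p z" by (rule p_radial) (simp add: norm_mult)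
    ultimately show "L b (cis t * z) = L a z" by (simp add: L_def)
  qed
  finally have "enn2real (A a) = enn2real (A b)" using E by simp
  moreover have "A x < \<infinity>" for x
    by (rule le_less_trans[OF upper]) (use I in \<open>simp add: ennreal_mult_less_top\<close>)
  then have "A x = ennreal (enn2real (A x))" for x by simp
  ultimately have "A a = A b" by metis
  then have "ennreal (m a q) * I \<le> ennreal (m b r) * I" using lower upper[of b] by simp
  then have "ennreal (m a q) \<le> ennreal (m b r)"
    using I by (subst (asm) (1 2) mult.commute) (simp add: ennreal_mult_le_mult_iff)
  then show False using q(2) m_nonneg[of b r] by (simp add: ennreal_le_iff)
qed

lemma m_radial: "cmod a = cmod b \<Longrightarrow> m a r = m b r"
  using m_radial_le[of a b r] m_radial_le[of b a r] by simp

end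

sublocale fock_potential \<subseteq> radial_doubling
  by unfold_locales (rule m_radial)

lemma bump_smaller: "bump \<alpha> \<beta> n x \<le> indicator {\<alpha>..\<beta>} x"
  using bump_bounds[of \<alpha> \<beta> n x] bump_eq_0[of \<alpha> x \<beta> n] by (auto simp: indicator_def)

lemma bump_measurable[measurable]: "bump \<alpha> \<beta> n \<in> borel_measurable borel"
  by (rule smooth_measurable[OF smooth_bump])

lemma integrable_bump: "integrable lborel (bump \<alpha> \<beta> n)"
proof (rule Bochner_Integration.integrable_bound)
  show "integrable lborel (indicat_real {\<alpha>..\<beta>})"
    by (rule integrable_real_indicator) (auto simp: emeasure_lborel_Icc_eq)
  show "AE x in lborel. norm (bump \<alpha> \<beta> n x) \<le> norm (indicat_real {\<alpha>..\<beta>} x)"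
    using bump_smaller[of \<alpha> \<beta> n] bump_bounds[of \<alpha> \<beta> n] by auto
qed simp

lemma integral_bump_pos:
  assumes "0 \<le> \<alpha>" "\<alpha> < \<beta>" shows "0 < (LINT s|lborel. bump \<alpha> \<beta> 1 s)"
proof -
  have "(LINT s|lborel. bump \<alpha> \<beta> 1 s) = enn2real (\<integral>\<^sup>+s. ennreal (bump \<alpha> \<beta> 1 s) \<partial>lborel)"
    by (rule integral_eq_nn_integral) (auto simp: bump_bounds)
  also have "\<dots> > 0" using bump_nn_integral_bounds[OF assms] by (simp add: enn2real_positive_iff)
  finally show ?thesis .
qed

lemma integrable_mult_continuous_Icc:
  fixes w f :: "real \<Rightarrow> real"
  assumes "integrable lborel (\<lambda>s. indicator {\<alpha>..\<beta>} s * w s)" "continuous_on UNIV f"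
  shows "integrable lborel (\<lambda>s. indicator {\<alpha>..\<beta>} s * w s * f s)"
proof -
  have [measurable]: "f \<in> borel_measurable borel" using assms(2) by (rule borel_measurable_continuous_onI)
  have "compact (f ` {\<alpha>..\<beta>})" using assms(2) by (intro compact_continuous_image) (auto intro: continuous_on_subset)
  then obtain B where "\<forall>x\<in>f ` {\<alpha>..\<beta>}. \<bar>x\<bar> \<le> B"
    using compact_imp_bounded[of "f ` {\<alpha>..\<beta>}"] unfolding bounded_real by blast
  then have B: "\<And>s. s \<in> {\<alpha>..\<beta>} \<Longrightarrow> \<bar>f s\<bar> \<le> B" by blast
  show ?thesis
  proof (rule Bochner_Integration.integrable_bound)
    show "integrable lborel (\<lambda>s. B * (indicator {\<alpha>..\<beta>} s * w s))" using assms(1) by simp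
    have "\<bar>w s\<bar> * \<bar>f s\<bar> \<le> \<bar>B\<bar> * \<bar>w s\<bar>" if "s \<in> {\<alpha>..\<beta>}" for s
    proof -
      have "\<bar>f s\<bar> \<le> \<bar>B\<bar>" using B[OF that] by linarith
      from mult_right_mono[OF this, of "\<bar>w s\<bar>"] show ?thesis by (simp add: mult.commute)
    qed
    then show "AE s in lborel. norm (indicator {\<alpha>..\<beta>} s * w s * f s) \<le> norm (B * (indicator {\<alpha>..\<beta>} s * w s))"
      by (intro AE_I2) (auto simp: abs_mult indicator_def)
    have "(\<lambda>s. indicator {\<alpha>..\<beta>} s * w s) \<in> borel_measurable lborel" using assms(1) by auto
    then show "(\<lambda>s. indicator {\<alpha>..\<beta>} s * w s * f s) \<in> borel_measurable lborel" by measurable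
  qed
qed

lemma deriv_zero_outside:
  assumes "\<And>x. (k has_real_derivative k' x) (at x)" "\<And>s. \<not> (\<alpha> < s \<and> s < \<beta>) \<Longrightarrow> k s = 0" "s \<notin> {\<alpha>..\<beta>}"
  shows "k' s = (0::real)"
proof -
  have "((\<lambda>_. 0) has_real_derivative k' s) (at s)"
    using assms(1)[of s]
    by (rule has_field_derivative_transform_within_open[of _ _ _ "- {\<alpha>..\<beta>}"]) (use assms(2,3) in auto)
  then show ?thesis using DERIV_unique DERIV_const by blast
qed

section \<open>Identification of the radial potential up to a constant\<close>

context fock_potential
begin

definition q :: "real \<Rightarrow> real" where "q s = p (of_real (sqrt s))"

lemma q_measurable[measurable]: "q \<in> borel_measurable borel"
  unfolding q_def[abs_def] by measurable

lemma p_eq_q: "p z = q ((cmod z)\<^sup>2)"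
  unfolding q_def by (rule p_radial) simp

lemma integrable_q:
  assumes "0 < \<alpha>" shows "integrable lborel (\<lambda>s. indicator {\<alpha>..\<beta>} s * q s)"
proof -
  define r where "r = \<bar>\<beta>\<bar> + 1"
  have r: "r > 0" "\<beta> < r\<^sup>2"
  proof -
    show "r > 0" by (simp add: r_def add_nonneg_pos)
    have "1 * r \<le> r * r" by (rule mult_right_mono) (auto simp: r_def)
    then show "\<beta> < r\<^sup>2" by (simp add: r_def power2_eq_square)
  qed
  have "integrable lborel (\<lambda>z. indicator (ball 0 r) z * p z)"
    using subharmonic_set_integrable[OF sub_\<phi>, of r] by (simp add: set_integrable_def p_def)
  also have "(\<lambda>z. indicator (ball 0 r) z * p z) = (\<lambda>z. (\<lambda>s. indicator {..<r\<^sup>2} s * q s) ((cmod z)\<^sup>2))"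
  proof
    fix z
    have "cmod z < r \<longleftrightarrow> (cmod z)\<^sup>2 < r\<^sup>2" using power_strict_mono[of "cmod z" r 2] power2_less_imp_less[of "cmod z" r] r(1) by auto
    then show "indicator (ball 0 r) z * p z = (\<lambda>s. indicator {..<r\<^sup>2} s * q s) ((cmod z)\<^sup>2)"
      by (simp add: p_eq_q indicator_def)
  qed
  finally have *: "integrable lborel (\<lambda>z. (\<lambda>s. indicator {..<r\<^sup>2} s * q s) ((cmod z)\<^sup>2))" .
  have "(\<lambda>s. indicator {..<r\<^sup>2} s * q s) \<in> borel_measurable borel" by measurable
  from lborel_integral_cmod_sq(2)[OF this] *
  have "integrable lborel (\<lambda>s. indicator {0<..} s * (indicator {..<r\<^sup>2} s * q s))" by blast
  then have "integrable lborel (\<lambda>s. indicator {\<alpha>..\<beta>} s *\<^sub>R (indicator {0<..} s * (indicator {..<r\<^sup>2} s * q s)))"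
    by (rule integrable_mult_indicator[rotated]) simp
  also have "(\<lambda>s. indicator {\<alpha>..\<beta>} s *\<^sub>R (indicator {0<..} s * (indicator {..<r\<^sup>2} s * q s))) = (\<lambda>s. indicator {\<alpha>..\<beta>} s * q s)"
    using assms r by (auto simp: indicator_def)
  finally show ?thesis .
qed

text \<open>In s = |z|^2 the equation to be solved is 4 pi s V'(s) = m 0 (sqrt s), and the right
  side is continuous because circles are null. The extension by 0 to nonpositive s only serves
  global measurability.\<close>

lemma log_potential:
  obtains V where "V \<in> borel_measurable borel"
    "\<And>s. s > 0 \<Longrightarrow> (V has_real_derivative m 0 (sqrt s) / (4 * pi * s)) (at s)"
proof -
  have "\<exists>V. \<forall>s :: real. 0 < ereal s \<longrightarrow> ereal s < \<infinity> \<longrightarrow> (V has_vector_derivative m 0 (sqrt s) / (4 * pi * s)) (at s)"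
  proof (rule einterval_antiderivative)
    fix s :: real assume "0 < ereal s"
    then have "s > 0" by simp
    then show "isCont (\<lambda>s. m 0 (sqrt s) / (4 * pi * s)) s"
      by (intro continuous_intros isCont_o2[OF _ isCont_m]) auto
  qed simp
  then obtain V where V: "\<And>s. s > 0 \<Longrightarrow> (V has_real_derivative m 0 (sqrt s) / (4 * pi * s)) (at s)"
    by (auto simp: has_real_derivative_iff_has_vector_derivative)
  show thesis
  proof (rule that[of "\<lambda>s. indicator {0<..} s *\<^sub>R V s"])
    show "(\<lambda>s. indicator {0<..} s *\<^sub>R V s) \<in> borel_measurable borel"
      using V by (intro borel_measurable_continuous_on_indicator) (auto intro!: continuous_at_imp_continuous_on DERIV_isCont)
    fix s :: real assume "s > 0"
    then show "((\<lambda>s. indicator {0<..} s *\<^sub>R V s) has_real_derivative m 0 (sqrt s) / (4 * pi * s)) (at s)"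
      by (intro has_field_derivative_transform_within_open[OF V, of _ "{0<..}"]) auto
  qed
qed

context
  fixes V :: "real \<Rightarrow> real"
  assumes V_measurable[measurable]: "V \<in> borel_measurable borel"
    and V_deriv: "\<And>s. s > 0 \<Longrightarrow> (V has_real_derivative m 0 (sqrt s) / (4 * pi * s)) (at s)"
begin

lemma integrable_V: "0 < \<alpha> \<Longrightarrow> integrable lborel (\<lambda>s. indicator {\<alpha>..\<beta>} s * V s)"
proof -
  assume "0 < \<alpha>"
  then have "continuous_on {\<alpha>..\<beta>} V"
    by (intro continuous_at_imp_continuous_on ballI DERIV_isCont[OF V_deriv]) auto
  then show ?thesis using borel_integrable_atLeastAtMost'[of \<alpha> \<beta> V] by (simp add: set_integrable_def)
qed

lemma integrable_w: "0 < \<alpha> \<Longrightarrow> integrable lborel (\<lambda>s. indicator {\<alpha>..\<beta>} s * (q s - V s))"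
  using Bochner_Integration.integrable_diff[OF integrable_q integrable_V, of \<alpha> \<alpha> \<beta> \<beta>] by (simp add: right_diff_distrib)

text \<open>With h = k/s, the expression h + s h' of \<open>test_identity\<close> becomes k', so its
  statement reads as the weak form of q' = V'. Support away from 0 keeps k/s smooth, and
  \<open>V\<close> is integrated by parts on the support.\<close>

lemma weak_derivative:
  assumes k: "smooth k" "\<And>s. 0 \<le> k s" "\<And>x. (k has_real_derivative k' x) (at x)"
    and \<alpha>: "0 < \<alpha>" "\<alpha> < \<beta>" and k0: "\<And>s. \<not> (\<alpha> < s \<and> s < \<beta>) \<Longrightarrow> k s = 0"
  shows "(LINT s|lborel. indicator {\<alpha>..\<beta>} s * (q s - V s) * k' s) = 0"
proof -
  have sk': "smooth k'" using k(1) k(3) by (rule smooth_deriv)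
  have [measurable]: "k \<in> borel_measurable borel" "k' \<in> borel_measurable borel"
    using k(1) sk' by (auto intro: smooth_measurable)
  define h where "h s = k s / s ^ 1" for s
  have sh: "smooth h" unfolding smooth_def h_def[abs_def]
    using diffn_divide_power[of _ k \<alpha> 1] k(1) k0 \<alpha> by (auto simp: smooth_def)
  obtain h' where h': "smooth h'" "\<And>x. (h has_real_derivative h' x) (at x)" using smooth_obtain_deriv[OF sh] by metis
  have [measurable]: "h \<in> borel_measurable borel" "h' \<in> borel_measurable borel"
    using sh h' by (auto intro: smooth_measurable)
  have h0: "h s = 0" if "\<not> (\<alpha> < s \<and> s < \<beta>)" for s using k0[OF that] by (simp add: h_def)
  have hpos: "0 \<le> h s" for s using h0[of s] k(2)[of s] \<alpha> by (cases "\<alpha> < s") (auto simp: h_def)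
  have k'_0: "k' s = 0" if "s \<notin> {\<alpha>..\<beta>}" for s
    by (rule deriv_zero_outside[OF k(3) k0 that])
  have hk: "h s + s * h' s = k' s" if "s > 0" for s
  proof -
    have "((\<lambda>s. s * h s) has_real_derivative h s + s * h' s) (at s)"
      by (auto intro!: derivative_eq_intros h')
    then have "(k has_real_derivative h s + s * h' s) (at s)"
      by (rule has_field_derivative_transform_within_open[of _ _ _ "{0<..}"]) (use that in \<open>auto simp: h_def\<close>)
    then show ?thesis using k(3) DERIV_unique by blast
  qed
  have "(LINT s|lborel. h s * m 0 (sqrt s)) = enn2real (\<integral>\<^sup>+s. ennreal (h s * m 0 (sqrt s)) \<partial>lborel)"
    by (rule integral_eq_nn_integral) (auto simp: hpos m_nonneg)
  also have "\<dots> = enn2real (\<integral>\<^sup>+s. ennreal (h s) * ennreal (m 0 (sqrt s)) \<partial>lborel)"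
    by (simp add: ennreal_mult hpos m_nonneg)
  also have "\<dots> = - 4 * (LINT z|lborel. p z * (h ((cmod (z - 0))\<^sup>2) + (cmod (z - 0))\<^sup>2 * h' ((cmod (z - 0))\<^sup>2)))"
    by (rule test_identity[OF sh hpos h'(2) _ h0]) (use \<alpha> in auto)
  also have "(LINT z|lborel. p z * (h ((cmod (z - 0))\<^sup>2) + (cmod (z - 0))\<^sup>2 * h' ((cmod (z - 0))\<^sup>2)))
      = (LINT z|lborel. (\<lambda>s. q s * (h s + s * h' s)) ((cmod z)\<^sup>2))"
    by (simp add: p_eq_q)
  also have "\<dots> = pi * (LINT s|lborel. indicator {0<..} s * (q s * (h s + s * h' s)))"
    by (rule lborel_integral_cmod_sq(1)) measurable
  also have "(LINT s|lborel. indicator {0<..} s * (q s * (h s + s * h' s))) = (LINT s|lborel. indicator {\<alpha>..\<beta>} s * q s * k' s)"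
    using \<alpha> hk k'_0 by (intro Bochner_Integration.integral_cong) (auto simp: indicator_def)
  finally have 1: "(LINT s|lborel. h s * m 0 (sqrt s)) = - 4 * (pi * (LINT s|lborel. indicator {\<alpha>..\<beta>} s * q s * k' s))" .
  have contV: "continuous_on {\<alpha>..\<beta>} V"
    using \<alpha> by (intro continuous_at_imp_continuous_on ballI DERIV_isCont[OF V_deriv]) auto
  have contk: "continuous_on A k" "continuous_on A k'" for A using k(1) sk' by (auto intro: smooth_continuous)
  have contm: "continuous_on {\<alpha>..\<beta>} (\<lambda>s. m 0 (sqrt s) / (4 * pi * s))"
    using \<alpha> by (intro continuous_at_imp_continuous_on ballI continuous_intros isCont_o2[OF _ isCont_m]) auto
  have "(LINT s|lborel. indicator {\<alpha>..\<beta>} s *\<^sub>R (k' s * V s + k s * (m 0 (sqrt s) / (4 * pi * s)))) = k \<beta> * V \<beta> - k \<alpha> * V \<alpha>"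
  proof (rule integral_FTC_atLeastAtMost)
    fix s assume "\<alpha> \<le> s" "s \<le> \<beta>"
    then have "((\<lambda>s. k s * V s) has_real_derivative k' s * V s + k s * (m 0 (sqrt s) / (4 * pi * s))) (at s)"
      using \<alpha> DERIV_mult[OF k(3) V_deriv, of s] by (simp add: mult.commute)
    then show "((\<lambda>s. k s * V s) has_vector_derivative k' s * V s + k s * (m 0 (sqrt s) / (4 * pi * s))) (at s within {\<alpha>..\<beta>})"
      by (simp add: has_real_derivative_iff_has_vector_derivative has_vector_derivative_at_within)
  next
    show "continuous_on {\<alpha>..\<beta>} (\<lambda>s. k' s * V s + k s * (m 0 (sqrt s) / (4 * pi * s)))"
      by (intro continuous_on_add continuous_on_mult contk contV contm)
  qed (use \<alpha> in auto)
  also have "\<dots> = 0" using k0[of \<beta>] k0[of \<alpha>] by simp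
  finally have 2: "(LINT s|lborel. indicator {\<alpha>..\<beta>} s * V s * k' s + indicator {\<alpha>..\<beta>} s * (k s * (m 0 (sqrt s) / (4 * pi * s)))) = 0"
    by (simp add: algebra_simps)
  have i1: "integrable lborel (\<lambda>s. indicator {\<alpha>..\<beta>} s * V s * k' s)"
    by (rule integrable_mult_continuous_Icc[OF integrable_V[OF \<alpha>(1)] contk(2)])
  have i2: "integrable lborel (\<lambda>s. indicator {\<alpha>..\<beta>} s * (k s * (m 0 (sqrt s) / (4 * pi * s))))"
    using borel_integrable_atLeastAtMost'[OF continuous_on_mult[OF contk(1) contm]] by (simp add: set_integrable_def)
  have i3: "integrable lborel (\<lambda>s. indicator {\<alpha>..\<beta>} s * q s * k' s)"
    by (rule integrable_mult_continuous_Icc[OF integrable_q[OF \<alpha>(1)] contk(2)])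
  have "(LINT s|lborel. indicator {\<alpha>..\<beta>} s * (k s * (m 0 (sqrt s) / (4 * pi * s)))) = (LINT s|lborel. h s * m 0 (sqrt s) / (4 * pi))"
  proof (intro Bochner_Integration.integral_cong refl)
    fix s show "indicator {\<alpha>..\<beta>} s * (k s * (m 0 (sqrt s) / (4 * pi * s))) = h s * m 0 (sqrt s) / (4 * pi)"
      by (cases "\<alpha> < s \<and> s < \<beta>") (auto simp: indicator_def h_def k0)
  qed
  also have "\<dots> = - (LINT s|lborel. indicator {\<alpha>..\<beta>} s * q s * k' s)"
    by (simp add: 1)
  finally have "(LINT s|lborel. indicator {\<alpha>..\<beta>} s * V s * k' s) = (LINT s|lborel. indicator {\<alpha>..\<beta>} s * q s * k' s)"
    using 2[unfolded Bochner_Integration.integral_add[OF i1 i2]] by linarith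
  then show ?thesis
    using Bochner_Integration.integral_diff[OF i3 i1] by (simp add: algebra_simps)
qed

definition I_bump where "I_bump \<alpha> \<beta> n = (LINT s|lborel. (q s - V s) * bump \<alpha> \<beta> n s)"

lemma integrable_w_bump: "0 < \<alpha> \<Longrightarrow> integrable lborel (\<lambda>s. (q s - V s) * bump \<alpha> \<beta> n s)"
proof -
  assume "0 < \<alpha>"
  then have "integrable lborel (\<lambda>s. indicator {\<alpha>..\<beta>} s * (q s - V s) * bump \<alpha> \<beta> n s)"
    by (intro integrable_mult_continuous_Icc[OF integrable_w] smooth_continuous smooth_bump)
  also have "(\<lambda>s. indicator {\<alpha>..\<beta>} s * (q s - V s) * bump \<alpha> \<beta> n s) = (\<lambda>s. (q s - V s) * bump \<alpha> \<beta> n s)"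
  proof
    fix s show "indicator {\<alpha>..\<beta>} s * (q s - V s) * bump \<alpha> \<beta> n s = (q s - V s) * bump \<alpha> \<beta> n s"
      by (cases "\<alpha> < s \<and> s < \<beta>") (auto simp: indicator_def bump_eq_0)
  qed
  finally show ?thesis .
qed

text \<open>The combination of the two bumps with total integral 0 is the derivative of some
  compactly supported k. Since \<open>weak_derivative\<close> admits only nonnegative k, the bump
  with positive sign has to lie to the left: k first rises and then falls back to 0.\<close>

lemma two_bumps:
  assumes "0 < \<alpha>" "\<alpha> < \<beta>" "\<beta> \<le> \<gamma>" "\<gamma> < \<delta>"
  shows "(LINT s|lborel. bump \<gamma> \<delta> j s) * I_bump \<alpha> \<beta> i = (LINT s|lborel. bump \<alpha> \<beta> i s) * I_bump \<gamma> \<delta> j"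
proof -
  define c where "c = (LINT s|lborel. bump \<alpha> \<beta> i s)"
  define d where "d = (LINT s|lborel. bump \<gamma> \<delta> j s)"
  have c: "c \<ge> 0" unfolding c_def by (rule Bochner_Integration.integral_nonneg) (auto simp: bump_bounds)
  have d: "d \<ge> 0" unfolding d_def by (rule Bochner_Integration.integral_nonneg) (auto simp: bump_bounds)
  define k' where "k' s = d * bump \<alpha> \<beta> i s + (- c) * bump \<gamma> \<delta> j s" for s
  have sk': "smooth k'"
    unfolding smooth_def k'_def[abs_def]
    using smooth_bump by (intro allI diffn_add diffn_mult diffn_const) (auto simp: smooth_def)
  obtain F where F: "\<And>x. (F has_real_derivative k' x) (at x)"
    using continuous_antiderivative[OF smooth_continuous[OF sk']] by blast
  define k where "k s = F s - F \<alpha>" for s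
  have k: "(k has_real_derivative k' s) (at s)" for s
    unfolding k_def[abs_def] by (auto intro!: derivative_eq_intros F)
  have sk: "smooth k" using sk' k by (rule smooth_antideriv)
  have k'0: "k' s = 0" if "\<not> (\<alpha> < s \<and> s < \<delta>)" for s
    using that assms bump_eq_0[of \<alpha> s \<beta> i] bump_eq_0[of \<gamma> s \<delta> j] by (auto simp: k'_def)
  have k\<alpha>: "k \<alpha> = 0" by (simp add: k_def)
  have "(LINT s|lborel. indicator {\<alpha>..\<delta>} s *\<^sub>R k' s) = k \<delta> - k \<alpha>"
    by (rule integral_FTC_atLeastAtMost)
       (use assms k sk' in \<open>auto intro!: smooth_continuous simp: has_real_derivative_iff_has_vector_derivative[symmetric] intro: has_field_derivative_at_within\<close>)
  moreover have "(LINT s|lborel. indicator {\<alpha>..\<delta>} s *\<^sub>R k' s) = (LINT s|lborel. k' s)"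
  proof (intro Bochner_Integration.integral_cong refl)
    fix s show "indicator {\<alpha>..\<delta>} s *\<^sub>R k' s = k' s"
      by (cases "\<alpha> < s \<and> s < \<delta>") (auto simp: indicator_def k'0)
  qed
  moreover have "(LINT s|lborel. k' s) = 0"
    unfolding k'_def using integrable_bump by (subst Bochner_Integration.integral_add) (auto simp: c_def d_def)
  ultimately have k\<delta>: "k \<delta> = 0" using k\<alpha> by simp
  have kl: "k s = 0" if "s \<le> \<alpha>" for s
  proof (cases "s = \<alpha>")
    case False
    with that have "s < \<alpha>" by simp
    then obtain z where "z < \<alpha>" "k \<alpha> - k s = (\<alpha> - s) * k' z" using MVT2[of s \<alpha> k k'] k by blast
    then show ?thesis using k'0[of z] k\<alpha> by simp
  qed (simp add: k\<alpha>)
  have kr: "k s = 0" if "\<delta> \<le> s" for s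
  proof (cases "s = \<delta>")
    case False
    with that have "\<delta> < s" by simp
    then obtain z where "z > \<delta>" "k s - k \<delta> = (s - \<delta>) * k' z" using MVT2[of \<delta> s k k'] k by blast
    then show ?thesis using k'0[of z] k\<delta> by simp
  qed (simp add: k\<delta>)
  have kpos: "0 \<le> k s" for s
  proof -
    consider "s \<le> \<alpha>" | "\<alpha> < s" "s \<le> \<gamma>" | "\<gamma> < s" "s < \<delta>" | "\<delta> \<le> s" by linarith
    then show ?thesis
    proof cases
      case 2
      have "k \<alpha> \<le> k s"
      proof (rule DERIV_nonneg_imp_nondecreasing[of \<alpha> s k])
        fix x assume "\<alpha> \<le> x" "x \<le> s"
        then have "bump \<gamma> \<delta> j x = 0" using 2 bump_eq_0 by auto
        then have "0 \<le> k' x" using d bump_bounds by (simp add: k'_def)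
        then show "\<exists>y. (k has_real_derivative y) (at x) \<and> 0 \<le> y" using k by blast
      qed (use 2 in auto)
      then show ?thesis by (simp add: k\<alpha>)
    next
      case 3
      have "k \<delta> \<le> k s"
      proof (rule DERIV_nonpos_imp_nonincreasing[of s \<delta> k])
        fix x assume "s \<le> x" "x \<le> \<delta>"
        then have "bump \<alpha> \<beta> i x = 0" using 3 assms bump_eq_0 by auto
        then have "k' x \<le> 0" using c bump_bounds by (simp add: k'_def)
        then show "\<exists>y. (k has_real_derivative y) (at x) \<and> y \<le> 0" using k by blast
      qed (use 3 in auto)
      then show ?thesis by (simp add: k\<delta>)
    qed (auto simp: kl kr)
  qed
  have "(LINT s|lborel. indicator {\<alpha>..\<delta>} s * (q s - V s) * k' s) = 0"
    by (rule weak_derivative[OF sk kpos k]) (use assms kl kr in \<open>auto simp: not_less\<close>)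
  also have "(LINT s|lborel. indicator {\<alpha>..\<delta>} s * (q s - V s) * k' s)
     = (LINT s|lborel. d * ((q s - V s) * bump \<alpha> \<beta> i s) - c * ((q s - V s) * bump \<gamma> \<delta> j s))"
  proof (intro Bochner_Integration.integral_cong refl)
    fix s
    have "(q s - V s) * k' s = d * ((q s - V s) * bump \<alpha> \<beta> i s) - c * ((q s - V s) * bump \<gamma> \<delta> j s)"
      by (simp add: k'_def algebra_simps)
    then show "indicator {\<alpha>..\<delta>} s * (q s - V s) * k' s = d * ((q s - V s) * bump \<alpha> \<beta> i s) - c * ((q s - V s) * bump \<gamma> \<delta> j s)"
      by (cases "\<alpha> < s \<and> s < \<delta>") (auto simp: indicator_def k'0)
  qed
  also have "\<dots> = d * I_bump \<alpha> \<beta> i - c * I_bump \<gamma> \<delta> j"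
    unfolding I_bump_def using assms integrable_w_bump by (subst Bochner_Integration.integral_diff) auto
  finally show ?thesis by (simp add: c_def d_def)
qed

lemma I_bump_const:
  obtains \<kappa> where "\<And>\<alpha> \<beta> n. 0 < \<alpha> \<Longrightarrow> \<alpha> < \<beta> \<Longrightarrow> I_bump \<alpha> \<beta> n = \<kappa> * (LINT s|lborel. bump \<alpha> \<beta> n s)"
proof
  fix \<alpha> \<beta> :: real and n assume a: "0 < \<alpha>" "\<alpha> < \<beta>"
  \<comment> \<open>A third bump to the right of both intervals mediates between an arbitrary bump
    and the fixed one on (1, 2), because \<open>two_bumps\<close> compares ordered intervals
    only.\<close>
  define \<gamma> where "\<gamma> = max \<beta> 2"
  have p: "(LINT s|lborel. bump \<gamma> (\<gamma> + 1) 1 s) > 0" "(LINT s|lborel. bump 1 2 1 s) > 0"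
    by (rule integral_bump_pos; simp add: \<gamma>_def)+
  have 1: "(LINT s|lborel. bump \<gamma> (\<gamma> + 1) 1 s) * I_bump \<alpha> \<beta> n = (LINT s|lborel. bump \<alpha> \<beta> n s) * I_bump \<gamma> (\<gamma> + 1) 1"
    by (rule two_bumps) (use a in \<open>auto simp: \<gamma>_def\<close>)
  have 2: "(LINT s|lborel. bump \<gamma> (\<gamma> + 1) 1 s) * I_bump 1 2 1 = (LINT s|lborel. bump 1 2 1 s) * I_bump \<gamma> (\<gamma> + 1) 1"
    by (rule two_bumps) (auto simp: \<gamma>_def)
  define x y z X Y Z where "x = (LINT s|lborel. bump \<gamma> (\<gamma> + 1) 1 s)" and "y = (LINT s|lborel. bump 1 2 1 s)"
    and "z = (LINT s|lborel. bump \<alpha> \<beta> n s)" and "X = I_bump \<gamma> (\<gamma> + 1) 1" and "Y = I_bump 1 2 1" and "Z = I_bump \<alpha> \<beta> n"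
  have "x * Z = z * X" "x * Y = y * X" "x > 0" "y > 0"
    using 1 2 p by (auto simp: x_def y_def z_def X_def Y_def Z_def)
  then have "Z = z * X / x" "X = x * Y / y" by (auto simp: field_simps)
  then have "Z = Y / y * z" using \<open>x > 0\<close> by simp
  then show "I_bump \<alpha> \<beta> n = I_bump 1 2 1 / (LINT s|lborel. bump 1 2 1 s) * (LINT s|lborel. bump \<alpha> \<beta> n s)"
    by (simp add: x_def y_def z_def X_def Y_def Z_def)
qed

text \<open>Sharpening the bumps and dominated convergence, with the locally integrable function
  itself as majorant.\<close>

lemma interval_integral_const:
  obtains \<kappa> where "\<And>\<alpha> \<beta>. 0 < \<alpha> \<Longrightarrow> \<alpha> < \<beta> \<Longrightarrow> (LINT s|lborel. (q s - V s) * indicator {\<alpha><..<\<beta>} s) = \<kappa> * (\<beta> - \<alpha>)"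
proof -
  obtain \<kappa> where \<kappa>: "\<And>\<alpha> \<beta> n. 0 < \<alpha> \<Longrightarrow> \<alpha> < \<beta> \<Longrightarrow> I_bump \<alpha> \<beta> n = \<kappa> * (LINT s|lborel. bump \<alpha> \<beta> n s)"
    by (rule I_bump_const) blast
  show thesis
  proof
    fix \<alpha> \<beta> :: real assume a: "0 < \<alpha>" "\<alpha> < \<beta>"
    have l1: "(\<lambda>n. LINT s|lborel. (q s - V s) * bump \<alpha> \<beta> n s) \<longlonglongrightarrow> (LINT s|lborel. (q s - V s) * indicator {\<alpha><..<\<beta>} s)"
    proof (rule integral_dominated_convergence)
      show "integrable lborel (\<lambda>s. indicator {\<alpha>..\<beta>} s * \<bar>q s - V s\<bar>)"
        using integrable_abs[OF integrable_w[OF a(1), of \<beta>]] by (simp add: abs_mult)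
      show "AE s in lborel. (\<lambda>n. (q s - V s) * bump \<alpha> \<beta> n s) \<longlonglongrightarrow> (q s - V s) * indicator {\<alpha><..<\<beta>} s"
        by (intro AE_I2 tendsto_intros bump_LIMSEQ)
      fix n
      show "AE s in lborel. norm ((q s - V s) * bump \<alpha> \<beta> n s) \<le> indicator {\<alpha>..\<beta>} s * \<bar>q s - V s\<bar>"
      proof (rule AE_I2)
        fix s show "norm ((q s - V s) * bump \<alpha> \<beta> n s) \<le> indicator {\<alpha>..\<beta>} s * \<bar>q s - V s\<bar>"
          using mult_left_mono[OF bump_smaller[of \<alpha> \<beta> n s], of "\<bar>q s - V s\<bar>"] bump_bounds[of \<alpha> \<beta> n s]
          by (simp add: abs_mult mult.commute)
      qed
    qed measurable
    have l2: "(\<lambda>n. \<kappa> * (LINT s|lborel. bump \<alpha> \<beta> n s)) \<longlonglongrightarrow> \<kappa> * (LINT s|lborel. indicator {\<alpha><..<\<beta>} s)"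
    proof (intro tendsto_mult tendsto_const integral_dominated_convergence)
      show "integrable lborel (indicat_real {\<alpha>..\<beta>})"
        by (rule integrable_real_indicator) (auto simp: emeasure_lborel_Icc_eq)
      show "AE s in lborel. (\<lambda>n. bump \<alpha> \<beta> n s) \<longlonglongrightarrow> indicator {\<alpha><..<\<beta>} s" by (intro AE_I2 bump_LIMSEQ)
      show "AE s in lborel. norm (bump \<alpha> \<beta> n s) \<le> indicat_real {\<alpha>..\<beta>} s" for n
        using bump_smaller bump_bounds by auto
    qed measurable
    have l3: "(LINT s|lborel. (q s - V s) * bump \<alpha> \<beta> n s) = \<kappa> * (LINT s|lborel. bump \<alpha> \<beta> n s)" for n
      using \<kappa>[OF a, of n] by (simp add: I_bump_def)
    have l4: "(LINT s|lborel. indicator {\<alpha><..<\<beta>} s) = \<beta> - \<alpha>" using a by simp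
    from LIMSEQ_unique[OF l1[unfolded l3] l2] show "(LINT s|lborel. (q s - V s) * indicator {\<alpha><..<\<beta>} s) = \<kappa> * (\<beta> - \<alpha>)"
      by (simp only: l4)
  qed
qed

text \<open>All interval averages of q - V equal \<kappa>, so Lebesgue differentiation gives the
  value at almost every point. Integrability is known only away from 0, hence the exhaustion by
  intervals.\<close>

lemma AE_eq_const: obtains \<kappa> where "AE s in lborel. s > 0 \<longrightarrow> q s - V s = \<kappa>"
proof -
  obtain \<kappa> where \<kappa>: "\<And>\<alpha> \<beta>. 0 < \<alpha> \<Longrightarrow> \<alpha> < \<beta> \<Longrightarrow> (LINT s|lborel. (q s - V s) * indicator {\<alpha><..<\<beta>} s) = \<kappa> * (\<beta> - \<alpha>)"
    by (rule interval_integral_const) blast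
  have "AE s in lborel. s \<in> {1 / real (Suc n)<..<real (Suc n)} \<longrightarrow> q s - V s = \<kappa>" for n
  proof -
    define a b where "a = 1 / real (Suc n)" and "b = real (Suc n)"
    have ab: "0 < a" by (simp add: a_def)
    define f where "f s = indicator {a<..<b} s * (q s - V s)" for s
    have "integrable lborel (\<lambda>s. indicator {a<..<b} s *\<^sub>R (indicator {a..b} s * (q s - V s)))"
      by (rule integrable_mult_indicator[OF _ integrable_w[OF ab]]) simp
    also have "(\<lambda>s. indicator {a<..<b} s *\<^sub>R (indicator {a..b} s * (q s - V s))) = f"
      by (auto simp: f_def indicator_def)
    finally have fi: "integrable lborel f" .
    have "f integrable_on cbox x y" for x y
      using integrable_on_lborel[OF fi] by (rule integrable_on_subcbox) simp
    then obtain N where N: "negligible N" "\<And>x e. x \<notin> N \<Longrightarrow> 0 < e \<Longrightarrow>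
      \<exists>d>0. \<forall>h. 0 < h \<and> h < d \<longrightarrow> norm (integral (cbox x (x + h *\<^sub>R One)) f /\<^sub>R h ^ DIM(real) - f x) < e"
      by (rule integrable_ccontinuous_explicit[of f]) blast
    have main: "f x = \<kappa>" if x: "x \<notin> N" "a < x" "x < b" for x
    proof (rule ccontr)
      assume "f x \<noteq> \<kappa>"
      then have "0 < \<bar>\<kappa> - f x\<bar>" by simp
      from N(2)[OF x(1) this] obtain d where d: "d > 0" "\<And>h. 0 < h \<Longrightarrow> h < d \<Longrightarrow> \<bar>integral {x..x + h} f / h - f x\<bar> < \<bar>\<kappa> - f x\<bar>"
        by (auto simp: divide_inverse mult.commute)
      define h where "h = min (d / 2) ((b - x) / 2)"
      have h: "0 < h" "h < d" "x + h < b" using d(1) x by (auto simp: h_def min_def field_simps)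
      have "integral {x..x + h} f = (LINT s:{x..x + h}|lborel. f s)"
        by (rule set_borel_integral_eq_integral(2)[symmetric])
           (use fi in \<open>auto simp: set_integrable_def intro!: integrable_mult_indicator simp del: real_scaleR_def\<close>)
      also have "\<dots> = (LINT s|lborel. (q s - V s) * indicator {x<..<x + h} s)"
        unfolding set_lebesgue_integral_def
      proof (rule integral_cong_AE)
        have "AE s in lborel. s \<noteq> x" "AE s in lborel. s \<noteq> x + h" by (auto simp: AE_lborel_singleton)
        then show "AE s in lborel. indicator {x..x + h} s *\<^sub>R f s = (q s - V s) * indicator {x<..<x + h} s"
          by eventually_elim (use x h in \<open>auto simp: f_def indicator_def\<close>)
        show "(\<lambda>s. indicator {x..x + h} s *\<^sub>R f s) \<in> borel_measurable lborel"
          unfolding f_def by measurable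
      qed measurable
      also have "\<dots> = \<kappa> * h" using \<kappa>[of x "x + h"] x ab h by simp
      finally show False using d(2)[OF h(1,2)] h(1) by simp
    qed
    have "AE s in completion lborel. s \<in> {a<..<b} \<longrightarrow> q s - V s = \<kappa>"
    proof (rule AE_I')
      show "N \<in> null_sets (completion lborel)" using N(1) by (simp add: negligible_iff_null_sets)
      show "{x \<in> space (completion lborel). \<not> (x \<in> {a<..<b} \<longrightarrow> q x - V x = \<kappa>)} \<subseteq> N"
        using main by (auto simp: f_def)
    qed
    then show ?thesis by (simp add: AE_completion_iff a_def b_def)
  qed
  then have "AE s in lborel. \<forall>n. s \<in> {1 / real (Suc n)<..<real (Suc n)} \<longrightarrow> q s - V s = \<kappa>"
    by (simp only: AE_all_countable) blast
  then have "AE s in lborel. s > 0 \<longrightarrow> q s - V s = \<kappa>"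
  proof eventually_elim
    case (elim s)
    show ?case
    proof
      assume s: "s > 0"
      obtain n where n: "inverse (real (Suc n)) < s" using reals_Archimedean[OF s] by blast
      obtain n' where n': "s < real n'" using reals_Archimedean2 by blast
      have "1 / real (Suc (max n n')) \<le> inverse (real (Suc n))" by (simp add: field_simps)
      then have "s \<in> {1 / real (Suc (max n n'))<..<real (Suc (max n n'))}" using n n' by auto
      then show "q s - V s = \<kappa>" using elim by blast
    qed
  qed
  then show thesis by (rule that)
qed

end

text \<open>All further estimates use the potential only through the two slope bounds, which come
  from comparing V with multiples of the logarithm on [r^2, s^2]. Equality almost everywhere is
  enough because \<phi> enters afterwards only as a density.\<close>

lemma potential_formula:
  obtains U where "U \<in> borel_measurable borel" "AE z in lborel. \<phi> z = ereal (U (cmod z))"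
    "\<And>r s. 0 < r \<Longrightarrow> r \<le> s \<Longrightarrow> m 0 r / (2 * pi) * ln (s / r) \<le> U s - U r"
    "\<And>r s. 0 < r \<Longrightarrow> r \<le> s \<Longrightarrow> U s - U r \<le> m 0 s / (2 * pi) * ln (s / r)"
proof -
  obtain V where V: "V \<in> borel_measurable borel"
    "\<And>s. s > 0 \<Longrightarrow> (V has_real_derivative m 0 (sqrt s) / (4 * pi * s)) (at s)"
    by (rule log_potential) blast
  note [measurable] = V(1)
  obtain \<kappa> where \<kappa>: "AE s in lborel. s > 0 \<longrightarrow> q s - V s = \<kappa>"
    using AE_eq_const[OF V] by blast
  define U where "U r = \<kappa> + V (r\<^sup>2)" for r
  have Um: "U \<in> borel_measurable borel" unfolding U_def[abs_def] by measurable
  have "AE s in density lborel (\<lambda>s. ennreal pi * indicator {0<..} s). q s - V s = \<kappa>"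
    using \<kappa> by (subst AE_density) (auto simp: indicator_def elim!: eventually_mono)
  then have "AE s in distr lborel borel (\<lambda>z::complex. (cmod z)\<^sup>2). q s - V s = \<kappa>"
    by (simp only: distr_lborel_cmod_sq)
  then have "AE z::complex in lborel. q ((cmod z)\<^sup>2) - V ((cmod z)\<^sup>2) = \<kappa>"
    using borel_measurable_eq[of "\<lambda>s. q s - V s" borel "\<lambda>_. \<kappa>"]
    by (subst (asm) AE_distr_iff) auto
  moreover note subharmonic_AE_finite[OF sub_\<phi>]
  ultimately have AE: "AE z in lborel. \<phi> z = ereal (U (cmod z))"
  proof eventually_elim
    case (elim z)
    then have "p z = U (cmod z)" using p_eq_q[of z] by (simp add: U_def)
    then show ?case using elim by (simp add: p_def)
  qed
  have lower: "m 0 r / (2 * pi) * ln (s / r) \<le> U s - U r" if "0 < r" "r \<le> s" for r s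
  proof -
    have "V (r\<^sup>2) - m 0 r / (4 * pi) * ln (r\<^sup>2) \<le> V (s\<^sup>2) - m 0 r / (4 * pi) * ln (s\<^sup>2)"
    proof (rule DERIV_nonneg_imp_nondecreasing[of "r\<^sup>2" "s\<^sup>2" "\<lambda>x. V x - m 0 r / (4 * pi) * ln x"])
      show "r\<^sup>2 \<le> s\<^sup>2" using that by (intro power_mono) auto
      fix x assume x: "r\<^sup>2 \<le> x" "x \<le> s\<^sup>2"
      then have x0: "x > 0" using that by (meson less_le_trans zero_less_power)
      have "r \<le> sqrt x" using x that by (intro real_le_rsqrt) auto
      then have "m 0 r \<le> m 0 (sqrt x)" by (rule m_mono_radius)
      moreover have "((\<lambda>x. V x - m 0 r / (4 * pi) * ln x) has_real_derivative m 0 (sqrt x) / (4 * pi * x) - m 0 r / (4 * pi) * (1 / x)) (at x)"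
        using x0 by (auto intro!: derivative_eq_intros V(2))
      ultimately show "\<exists>y. ((\<lambda>x. V x - m 0 r / (4 * pi) * ln x) has_real_derivative y) (at x) \<and> 0 \<le> y"
        using x0 by (intro exI conjI) (assumption, simp add: field_simps)
    qed
    moreover have "m 0 r / (2 * pi) * ln (s / r) = m 0 r / (4 * pi) * ln (s\<^sup>2) - m 0 r / (4 * pi) * ln (r\<^sup>2)"
    proof -
      have "ln (s / r) = ln s - ln r" "ln (r\<^sup>2) = 2 * ln r" "ln (s\<^sup>2) = 2 * ln s"
        using that by (auto simp: ln_div ln_realpow)
      then show ?thesis by (simp add: right_diff_distrib mult.commute diff_divide_distrib)
    qed
    ultimately show ?thesis unfolding U_def by linarith
  qed
  have upper: "U s - U r \<le> m 0 s / (2 * pi) * ln (s / r)" if "0 < r" "r \<le> s" for r s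
  proof -
    have "m 0 s / (4 * pi) * ln (r\<^sup>2) - V (r\<^sup>2) \<le> m 0 s / (4 * pi) * ln (s\<^sup>2) - V (s\<^sup>2)"
    proof (rule DERIV_nonneg_imp_nondecreasing[of "r\<^sup>2" "s\<^sup>2" "\<lambda>x. m 0 s / (4 * pi) * ln x - V x"])
      show "r\<^sup>2 \<le> s\<^sup>2" using that by (intro power_mono) auto
      fix x assume x: "r\<^sup>2 \<le> x" "x \<le> s\<^sup>2"
      then have x0: "x > 0" using that by (meson less_le_trans zero_less_power)
      have "sqrt x \<le> s" using x that by (intro real_le_lsqrt) auto
      then have "m 0 (sqrt x) \<le> m 0 s" by (rule m_mono_radius)
      moreover have "((\<lambda>x. m 0 s / (4 * pi) * ln x - V x) has_real_derivative m 0 s / (4 * pi) * (1 / x) - m 0 (sqrt x) / (4 * pi * x)) (at x)"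
        using x0 by (auto intro!: derivative_eq_intros V(2))
      ultimately show "\<exists>y. ((\<lambda>x. m 0 s / (4 * pi) * ln x - V x) has_real_derivative y) (at x) \<and> 0 \<le> y"
        using x0 by (intro exI conjI) (assumption, simp add: field_simps)
    qed
    moreover have "m 0 s / (2 * pi) * ln (s / r) = m 0 s / (4 * pi) * ln (s\<^sup>2) - m 0 s / (4 * pi) * ln (r\<^sup>2)"
    proof -
      have "ln (s / r) = ln s - ln r" "ln (r\<^sup>2) = 2 * ln r" "ln (s\<^sup>2) = 2 * ln s"
        using that by (auto simp: ln_div ln_realpow)
      then show ?thesis by (simp add: right_diff_distrib mult.commute diff_divide_distrib)
    qed
    ultimately show ?thesis unfolding U_def by linarith
  qed
  show thesis by (rule that[OF Um AE lower upper])
qed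

end

section \<open>Moments of a radial Fock weight\<close>

lemma nn_integral_inverse_square: "(\<integral>\<^sup>+s. ennreal (1 / (1 + \<bar>s\<bar>)\<^sup>2) \<partial>lborel) = 2"
proof -
  have half: "(\<integral>\<^sup>+s. ennreal (1 / (1 + s)\<^sup>2) * indicator {0..} s \<partial>lborel) = ennreal (0 - (- 1 / (1 + 0)))"
  proof (rule nn_integral_FTC_atLeast[where F="\<lambda>s. - 1 / (1 + s)"])
    fix x :: real assume "0 \<le> x"
    then show "((\<lambda>s. - 1 / (1 + s)) has_real_derivative 1 / (1 + x)\<^sup>2) (at x)"
      by (auto intro!: derivative_eq_intros simp: power2_eq_square)
  next
    show "((\<lambda>s. - 1 / (1 + s :: real)) \<longlongrightarrow> 0) at_top" by real_asymp
  qed auto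
  have "(\<integral>\<^sup>+s. ennreal (1 / (1 + \<bar>s\<bar>)\<^sup>2) \<partial>lborel)
     = (\<integral>\<^sup>+s. ennreal (1 / (1 + s)\<^sup>2) * indicator {0..} s + ennreal (1 / (1 - s)\<^sup>2) * indicator {..0} s \<partial>lborel)"
  proof (rule nn_integral_cong_AE)
    have "AE s in lborel. s \<noteq> (0::real)" by (rule AE_lborel_singleton)
    then show "AE s in lborel. ennreal (1 / (1 + \<bar>s\<bar>)\<^sup>2) = ennreal (1 / (1 + s)\<^sup>2) * indicator {0..} s + ennreal (1 / (1 - s)\<^sup>2) * indicator {..0} s"
      by eventually_elim (auto simp: indicator_def abs_if)
  qed
  also have "\<dots> = (\<integral>\<^sup>+s. ennreal (1 / (1 + s)\<^sup>2) * indicator {0..} s \<partial>lborel) + (\<integral>\<^sup>+s. ennreal (1 / (1 - s)\<^sup>2) * indicator {..0} s \<partial>lborel)"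
    by (rule nn_integral_add) auto
  also have "(\<integral>\<^sup>+s. ennreal (1 / (1 - s)\<^sup>2) * indicator {..0} s \<partial>lborel) = (\<integral>\<^sup>+s. ennreal (1 / (1 + s)\<^sup>2) * indicator {0..} s \<partial>lborel)"
    by (subst nn_integral_real_affine[where c="-1" and t=0]) (auto intro!: nn_integral_cong simp: indicator_def)
  finally show ?thesis using half by simp
qed

text \<open>Apart from the first term \<tau>, the sum is dominated by a telescoping one: \<tau> / (a
  + \<tau>)^2 is at most 1/a - 1/(a + \<tau>). The bound stays finite as the step \<tau> tends to 0,
  like a Riemann sum.\<close>

lemma sum_inverse_square_le:
  assumes \<tau>: "0 < \<tau>" shows "(\<Sum>j<n. \<tau> / (1 + real j * \<tau>)\<^sup>2) \<le> \<tau> + 1"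
proof -
  have *: "(\<Sum>j<Suc n. \<tau> / (1 + real j * \<tau>)\<^sup>2) \<le> \<tau> + 1 - 1 / (1 + real n * \<tau>)" for n
  proof (induction n)
    case (Suc n)
    define a where "a = 1 + real n * \<tau>"
    have a: "0 < a" using \<tau> by (simp add: a_def add_pos_nonneg)
    have s: "1 + real (Suc n) * \<tau> = a + \<tau>" by (simp add: a_def algebra_simps)
    have "\<tau> / (a + \<tau>)\<^sup>2 \<le> \<tau> / (a * (a + \<tau>))"
      using a \<tau> by (intro divide_left_mono) (auto simp: power2_eq_square)
    also have "\<dots> = 1 / a - 1 / (a + \<tau>)" using a \<tau> by (simp add: field_simps)
    finally have "\<tau> / (a + \<tau>)\<^sup>2 \<le> 1 / a - 1 / (a + \<tau>)" .
    then show ?case using Suc.IH unfolding sum.lessThan_Suc[of _ "Suc n"] s a_def[symmetric] by linarith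
  qed simp
  show ?thesis
  proof (cases n)
    case (Suc k)
    have "0 \<le> 1 / (1 + real k * \<tau>)" using \<tau> by simp
    then show ?thesis using *[of k] unfolding Suc by linarith
  qed (use \<tau> in simp)
qed

lemma sum_inverse_square_two_sided:
  assumes \<tau>: "0 < \<tau>" and x: "0 \<le> x"
  shows "(\<Sum>k<n. \<tau> / (1 + \<bar>real k - x\<bar> * \<tau>)\<^sup>2) \<le> 2 * (\<tau> + 1)"
proof -
  define a where "a = nat \<lceil>x\<rceil>"
  have a: "x \<le> real a" "real a < x + 1" unfolding a_def using x by linarith+
  let ?f = "\<lambda>k. \<tau> / (1 + \<bar>real k - x\<bar> * \<tau>)\<^sup>2"
  let ?g = "\<lambda>j. \<tau> / (1 + real j * \<tau>)\<^sup>2"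
  have fg: "?f k \<le> ?g j" if "real j \<le> \<bar>real k - x\<bar>" for k j
  proof (rule divide_left_mono)
    have "1 + real j * \<tau> \<le> 1 + \<bar>real k - x\<bar> * \<tau>" using that \<tau> by (simp add: mult_right_mono)
    then show "(1 + real j * \<tau>)\<^sup>2 \<le> (1 + \<bar>real k - x\<bar> * \<tau>)\<^sup>2" using \<tau> by (intro power_mono) auto
    show "0 < (1 + \<bar>real k - x\<bar> * \<tau>)\<^sup>2 * (1 + real j * \<tau>)\<^sup>2"
      using \<tau> by (intro mult_pos_pos zero_less_power add_pos_nonneg) auto
  qed (use \<tau> in simp)
  have shift: "(\<Sum>k<a + n. h k) = (\<Sum>k<a. h k) + (\<Sum>j<n. h (a + j))" for h :: "nat \<Rightarrow> real" and n
    by (induction n) (auto simp: algebra_simps)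
  have "(\<Sum>k<n. ?f k) \<le> (\<Sum>k<a + n. ?f k)" using \<tau> by (intro sum_mono2) auto
  also have "\<dots> = (\<Sum>k<a. ?f k) + (\<Sum>j<n. ?f (a + j))"
    by (rule shift)
  also have "(\<Sum>j<n. ?f (a + j)) \<le> (\<Sum>j<n. ?g j)" using a by (intro sum_mono fg) auto
  also have "(\<Sum>k<a. ?f k) = (\<Sum>j<a. ?f (a - Suc j))" by (rule sum.nat_diff_reindex[symmetric])
  also have "(\<Sum>j<a. ?f (a - Suc j)) \<le> (\<Sum>j<a. ?g j)" using a by (intro sum_mono fg) (auto simp: of_nat_diff)
  also have "(\<Sum>j<a. ?g j) \<le> \<tau> + 1" by (rule sum_inverse_square_le[OF \<tau>])
  also have "(\<Sum>j<n. ?g j) \<le> \<tau> + 1" by (rule sum_inverse_square_le[OF \<tau>])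
  finally show ?thesis by simp
qed

lemma ln_1_plus_ge: "0 \<le> x \<Longrightarrow> x \<le> 1 / 2 \<Longrightarrow> x / 2 \<le> ln (1 + x :: real)"
proof -
  assume x: "0 \<le> x" "x \<le> 1 / 2"
  have "x * x \<le> x * (1 / 2)" using x by (intro mult_left_mono) auto
  then have "x / 2 \<le> x - x\<^sup>2" by (simp add: power2_eq_square)
  also have "\<dots> \<le> ln (1 + x)" by (rule ln_one_plus_pos_lower_bound) (use x in auto)
  finally show ?thesis .
qed

lemma exp_double_ge: "0 \<le> x \<Longrightarrow> (1 + x)\<^sup>2 \<le> exp (2 * x :: real)"
  using power_mono[OF exp_ge_add_one_self[of x], of 2] by (simp add: exp_double)

locale fock_radial = radial_doubling +
  fixes U :: "real \<Rightarrow> real"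
  assumes U_measurable[measurable]: "U \<in> borel_measurable borel"
    and U_lower: "\<And>r s. 0 < r \<Longrightarrow> r \<le> s \<Longrightarrow> m 0 r / (2 * pi) * ln (s / r) \<le> U s - U r"
    and U_upper: "\<And>r s. 0 < r \<Longrightarrow> r \<le> s \<Longrightarrow> U s - U r \<le> m 0 s / (2 * pi) * ln (s / r)"
begin

text \<open>The logarithmic slope of U. The factor r^(2k) exp(-2 U(r)) has its maximum where N r =
  k, so this is the index of the monomial that lives near radius r.\<close>

definition N :: "real \<Rightarrow> real" where "N r = m 0 r / (2 * pi)"

lemma N_nonneg: "0 \<le> N r" by (simp add: N_def m_nonneg)

lemma N_mono: "r \<le> s \<Longrightarrow> N r \<le> N s"
  by (simp add: N_def m_mono_radius divide_right_mono)

lemma U_lower': "0 < r \<Longrightarrow> r \<le> s \<Longrightarrow> N r * ln (s / r) \<le> U s - U r"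
  using U_lower by (simp add: N_def)

lemma U_upper': "0 < r \<Longrightarrow> r \<le> s \<Longrightarrow> U s - U r \<le> N s * ln (s / r)"
  using U_upper by (simp add: N_def)

lemma R_ge_half: "\<bar>s - r\<bar> \<le> R r \<Longrightarrow> R s \<le> 2 * R r"
  using R_lipschitz[of s r] by linarith

text \<open>The constant of \<open>annulus_upper\<close> divided by 2 pi, simplified with pi >
  2.\<close>

definition N_const :: real where "N_const = 2 * C ^ 2"

lemma N_const_pos: "N_const > 0" using C_pos by (simp add: N_const_def)

lemma N_increment:
  assumes "0 < r" "R r \<le> r" shows "N (r + R r) - N (r - R r) \<le> N_const * (r / R r)"
proof -
  have "N (r + R r) - N (r - R r) = (m 0 (r + R r) - m 0 (r - R r)) / (2 * pi)"
    by (simp add: N_def diff_divide_distrib)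
  also have "\<dots> \<le> 8 * C ^ 2 * (r / R r) / (2 * pi)"
    using annulus_upper[OF assms] by (intro divide_right_mono) auto
  also have "\<dots> = (2 / pi) * (2 * C ^ 2 * (r / R r))" by simp
  also have "\<dots> \<le> 1 * (2 * C ^ 2 * (r / R r))"
    using pi_gt3 assms R_pos[of r] by (intro mult_right_mono) auto
  finally show ?thesis by (simp add: N_const_def)
qed

text \<open>Squared norm of z^k in polar coordinates, as an extended real until finiteness is
  known.\<close>

definition cc :: "nat \<Rightarrow> ennreal" where
  "cc k = (\<integral>\<^sup>+r. ennreal (2 * pi * r * (r ^ (2 * k) * exp (- 2 * U r) / (R r)\<^sup>2)) * indicator {0<..} r \<partial>lborel)"

lemma cc_ge_window:
  assumes J: "J = {x..x + l}" "0 \<le> l" "0 < x" and B: "0 \<le> B"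
    "\<And>s. s \<in> J \<Longrightarrow> B \<le> 2 * pi * s * (s ^ (2 * k) * exp (- 2 * U s) / (R s)\<^sup>2)"
  shows "ennreal (B * l) \<le> cc k"
proof -
  have "ennreal (B * l) = (\<integral>\<^sup>+r. ennreal B * indicator J r \<partial>lborel)"
    using J B by (simp add: nn_integral_cmult_indicator ennreal_mult)
  also have "\<dots> \<le> cc k" unfolding cc_def
    using J B(2) by (intro nn_integral_mono) (auto simp: indicator_def intro!: ennreal_leI)
  finally show ?thesis .
qed

lemma power_ratio: "0 < r \<Longrightarrow> 0 < s \<Longrightarrow> s ^ (2 * k) = r ^ (2 * k) * exp (2 * real k * ln (s / r))"
proof -
  assume a: "0 < r" "0 < s"
  have "exp (2 * real k * ln (s / r)) = (s / r) ^ (2 * k)"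
    using a exp_of_nat_mult[of "2 * k" "ln (s / r)"] by simp
  then show ?thesis using a by (simp add: power_divide)
qed

text \<open>The factor 8/pi collects the window length \<open>R r / 2\<close> and the bounds r/2
  \<le> s and R s \<le> 2 R r on it; the exponential is the loss from the variation of
  \<open>N\<close> across the window.\<close>

definition KU :: real where "KU = 8 / pi * exp (4 * N_const)"

lemma KU_pos: "KU > 0" by (simp add: KU_def)

text \<open>Only a window on the side of r where the integrand grows is kept: to the right for k
  \<ge> N r, to the left otherwise. There its logarithm exceeds the value at r by a multiple of |k -
  N r| up to the variation of \<open>N\<close>, which \<open>annulus_upper\<close> controls. The
  inequality exp(2x) \<ge> (1 + x)^2 leaves the quadratic growth in |k - N r| that makes the later
  sums over k converge.\<close>

lemma cc_lower:
  assumes r: "0 < r" "R r \<le> r / 2"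
  shows "ennreal (r ^ (2 * k) * exp (- 2 * U r) * (r / R r) * (1 + \<bar>real k - N r\<bar> * (R r / r / 4))\<^sup>2 / KU) \<le> cc k"
proof -
  define t where "t = R r / r"
  have t: "0 < t" "t \<le> 1 / 2" "R r = t * r" using r R_pos[of r] by (auto simp: t_def)
  define b where "b = real k - N r"
  define D where "D = r ^ (2 * k) * exp (- 2 * U r)"
  have D: "0 \<le> D" using r by (simp add: D_def)
  have key: "D * exp (2 * (real k * ln (s / r) - (U s - U r))) = s ^ (2 * k) * exp (- 2 * U s)" if "0 < s" for s
    using power_ratio[OF r(1) that, of k] by (simp add: D_def exp_add[symmetric] exp_diff[symmetric] algebra_simps)
  have inc: "N (r + R r) - N (r - R r) \<le> N_const / t"
    using N_increment[of r] r R_pos[of r] by (simp add: t_def)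
  have W: "2 * pi * (r / 2) * (B / (2 * R r)\<^sup>2) \<le> 2 * pi * s * (B' / (R s)\<^sup>2)"
    if "B \<le> B'" "0 \<le> B" "r / 2 \<le> s" "\<bar>s - r\<bar> \<le> R r" for s B B'
  proof (rule mult_mono)
    show "B / (2 * R r)\<^sup>2 \<le> B' / (R s)\<^sup>2"
      using that R_ge_half[OF that(4)] R_pos[of s] by (intro frac_le power_mono) auto
  qed (use that r in auto)
  define E where "E = D * exp (- 4 * N_const) * (1 + \<bar>b\<bar> * (t / 4))\<^sup>2"
  have E: "0 \<le> E" using D by (simp add: E_def)
  have fin: "r ^ (2 * k) * exp (- 2 * U r) * (r / R r) * (1 + \<bar>real k - N r\<bar> * (R r / r / 4))\<^sup>2 / KU
      = 2 * pi * (r / 2) * (E / (2 * R r)\<^sup>2) * (R r / 2)"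
    using R_pos[of r] by (simp add: E_def D_def KU_def b_def t_def exp_minus field_simps power2_eq_square)
  \<comment> \<open>The window starts at distance \<open>R r / 2\<close> from r so that the
    logarithmic distance to r is at least t/4, and ends at distance \<open>R r\<close>, where
    \<open>N\<close> has changed by at most \<open>N_const / t\<close>.\<close>
  have "\<exists>x>0. \<forall>s\<in>{x..x + R r / 2}. r / 2 \<le> s \<and> \<bar>s - r\<bar> \<le> R r \<and> E \<le> s ^ (2 * k) * exp (- 2 * U s)"
  proof (cases "b \<ge> 0")
    case True
    show ?thesis
    proof (intro exI[of _ "r + R r / 2"] conjI ballI)
      fix s assume s: "s \<in> {r + R r / 2..r + R r / 2 + R r / 2}"
      then have s': "r + R r / 2 \<le> s" "s \<le> r + R r" by auto
      show "r / 2 \<le> s" "\<bar>s - r\<bar> \<le> R r" using s' r R_pos[of r] by auto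
      have s0: "0 < s" "r \<le> s" using s' r R_pos[of r] by linarith+
      define L where "L = ln (s / r)"
      have L0: "0 \<le> L" using s0 r by (simp add: L_def)
      have "(1 + t / 2) * r \<le> s" using s' t(3) by (simp add: algebra_simps)
      then have "1 + t / 2 \<le> s / r" using r by (simp add: pos_le_divide_eq)
      then have "ln (1 + t / 2) \<le> L" unfolding L_def using t s0 r by (intro ln_mono) auto
      then have L1: "t / 4 \<le> L" using ln_1_plus_ge[of "t / 2"] t by simp
      have "L \<le> s / r - 1" unfolding L_def using s0 r by (intro ln_le_minus_one) auto
      also have "s / r \<le> 1 + t"
      proof -
        have "s \<le> (1 + t) * r" using s' t(3) by (simp add: algebra_simps)
        then show ?thesis using r by (simp add: pos_divide_le_eq)
      qed
      then have "s / r - 1 \<le> t" by simp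
      finally have L2: "L \<le> t" .
      have "U s - U r \<le> N s * L" unfolding L_def by (rule U_upper') (use s0 r in auto)
      also have "\<dots> = N r * L + (N s - N r) * L" by (simp add: algebra_simps)
      also have "(N s - N r) * L \<le> (N_const / t) * t"
        using inc N_mono[of s "r + R r"] N_mono[of "r - R r" r] s' R_pos[of r] L0 L2 N_mono[of r s] s0 N_const_pos t
        by (intro mult_mono) auto
      finally have "U s - U r \<le> N r * L + N_const" using t by simp
      then have "2 * (b * L) - 2 * N_const \<le> 2 * (real k * L - (U s - U r))" by (simp add: b_def algebra_simps)
      moreover have "b * (t / 4) \<le> b * L" using True L1 by (intro mult_left_mono) auto
      ultimately have e: "2 * (b * (t / 4)) - 4 * N_const \<le> 2 * (real k * L - (U s - U r))"
        using N_const_pos by linarith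
      have "E \<le> D * exp (- 4 * N_const) * exp (2 * (b * (t / 4)))" unfolding E_def
        using True D t exp_double_ge[of "b * (t / 4)"] by (intro mult_left_mono) auto
      also have "\<dots> = D * exp (2 * (b * (t / 4)) - 4 * N_const)" by (simp add: mult.assoc exp_add[symmetric])
      also have "\<dots> \<le> D * exp (2 * (real k * L - (U s - U r)))" using e D by (intro mult_left_mono) auto
      finally show "E \<le> s ^ (2 * k) * exp (- 2 * U s)" using key[OF s0(1)] by (simp add: L_def)
    qed (use r R_pos[of r] in auto)
  next
    case False
    show ?thesis
    proof (intro exI[of _ "r - R r"] conjI ballI)
      fix s assume s: "s \<in> {r - R r..r - R r + R r / 2}"
      then have s': "r - R r \<le> s" "s \<le> r - R r / 2" by auto
      show "r / 2 \<le> s" "\<bar>s - r\<bar> \<le> R r" using s' r R_pos[of r] by auto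
      have s0: "0 < s" "s \<le> r" using s' r R_pos[of r] by linarith+
      define L where "L = ln (r / s)"
      have Lneg: "ln (s / r) = - L" using s0 r by (simp add: L_def ln_div)
      have L0: "0 \<le> L" using s0 r by (simp add: L_def)
      have "s * (1 + t / 2) \<le> (r - R r / 2) * (1 + t / 2)" using s' t by (intro mult_right_mono) auto
      also have "\<dots> = r - r * t\<^sup>2 / 4" using r by (simp add: t_def field_simps power2_eq_square)
      also have "\<dots> \<le> r" using r by simp
      finally have "1 + t / 2 \<le> r / s" using s0 by (simp add: field_simps)
      then have "ln (1 + t / 2) \<le> L" unfolding L_def using t s0 r by (intro ln_mono) auto
      then have L1: "t / 4 \<le> L" using ln_1_plus_ge[of "t / 2"] t by simp
      have "L \<le> r / s - 1" unfolding L_def using s0 r by (intro ln_le_minus_one) auto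
      also have "\<dots> = (r - s) / s" using s0 by (simp add: field_simps)
      also have "\<dots> \<le> R r / (r / 2)" using s' r R_pos[of r] by (intro frac_le) auto
      finally have L2: "L \<le> 2 * t" by (simp add: t_def mult.commute)
      have "N s * L \<le> U r - U s" unfolding L_def by (rule U_lower') (use s0 r in auto)
      moreover have "N s * L = N r * L - (N r - N s) * L" by (simp add: algebra_simps)
      moreover have "(N r - N s) * L \<le> (N_const / t) * (2 * t)"
        using inc N_mono[of r "r + R r"] N_mono[of "r - R r" s] s' R_pos[of r] L0 L2 N_mono[of s r] s0 N_const_pos t
        by (intro mult_mono) auto
      ultimately have "N r * L - 2 * N_const \<le> U r - U s" using t by simp
      then have "2 * ((- b) * L) - 4 * N_const \<le> 2 * (real k * (- L) - (U s - U r))" by (simp add: b_def algebra_simps)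
      moreover have "(- b) * (t / 4) \<le> (- b) * L" using False L1 by (intro mult_left_mono) auto
      ultimately have e: "2 * ((- b) * (t / 4)) - 4 * N_const \<le> 2 * (real k * ln (s / r) - (U s - U r))"
        unfolding Lneg by linarith
      have "E \<le> D * exp (- 4 * N_const) * exp (2 * ((- b) * (t / 4)))" unfolding E_def
        using False D t exp_double_ge[of "(- b) * (t / 4)"] mult_nonneg_nonneg[of "- b" "t / 4"]
        by (intro mult_left_mono) auto
      also have "\<dots> = D * exp (2 * ((- b) * (t / 4)) - 4 * N_const)" by (simp add: mult.assoc exp_add[symmetric])
      also have "\<dots> \<le> D * exp (2 * (real k * ln (s / r) - (U s - U r)))" using e D by (intro mult_left_mono) auto
      finally show "E \<le> s ^ (2 * k) * exp (- 2 * U s)" using key[OF s0(1)] by simp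
    qed (use r R_pos[of r] in auto)
  qed
  then obtain x where x: "x > 0" "\<And>s. s \<in> {x..x + R r / 2} \<Longrightarrow> r / 2 \<le> s \<and> \<bar>s - r\<bar> \<le> R r \<and> E \<le> s ^ (2 * k) * exp (- 2 * U s)"
    by blast
  show ?thesis unfolding fin
  proof (rule cc_ge_window[OF refl _ x(1)])
    fix s assume "s \<in> {x..x + R r / 2}"
    then show "2 * pi * (r / 2) * (E / (2 * R r)\<^sup>2) \<le> 2 * pi * s * (s ^ (2 * k) * exp (- 2 * U s) / (R s)\<^sup>2)"
      using x(2)[of s] E by (intro W) auto
  qed (use r E R_pos[of r] in auto)
qed

end

context fock_radial
begin

lemma R_ratio:
  obtains K P where "K > 0" "\<And>r s. R r \<le> K * (1 + \<bar>s - r\<bar> / R r) ^ P * R s"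
proof -
  obtain K P where K: "K > 0" "\<And>z w. \<rho> z \<le> K * (1 + dist z w / \<rho> z) ^ P * \<rho> w" by (rule \<rho>_ratio_bound) blast
  show thesis
  proof (rule that[OF K(1)])
    fix r s
    show "R r \<le> K * (1 + \<bar>s - r\<bar> / R r) ^ P * R s"
      using K(2)[of "of_real r" "of_real s"] by (simp add: R_def dist_norm abs_minus_commute[of s r] flip: of_real_diff)
  qed
qed

lemma R_sublinear: assumes "\<epsilon> > 0" obtains R0 where "R0 > 0" "\<And>r. r \<ge> R0 \<Longrightarrow> R r \<le> \<epsilon> * r"
proof -
  obtain R0 where R0: "R0 > 0" "\<And>z. cmod z \<ge> R0 \<Longrightarrow> \<rho> z \<le> \<epsilon> * cmod z" by (rule \<rho>_sublinear[OF assms]) blast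
  show thesis
  proof (rule that[OF R0(1)])
    fix r assume "r \<ge> R0" then show "R r \<le> \<epsilon> * r" using R0(1) R0(2)[of "of_real r"] by (simp add: R_def)
  qed
qed

text \<open>Half the rate at which \<open>annulus_lower\<close> makes \<open>N\<close> grow:
  \<open>N\<close> changes by \<open>2 * c0 * (r / R r)\<close> on each side of r, so an index
  within \<open>c0 * (r / R r)\<close> of \<open>N r\<close> keeps a margin of the same
  size.\<close>

definition c0 :: real where "c0 = 1 / (4 * pi * C ^ 4)"

lemma c0_pos: "c0 > 0" using C_pos by (simp add: c0_def)

lemma N_increment_lower:
  assumes "0 < r" "R r \<le> r"
  shows "2 * c0 * (r / R r) \<le> N (r + R r) - N r" "2 * c0 * (r / R r) \<le> N r - N (r - R r)"
proof -
  have e: "2 * c0 * (r / R r) = r / R r / C ^ 4 / (2 * pi)" by (simp add: c0_def)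
  have "r / R r / C ^ 4 / (2 * pi) \<le> (m 0 (r + R r) - m 0 r) / (2 * pi)"
    using annulus_lower[OF assms, of "r + R r / 2"] R_pos[of r] by (intro divide_right_mono) (auto simp: add.commute)
  then show "2 * c0 * (r / R r) \<le> N (r + R r) - N r" unfolding e by (simp add: N_def diff_divide_distrib)
  have "r / R r / C ^ 4 / (2 * pi) \<le> (m 0 r - m 0 (r - R r)) / (2 * pi)"
    using annulus_lower[OF assms, of "r - R r / 2"] R_pos[of r] by (intro divide_right_mono) auto
  then show "2 * c0 * (r / R r) \<le> N r - N (r - R r)" unfolding e by (simp add: N_def diff_divide_distrib)
qed

text \<open>The slope \<open>N\<close> of the convex function \<open>t \<mapsto> U (exp t)\<close> passes \<open>k\<close> with margin
  \<open>c0 * r / R r\<close> within one unit \<open>R r / r\<close> on either side of \<open>ln r\<close>.\<close>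

lemma exponent_bound:
  assumes r: "0 < r" "R r \<le> r / 2" and k: "\<bar>real k - N r\<bar> \<le> c0 * (r / R r)" and s: "0 < s"
  shows "real k * ln (s / r) - (U s - U r) \<le> 4 * c0 - c0 * (r / R r) * \<bar>ln (s / r)\<bar>"
proof -
  define a where "a = c0 * (r / R r)"
  define t where "t = R r / r"
  have t: "0 < t" "t \<le> 1 / 2" using r R_pos[of r] by (auto simp: t_def)
  have a: "a > 0" "a * t = c0" using r R_pos[of r] c0_pos by (auto simp: a_def t_def)
  have k': "real k - N r \<le> a" "N r - real k \<le> a" using k by (auto simp: a_def)
  have inc: "2 * a \<le> N (r + R r) - N r" "2 * a \<le> N r - N (r - R r)"
    using N_increment_lower[of r] r by (auto simp: a_def)
  \<comment> \<open>Within one unit of ln r the slope may have the wrong sign. Since a t = c0 there,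
    replacing a L by -a L costs at most 4 c0.\<close>
  have small: "a * L \<le> - a * L + 4 * c0" if "L \<le> 2 * t" for L
  proof -
    have "a * L \<le> a * (2 * t)" using that a by (intro mult_left_mono) auto
    also have "a * (2 * t) = 2 * c0" using a(2) by simp
    finally show ?thesis by (simp add: mult.commute)
  qed
  consider "r + R r \<le> s" | "r \<le> s" "s < r + R r" | "s \<le> r - R r" | "r - R r < s" "s < r" by linarith
  then have "real k * ln (s / r) - (U s - U r) \<le> 4 * c0 - a * \<bar>ln (s / r)\<bar>"
  proof cases
    case 1
    define L1 where "L1 = ln (s / (r + R r))"
    define L2 where "L2 = ln ((r + R r) / r)"
    have L: "ln (s / r) = L1 + L2" "0 \<le> L1" "0 \<le> L2"
      using 1 r s R_pos[of r] by (auto simp: L1_def L2_def ln_div)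
    have "L2 \<le> (r + R r) / r - 1" unfolding L2_def using r R_pos[of r] by (intro ln_le_minus_one) auto
    then have L2: "L2 \<le> 2 * t" using r t by (simp add: t_def field_simps)
    have "N (r + R r) * L1 \<le> U s - U (r + R r)" unfolding L1_def using 1 r R_pos[of r] by (intro U_lower') auto
    moreover have "N r * L2 \<le> U (r + R r) - U r" unfolding L2_def using r R_pos[of r] by (intro U_lower') auto
    ultimately have "real k * (L1 + L2) - (U s - U r) \<le> (real k - N (r + R r)) * L1 + (real k - N r) * L2"
      by (simp add: algebra_simps)
    also have "\<dots> \<le> (- a) * L1 + a * L2" using inc(1) k' L by (intro add_mono mult_right_mono) auto
    also have "\<dots> \<le> (- a) * L1 + (- a * L2 + 4 * c0)" using small[OF L2] by simp
    finally show ?thesis using L by (simp add: algebra_simps)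
  next
    case 2
    define L where "L = ln (s / r)"
    have L: "0 \<le> L" using 2 r by (simp add: L_def)
    have "L \<le> s / r - 1" unfolding L_def using 2 r by (intro ln_le_minus_one) auto
    also have "s / r \<le> 1 + 2 * t"
    proof -
      have "(1 + 2 * t) * r = r + 2 * R r" using r by (simp add: t_def field_simps)
      then have "s \<le> (1 + 2 * t) * r" using 2 R_pos[of r] by linarith
      then show ?thesis using r by (simp add: pos_divide_le_eq)
    qed
    then have "s / r - 1 \<le> 2 * t" by simp
    finally have L2: "L \<le> 2 * t" .
    have "N r * L \<le> U s - U r" unfolding L_def using 2 r by (intro U_lower') auto
    then have "real k * L - (U s - U r) \<le> (real k - N r) * L" by (simp add: algebra_simps)
    also have "\<dots> \<le> a * L" using k' L by (intro mult_right_mono) auto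
    also have "\<dots> \<le> - a * L + 4 * c0" by (rule small[OF L2])
    finally show ?thesis using L unfolding L_def[symmetric] by simp
  next
    case 3
    have rR: "0 < r - R r" using r R_pos[of r] by linarith
    define L1 where "L1 = ln ((r - R r) / s)"
    define L2 where "L2 = ln (r / (r - R r))"
    have L: "ln (s / r) = - (L1 + L2)" "0 \<le> L1" "0 \<le> L2"
      using 3 r s R_pos[of r] rR by (auto simp: L1_def L2_def ln_div)
    have "L2 \<le> r / (r - R r) - 1" unfolding L2_def using r rR by (intro ln_le_minus_one) auto
    also have "\<dots> = R r / (r - R r)" using rR by (simp add: field_simps)
    also have "\<dots> \<le> R r / (r / 2)" using r R_pos[of r] by (intro divide_left_mono) auto
    finally have L2: "L2 \<le> 2 * t" by (simp add: t_def mult.commute)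
    have "U (r - R r) - U s \<le> N (r - R r) * L1" unfolding L1_def using 3 s by (intro U_upper') auto
    moreover have "U r - U (r - R r) \<le> N r * L2" unfolding L2_def using rR R_pos[of r] by (intro U_upper') auto
    ultimately have "- real k * (L1 + L2) - (U s - U r) \<le> (N (r - R r) - real k) * L1 + (N r - real k) * L2"
      by (simp add: algebra_simps)
    also have "\<dots> \<le> (- a) * L1 + a * L2" using inc(2) k' L by (intro add_mono mult_right_mono) auto
    also have "\<dots> \<le> (- a) * L1 + (- a * L2 + 4 * c0)" using small[OF L2] by simp
    finally have "- real k * (L1 + L2) - (U s - U r) \<le> 4 * c0 - a * (L1 + L2)" by (simp add: algebra_simps)
    moreover have "\<bar>- (L1 + L2)\<bar> = L1 + L2" using L(2,3) by simp
    ultimately show ?thesis unfolding L(1) by (simp only: mult_minus_left mult_minus_right)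
  next
    case 4
    define L where "L = ln (r / s)"
    have L: "0 \<le> L" "ln (s / r) = - L" using 4 r s by (auto simp: L_def ln_div)
    have "L \<le> r / s - 1" unfolding L_def using s r by (intro ln_le_minus_one) auto
    also have "\<dots> = (r - s) / s" using s by (simp add: field_simps)
    also have "\<dots> \<le> R r / (r / 2)" using 4 r R_pos[of r] by (intro frac_le) auto
    finally have L2: "L \<le> 2 * t" by (simp add: t_def mult.commute)
    have "U r - U s \<le> N r * L" unfolding L_def using 4 s by (intro U_upper') auto
    then have "- real k * L - (U s - U r) \<le> (N r - real k) * L" by (simp add: algebra_simps)
    also have "\<dots> \<le> a * L" using k' L by (intro mult_right_mono) auto
    also have "\<dots> \<le> - a * L + 4 * c0" by (rule small[OF L2])
    finally show ?thesis using L by simp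
  qed
  then show ?thesis by (simp add: a_def)
qed

text \<open>The power c/\<tau> of 1 + \<tau> x is at least n M with n of order c/(\<tau> M), and
  Bernoulli bounds (1 + \<tau> x)^n below by 1 + n \<tau> x. The condition on \<tau> keeps n \<tau>
  above c/(2M), so that the decay in x has any prescribed order M with constants uniform in
  \<tau>.\<close>

lemma exp_decay:
  assumes M: "M > 0" and \<tau>: "0 < \<tau>" "2 * \<tau> * real M \<le> c" and x: "0 \<le> x"
  shows "exp (- (c / \<tau>) * ln (1 + \<tau> * x)) \<le> (1 / (min 1 (c / (2 * real M)) * (1 + x))) ^ M"
proof -
  have c: "c > 0" using M \<tau> by (intro less_le_trans[OF _ \<tau>(2)]) simp
  define n where "n = nat \<lfloor>c / (\<tau> * real M)\<rfloor>"
  have q: "2 \<le> c / (\<tau> * real M)" using M \<tau> by (simp add: field_simps)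
  then have n: "real n \<le> c / (\<tau> * real M)" "c / (\<tau> * real M) < real n + 1" unfolding n_def by linarith+
  have "y / 2 \<le> real n" if "2 \<le> y" "y < real n + 1" for y using that by linarith
  from this[OF q n(2)] have n2: "c / (\<tau> * real M) / 2 \<le> real n" .
  have nM: "real (n * M) \<le> c / \<tau>" using n(1) M \<tau> by (simp add: field_simps)
  have n\<tau>: "c / (2 * real M) \<le> real n * \<tau>" using n2 M \<tau> by (simp add: field_simps)
  have l: "0 \<le> ln (1 + \<tau> * x)" using \<tau> x by simp
  let ?d = "min 1 (c / (2 * real M))"
  have d: "0 < ?d" using c M by simp
  have "?d * (1 + x) \<le> 1 + real n * (\<tau> * x)"
  proof -
    have "?d * x \<le> real n * \<tau> * x" using n\<tau> x by (intro mult_right_mono) auto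
    moreover have "?d * (1 + x) = ?d + ?d * x" by (simp only: distrib_left mult_1_right)
    moreover have "?d \<le> 1" by simp
    ultimately show ?thesis by (simp only: mult.assoc)
  qed
  also have "\<dots> \<le> (1 + \<tau> * x) ^ n" using Bernoulli_inequality[of "\<tau> * x" n] \<tau> x by (simp add: order_trans[OF _ mult_nonneg_nonneg])
  finally have "(?d * (1 + x)) ^ M \<le> ((1 + \<tau> * x) ^ n) ^ M" using d x by (intro power_mono) auto
  also have "\<dots> = exp (real (n * M) * ln (1 + \<tau> * x))"
    using \<tau> x by (simp add: exp_of_nat_mult power_mult add_pos_nonneg del: of_nat_mult)
  also have "\<dots> \<le> exp (c / \<tau> * ln (1 + \<tau> * x))" using mult_right_mono[OF nM l] by (simp only: exp_le_cancel_iff)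
  finally have le: "(?d * (1 + x)) ^ M \<le> exp (c / \<tau> * ln (1 + \<tau> * x))" .
  have "exp (- (c / \<tau>) * ln (1 + \<tau> * x)) = 1 / exp (c / \<tau> * ln (1 + \<tau> * x))" by (simp add: exp_minus inverse_eq_divide)
  also have "\<dots> \<le> 1 / (?d * (1 + x)) ^ M" using le d x by (intro divide_left_mono mult_pos_pos) (auto intro!: mult_pos_pos)
  finally show ?thesis by (simp add: power_divide)
qed

text \<open>For these indices \<open>exponent_bound\<close> forces the integrand to decay on both
  sides of r on the scale \<open>R r\<close>. In x = |s - r| / R r the decay is polynomial of
  arbitrary order, beating the growth of s / (R s)^2, and integration contributes one factor
  \<open>R r\<close>.\<close>

lemma cc_upper:
  obtains R0 KL where "R0 > 0" "KL > 0" "\<And>r. r \<ge> R0 \<Longrightarrow> R r \<le> r / 2"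
    "\<And>r k. r \<ge> R0 \<Longrightarrow> \<bar>real k - N r\<bar> \<le> c0 * (r / R r) \<Longrightarrow> cc k \<le> ennreal (KL * (r ^ (2 * k) * exp (- 2 * U r) * (r / R r)))"
proof -
  obtain K P where K: "K > 0" "\<And>r s. R r \<le> K * (1 + \<bar>s - r\<bar> / R r) ^ P * R s" by (rule R_ratio) blast
  \<comment> \<open>Of the 2P + 3 powers of 1 + x, 2P compensate 1 / (R s)^2, one compensates s
    \<le> r (1 + x), and two remain for integrability.\<close>
  define M where "M = 2 * P + 3"
  have M: "M > 0" by (simp add: M_def)
  define d where "d = min 1 (2 * c0 / (2 * real M))"
  have d: "d > 0" using c0_pos M by (simp add: d_def)
  \<comment> \<open>Smallness of R r / r is asked for twice: 1/2 for \<open>exponent_bound\<close>,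
    and c0 / M for \<open>exp_decay\<close> with c = 2 c0.\<close>
  define \<epsilon> where "\<epsilon> = min (1 / 2) (c0 / real M)"
  have \<epsilon>: "\<epsilon> > 0" "\<epsilon> \<le> 1 / 2" "2 * \<epsilon> * real M \<le> 2 * c0"
    using c0_pos M by (auto simp: \<epsilon>_def min_def field_simps)
  obtain R0 where R0: "R0 > 0" "\<And>r. r \<ge> R0 \<Longrightarrow> R r \<le> \<epsilon> * r" by (rule R_sublinear[OF \<epsilon>(1)]) blast
  define KL where "KL = 2 * (2 * pi * exp (8 * c0) * K\<^sup>2 * (1 / d) ^ M)"
  have KL: "KL > 0" using K d by (simp add: KL_def)
  show thesis
  proof (rule that[OF R0(1) KL])
    fix r assume r: "r \<ge> R0"
    have r0: "0 < r" using r R0(1) by linarith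
    have "\<epsilon> * r \<le> 1 / 2 * r" using \<epsilon> r0 by (intro mult_right_mono) auto
    then show Rr: "R r \<le> r / 2" using R0(2)[OF r] by simp
    fix k assume k: "\<bar>real k - N r\<bar> \<le> c0 * (r / R r)"
    define t where "t = R r / r"
    have t: "0 < t" "t \<le> \<epsilon>" using R_pos[of r] r0 R0(2)[OF r] by (auto simp: t_def field_simps)
    have tM: "2 * t * real M \<le> 2 * c0"
    proof -
      have "2 * t * real M \<le> 2 * \<epsilon> * real M" using t by (intro mult_right_mono) auto
      then show ?thesis using \<epsilon>(3) by linarith
    qed
    define D where "D = r ^ (2 * k) * exp (- 2 * U r)"
    have D: "0 \<le> D" using r0 by (simp add: D_def)
    define B where "B = 2 * pi * r * (D * exp (8 * c0) * (1 / d) ^ M) * K\<^sup>2 / (R r)\<^sup>2"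
    have B: "0 \<le> B" using r0 D d by (simp add: B_def)
    have pw: "2 * pi * s * (s ^ (2 * k) * exp (- 2 * U s) / (R s)\<^sup>2) \<le> B * (1 / (1 + \<bar>(s - r) / R r\<bar>)\<^sup>2)" if s: "0 < s" for s
    proof -
      define x where "x = \<bar>s - r\<bar> / R r"
      have x: "0 \<le> x" "1 \<le> 1 + x" using R_pos[of r] by (auto simp: x_def)
      have xe: "\<bar>(s - r) / R r\<bar> = x" using R_pos[of r] by (simp add: x_def)
      have "t * x = \<bar>s - r\<bar> / r" using R_pos[of r] by (simp add: t_def x_def)
      then have ln_ge: "ln (1 + t * x) \<le> \<bar>ln (s / r)\<bar>"
      proof (cases "r \<le> s")
        case True
        then have "1 + t * x = s / r" using \<open>t * x = _\<close> r0 by (simp add: field_simps)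
        then show ?thesis by simp
      next
        case False
        then have "1 + t * x = 2 - s / r" using \<open>t * x = _\<close> r0 by (simp add: field_simps)
        also have "2 - s / r \<le> r / s"
        proof -
          have "2 * r * s \<le> r\<^sup>2 + s\<^sup>2" by (rule sum_squares_bound)
          then show ?thesis using s r0 by (simp add: field_simps power2_eq_square)
        qed
        finally have "ln (1 + t * x) \<le> ln (r / s)" using x t s r0 by (intro ln_mono) (auto intro: add_pos_nonneg)
        then show ?thesis using s r0 by (simp add: ln_div)
      qed
      have "s ^ (2 * k) * exp (- 2 * U s) = D * exp (2 * (real k * ln (s / r) - (U s - U r)))"
        using power_ratio[OF r0 s, of k] by (simp add: D_def exp_add[symmetric] exp_diff[symmetric] algebra_simps)
      also have "\<dots> \<le> D * exp (8 * c0 - (2 * c0 / t) * \<bar>ln (s / r)\<bar>)"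
        using exponent_bound[OF r0 Rr k s] D by (intro mult_left_mono) (auto simp: t_def)
      also have "\<dots> \<le> D * exp (8 * c0 + (- (2 * c0 / t) * ln (1 + t * x)))"
        using ln_ge t c0_pos D by (intro mult_left_mono) (auto simp: mult_left_mono divide_right_mono)
      also have "\<dots> = D * exp (8 * c0) * exp (- (2 * c0 / t) * ln (1 + t * x))" by (simp only: exp_add mult.assoc)
      also have "\<dots> \<le> D * exp (8 * c0) * (1 / (d * (1 + x))) ^ M"
        using exp_decay[OF M t(1) tM x(1)] D by (intro mult_left_mono) (auto simp: d_def)
      finally have 1: "s ^ (2 * k) * exp (- 2 * U s) \<le> D * exp (8 * c0) * (1 / (d * (1 + x))) ^ M" .
      have "R r \<le> K * (1 + x) ^ P * R s" unfolding x_def by (rule K(2))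
      then have "1 / R s \<le> K * (1 + x) ^ P / R r" using R_pos[of r] R_pos[of s] by (simp add: field_simps)
      then have "(1 / R s)\<^sup>2 \<le> (K * (1 + x) ^ P / R r)\<^sup>2" using R_pos[of s] by (intro power_mono) auto
      then have 2: "1 / (R s)\<^sup>2 \<le> (K * (1 + x) ^ P / R r)\<^sup>2" by (simp add: power_divide)
      have "s \<le> r + \<bar>s - r\<bar>" by simp
      also have "\<bar>s - r\<bar> = x * R r" using R_pos[of r] by (simp add: x_def)
      also have "r + x * R r \<le> r + x * r" using Rr r0 x by (intro add_left_mono mult_left_mono) auto
      finally have 3: "s \<le> r * (1 + x)" by (simp add: algebra_simps)
      have "2 * pi * s * (s ^ (2 * k) * exp (- 2 * U s) / (R s)\<^sup>2) = 2 * pi * s * ((s ^ (2 * k) * exp (- 2 * U s)) * (1 / (R s)\<^sup>2))" by simp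
      also have "\<dots> \<le> 2 * pi * (r * (1 + x)) * ((D * exp (8 * c0) * (1 / (d * (1 + x))) ^ M) * (K * (1 + x) ^ P / R r)\<^sup>2)"
        using s r0 x D d by (intro mult_mono[OF mult_left_mono[OF 3] mult_mono[OF 1 2]]) auto
      also have "\<dots> = B * ((1 + x) * ((1 + x) ^ P)\<^sup>2 / (1 + x) ^ M)"
      proof -
        have "2 * pi * (r * y) * ((D * exp (8 * c0) * (1 / (d * y)) ^ M) * (K * Y / R r)\<^sup>2) = B * (y * Y\<^sup>2 / y ^ M)" if "y > 0" for y Y
          using d that by (simp add: B_def power_divide power_mult_distrib mult_ac)
        from this[of "1 + x" "(1 + x) ^ P"] show ?thesis using x by simp
      qed
      also have "(1 + x) * ((1 + x) ^ P)\<^sup>2 / (1 + x) ^ M = 1 / (1 + x)\<^sup>2"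
      proof -
        have "(1 + x) ^ M = (1 + x) * ((1 + x) ^ P)\<^sup>2 * (1 + x)\<^sup>2"
          unfolding M_def power_add power_even_eq by (simp only: power3_eq_cube power2_eq_square mult_ac)
        then show ?thesis using x by simp
      qed
      finally show ?thesis unfolding xe .
    qed
    have "cc k \<le> (\<integral>\<^sup>+s. ennreal B * ennreal (1 / (1 + \<bar>(s - r) / R r\<bar>)\<^sup>2) \<partial>lborel)"
      unfolding cc_def
    proof (rule nn_integral_mono)
      fix s
      show "ennreal (2 * pi * s * (s ^ (2 * k) * exp (- 2 * U s) / (R s)\<^sup>2)) * indicator {0<..} s \<le> ennreal B * ennreal (1 / (1 + \<bar>(s - r) / R r\<bar>)\<^sup>2)"
        using pw[of s] B by (cases "0 < s") (auto simp: indicator_def ennreal_mult[symmetric] intro!: ennreal_leI)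
    qed
    also have "\<dots> = ennreal B * (\<integral>\<^sup>+s. ennreal (1 / (1 + \<bar>(s - r) / R r\<bar>)\<^sup>2) \<partial>lborel)" by (rule nn_integral_cmult) measurable
    also have "(\<integral>\<^sup>+s. ennreal (1 / (1 + \<bar>(s - r) / R r\<bar>)\<^sup>2) \<partial>lborel) = ennreal (R r) * 2"
      using R_pos[of r] nn_integral_inverse_square
      by (subst nn_integral_real_affine[where c="R r" and t=r]) auto
    also have "ennreal B * (ennreal (R r) * 2) = ennreal (KL * (D * (r / R r)))"
    proof -
      have "B * (R r * 2) = KL * (D * (r / R r))" using R_pos[of r] by (simp add: B_def KL_def power2_eq_square)
      moreover have "ennreal B * (ennreal (R r) * 2) = ennreal (B * (R r * 2))"
        using B R_pos[of r] by (simp add: ennreal_mult)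
      ultimately show ?thesis by simp
    qed
    finally show "cc k \<le> ennreal (KL * (r ^ (2 * k) * exp (- 2 * U r) * (r / R r)))" by (simp add: D_def)
  qed
qed

end

section \<open>Finiteness of the moments and the size of the kernel on the diagonal\<close>

context fock_radial
begin

lemma large_radius: obtains r where "r \<ge> r1" "0 < r" "R r \<le> r / 2"
proof -
  obtain R0 where R0: "R0 > 0" "\<And>r. r \<ge> R0 \<Longrightarrow> R r \<le> 1 / 2 * r" by (rule R_sublinear[of "1 / 2"]) auto
  show thesis by (rule that[of "max r1 R0"]) (use R0(1) R0(2)[of "max r1 R0"] in auto)
qed

lemma cc_pos: "0 < cc k"
proof -
  obtain r where r: "0 < r" "R r \<le> r / 2" using large_radius by blast
  have "0 < ennreal (r ^ (2 * k) * exp (- 2 * U r) * (r / R r) * (1 + \<bar>real k - N r\<bar> * (R r / r / 4))\<^sup>2 / KU)"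
    unfolding ennreal_less_zero_iff using r R_pos[of r] KU_pos
    by (intro divide_pos_pos mult_pos_pos zero_less_power add_pos_nonneg mult_nonneg_nonneg) auto
  also have "\<dots> \<le> cc k" by (rule cc_lower[OF r])
  finally show ?thesis .
qed

lemma cc_finite_large: "\<exists>k'\<ge>k. cc k' < \<infinity>"
proof -
  obtain R0 KL where R0: "R0 > 0" "KL > 0" "\<And>r. r \<ge> R0 \<Longrightarrow> R r \<le> r / 2"
    "\<And>r k. r \<ge> R0 \<Longrightarrow> \<bar>real k - N r\<bar> \<le> c0 * (r / R r) \<Longrightarrow> cc k \<le> ennreal (KL * (r ^ (2 * k) * exp (- 2 * U r) * (r / R r)))"
    by (rule cc_upper) blast
  obtain R1 where R1: "R1 > 0" "\<And>r. r \<ge> R1 \<Longrightarrow> R r \<le> c0 * r" by (rule R_sublinear[OF c0_pos]) blast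
  obtain R2 where R2: "m 0 R2 > 2 * pi * real k" using m_unbounded by blast
  define r where "r = max (max R0 R1) R2"
  have r: "r \<ge> R0" "r \<ge> R1" "r \<ge> R2" by (auto simp: r_def)
  have "m 0 r > 2 * pi * real k" using R2 m_mono_radius[OF r(3), of 0] by linarith
  then have Nk: "N r \<ge> real k" by (simp add: N_def field_simps)
  define k' where "k' = nat \<lceil>N r\<rceil>"
  have "1 \<le> c0 * (r / R r)" using R1(2)[OF r(2)] R_pos[of r] by (simp add: field_simps)
  moreover have k': "N r \<le> real k'" "real k' < N r + 1" unfolding k'_def using N_nonneg[of r] by linarith+
  ultimately have "\<bar>real k' - N r\<bar> \<le> c0 * (r / R r)" by linarith
  from R0(4)[OF r(1) this] have "cc k' < \<infinity>" by (rule le_less_trans) simp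
  moreover have "k \<le> k'" using Nk k' by linarith
  ultimately show ?thesis by blast
qed

text \<open>Outside the unit disk the integrand is dominated by that of a larger index with finite
  moment. Inside, \<open>R\<close> is bounded below and the only danger is exp(-2U) at the
  origin.\<close>

lemma cc_finite: "cc k < \<infinity>"
proof -
  obtain k' where k': "k \<le> k'" "cc k' < \<infinity>" using cc_finite_large by blast
  obtain K P where K: "K > 0" "\<And>r s. R r \<le> K * (1 + \<bar>s - r\<bar> / R r) ^ P * R s" by (rule R_ratio) blast
  \<comment> \<open>The origin carries no mass, so some disk about it has mass below pi; there 2 N
    is at most 1 and exp(-2 U(s)) is at most a constant over s, which the factor s of polar
    coordinates absorbs.\<close>
  obtain d where d: "d > 0" "\<And>x. dist x 0 < d \<Longrightarrow> dist (m 0 x) (m 0 0) < pi"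
    using isCont_m[of 0 0] pi_gt_zero unfolding continuous_at_eps_delta by blast
  define r0 where "r0 = min (d / 2) 1"
  have r0: "0 < r0" "r0 \<le> 1" "r0 < d" using d(1) by (auto simp: r0_def)
  have "m 0 r0 < pi" using d(2)[of r0] r0 m_0[of 0 0] m_nonneg[of 0 r0] by (simp add: dist_real_def)
  then have N0: "2 * N r0 \<le> 1" by (simp add: N_def)
  define \<delta> where "\<delta> = R 0 / (K * (1 + 1 / R 0) ^ P)"
  have \<delta>: "\<delta> > 0" using K(1) R_pos[of 0] by (auto simp: \<delta>_def intro!: divide_pos_pos mult_pos_pos zero_less_power add_pos_pos)
  have R\<delta>: "\<delta> \<le> R s" if "0 < s" "s \<le> 1" for s
  proof -
    have "R 0 \<le> K * (1 + \<bar>s - 0\<bar> / R 0) ^ P * R s" by (rule K(2))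
    also have "\<dots> \<le> K * (1 + 1 / R 0) ^ P * R s"
      using that K(1) R_pos[of 0] R_pos[of s]
      by (intro mult_right_mono mult_left_mono power_mono add_left_mono divide_right_mono) auto
    finally show ?thesis
      using K(1) R_pos[of 0] by (simp add: \<delta>_def pos_divide_le_eq add_pos_pos mult.commute)
  qed
  define B where "B = 2 * pi * exp (- 2 * U r0) / \<delta>\<^sup>2"
  have B: "0 \<le> B" by (simp add: B_def)
  have bound: "2 * pi * s * (s ^ (2 * k) * exp (- 2 * U s) / (R s)\<^sup>2) \<le> B" if s: "0 < s" "s \<le> 1" for s
  proof -
    have "s * exp (- 2 * U s) \<le> exp (- 2 * U r0)"
    proof (cases "s \<le> r0")
      case True
      have "U r0 - U s \<le> N r0 * ln (r0 / s)" by (rule U_upper') (use s True in auto)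
      then have "- 2 * U s \<le> - 2 * U r0 + 2 * N r0 * ln (r0 / s)" by simp
      also have "2 * N r0 * ln (r0 / s) \<le> 1 * ln (r0 / s)" using N0 True s by (intro mult_right_mono) auto
      finally have "exp (- 2 * U s) \<le> exp (- 2 * U r0 + ln (r0 / s))" by simp
      also have "\<dots> = exp (- 2 * U r0) * (r0 / s)"
        using divide_pos_pos[OF r0(1) s(1)] by (simp only: exp_add exp_ln)
      finally have "s * exp (- 2 * U s) \<le> exp (- 2 * U r0) * r0" using s by (simp add: field_simps)
      also have "\<dots> \<le> exp (- 2 * U r0) * 1" using r0 by (intro mult_left_mono) auto
      finally show ?thesis by simp
    next
      case False
      have "0 \<le> N r0 * ln (s / r0)" using N_nonneg False r0 by (intro mult_nonneg_nonneg) auto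
      also have "\<dots> \<le> U s - U r0" by (rule U_lower') (use False r0 in auto)
      finally have "exp (- 2 * U s) \<le> exp (- 2 * U r0)" by simp
      then have "s * exp (- 2 * U s) \<le> 1 * exp (- 2 * U r0)" using s by (intro mult_mono) auto
      then show ?thesis by simp
    qed
    then have 1: "s ^ (2 * k) * (s * exp (- 2 * U s)) \<le> 1 * exp (- 2 * U r0)"
      using s by (intro mult_mono power_le_one) auto
    have "2 * pi * s * (s ^ (2 * k) * exp (- 2 * U s) / (R s)\<^sup>2) = 2 * pi * (s ^ (2 * k) * (s * exp (- 2 * U s))) / (R s)\<^sup>2" by simp
    also have "\<dots> \<le> 2 * pi * exp (- 2 * U r0) / \<delta>\<^sup>2"
      using 1 R\<delta>[OF s] \<delta> s by (intro frac_le mult_left_mono power_mono) auto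
    finally show ?thesis by (simp add: B_def)
  qed
  have "cc k \<le> (\<integral>\<^sup>+r. ennreal B * indicator {0..1} r + ennreal (2 * pi * r * (r ^ (2 * k') * exp (- 2 * U r) / (R r)\<^sup>2)) * indicator {0<..} r \<partial>lborel)"
    unfolding cc_def
  proof (rule nn_integral_mono)
    fix r :: real
    show "ennreal (2 * pi * r * (r ^ (2 * k) * exp (- 2 * U r) / (R r)\<^sup>2)) * indicator {0<..} r
      \<le> ennreal B * indicator {0..1} r + ennreal (2 * pi * r * (r ^ (2 * k') * exp (- 2 * U r) / (R r)\<^sup>2)) * indicator {0<..} r"
    proof (cases "0 < r")
      case True
      show ?thesis
      proof (cases "r \<le> 1")
        case True
        then show ?thesis using \<open>0 < r\<close> bound[of r] by (auto intro!: add_increasing2 ennreal_leI)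
      next
        case False
        then have "r ^ (2 * k) \<le> r ^ (2 * k')" using k' by (intro power_increasing) auto
        then have "2 * pi * r * (r ^ (2 * k) * exp (- 2 * U r) / (R r)\<^sup>2) \<le> 2 * pi * r * (r ^ (2 * k') * exp (- 2 * U r) / (R r)\<^sup>2)"
          using \<open>0 < r\<close> by (intro mult_left_mono divide_right_mono mult_right_mono) auto
        then show ?thesis using False by (simp add: ennreal_leI)
      qed
    qed simp
  qed
  also have "\<dots> = ennreal B + cc k'"
    unfolding cc_def by (subst nn_integral_add) (auto simp: nn_integral_cmult_indicator)
  also have "\<dots> < \<infinity>" using k'(2) by simp
  finally show ?thesis .
qed

definition c :: "nat \<Rightarrow> real" where "c k = enn2real (cc k)"

lemma cc_eq: "cc k = ennreal (c k)"
  using cc_finite[of k] by (simp add: c_def)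

lemma c_pos: "0 < c k"
  using cc_pos[of k] cc_finite[of k] by (simp add: c_def enn2real_positive_iff)

text \<open>The contribution of the k-th orthonormal monomial to K(z, z) exp(-2U) at modulus
  r.\<close>

definition \<kappa> :: "nat \<Rightarrow> real \<Rightarrow> real" where "\<kappa> k r = r ^ (2 * k) * exp (- 2 * U r) / c k"

lemma \<kappa>_nonneg: "0 \<le> \<kappa> k r"
  using c_pos[of k] by (simp add: \<kappa>_def)

lemma \<kappa>_upper:
  assumes r: "0 < r" "R r \<le> r / 2"
  shows "\<kappa> k r \<le> KU * (R r / r) / (1 + \<bar>real k - N r\<bar> * (R r / r / 4))\<^sup>2"
proof -
  define Q where "Q = (1 + \<bar>real k - N r\<bar> * (R r / r / 4))\<^sup>2"
  have Q: "Q > 0" unfolding Q_def using r R_pos[of r]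
    by (intro zero_less_power add_pos_nonneg mult_nonneg_nonneg) auto
  define D where "D = r ^ (2 * k) * exp (- 2 * U r)"
  have "D * (r / R r) * Q / KU \<le> c k"
    using cc_lower[OF r, of k] c_pos[of k] by (simp add: cc_eq ennreal_le_iff D_def Q_def)
  then have "D / c k \<le> KU * (R r / r) / Q"
    using Q c_pos[of k] KU_pos r R_pos[of r] by (simp add: field_simps)
  then show ?thesis by (simp add: \<kappa>_def D_def Q_def)
qed

lemma \<kappa>_le:
  assumes r: "0 < r" "R r \<le> r / 2" shows "\<kappa> k r \<le> KU * (R r / r)"
proof -
  have gen: "a / X \<le> a / 1" if "1 \<le> X" "0 \<le> a" for a X :: real
    by (rule divide_left_mono) (use that in auto)
  have Q: "1 \<le> (1 + \<bar>real k - N r\<bar> * (R r / r / 4))\<^sup>2" using r R_pos[of r] by (intro one_le_power) auto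
  have "0 \<le> KU * (R r / r)" using KU_pos r R_pos[of r] by simp
  from gen[OF Q this]
  show ?thesis using \<kappa>_upper[OF r, of k] by simp
qed

text \<open>With t = R r / (4 r) the bound \<open>\<kappa>_upper\<close> is 4 KU times a summand of
  \<open>sum_inverse_square_two_sided\<close>; as t is at most 1/8, the total is below 10
  KU.\<close>

lemma \<kappa>_sum_upper:
  assumes r: "0 < r" "R r \<le> r / 2" shows "(\<Sum>k<n. \<kappa> k r) \<le> 10 * KU"
proof -
  define t where "t = R r / r / 4"
  have t: "0 < t" "t \<le> 1 / 8" using r R_pos[of r] by (auto simp: t_def)
  have "(\<Sum>k<n. \<kappa> k r) \<le> (\<Sum>k<n. 4 * KU * (t / (1 + \<bar>real k - N r\<bar> * t)\<^sup>2))"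
    using \<kappa>_upper[OF r] by (intro sum_mono) (auto simp: t_def)
  also have "\<dots> = 4 * KU * (\<Sum>k<n. t / (1 + \<bar>real k - N r\<bar> * t)\<^sup>2)" by (rule sum_distrib_left[symmetric])
  also have "\<dots> \<le> 4 * KU * (2 * (t + 1))"
    using sum_inverse_square_two_sided[OF t(1) N_nonneg] KU_pos by (intro mult_left_mono) auto
  also have "\<dots> \<le> 4 * KU * (10 / 4)" using t KU_pos by (intro mult_left_mono) auto
  finally show ?thesis by simp
qed

text \<open>The roughly \<open>c0 * (r / R r)\<close> indices just above \<open>N r\<close> fall
  under \<open>cc_upper\<close>, so each contributes at least a constant times
  \<open>R r / r\<close>. The number of terms required depends on r, only the bound is
  uniform.\<close>

lemma \<kappa>_sum_lower:
  obtains R0 a where "R0 > 0" "a > 0" "\<And>r. r \<ge> R0 \<Longrightarrow> \<exists>n0. \<forall>n\<ge>n0. a \<le> (\<Sum>k<n. \<kappa> k r)"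
proof -
  obtain R0 KL where R0: "R0 > 0" "KL > 0" "\<And>r. r \<ge> R0 \<Longrightarrow> R r \<le> r / 2"
    "\<And>r k. r \<ge> R0 \<Longrightarrow> \<bar>real k - N r\<bar> \<le> c0 * (r / R r) \<Longrightarrow> cc k \<le> ennreal (KL * (r ^ (2 * k) * exp (- 2 * U r) * (r / R r)))"
    by (rule cc_upper) blast
  obtain R1 where R1: "R1 > 0" "\<And>r. r \<ge> R1 \<Longrightarrow> R r \<le> c0 * r" by (rule R_sublinear[OF c0_pos]) blast
  show thesis
  proof (rule that[of "max R0 R1" "c0 / (2 * KL)"])
    fix r assume "r \<ge> max R0 R1"
    then have r: "r \<ge> R0" "r \<ge> R1" "0 < r" using R0(1) by auto
    define b where "b = c0 * (r / R r)"
    have b1: "1 \<le> b" using R1(2)[OF r(2)] R_pos[of r] by (simp add: b_def field_simps)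
    define i where "i = nat \<lceil>N r\<rceil>"
    define j where "j = nat \<lfloor>b\<rfloor>"
    have i: "N r \<le> real i" "real i < N r + 1" unfolding i_def using N_nonneg[of r] by linarith+
    have j: "real j \<le> b" "b < real j + 1" "1 \<le> j" unfolding j_def using b1 by linarith+
    have jb: "b / 2 \<le> real j" using j by linarith
    have low: "R r / r / KL \<le> \<kappa> k r" if "k \<in> {i..<i + j}" for k
    proof -
      have "real k \<le> real i + real j - 1" using that j by (simp add: of_nat_diff)
      then have "\<bar>real k - N r\<bar> \<le> b" using that i j by auto
      then have "cc k \<le> ennreal (KL * (r ^ (2 * k) * exp (- 2 * U r) * (r / R r)))" by (intro R0(4)[OF r(1)]) (simp add: b_def)
      then have "c k \<le> KL * (r ^ (2 * k) * exp (- 2 * U r) * (r / R r))"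
        using R0(2) r R_pos[of r] by (simp add: cc_eq ennreal_le_iff)
      then show ?thesis using R0(2) r R_pos[of r] c_pos[of k] by (simp add: \<kappa>_def field_simps)
    qed
    show "\<exists>n0. \<forall>n\<ge>n0. c0 / (2 * KL) \<le> (\<Sum>k<n. \<kappa> k r)"
    proof (intro exI allI impI)
      fix n assume n: "i + j \<le> n"
      have "c0 / (2 * KL) = b / 2 * (R r / r / KL)" using r R_pos[of r] by (simp add: b_def)
      also have "\<dots> \<le> real j * (R r / r / KL)" using jb R0(2) r R_pos[of r] by (intro mult_right_mono) auto
      also have "\<dots> = (\<Sum>k\<in>{i..<i + j}. R r / r / KL)" by simp
      also have "\<dots> \<le> (\<Sum>k\<in>{i..<i + j}. \<kappa> k r)" by (intro sum_mono low)
      also have "\<dots> \<le> (\<Sum>k<n. \<kappa> k r)" using n \<kappa>_nonneg by (intro sum_mono2) auto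
      finally show "c0 / (2 * KL) \<le> (\<Sum>k<n. \<kappa> k r)" .
    qed
  qed (use R0 c0_pos in auto)
qed

end

section \<open>Kernel and factorial moments for radial weights\<close>

text \<open>On rotation-invariant sets the monomials stay orthogonal, so the restricted kernel is
  diagonal; annuli about 0 are the sets used.\<close>

definition circled :: "complex set \<Rightarrow> bool" where
  "circled B \<longleftrightarrow> B \<in> sets borel \<and> (\<forall>z w. cmod z = cmod w \<longrightarrow> (z \<in> B \<longleftrightarrow> w \<in> B))"

lemma circledI: "A \<in> sets borel \<Longrightarrow> circled {z. cmod z \<in> A}"
  unfolding circled_def by auto

lemma circled_borel: "circled B \<Longrightarrow> B \<in> sets borel"
  by (simp add: circled_def)

lemma circled_rotate: "circled B \<Longrightarrow> cis t * z \<in> B \<longleftrightarrow> z \<in> B"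
  unfolding circled_def by (metis mult_1 norm_cis norm_mult)

lemma circled_ball: "circled (ball 0 r)"
  by (auto simp: circled_def)

lemma mult_le_sum_squares: "0 \<le> x \<Longrightarrow> 0 \<le> y \<Longrightarrow> x * y \<le> x\<^sup>2 + (y :: real)\<^sup>2"
  using sum_squares_bound[of x y] mult_nonneg_nonneg[of x y] by linarith

locale radial_moments =
  fixes \<mu> :: "complex measure" and c :: "nat \<Rightarrow> real"
  assumes sets_\<mu>[measurable_cong, simp]: "sets \<mu> = sets borel"
    and rotation_\<mu>: "distr \<mu> borel (\<lambda>z. cis t * z) = \<mu>"
    and moment: "(\<integral>\<^sup>+z. ennreal (cmod z ^ (2 * k)) \<partial>\<mu>) = ennreal (c k)"
    and c_pos: "0 < c k"
begin

lemma space_\<mu>[simp]: "space \<mu> = UNIV"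
  using sets_eq_imp_space_eq[OF sets_\<mu>] by simp

lemma finite_\<mu>: "finite_measure \<mu>"
proof
  have "emeasure \<mu> (space \<mu>) = (\<integral>\<^sup>+z. ennreal (cmod z ^ (2 * 0)) \<partial>\<mu>)" by simp
  then show "emeasure \<mu> (space \<mu>) \<noteq> \<infinity>" unfolding moment by simp
qed

sublocale \<mu>: finite_measure \<mu> by (rule finite_\<mu>)

lemma integral_rotation:
  fixes F :: "complex \<Rightarrow> complex"
  assumes [measurable]: "F \<in> borel_measurable borel"
  shows "(LINT z|\<mu>. F (cis t * z)) = (LINT z|\<mu>. F z)"
  by (subst (2) rotation_\<mu>[of t, symmetric], subst integral_distr) (auto cong: measurable_cong_sets)

lemma integrable_even_power: "integrable \<mu> (\<lambda>z. cmod z ^ (2 * k))"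
  by (rule integrableI_bounded) (simp_all add: moment measurable_cong_sets[OF sets_\<mu> refl])

lemma integral_even_power: "(LINT z|\<mu>. cmod z ^ (2 * k)) = c k"
  using integral_eq_nn_integral[of "\<lambda>z. cmod z ^ (2 * k)" \<mu>] c_pos[of k]
  by (simp add: moment measurable_cong_sets[OF sets_\<mu> refl] less_imp_le)

lemma integrable_monomials: "integrable \<mu> (\<lambda>z. z ^ k * cnj (z ^ l))"
proof (rule Bochner_Integration.integrable_bound)
  show "integrable \<mu> (\<lambda>z. cmod z ^ (2 * k) + cmod z ^ (2 * l))"
    by (intro Bochner_Integration.integrable_add integrable_even_power)
  have "cmod z ^ k * cmod z ^ l \<le> cmod z ^ (2 * k) + cmod z ^ (2 * l)" for z
    unfolding power_even_eq by (rule mult_le_sum_squares) auto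
  then show "AE z in \<mu>. cmod (z ^ k * cnj (z ^ l)) \<le> norm (cmod z ^ (2 * k) + cmod z ^ (2 * l))"
    by (intro AE_I2) (simp add: norm_mult norm_power)
qed measurable

lemma integrable_indicator_mult:
  fixes f :: "complex \<Rightarrow> complex"
  assumes "B \<in> sets borel" "integrable \<mu> f" shows "integrable \<mu> (\<lambda>z. indicator B z * f z)"
proof -
  have "integrable \<mu> (\<lambda>z. indicator B z *\<^sub>R f z)" using assms by (intro integrable_mult_indicator) auto
  also have "(\<lambda>z. indicator B z *\<^sub>R f z) = (\<lambda>z. indicator B z * f z)" by (auto simp: indicator_def)
  finally show ?thesis .
qed

text \<open>The eigenvalue of the kernel restricted to B that belongs to the k-th monomial, if B is
  rotation invariant. In moment formulas it acts as the probability that mode k lies in B.\<close>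

definition a :: "nat \<Rightarrow> complex set \<Rightarrow> real" where
  "a k B = (LINT z|\<mu>. indicator B z * cmod z ^ (2 * k)) / c k"

text \<open>For k \<noteq> l the rotation by pi / (k - l) changes the sign of the integrand and
  preserves the measure and B.\<close>

lemma orthogonal:
  assumes B: "circled B"
  shows "(LINT z|\<mu>. indicator B z * (z ^ k * cnj (z ^ l))) = (if k = l then of_real (c k * a k B) else 0)"
proof (cases "k = l")
  case True
  have *: "complex_of_real (cmod z ^ (2 * k)) = z ^ k * cnj (z ^ k)" for z
  proof -
    have "complex_of_real (cmod z ^ (2 * k)) = complex_of_real ((cmod z)\<^sup>2) ^ k" by (simp add: power_mult)
    also have "\<dots> = (z * cnj z) ^ k" by (simp only: complex_norm_square)
    finally show ?thesis by (simp add: power_mult_distrib)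
  qed
  have "(LINT z|\<mu>. indicator B z * (z ^ k * cnj (z ^ k))) = (LINT z|\<mu>. complex_of_real (indicator B z * cmod z ^ (2 * k)))"
    unfolding of_real_mult * by (intro Bochner_Integration.integral_cong) (auto simp: indicator_def)
  also have "\<dots> = of_real (LINT z|\<mu>. indicator B z * cmod z ^ (2 * k))" by (rule integral_complex_of_real)
  finally show ?thesis using True c_pos[of k] by (simp add: a_def)
next
  case False
  note [measurable] = circled_borel[OF B]
  define t where "t = pi / (real k - real l)"
  have rot: "(cis t) ^ k * cnj ((cis t) ^ l) = - 1"
  proof -
    have "(cis t) ^ k * cnj ((cis t) ^ l) = cis (real k * t - real l * t)"
      by (simp add: Complex.DeMoivre cis_cnj cis_mult)
    also have "real k * t - real l * t = (real k - real l) * t" by (rule left_diff_distrib[symmetric])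
    also have "\<dots> = pi" using False by (simp add: t_def)
    finally show ?thesis by simp
  qed
  define F where "F z = indicator B z * (z ^ k * cnj (z ^ l))" for z :: complex
  have [measurable]: "F \<in> borel_measurable borel" unfolding F_def by measurable
  have "(LINT z|\<mu>. F z) = (LINT z|\<mu>. F (cis t * z))" by (rule integral_rotation[symmetric]) simp
  also have "\<dots> = (LINT z|\<mu>. - F z)"
  proof (intro Bochner_Integration.integral_cong refl)
    fix z
    have "(cis t * z) ^ k * cnj ((cis t * z) ^ l) = ((cis t) ^ k * cnj ((cis t) ^ l)) * (z ^ k * cnj (z ^ l))"
      by (simp add: power_mult_distrib mult_ac)
    then show "F (cis t * z) = - F z" unfolding rot F_def using circled_rotate[OF B, of t z] by (simp add: indicator_def)
  qed
  also have "\<dots> = - (LINT z|\<mu>. F z)" by simp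
  finally have "(LINT z|\<mu>. F z) = 0" by simp
  then show ?thesis using False by (simp add: F_def)
qed

lemma a_nonneg: "0 \<le> a k B"
  unfolding a_def using c_pos[of k] by (intro divide_nonneg_nonneg Bochner_Integration.integral_nonneg) auto

context
  fixes K :: "complex \<Rightarrow> complex \<Rightarrow> complex"
  assumes K: "reproducing_kernel (fock_space \<mu>) \<mu> K"
begin

text \<open>The reproducing property is applied to z^k. Integrating the power series of the kernel
  term by term is justified on disks, where orthogonality leaves a single term; the disks then grow
  to the plane by dominated convergence on both sides.\<close>

lemma kernel_coefficient:
  fixes b :: "nat \<Rightarrow> complex"
  assumes b: "\<And>z. (\<lambda>n. b n * z ^ n) sums K z \<zeta>"
  shows "b k = cnj \<zeta> ^ k / of_real (c k)"
proof -
  define f where "f z = K z \<zeta>" for z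
  have "f \<in> fock_space \<mu>" using K by (simp add: reproducing_kernel_def f_def[abs_def])
  then have hol: "f holomorphic_on UNIV" and f2: "(\<integral>\<^sup>+z. ennreal ((cmod (f z))\<^sup>2) \<partial>\<mu>) < \<infinity>"
    by (auto simp: fock_space_def)
  have fm[measurable]: "f \<in> borel_measurable borel"
    using hol by (intro borel_measurable_continuous_onI holomorphic_on_imp_continuous_on)
  have if2: "integrable \<mu> (\<lambda>z. (cmod (f z))\<^sup>2)"
    using f2 by (intro integrableI_bounded) (auto simp: measurable_cong_sets[OF sets_\<mu> refl])
  have "(\<lambda>z. z ^ k) \<in> fock_space \<mu>"
    using moment[of k] by (auto simp: fock_space_def norm_power power_mult[symmetric] mult.commute intro!: holomorphic_intros)
  then have rep: "\<zeta> ^ k = (LINT z|\<mu>. z ^ k * cnj (f z))"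
    using K by (simp add: reproducing_kernel_def f_def)
  have int: "integrable \<mu> (\<lambda>z. z ^ k * cnj (f z))"
  proof (rule Bochner_Integration.integrable_bound)
    show "integrable \<mu> (\<lambda>z. cmod z ^ (2 * k) + (cmod (f z))\<^sup>2)"
      by (intro Bochner_Integration.integrable_add integrable_even_power if2)
    have "cmod z ^ k * cmod (f z) \<le> cmod z ^ (2 * k) + (cmod (f z))\<^sup>2" for z
      unfolding power_even_eq by (rule mult_le_sum_squares) auto
    then show "AE z in \<mu>. cmod (z ^ k * cnj (f z)) \<le> norm (cmod z ^ (2 * k) + (cmod (f z))\<^sup>2)"
      by (intro AE_I2) (simp add: norm_mult norm_power)
  qed measurable
  have disc: "(LINT z|\<mu>. indicator (ball 0 (real j)) z * (z ^ k * cnj (f z))) = cnj (b k) * of_real (c k * a k (ball 0 (real j)))" for j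
  proof -
    let ?B = "ball (0::complex) (real j)"
    let ?g = "\<lambda>n z. indicator ?B z * (z ^ k * cnj (b n * z ^ n))"
    \<comment> \<open>Convergence at the point j + 1 gives absolute convergence at modulus
      j.\<close>
    have sb: "summable (\<lambda>n. cmod (b n) * real j ^ n)"
    proof -
      have "summable (\<lambda>n. b n * (of_real (real j + 1)) ^ n)" using b by (rule sums_summable)
      then have "summable (\<lambda>n. norm (b n * of_real (real j) ^ n))"
        by (rule powser_insidea) (subst (1 2) norm_of_real, simp)
      then show ?thesis by (simp add: norm_mult norm_power)
    qed
    have gi: "integrable \<mu> (?g n)" for n
    proof -
      have "integrable \<mu> (\<lambda>z. cnj (b n) * (indicator ?B z * (z ^ k * cnj (z ^ n))))"
        by (intro integrable_mult_right integrable_indicator_mult integrable_monomials) simp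
      then show ?thesis by (simp add: mult_ac)
    qed
    have gb: "norm (?g n z) \<le> real j ^ k * (cmod (b n) * real j ^ n)" for n z
    proof (cases "z \<in> ?B")
      case True
      then have "cmod z ^ k \<le> real j ^ k" "cmod z ^ n \<le> real j ^ n" by (auto intro!: power_mono)
      then have "cmod z ^ k * (cmod (b n) * cmod z ^ n) \<le> real j ^ k * (cmod (b n) * real j ^ n)"
        by (intro mult_mono) auto
      then show ?thesis using True by (simp add: norm_mult norm_power)
    qed simp
    have "(LINT z|\<mu>. indicator ?B z * (z ^ k * cnj (f z))) = (LINT z|\<mu>. (\<Sum>n. ?g n z))"
    proof (intro Bochner_Integration.integral_cong refl)
      fix z
      have "(\<lambda>n. cnj (b n * z ^ n)) sums cnj (f z)" using b[of z] by (simp only: sums_cnj f_def)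
      then have "(\<lambda>n. ?g n z) sums (indicator ?B z * (z ^ k * cnj (f z)))" by (intro sums_mult)
      then show "indicator ?B z * (z ^ k * cnj (f z)) = (\<Sum>n. ?g n z)" by (rule sums_unique)
    qed
    also have "\<dots> = (\<Sum>n. LINT z|\<mu>. ?g n z)"
    proof (rule integral_suminf[OF gi])
      have sm: "summable (\<lambda>n. real j ^ k * (cmod (b n) * real j ^ n))" using sb by (rule summable_mult)
      show "AE z in \<mu>. summable (\<lambda>n. norm (?g n z))"
      proof (rule AE_I2)
        fix z show "summable (\<lambda>n. norm (?g n z))"
        proof (rule summable_comparison_test'[OF sm, of 0])
          fix n show "norm (norm (?g n z)) \<le> real j ^ k * (cmod (b n) * real j ^ n)"
            unfolding real_norm_def abs_norm_cancel by (rule gb)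
        qed
      qed
      have "summable (\<lambda>n. real j ^ k * (cmod (b n) * real j ^ n) * measure \<mu> UNIV)"
        using sb by (intro summable_mult2 summable_mult)
      then show "summable (\<lambda>n. LINT z|\<mu>. norm (?g n z))"
      proof (rule summable_comparison_test'[where N=0])
        fix n
        have "(LINT z|\<mu>. norm (?g n z)) \<le> (LINT z|\<mu>. real j ^ k * (cmod (b n) * real j ^ n))"
          using gb by (intro integral_mono integrable_norm gi) auto
        moreover have "0 \<le> (LINT z|\<mu>. norm (?g n z))" by (intro Bochner_Integration.integral_nonneg) auto
        moreover have "(LINT z|\<mu>. x) = x * measure \<mu> UNIV" for x :: real by (simp add: mult.commute)
        ultimately show "norm (LINT z|\<mu>. norm (?g n z)) \<le> real j ^ k * (cmod (b n) * real j ^ n) * measure \<mu> UNIV"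
          by (simp only: real_norm_def abs_of_nonneg)
      qed
    qed
    also have "\<dots> = (\<Sum>n. if n = k then cnj (b k) * of_real (c k * a k ?B) else 0)"
    proof (rule suminf_cong)
      fix n
      have "(LINT z|\<mu>. ?g n z) = (LINT z|\<mu>. cnj (b n) * (indicator ?B z * (z ^ k * cnj (z ^ n))))"
        by (intro Bochner_Integration.integral_cong) (auto simp: mult_ac)
      also have "\<dots> = cnj (b n) * (LINT z|\<mu>. indicator ?B z * (z ^ k * cnj (z ^ n)))" by simp
      finally show "(LINT z|\<mu>. ?g n z) = (if n = k then cnj (b k) * of_real (c k * a k ?B) else 0)"
        unfolding orthogonal[OF circled_ball] by auto
    qed
    also have "\<dots> = cnj (b k) * of_real (c k * a k ?B)" by (subst suminf_finite[of "{k}"]) auto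
    finally show ?thesis .
  qed
  have ind: "(\<lambda>j. indicator (ball 0 (real j)) z :: real) \<longlonglongrightarrow> 1" for z :: complex
  proof (rule tendsto_eventually)
    obtain n where "cmod z < real n" using reals_Archimedean2 by blast
    then show "eventually (\<lambda>j. indicator (ball 0 (real j)) z = (1::real)) sequentially"
      unfolding eventually_sequentially by (intro exI[of _ n]) (auto simp: indicator_def)
  qed
  have ind': "(\<lambda>j. indicator (ball 0 (real j)) z :: complex) \<longlonglongrightarrow> 1" for z :: complex
    using tendsto_of_real[OF ind[of z], where 'a=complex] by (simp add: indicator_def of_bool_def if_distrib cong: if_cong)
  have l1: "(\<lambda>j. LINT z|\<mu>. indicator (ball 0 (real j)) z * (z ^ k * cnj (f z))) \<longlonglongrightarrow> (LINT z|\<mu>. z ^ k * cnj (f z))"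
  proof (rule integral_dominated_convergence)
    show "integrable \<mu> (\<lambda>z. cmod (z ^ k * cnj (f z)))" using int by (rule integrable_norm)
    show "AE z in \<mu>. (\<lambda>j. indicator (ball 0 (real j)) z * (z ^ k * cnj (f z))) \<longlonglongrightarrow> z ^ k * cnj (f z)"
    proof (rule AE_I2)
      fix z show "(\<lambda>j. indicator (ball 0 (real j)) z * (z ^ k * cnj (f z))) \<longlonglongrightarrow> z ^ k * cnj (f z)"
        using tendsto_mult[OF ind'[of z] tendsto_const[of "z ^ k * cnj (f z)"]] by simp
    qed
    show "AE z in \<mu>. cmod (indicator (ball 0 (real j)) z * (z ^ k * cnj (f z))) \<le> cmod (z ^ k * cnj (f z))" for j
      by (intro AE_I2) (auto simp: indicator_def)
  qed (use int in \<open>auto simp: measurable_cong_sets[OF sets_\<mu> refl]\<close>)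
  have l2: "(\<lambda>j. LINT z|\<mu>. indicator (ball 0 (real j)) z * cmod z ^ (2 * k)) \<longlonglongrightarrow> (LINT z|\<mu>. cmod z ^ (2 * k))"
  proof (rule integral_dominated_convergence)
    show "integrable \<mu> (\<lambda>z. cmod z ^ (2 * k))" by (rule integrable_even_power)
    show "AE z in \<mu>. (\<lambda>j. indicator (ball 0 (real j)) z * cmod z ^ (2 * k)) \<longlonglongrightarrow> cmod z ^ (2 * k)"
    proof (rule AE_I2)
      fix z show "(\<lambda>j. indicator (ball 0 (real j)) z * cmod z ^ (2 * k)) \<longlonglongrightarrow> cmod z ^ (2 * k)"
        using tendsto_mult[OF ind[of z] tendsto_const[of "cmod z ^ (2 * k)"]] by simp
    qed
    show "AE z in \<mu>. norm (indicator (ball 0 (real j)) z * cmod z ^ (2 * k)) \<le> cmod z ^ (2 * k)" for j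
      by (intro AE_I2) (auto simp: indicator_def)
  qed (auto simp: measurable_cong_sets[OF sets_\<mu> refl])
  have "(\<lambda>j. cnj (b k) * of_real (c k * a k (ball 0 (real j)))) \<longlonglongrightarrow> cnj (b k) * of_real (c k)"
    using l2 c_pos[of k] unfolding integral_even_power a_def by (intro tendsto_intros) simp
  with l1 have "(LINT z|\<mu>. z ^ k * cnj (f z)) = cnj (b k) * of_real (c k)"
    unfolding disc by (rule LIMSEQ_unique)
  then have "cnj (\<zeta> ^ k) = b k * of_real (c k)"
    unfolding rep by (simp flip: complex_cnj_cancel_iff[of "b k * of_real (c k)"])
  then show ?thesis using c_pos[of k] by (simp add: field_simps)
qed

theorem kernel_sums: "(\<lambda>k. (z * cnj \<zeta>) ^ k / of_real (c k)) sums K z \<zeta>"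
proof -
  have "(\<lambda>z. K z \<zeta>) \<in> fock_space \<mu>" using K by (simp add: reproducing_kernel_def)
  then have hol: "(\<lambda>z. K z \<zeta>) holomorphic_on UNIV" by (simp add: fock_space_def)
  define b where "b n = (deriv ^^ n) (\<lambda>z. K z \<zeta>) 0 / fact n" for n
  have b: "(\<lambda>n. b n * w ^ n) sums K w \<zeta>" for w
    using holomorphic_power_series[OF holomorphic_on_subset[OF hol], of 0 "cmod w + 1" w]
    by (simp add: b_def)
  show ?thesis
    using b[of z] kernel_coefficient[OF b] by (simp add: power_mult_distrib mult_ac)
qed

end

end

section \<open>Gram determinants of truncated kernels and their integrals over rotation-invariant
  sets\<close>

definition det_kernel :: "(complex \<Rightarrow> complex \<Rightarrow> complex) \<Rightarrow> nat \<Rightarrow> (nat \<Rightarrow> complex) \<Rightarrow> complex" where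
  "det_kernel A n z = Determinant.det (Matrix.mat n n (\<lambda>(i, j). A (z i) (z j)))"

lemma det_mat_fun:
  "Determinant.det (Matrix.mat n n (\<lambda>(i, j). f i j)) = (\<Sum>p | p permutes {..<n}. signof p * (\<Prod>i<n. f i (p i)))"
proof -
  have "Determinant.det (Matrix.mat n n (\<lambda>(i, j). f i j)) = (\<Sum>p | p permutes {0..<n}. signof p * (\<Prod>i=0..<n. Matrix.mat n n (\<lambda>(i, j). f i j) $$ (i, p i)))"
    by (rule det_def') simp
  also have "\<dots> = (\<Sum>p | p permutes {0..<n}. signof p * (\<Prod>i=0..<n. f i (p i)))"
    by (intro sum.cong refl arg_cong2[where f="(*)"] prod.cong) (auto simp: permutes_in_image[of _ "{0..<n}", simplified] dest: permutes_in_image[of _ "{0..<n}"])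
  finally show ?thesis by (simp add: atLeast0LessThan)
qed

lemma det_mat_fun_col:
  "Determinant.det (Matrix.mat n n (\<lambda>(i, j). f i j)) = (\<Sum>p | p permutes {..<n}. signof p * (\<Prod>j<n. f (p j) j))"
proof -
  have "Determinant.det (Matrix.mat n n (\<lambda>(i, j). f i j)) = (\<Sum>p | p permutes {0..<n}. signof p * (\<Prod>j<n. Matrix.mat n n (\<lambda>(i, j). f i j) $$ (p j, j)))"
    by (rule det_col) simp
  also have "\<dots> = (\<Sum>p | p permutes {0..<n}. signof p * (\<Prod>j<n. f (p j) j))"
    by (intro sum.cong refl arg_cong2[where f="(*)"] prod.cong) (auto simp: permutes_in_image[of _ "{0..<n}", simplified] dest: permutes_in_image[of _ "{0..<n}"])
  finally show ?thesis by (simp add: atLeast0LessThan)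
qed

lemma det_permuted_rows:
  assumes "q permutes {..<n}"
  shows "Determinant.det (Matrix.mat n n (\<lambda>(i, j). f (q i) j)) = signof q * Determinant.det (Matrix.mat n n (\<lambda>(i, j). f i j))"
proof -
  have q: "q permutes {0..<n}" using assms by (simp add: atLeast0LessThan)
  have "Matrix.mat n n (\<lambda>(i, j). f (q i) j) = Matrix.mat n n (\<lambda>(i, j). Matrix.mat n n (\<lambda>(i, j). f i j) $$ (q i, j))"
    by (rule eq_matI) (use permutes_in_image[OF q] in auto)
  then show ?thesis using det_permute_rows[OF mat_carrier q, of "\<lambda>(i, j). f i j"] by simp
qed

lemma cnj_signof: "cnj (signof p) = (signof p :: complex)"
  by (simp add: sign_def)

text \<open>Multilinearity in the rows: choosing one summand from each row yields an index tuple,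
  and summing over permutations afterwards rebuilds a determinant for each tuple.\<close>

lemma gram_expansion:
  fixes \<phi> :: "nat \<Rightarrow> nat \<Rightarrow> complex"
  shows "Determinant.det (Matrix.mat n n (\<lambda>(i, j). \<Sum>k<m. \<phi> k i * cnj (\<phi> k j)))
    = (\<Sum>k\<in>PiE {..<n} (\<lambda>_. {..<m}). (\<Prod>i<n. \<phi> (k i) i) * cnj (Determinant.det (Matrix.mat n n (\<lambda>(i, j). \<phi> (k i) j))))"
proof -
  have "Determinant.det (Matrix.mat n n (\<lambda>(i, j). \<Sum>k<m. \<phi> k i * cnj (\<phi> k j)))
    = (\<Sum>p | p permutes {..<n}. signof p * (\<Sum>k\<in>PiE {..<n} (\<lambda>_. {..<m}). \<Prod>i<n. \<phi> (k i) i * cnj (\<phi> (k i) (p i))))"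
    unfolding det_mat_fun by (subst prod_sum_PiE) auto
  also have "\<dots> = (\<Sum>k\<in>PiE {..<n} (\<lambda>_. {..<m}). \<Sum>p | p permutes {..<n}. signof p * (\<Prod>i<n. \<phi> (k i) i * cnj (\<phi> (k i) (p i))))"
    unfolding sum_distrib_left by (rule sum.swap)
  also have "\<dots> = (\<Sum>k\<in>PiE {..<n} (\<lambda>_. {..<m}). (\<Prod>i<n. \<phi> (k i) i) * cnj (Determinant.det (Matrix.mat n n (\<lambda>(i, j). \<phi> (k i) j))))"
    unfolding det_mat_fun by (intro sum.cong refl) (simp add: prod.distrib sum_distrib_left cnj_signof mult_ac)
  finally show ?thesis .
qed

text \<open>Symmetrising the Gram expansion over permutations of the index tuple turns it into a sum of
  squared moduli (Cauchy--Binet).\<close>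

lemma gram_det_nonneg:
  fixes \<phi> :: "nat \<Rightarrow> nat \<Rightarrow> complex"
  shows "0 \<le> Re (Determinant.det (Matrix.mat n n (\<lambda>(i, j). \<Sum>k<m. \<phi> k i * cnj (\<phi> k j))))"
proof -
  let ?P = "{p. p permutes {..<n}}"
  let ?T = "PiE {..<n} (\<lambda>_. {..<m})"
  define D where "D k = Determinant.det (Matrix.mat n n (\<lambda>(i, j). \<phi> (k i) j))" for k :: "nat \<Rightarrow> nat"
  define G where "G = Determinant.det (Matrix.mat n n (\<lambda>(i, j). \<Sum>k<m. \<phi> k i * cnj (\<phi> k j)))"
  have G: "G = (\<Sum>k\<in>?T. (\<Prod>i<n. \<phi> (k i) i) * cnj (D k))" unfolding G_def D_def by (rule gram_expansion)
  have perm: "G = (\<Sum>k\<in>?T. signof q * (\<Prod>i<n. \<phi> (k (q i)) i) * cnj (D k))" if q: "q \<in> ?P" for q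
  proof -
    have qp: "q permutes {..<n}" using q by simp
    have "G = (\<Sum>k\<in>?T. (\<Prod>i<n. \<phi> ((k \<circ> q) i) i) * cnj (D (k \<circ> q)))"
      unfolding G
    proof (rule sum.reindex_bij_witness[where i="\<lambda>k. k \<circ> q" and j="\<lambda>k. k \<circ> inv_into UNIV q"])
      show "(k \<circ> inv_into UNIV q) \<circ> q = k" for k :: "nat \<Rightarrow> nat" using qp by (simp add: comp_assoc permutes_inv_o)
      show "(k \<circ> q) \<circ> inv_into UNIV q = k" for k :: "nat \<Rightarrow> nat" using qp by (simp add: comp_assoc permutes_inv_o)
      show "k \<circ> q \<in> ?T" if "k \<in> ?T" for k
        using that permutes_in_image[OF qp] permutes_not_in[OF qp] by (auto simp: PiE_iff extensional_def)
      show "k \<circ> inv_into UNIV q \<in> ?T" if "k \<in> ?T" for k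
        using that permutes_in_image[OF permutes_inv[OF qp]] permutes_not_in[OF permutes_inv[OF qp]] by (auto simp: PiE_iff extensional_def)
    qed (use qp in \<open>simp_all add: comp_assoc permutes_inv_o\<close>)
    also have "\<dots> = (\<Sum>k\<in>?T. signof q * (\<Prod>i<n. \<phi> (k (q i)) i) * cnj (D k))"
    proof (intro sum.cong refl)
      fix k
      have "D (k \<circ> q) = signof q * D k" unfolding D_def comp_def
        by (rule det_permuted_rows[OF qp, of "\<lambda>i j. \<phi> (k i) j"])
      then show "(\<Prod>i<n. \<phi> ((k \<circ> q) i) i) * cnj (D (k \<circ> q)) = signof q * (\<Prod>i<n. \<phi> (k (q i)) i) * cnj (D k)"
        by (simp add: cnj_signof)
    qed
    finally show ?thesis .
  qed
  have "of_nat (card ?P) * G = (\<Sum>q\<in>?P. \<Sum>k\<in>?T. signof q * (\<Prod>i<n. \<phi> (k (q i)) i) * cnj (D k))"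
  proof -
    have "of_nat (card ?P) * G = (\<Sum>q\<in>?P. G)" by simp
    also have "\<dots> = (\<Sum>q\<in>?P. \<Sum>k\<in>?T. signof q * (\<Prod>i<n. \<phi> (k (q i)) i) * cnj (D k))"
      by (rule sum.cong[OF refl perm])
    finally show ?thesis .
  qed
  also have "\<dots> = (\<Sum>k\<in>?T. (\<Sum>q\<in>?P. signof q * (\<Prod>i<n. \<phi> (k (q i)) i)) * cnj (D k))"
    by (subst sum.swap) (simp add: sum_distrib_right)
  also have "\<dots> = (\<Sum>k\<in>?T. D k * cnj (D k))"
    unfolding D_def det_mat_fun_col by simp
  also have "\<dots> = of_real (\<Sum>k\<in>?T. (cmod (D k))\<^sup>2)" by (simp add: complex_norm_square del: of_real_power)
  finally have eq: "of_nat (card ?P) * G = complex_of_real (\<Sum>k\<in>?T. (cmod (D k))\<^sup>2)" .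
  have "real (card ?P) * Re G = (\<Sum>k\<in>?T. (cmod (D k))\<^sup>2)"
    using arg_cong[OF eq, of Re] by simp
  moreover have "0 \<le> (\<Sum>k\<in>?T. (cmod (D k))\<^sup>2)" by (intro sum_nonneg) auto
  moreover have "card ?P > 0" using permutes_id[of "{..<n}"] by (auto simp: card_gt_0_iff finite_permutations intro: exI[of _ id])
  ultimately have "0 \<le> real (card ?P) * Re G" "0 < real (card ?P)" by linarith+
  then have "0 \<le> Re G" by (simp only: zero_le_mult_iff) linarith
  then show ?thesis unfolding G_def .
qed

text \<open>The sum is the determinant of the matrix with entries [k i = k j], which is the identity
  for injective k and has two equal rows otherwise.\<close>

lemma sum_sign_delta:
  fixes k :: "nat \<Rightarrow> nat"
  shows "(\<Sum>p | p permutes {..<n}. signof p * (\<Prod>i<n. if k i = k (p i) then 1 else 0)) = (if inj_on k {..<n} then 1 else (0::complex))"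
proof -
  have "(\<Sum>p | p permutes {..<n}. signof p * (\<Prod>i<n. if k i = k (p i) then 1 else 0)) = Determinant.det (Matrix.mat n n (\<lambda>(i, j). if k i = k j then 1 else (0::complex)))"
    by (rule det_mat_fun[symmetric])
  also have "\<dots> = (if inj_on k {..<n} then 1 else 0)"
  proof (cases "inj_on k {..<n}")
    case True
    have "Matrix.mat n n (\<lambda>(i, j). if k i = k j then 1 else (0::complex)) = 1\<^sub>m n"
      by (rule eq_matI) (use True in \<open>auto simp: inj_on_def\<close>)
    then show ?thesis using True by simp
  next
    case False
    then obtain i j where ij: "i < n" "j < n" "i \<noteq> j" "k i = k j" by (auto simp: inj_on_def)
    have "Determinant.det (Matrix.mat n n (\<lambda>(i, j). if k i = k j then 1 else (0::complex))) = 0"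
      by (rule det_identical_rows[OF _ ij(3,1,2)]) (use ij in \<open>auto intro!: eq_vecI\<close>)
    then show ?thesis using False by simp
  qed
  finally show ?thesis .
qed

context radial_moments
begin

definition basis :: "nat \<Rightarrow> complex \<Rightarrow> complex" where "basis k z = z ^ k / of_real (sqrt (c k))"

definition partial_kernel :: "nat \<Rightarrow> complex \<Rightarrow> complex \<Rightarrow> complex" where
  "partial_kernel m z w = (\<Sum>k<m. basis k z * cnj (basis k w))"

lemma basis_mult: "basis k z * cnj (basis l w) = z ^ k * cnj (w ^ l) / of_real (sqrt (c k) * sqrt (c l))"
  by (simp add: basis_def)

lemma basis_mult_same: "basis k z * cnj (basis k w) = (z * cnj w) ^ k / of_real (c k)"
  using c_pos[of k] by (simp add: basis_mult power_mult_distrib less_imp_le flip: of_real_mult)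

lemma basis_measurable[measurable]: "basis k \<in> borel_measurable borel"
  unfolding basis_def[abs_def] by measurable

lemma basis_integral:
  assumes B: "circled B"
  shows "(LINT z|\<mu>. indicator B z * (basis k z * cnj (basis l z))) = (if k = l then of_real (a k B) else 0)"
    and "integrable \<mu> (\<lambda>z. indicator B z * (basis k z * cnj (basis l z)))"
proof -
  have e: "indicator B z * (basis k z * cnj (basis l z)) = (indicator B z * (z ^ k * cnj (z ^ l))) / of_real (sqrt (c k) * sqrt (c l))" for z
    by (simp add: basis_mult)
  show "(LINT z|\<mu>. indicator B z * (basis k z * cnj (basis l z))) = (if k = l then of_real (a k B) else 0)"
    unfolding e Bochner_Integration.integral_divide_zero orthogonal[OF B]
  proof (cases "k = l")
    case True
    have "sqrt (c k) * sqrt (c k) = c k" using c_pos[of k] by simp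
    then show "(if k = l then complex_of_real (c k * a k B) else 0) / of_real (sqrt (c k) * sqrt (c l)) = (if k = l then of_real (a k B) else 0)"
      using True c_pos[of k] by simp
  qed simp
  show "integrable \<mu> (\<lambda>z. indicator B z * (basis k z * cnj (basis l z)))"
    unfolding e by (intro integrable_divide_zero integrable_indicator_mult circled_borel[OF B] integrable_monomials)
qed

sublocale PM: product_sigma_finite "\<lambda>_::nat. \<mu>"
  by unfold_locales

lemma indicator_PiE_prod:
  assumes "z \<in> space (PiM {..<n :: nat} (\<lambda>_. \<mu>))"
  shows "indicator (PiE {..<n} B) z = (\<Prod>i<n. indicator (B i) (z i) :: 'b :: comm_semiring_1)"
proof (cases "z \<in> PiE {..<n} B")
  case True
  then have "\<And>i. i < n \<Longrightarrow> z i \<in> B i" by auto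
  then show ?thesis using True by simp
next
  case False
  then obtain i where "i < n" "z i \<notin> B i" using assms by (auto simp: space_PiM PiE_iff)
  then have "(\<Prod>i<n. indicator (B i) (z i) :: 'b) = 0" by (intro prod_zero bexI[of _ i]) auto
  then show ?thesis using False by simp
qed

lemma prod_permute_lessThan: "q permutes {..<n} \<Longrightarrow> (\<Prod>i<n. f (q i)) = (\<Prod>i<n. f i)"
  by (subst (2) prod.permute[of q "{..<n}"]) (auto simp: comp_def)

text \<open>After the Gram expansion the variable z i occurs with the modes k i and k (p^(-1) i).
  Orthogonality makes the integral vanish unless these agree for every i, and the signed sum over p
  then keeps precisely the injective tuples by \<open>sum_sign_delta\<close>.\<close>

lemma partial_det_integral:
  assumes B: "\<And>i. i < n \<Longrightarrow> circled (B i)"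
  shows "(LINT z|PiM {..<n} (\<lambda>_. \<mu>). indicator (PiE {..<n} B) z * det_kernel (partial_kernel m) n z)
     = of_real (\<Sum>k | k \<in> PiE {..<n} (\<lambda>_. {..<m}) \<and> inj_on k {..<n}. \<Prod>i<n. a (k i) (B i))"
proof -
  let ?T = "PiE {..<n} (\<lambda>_. {..<m})"
  let ?P = "{p. p permutes {..<n}}"
  let ?\<mu> = "PiM {..<n} (\<lambda>_. \<mu>)"
  let ?h = "\<lambda>k p i x. indicator (B i) x * (basis (k i) x * cnj (basis (k (inv_into UNIV p i)) x))"
  have trm: "indicator (PiE {..<n} B) z * det_kernel (partial_kernel m) n z
     = (\<Sum>k\<in>?T. \<Sum>p\<in>?P. signof p * (\<Prod>i<n. ?h k p i (z i)))" if z: "z \<in> space ?\<mu>" for z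
  proof -
    have inner: "(\<Prod>i<n. basis (k i) (z i)) * (\<Prod>i<n. cnj (basis (k i) (z (p i)))) * indicator (PiE {..<n} B) z = (\<Prod>i<n. ?h k p i (z i))"
      if p: "p \<in> ?P" for k p
    proof -
      have p': "p permutes {..<n}" using p by simp
      have "(\<Prod>i<n. cnj (basis (k (inv_into UNIV p (p i))) (z (p i)))) = (\<Prod>i<n. cnj (basis (k (inv_into UNIV p i)) (z i)))"
        by (rule prod_permute_lessThan[OF p'])
      then show ?thesis unfolding indicator_PiE_prod[OF z]
        using p' by (simp add: permutes_inverses prod.distrib mult_ac)
    qed
    have "det_kernel (partial_kernel m) n z = (\<Sum>k\<in>?T. (\<Prod>i<n. basis (k i) (z i)) * (\<Sum>p\<in>?P. signof p * (\<Prod>i<n. cnj (basis (k i) (z (p i))))))"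
      unfolding det_kernel_def partial_kernel_def gram_expansion[where n=n and m=m and \<phi>="\<lambda>k i. basis k (z i)"]
      unfolding det_mat_fun by (simp add: cnj_signof)
    then have "indicator (PiE {..<n} B) z * det_kernel (partial_kernel m) n z
       = (\<Sum>k\<in>?T. \<Sum>p\<in>?P. signof p * ((\<Prod>i<n. basis (k i) (z i)) * (\<Prod>i<n. cnj (basis (k i) (z (p i)))) * indicator (PiE {..<n} B) z))"
      by (simp add: sum_distrib_left mult_ac)
    also have "\<dots> = (\<Sum>k\<in>?T. \<Sum>p\<in>?P. signof p * (\<Prod>i<n. ?h k p i (z i)))"
      by (intro sum.cong refl) (simp only: inner)
    finally show ?thesis .
  qed
  have int: "integrable ?\<mu> (\<lambda>z. \<Prod>i<n. ?h k p i (z i))" for k p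
    using B by (intro PM.product_integrable_prod basis_integral(2)) auto
  have val: "(LINT z|?\<mu>. (\<Prod>i<n. ?h k p i (z i))) = (\<Prod>i<n. if k i = k (inv_into UNIV p i) then of_real (a (k i) (B i)) else 0)" for k p
    using B by (subst PM.product_integral_prod) (auto simp: basis_integral)
  have "(LINT z|?\<mu>. indicator (PiE {..<n} B) z * det_kernel (partial_kernel m) n z) = (LINT z|?\<mu>. (\<Sum>k\<in>?T. \<Sum>p\<in>?P. signof p * (\<Prod>i<n. ?h k p i (z i))))"
    using trm by (intro Bochner_Integration.integral_cong refl)
  also have "\<dots> = (\<Sum>k\<in>?T. \<Sum>p\<in>?P. signof p * (\<Prod>i<n. if k i = k (inv_into UNIV p i) then of_real (a (k i) (B i)) else 0))"
    using int by (simp add: Bochner_Integration.integral_sum val)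
  also have "\<dots> = (\<Sum>k\<in>?T. if inj_on k {..<n} then of_real (\<Prod>i<n. a (k i) (B i)) else 0)"
  proof (intro sum.cong refl)
    fix k
    let ?b = "\<lambda>i. complex_of_real (a (k i) (B i))"
    have "(\<Sum>p\<in>?P. signof p * (\<Prod>i<n. if k i = k (inv_into UNIV p i) then ?b i else 0))
       = (\<Sum>p\<in>?P. (\<Prod>i<n. ?b i) * (signof p * (\<Prod>i<n. if k i = k (inv_into UNIV p i) then 1 else 0)))"
      by (intro sum.cong refl) (simp add: prod.distrib[symmetric] mult.left_commute, intro disjI2 prod.cong, auto)
    also have "\<dots> = (\<Prod>i<n. ?b i) * (\<Sum>p\<in>?P. signof p * (\<Prod>i<n. if k i = k (inv_into UNIV p i) then 1 else 0))"
      by (rule sum_distrib_left[symmetric])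
    also have "(\<Sum>p\<in>?P. signof p * (\<Prod>i<n. if k i = k (inv_into UNIV p i) then 1 else (0::complex)))
       = (\<Sum>p\<in>?P. signof (inv_into UNIV p) * (\<Prod>i<n. if k i = k (inv_into UNIV p i) then 1 else 0))"
      by (intro sum.cong refl) (simp add: sign_inverse permutation_permutes[THEN iffD2] permutes_imp_permutation[of "{..<n}"])
    also have "\<dots> = (\<Sum>p\<in>?P. signof p * (\<Prod>i<n. if k i = k (p i) then 1 else 0))"
      by (rule sum_permutations_inverse[symmetric])
    also have "\<dots> = (if inj_on k {..<n} then 1 else 0)" by (rule sum_sign_delta)
    finally show "(\<Sum>p\<in>?P. signof p * (\<Prod>i<n. if k i = k (inv_into UNIV p i) then ?b i else 0)) = (if inj_on k {..<n} then of_real (\<Prod>i<n. a (k i) (B i)) else 0)"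
      by simp
  qed
  also have "\<dots> = of_real (\<Sum>k | k \<in> ?T \<and> inj_on k {..<n}. \<Prod>i<n. a (k i) (B i))"
    by (simp add: sum.inter_filter finite_PiE flip: of_real_prod) (simp add: if_distrib cong: if_cong)
  finally show ?thesis .
qed

end

context radial_moments
begin

context
  fixes K :: "complex \<Rightarrow> complex \<Rightarrow> complex"
  assumes K: "reproducing_kernel (fock_space \<mu>) \<mu> K"
begin

lemma partial_kernel_tendsto: "(\<lambda>m. partial_kernel m z w) \<longlonglongrightarrow> K z w"
  using kernel_sums[OF K, of z w] by (simp add: sums_def partial_kernel_def basis_mult_same)

text \<open>The diagonal series at r majorises every truncation, uniformly in m; this is the
  dominating constant for the passage to the full kernel.\<close>

lemma partial_kernel_bound:
  obtains S where "S \<ge> 0" "\<And>m z w. cmod z < r \<Longrightarrow> cmod w < r \<Longrightarrow> cmod (partial_kernel m z w) \<le> S"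
proof
  have s: "summable (\<lambda>k. (r * r) ^ k / c k)"
  proof -
    have "summable (\<lambda>k. (of_real r * cnj (of_real r)) ^ k / complex_of_real (c k))"
      using kernel_sums[OF K, of "of_real r" "of_real r"] by (rule sums_summable)
    then have "summable (\<lambda>k. complex_of_real ((r * r) ^ k / c k))" by simp
    then show ?thesis by (simp only: summable_complex_of_real)
  qed
  show "0 \<le> (\<Sum>k. (r * r) ^ k / c k)"
    using c_pos by (intro suminf_nonneg s) (auto simp: less_imp_le)
  fix m z w assume zw: "cmod z < r" "cmod w < r"
  have "cmod (partial_kernel m z w) \<le> (\<Sum>k<m. (r * r) ^ k / c k)"
    unfolding partial_kernel_def
  proof (rule sum_norm_le)
    fix k
    have "cmod z * cmod w \<le> r * r" using zw by (intro mult_mono) (auto intro: order_trans[OF norm_ge_zero less_imp_le])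
    then have "(cmod z * cmod w) ^ k \<le> (r * r) ^ k" by (intro power_mono) auto
    then show "cmod (basis k z * cnj (basis k w)) \<le> (r * r) ^ k / c k"
      using c_pos[of k] by (simp add: basis_mult_same norm_divide norm_power norm_mult divide_right_mono)
  qed
  also have "\<dots> \<le> (\<Sum>k. (r * r) ^ k / c k)"
    using c_pos by (intro sum_le_suminf s) (auto simp: less_imp_le)
  finally show "cmod (partial_kernel m z w) \<le> (\<Sum>k. (r * r) ^ k / c k)" .
qed

lemma det_partial_tendsto: "(\<lambda>m. det_kernel (partial_kernel m) n z) \<longlonglongrightarrow> det_kernel K n z"
  unfolding det_kernel_def det_mat_fun by (intro tendsto_intros partial_kernel_tendsto)

lemma det_kernel_nonneg: "0 \<le> Re (det_kernel K n z)"
proof -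
  have "0 \<le> Re (det_kernel (partial_kernel m) n z)" for m
    unfolding det_kernel_def partial_kernel_def by (rule gram_det_nonneg[where \<phi>="\<lambda>k i. basis k (z i)"])
  moreover have "(\<lambda>m. Re (det_kernel (partial_kernel m) n z)) \<longlonglongrightarrow> Re (det_kernel K n z)"
    by (intro tendsto_intros det_partial_tendsto)
  ultimately show ?thesis by (intro LIMSEQ_le_const) auto
qed

lemma det_kernel_not_inj: "\<not> inj_on z {..<n} \<Longrightarrow> det_kernel K n z = 0"
proof -
  assume "\<not> inj_on z {..<n}"
  then obtain i j where ij: "i < n" "j < n" "i \<noteq> j" "z i = z j" by (auto simp: inj_on_def)
  then show ?thesis unfolding det_kernel_def
    by (intro det_identical_rows[OF _ ij(3,1,2)]) (auto intro!: eq_vecI)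
qed

lemma det_partial_measurable: "(\<lambda>z. det_kernel (partial_kernel m) n z) \<in> borel_measurable (PiM {..<n} (\<lambda>_. \<mu>))"
proof -
  have comp: "(\<lambda>z. basis k (z i)) \<in> borel_measurable (PiM {..<n} (\<lambda>_. \<mu>))" if "i < n" for i k
    using measurable_compose[OF measurable_component_singleton[of i "{..<n}" "\<lambda>_. \<mu>"], of "basis k" borel] that
    by (simp add: measurable_cong_sets[OF sets_\<mu> refl])
  have "(\<lambda>z. partial_kernel m (z i) (z (p i))) \<in> borel_measurable (PiM {..<n} (\<lambda>_. \<mu>))" if "i < n" "p permutes {..<n}" for i p
    unfolding partial_kernel_def using that permutes_in_image[OF that(2), of i]
    by (intro borel_measurable_sum borel_measurable_times comp measurable_compose[OF comp cnj_borel_measurable]) auto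
  then show ?thesis unfolding det_kernel_def det_mat_fun
    by (intro borel_measurable_sum borel_measurable_times borel_measurable_const borel_measurable_prod) auto
qed

lemma det_kernel_measurable: "(\<lambda>z. det_kernel K n z) \<in> borel_measurable (PiM {..<n} (\<lambda>_. \<mu>))"
  by (rule borel_measurable_LIMSEQ_metric[OF det_partial_measurable det_partial_tendsto])

text \<open>Dominated convergence of the truncated determinants on a bounded set. The value is left
  as a limit of finite sums over tuples, in which form inequalities between moments are finite
  algebra.\<close>

lemma det_integral_limit:
  assumes B: "\<And>i. i < n \<Longrightarrow> circled (B i)" "\<And>i. i < n \<Longrightarrow> B i \<subseteq> ball 0 r"
  obtains L where "(\<integral>\<^sup>+z\<in>PiE {..<n} B. ennreal (Re (det_kernel K n z)) \<partial>PiM {..<n} (\<lambda>_. \<mu>)) = ennreal L"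
    "(\<lambda>m. \<Sum>k | k \<in> PiE {..<n} (\<lambda>_. {..<m}) \<and> inj_on k {..<n}. \<Prod>i<n. a (k i) (B i)) \<longlonglongrightarrow> L"
proof -
  let ?\<mu> = "PiM {..<n} (\<lambda>_. \<mu>)"
  let ?I = "indicator (PiE {..<n} B)"
  obtain S where S: "S \<ge> 0" "\<And>m z w. cmod z < r \<Longrightarrow> cmod w < r \<Longrightarrow> cmod (partial_kernel m z w) \<le> S"
    by (rule partial_kernel_bound[of r]) blast
  have Bs: "PiE {..<n} B \<in> sets ?\<mu>" using B(1) circled_borel by (intro sets_PiM_I_finite) auto
  interpret P: finite_measure ?\<mu>
  proof
    have "emeasure ?\<mu> (PiE {..<n} (\<lambda>_. UNIV)) = (\<Prod>i<n. emeasure \<mu> UNIV)"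
      by (rule PM.emeasure_PiM) auto
    also have "\<dots> < \<infinity>"
    proof -
      have "emeasure \<mu> UNIV < \<infinity>" using \<mu>.emeasure_finite[of UNIV] by (metis infinity_ennreal_def less_top)
      then show ?thesis by (simp add: power_less_top_ennreal)
    qed
    finally show "emeasure ?\<mu> (space ?\<mu>) \<noteq> \<infinity>" by (simp add: space_PiM)
  qed
  define C where "C = real (card {p. p permutes {..<n}}) * S ^ n"
  have bound: "cmod (?I z * det_kernel (partial_kernel m) n z) \<le> C" for z m
  proof (cases "z \<in> PiE {..<n} B")
    case True
    have "cmod (det_kernel (partial_kernel m) n z) \<le> (\<Sum>p | p permutes {..<n}. S ^ n)"
      unfolding det_kernel_def det_mat_fun
    proof (rule sum_norm_le)
      fix p assume "p \<in> {p. p permutes {..<n}}"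
      then have p: "p permutes {..<n}" by simp
      have "cmod (\<Prod>i<n. partial_kernel m (z i) (z (p i))) \<le> (\<Prod>i<n. S)"
        unfolding prod_norm[symmetric]
      proof (rule prod_mono)
        fix i assume "i \<in> {..<n}"
        then have "z i \<in> B i" "z (p i) \<in> B (p i)" "p i < n" "i < n" using True permutes_in_image[OF p, of i] by auto
        then show "0 \<le> cmod (partial_kernel m (z i) (z (p i))) \<and> cmod (partial_kernel m (z i) (z (p i))) \<le> S"
          using B(2)[of i] B(2)[of "p i"] by (auto intro!: S(2))
      qed
      moreover have "cmod (signof p) = 1" by (simp add: sign_def)
      ultimately show "cmod (signof p * (\<Prod>i<n. partial_kernel m (z i) (z (p i)))) \<le> S ^ n" by (simp add: norm_mult)
    qed
    then show ?thesis using True by (simp add: C_def)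
  qed (use S(1) in \<open>simp add: C_def\<close>)
  have meas: "(\<lambda>z. ?I z * det_kernel (partial_kernel m) n z) \<in> borel_measurable ?\<mu>" for m
    using Bs det_partial_measurable by (intro borel_measurable_times borel_measurable_indicator)
  have measK: "(\<lambda>z. ?I z * det_kernel K n z) \<in> borel_measurable ?\<mu>"
    using Bs det_kernel_measurable by (intro borel_measurable_times borel_measurable_indicator)
  have lim: "(\<lambda>m. ?I z * det_kernel (partial_kernel m) n z) \<longlonglongrightarrow> ?I z * det_kernel K n z" for z
    by (intro tendsto_intros det_partial_tendsto)
  have boundK: "cmod (?I z * det_kernel K n z) \<le> C" for z
    by (rule LIMSEQ_le_const2[OF tendsto_norm[OF lim]]) (use bound in auto)
  have intK: "integrable ?\<mu> (\<lambda>z. ?I z * det_kernel K n z)"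
    by (rule P.integrable_const_bound[where B=C]) (use boundK measK in auto)
  have "(\<lambda>m. LINT z|?\<mu>. ?I z * det_kernel (partial_kernel m) n z) \<longlonglongrightarrow> (LINT z|?\<mu>. ?I z * det_kernel K n z)"
    by (rule integral_dominated_convergence[where w="\<lambda>_. C"])
       (use meas measK lim bound in \<open>auto intro!: AE_I2\<close>)
  then have *: "(\<lambda>m. Re (LINT z|?\<mu>. ?I z * det_kernel (partial_kernel m) n z)) \<longlonglongrightarrow> Re (LINT z|?\<mu>. ?I z * det_kernel K n z)"
    by (intro tendsto_intros)
  have T: "(\<lambda>m. \<Sum>k | k \<in> PiE {..<n} (\<lambda>_. {..<m}) \<and> inj_on k {..<n}. \<Prod>i<n. a (k i) (B i)) \<longlonglongrightarrow> Re (LINT z|?\<mu>. ?I z * det_kernel K n z)"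
  proof -
    have "Re (\<Prod>i<n. complex_of_real (f i)) = (\<Prod>i<n. f i)" for f
      by (simp only: of_real_prod[symmetric] Re_complex_of_real)
    then show ?thesis using * partial_det_integral[OF B(1)] by simp
  qed
  have "Re (LINT z|?\<mu>. ?I z * det_kernel K n z) = (LINT z|?\<mu>. Re (?I z * det_kernel K n z))"
    using intK by (rule integral_Re[symmetric])
  also have "\<dots> = (LINT z|?\<mu>. ?I z * Re (det_kernel K n z))"
    by (intro Bochner_Integration.integral_cong) (auto simp: indicator_def)
  finally have Re: "Re (LINT z|?\<mu>. ?I z * det_kernel K n z) = (LINT z|?\<mu>. ?I z * Re (det_kernel K n z))" .
  have "(\<integral>\<^sup>+z\<in>PiE {..<n} B. ennreal (Re (det_kernel K n z)) \<partial>?\<mu>) = (\<integral>\<^sup>+z. ennreal (?I z * Re (det_kernel K n z)) \<partial>?\<mu>)"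
    by (intro nn_integral_cong) (auto simp: indicator_def)
  also have "\<dots> = ennreal (LINT z|?\<mu>. ?I z * Re (det_kernel K n z))"
  proof (rule nn_integral_eq_integral)
    have "integrable ?\<mu> (\<lambda>z. Re (?I z * det_kernel K n z))" using intK by (rule integrable_Re)
    also have "(\<lambda>z. Re (?I z * det_kernel K n z)) = (\<lambda>z. ?I z * Re (det_kernel K n z))" by (auto simp: indicator_def)
    finally show "integrable ?\<mu> (\<lambda>z. ?I z * Re (det_kernel K n z))" .
  qed (auto simp: det_kernel_nonneg)
  finally show thesis using T that unfolding Re by blast
qed

end

end

section \<open>Dyadic cells, and counts of tuples in sets that may overlap\<close>

definition cell :: "nat \<Rightarrow> complex \<Rightarrow> int \<times> int" where
  "cell N z = (\<lfloor>2 ^ N * Re z\<rfloor>, \<lfloor>2 ^ N * Im z\<rfloor>)"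

lemma floor_double_refine:
  fixes x y :: real shows "\<lfloor>2 * x\<rfloor> = \<lfloor>2 * y\<rfloor> \<Longrightarrow> \<lfloor>x\<rfloor> = \<lfloor>y\<rfloor>"
  using floor_divide_real_eq_div[of 2 "2 * x"] floor_divide_real_eq_div[of 2 "2 * y"] by simp

lemma cell_refine: "cell (Suc N) z = cell (Suc N) w \<Longrightarrow> cell N z = cell N w"
  using floor_double_refine[of "2 ^ N * Re z" "2 ^ N * Re w"] floor_double_refine[of "2 ^ N * Im z" "2 ^ N * Im w"]
  by (simp add: cell_def mult.assoc)

lemma cell_refine_le: "N \<le> N' \<Longrightarrow> cell N' z = cell N' w \<Longrightarrow> cell N z = cell N w"
  by (induction N' rule: dec_induct) (auto dest: cell_refine)

lemma floor_separates: assumes "x \<noteq> y" shows "\<exists>N. \<lfloor>2 ^ N * x\<rfloor> \<noteq> \<lfloor>2 ^ N * y :: real\<rfloor>"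
proof -
  obtain N where N: "1 / \<bar>x - y\<bar> < 2 ^ N" using real_arch_pow[of 2 "1 / \<bar>x - y\<bar>"] by auto
  then have "1 < 2 ^ N * \<bar>x - y\<bar>" using assms by (simp add: field_simps)
  also have "\<dots> = \<bar>2 ^ N * x - 2 ^ N * y\<bar>" by (simp add: abs_mult flip: right_diff_distrib)
  finally have "1 < \<bar>2 ^ N * x - 2 ^ N * y\<bar>" .
  then have "\<lfloor>2 ^ N * x\<rfloor> \<noteq> \<lfloor>2 ^ N * y\<rfloor>" by linarith
  then show ?thesis by blast
qed

lemma cell_separates: assumes "z \<noteq> w" shows "\<exists>N. cell N z \<noteq> cell N w"
proof -
  have "Re z \<noteq> Re w \<or> Im z \<noteq> Im w" using assms by (auto simp: complex_eq_iff)
  then show ?thesis using floor_separates[of "Re z" "Re w"] floor_separates[of "Im z" "Im w"] by (auto simp: cell_def)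
qed

lemma inj_on_cell_mono: "N \<le> N' \<Longrightarrow> inj_on (\<lambda>l. cell N (z l)) A \<Longrightarrow> inj_on (\<lambda>l. cell N' (z l)) A"
  unfolding inj_on_def using cell_refine_le by blast

lemma inj_on_cell_eventually:
  assumes "finite A" "inj_on z A" shows "eventually (\<lambda>N. inj_on (\<lambda>l. cell N (z l)) A) sequentially"
proof -
  have "eventually (\<lambda>N. cell N (z i) = cell N (z j) \<longrightarrow> i = j) sequentially" if "i \<in> A" "j \<in> A" for i j
  proof (cases "i = j")
    case False
    then have "z i \<noteq> z j" using assms(2) that by (auto simp: inj_on_def)
    then obtain N where "cell N (z i) \<noteq> cell N (z j)" using cell_separates by blast
    then show ?thesis unfolding eventually_sequentially using cell_refine_le by blast
  qed simp
  then show ?thesis unfolding inj_on_def using assms(1)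
    by (simp add: eventually_ball_finite_distrib)
qed

lemma cell_measurable: "{z. cell N z = q} \<in> sets borel"
proof -
  have "{z. cell N z = q} = {z. \<lfloor>2 ^ N * Re z\<rfloor> = fst q \<and> \<lfloor>2 ^ N * Im z\<rfloor> = snd q}"
    by (auto simp: cell_def prod_eq_iff)
  also have "\<dots> = {z. real_of_int (fst q) \<le> 2 ^ N * Re z \<and> 2 ^ N * Re z < real_of_int (fst q) + 1
      \<and> real_of_int (snd q) \<le> 2 ^ N * Im z \<and> 2 ^ N * Im z < real_of_int (snd q) + 1}"
    by (auto simp: floor_eq_iff)
  also have "\<dots> \<in> sets borel" by measurable
  finally show ?thesis .
qed

lemma finite_cells: "finite (cell N ` ball 0 r)"
proof (rule finite_subset)
  show "cell N ` ball 0 r \<subseteq> {\<lfloor>- (2 ^ N * \<bar>r\<bar>)\<rfloor>..\<lfloor>2 ^ N * \<bar>r\<bar>\<rfloor>} \<times> {\<lfloor>- (2 ^ N * \<bar>r\<bar>)\<rfloor>..\<lfloor>2 ^ N * \<bar>r\<bar>\<rfloor>}"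
  proof
    fix q assume "q \<in> cell N ` ball 0 r"
    then obtain z where z: "q = cell N z" "cmod z < r" by auto
    have *: "\<lfloor>- (2 ^ N * \<bar>r\<bar>)\<rfloor> \<le> \<lfloor>2 ^ N * x\<rfloor> \<and> \<lfloor>2 ^ N * x\<rfloor> \<le> \<lfloor>2 ^ N * \<bar>r\<bar>\<rfloor>" if "\<bar>x\<bar> \<le> cmod z" for x :: real
    proof -
      have "\<bar>2 ^ N * x\<bar> \<le> 2 ^ N * \<bar>r\<bar>" using that z(2) by (simp add: abs_mult)
      then show ?thesis by (intro conjI floor_mono) linarith+
    qed
    show "q \<in> {\<lfloor>- (2 ^ N * \<bar>r\<bar>)\<rfloor>..\<lfloor>2 ^ N * \<bar>r\<bar>\<rfloor>} \<times> {\<lfloor>- (2 ^ N * \<bar>r\<bar>)\<rfloor>..\<lfloor>2 ^ N * \<bar>r\<bar>\<rfloor>}"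
      using *[OF abs_Re_le_cmod] *[OF abs_Im_le_cmod] by (simp add: z(1) cell_def)
  qed
qed simp

lemma num_points_eq_suminf: "num_points X B \<omega> = (\<Sum>k. indicator B (X k \<omega>))"
proof -
  have "num_points X B \<omega> = (\<integral>\<^sup>+k. indicator {k. X k \<omega> \<in> B} k \<partial>count_space UNIV)"
    unfolding num_points_def by (subst nn_integral_indicator) auto
  also have "\<dots> = (\<Sum>k. indicator B (X k \<omega>))" by (subst nn_integral_count_space_nat) (intro suminf_cong, simp add: indicator_def)
  finally show ?thesis .
qed

lemma num_points_measurable:
  assumes "\<And>k. X k \<in> borel_measurable M" "B \<in> sets borel"
  shows "num_points X B \<in> borel_measurable M"
proof -
  have [measurable]: "(\<lambda>\<omega>. indicator B (X k \<omega>) :: ennreal) \<in> borel_measurable M" for k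
    by (rule measurable_compose[OF assms(1) borel_measurable_indicator[OF assms(2)]])
  show ?thesis unfolding num_points_eq_suminf[abs_def] by measurable
qed

lemma num_points_finite:
  assumes "finite {k. X k \<omega> \<in> B}" "A \<subseteq> B"
  shows "num_points X A \<omega> = (\<Sum>k | X k \<omega> \<in> B. indicator A (X k \<omega>))"
  unfolding num_points_eq_suminf using assms by (intro suminf_finite) (auto simp: indicator_def)

text \<open>Ordered tuples of distinct indices: for n copies of one finite set of points this is the
  falling factorial of its size. The value 0 of \<open>card\<close> at infinite sets is harmless, as
  bounded sets almost surely hold finitely many points.\<close>

definition tuple_count :: "(nat \<Rightarrow> 'a \<Rightarrow> complex) \<Rightarrow> nat \<Rightarrow> (nat \<Rightarrow> complex set) \<Rightarrow> 'a \<Rightarrow> nat" where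
  "tuple_count X n B \<omega> = card {t \<in> PiE {..<n} (\<lambda>l. {k. X k \<omega> \<in> B l}). inj_on t {..<n}}"

text \<open>The defining identity concerns disjoint sets only. Splitting into dyadic cells that shrink to
  points extends it to arbitrary bounded sets, with counts of tuples of distinct points; the
  diagonal carries no mass because the determinant vanishes there.\<close>

lemma tuple_count_expectation:
  fixes X :: "nat \<Rightarrow> 'a \<Rightarrow> complex" and D :: "(nat \<Rightarrow> complex) \<Rightarrow> ennreal"
  assumes X: "\<And>k. X k \<in> borel_measurable M" "AE \<omega> in M. inj (\<lambda>k. X k \<omega>)"
    and sets_\<mu>: "sets \<mu> = sets borel"
    and D: "D \<in> borel_measurable (PiM {..<n} (\<lambda>_. \<mu>))" "\<And>z. \<not> inj_on z {..<n} \<Longrightarrow> D z = 0"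
    and B: "\<And>l. l < n \<Longrightarrow> B l \<in> sets borel" "\<And>l. l < n \<Longrightarrow> B l \<subseteq> ball 0 r"
    and fin: "AE \<omega> in M. finite {k. X k \<omega> \<in> ball 0 r}"
    and det: "\<And>A. (\<And>l. l < n \<Longrightarrow> A l \<in> sets borel \<and> bounded (A l)) \<Longrightarrow> disjoint_family_on A {..<n} \<Longrightarrow>
      (\<integral>\<^sup>+\<omega>. (\<Prod>l<n. num_points X (A l) \<omega>) \<partial>M) = (\<integral>\<^sup>+z\<in>PiE {..<n} A. D z \<partial>PiM {..<n} (\<lambda>_. \<mu>))"
  shows "(\<integral>\<^sup>+\<omega>. of_nat (tuple_count X n B \<omega>) \<partial>M) = (\<integral>\<^sup>+z\<in>PiE {..<n} B. D z \<partial>PiM {..<n} (\<lambda>_. \<mu>))"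
proof -
  let ?\<mu> = "PiM {..<n} (\<lambda>_. \<mu>)"
  define Q where "Q N = {q \<in> PiE {..<n} (\<lambda>_. cell N ` ball 0 r). inj_on q {..<n}}" for N
  have finQ: "finite (Q N)" for N
    unfolding Q_def using finite_PiE[of "{..<n}" "\<lambda>_. cell N ` ball 0 r"] finite_cells by auto
  define A where "A N q l = B l \<inter> {z. cell N z = q l}" for N q l
  define F where "F N \<omega> = (\<Sum>q\<in>Q N. \<Prod>l<n. num_points X (A N q l) \<omega>)" for N \<omega>
  define G where "G N z = D z * indicator (PiE {..<n} B) z * of_bool (inj_on (\<lambda>l. cell N (z l)) {..<n})" for N z
  have Asets: "A N q l \<in> sets borel" "bounded (A N q l)" if "l < n" for N q l
    using B[OF that] cell_measurable bounded_subset[OF bounded_ball] unfolding A_def by (auto intro: bounded_subset[OF bounded_ball])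
  have Fm: "F N \<in> borel_measurable M" for N
    unfolding F_def[abs_def] using X(1) Asets
    by (intro borel_measurable_sum borel_measurable_prod_ennreal num_points_measurable) auto
  \<comment> \<open>Exactly one assignment of cells fits the given points; it is among those summed
    over just when the points lie in different cells.\<close>
  have unique: "(\<Sum>q\<in>Q N. \<Prod>l<n. of_bool (cell N (z l) = q l)) = (of_bool (inj_on (\<lambda>l. cell N (z l)) {..<n}) :: ennreal)"
    if z: "\<And>l. l < n \<Longrightarrow> z l \<in> ball 0 r" for z N
  proof -
    define q0 where "q0 = restrict (\<lambda>l. cell N (z l)) {..<n}"
    have eq: "(\<Prod>l<n. of_bool (cell N (z l) = q l)) = (if q = q0 then 1 else (0::ennreal))" if "q \<in> Q N" for q
    proof (cases "q = q0")
      case False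
      have "q \<in> extensional {..<n}" "q0 \<in> extensional {..<n}" using that by (auto simp: Q_def q0_def PiE_iff)
      with False obtain l where "l < n" "q l \<noteq> q0 l" by (meson extensionalityI lessThan_iff)
      then have "(\<Prod>l<n. of_bool (cell N (z l) = q l)) = (0::ennreal)"
        by (intro prod_zero bexI[of _ l]) (auto simp: q0_def)
      then show ?thesis using False by simp
    qed (simp add: q0_def)
    have "(\<Sum>q\<in>Q N. \<Prod>l<n. of_bool (cell N (z l) = q l)) = (\<Sum>q\<in>Q N. if q = q0 then 1 else (0::ennreal))"
      by (rule sum.cong[OF refl eq])
    also have "\<dots> = of_bool (q0 \<in> Q N)" using finQ by (simp add: sum.delta')
    also have "q0 \<in> Q N \<longleftrightarrow> inj_on (\<lambda>l. cell N (z l)) {..<n}"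
      using z by (auto simp: Q_def q0_def inj_on_def)
    finally show ?thesis .
  qed
  have FG: "(\<integral>\<^sup>+\<omega>. F N \<omega> \<partial>M) = (\<integral>\<^sup>+z. G N z \<partial>?\<mu>)" for N
  proof -
    have Pm: "PiE {..<n} (A N q) \<in> sets ?\<mu>" for q
      using Asets sets_\<mu> by (intro sets_PiM_I_finite) auto
    have "(\<integral>\<^sup>+\<omega>. F N \<omega> \<partial>M) = (\<Sum>q\<in>Q N. \<integral>\<^sup>+\<omega>. (\<Prod>l<n. num_points X (A N q l) \<omega>) \<partial>M)"
      unfolding F_def using X(1) Asets by (intro nn_integral_sum borel_measurable_prod_ennreal num_points_measurable) auto
    also have "\<dots> = (\<Sum>q\<in>Q N. \<integral>\<^sup>+z\<in>PiE {..<n} (A N q). D z \<partial>?\<mu>)"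
    proof (intro sum.cong refl det)
      fix q assume "q \<in> Q N"
      then show "disjoint_family_on (A N q) {..<n}" by (auto simp: Q_def disjoint_family_on_def A_def inj_on_def)
    qed (use Asets in auto)
    also have "\<dots> = (\<integral>\<^sup>+z. (\<Sum>q\<in>Q N. D z * indicator (PiE {..<n} (A N q)) z) \<partial>?\<mu>)"
      using D(1) Pm by (intro nn_integral_sum[symmetric] borel_measurable_times borel_measurable_indicator) auto
    also have "\<dots> = (\<integral>\<^sup>+z. G N z \<partial>?\<mu>)"
    proof (rule nn_integral_cong)
      fix z assume z: "z \<in> space ?\<mu>"
      show "(\<Sum>q\<in>Q N. D z * indicator (PiE {..<n} (A N q)) z) = G N z"
      proof (cases "z \<in> PiE {..<n} B")
        case True
        have "(\<Sum>q\<in>Q N. D z * indicator (PiE {..<n} (A N q)) z) = D z * (\<Sum>q\<in>Q N. \<Prod>l<n. of_bool (cell N (z l) = q l))"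
          unfolding sum_distrib_left
        proof (intro sum.cong refl arg_cong2[where f="(*)"])
          fix q
          show "indicator (PiE {..<n} (A N q)) z = (\<Prod>l<n. of_bool (cell N (z l) = q l) :: ennreal)"
          proof (cases "\<forall>l<n. cell N (z l) = q l")
            case True
            then show ?thesis using \<open>z \<in> PiE {..<n} B\<close> by (auto simp: A_def PiE_iff)
          next
            case False
            then obtain l where l: "l < n" "cell N (z l) \<noteq> q l" by blast
            then have "(\<Prod>l<n. of_bool (cell N (z l) = q l)) = (0::ennreal)"
              by (intro prod_zero bexI[of _ l]) auto
            moreover have "z \<notin> PiE {..<n} (A N q)" using l by (auto simp: A_def PiE_iff)
            ultimately show ?thesis by simp
          qed
        qed
        also have "\<dots> = D z * of_bool (inj_on (\<lambda>l. cell N (z l)) {..<n})"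
        proof -
          have "z l \<in> ball 0 r" if "l < n" for l using True B(2)[OF that] that by (auto simp: PiE_iff)
          from unique[OF this] show ?thesis by simp
        qed
        finally show ?thesis using True by (simp add: G_def)
      next
        case False
        then have "z \<notin> PiE {..<n} (A N q)" for q by (auto simp: A_def PiE_iff)
        then show ?thesis using False by (simp add: G_def)
      qed
    qed
    finally show ?thesis .
  qed
  have Gm: "G N \<in> borel_measurable ?\<mu>" for N
  proof -
    have Bs: "PiE {..<n} B \<in> sets ?\<mu>" using B(1) sets_\<mu> by (intro sets_PiM_I_finite) auto
    have cellm: "cell N \<in> measurable borel (count_space UNIV)"
      using cell_measurable by (intro measurable_count_space_eq_countable[THEN iffD2]) (auto simp: vimage_def)
    have comp: "(\<lambda>z. cell N (z l)) \<in> measurable ?\<mu> (count_space UNIV)" if "l < n" for l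
    proof -
      have "(\<lambda>z. z l) \<in> measurable ?\<mu> borel"
        using measurable_component_singleton[of l "{..<n}" "\<lambda>_. \<mu>"] that by (simp add: measurable_cong_sets[OF refl sets_\<mu>])
      then show ?thesis by (rule measurable_compose[OF _ cellm])
    qed
    have eqm: "Measurable.pred ?\<mu> (\<lambda>z. cell N (z i) = cell N (z j))" if "i < n" "j < n" for i j
      using comp[OF that(1)] comp[OF that(2)] by measurable
    have "Measurable.pred ?\<mu> (\<lambda>z. \<forall>i\<in>{..<n}. \<forall>j\<in>{..<n}. cell N (z i) = cell N (z j) \<longrightarrow> i = j)"
      using eqm by (intro pred_intros_finite pred_intros_logic) auto
    then have "{z \<in> space ?\<mu>. inj_on (\<lambda>l. cell N (z l)) {..<n}} \<in> sets ?\<mu>" by (simp add: inj_on_def pred_def)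
    then have "(\<lambda>z. D z * indicator (PiE {..<n} B) z * indicator {z \<in> space ?\<mu>. inj_on (\<lambda>l. cell N (z l)) {..<n}} z) \<in> borel_measurable ?\<mu>"
      using D(1) Bs by (intro borel_measurable_times_ennreal borel_measurable_indicator) auto
    then show ?thesis by (rule measurable_cong[THEN iffD1, rotated]) (auto simp: G_def indicator_def)
  qed
  have Glim: "(\<lambda>N. \<integral>\<^sup>+z. G N z \<partial>?\<mu>) \<longlonglongrightarrow> (\<integral>\<^sup>+z\<in>PiE {..<n} B. D z \<partial>?\<mu>)"
  proof (rule nn_integral_LIMSEQ)
    show "incseq G" unfolding incseq_def le_fun_def G_def
      using inj_on_cell_mono by (auto intro!: mult_left_mono)
    fix z
    show "(\<lambda>N. G N z) \<longlonglongrightarrow> D z * indicator (PiE {..<n} B) z"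
    proof (cases "inj_on z {..<n}")
      case True
      have "eventually (\<lambda>N. G N z = D z * indicator (PiE {..<n} B) z) sequentially"
        using inj_on_cell_eventually[OF finite_lessThan True] by (rule eventually_mono) (simp add: G_def)
      then show ?thesis by (rule tendsto_eventually)
    next
      case False
      then show ?thesis using D(2) by (simp add: G_def)
    qed
  qed (rule Gm)
  \<comment> \<open>The cell sum rewritten over index tuples. A tuple is counted once its points lie
    in different cells, which happens from some level on for distinct indices since the points are
    almost surely distinct, and never for repeated ones.\<close>
  define H where "H N \<omega> = (\<Sum>t\<in>PiE {..<n} (\<lambda>l. {k. X k \<omega> \<in> B l}). of_bool (inj_on (\<lambda>l. cell N (X (t l) \<omega>)) {..<n}) :: ennreal)" for N \<omega>
  have finB: "finite {k. X k \<omega> \<in> B l}" if "finite {k. X k \<omega> \<in> ball 0 r}" "l < n" for \<omega> l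
    using B(2)[OF that(2)] by (intro finite_subset[OF _ that(1)]) auto
  have FH: "F N \<omega> = H N \<omega>" if \<omega>: "finite {k. X k \<omega> \<in> ball 0 r}" for N \<omega>
  proof -
    have "F N \<omega> = (\<Sum>q\<in>Q N. \<Prod>l<n. \<Sum>k | X k \<omega> \<in> B l. of_bool (cell N (X k \<omega>) = q l))"
      unfolding F_def
    proof (intro sum.cong prod.cong refl)
      fix q l assume "l \<in> {..<n}"
      then have "num_points X (A N q l) \<omega> = (\<Sum>k | X k \<omega> \<in> B l. indicator (A N q l) (X k \<omega>))"
        using finB[OF \<omega>] by (intro num_points_finite) (auto simp: A_def)
      also have "\<dots> = (\<Sum>k | X k \<omega> \<in> B l. of_bool (cell N (X k \<omega>) = q l))"
        by (intro sum.cong) (auto simp: A_def indicator_def)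
      finally show "num_points X (A N q l) \<omega> = (\<Sum>k | X k \<omega> \<in> B l. of_bool (cell N (X k \<omega>) = q l))" .
    qed
    also have "\<dots> = (\<Sum>q\<in>Q N. \<Sum>t\<in>PiE {..<n} (\<lambda>l. {k. X k \<omega> \<in> B l}). \<Prod>l<n. of_bool (cell N (X (t l) \<omega>) = q l))"
      using finB[OF \<omega>] by (subst prod_sum_PiE) auto
    also have "\<dots> = (\<Sum>t\<in>PiE {..<n} (\<lambda>l. {k. X k \<omega> \<in> B l}). \<Sum>q\<in>Q N. \<Prod>l<n. of_bool (cell N (X (t l) \<omega>) = q l))"
      by (rule sum.swap)
    also have "\<dots> = H N \<omega>" unfolding H_def
      using B(2) by (intro sum.cong refl unique) (fastforce simp: PiE_iff)
    finally show ?thesis .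
  qed
  have Flim: "AE \<omega> in M. (\<lambda>N. F N \<omega>) \<longlonglongrightarrow> of_nat (tuple_count X n B \<omega>)"
    using X(2) fin
  proof eventually_elim
    case (elim \<omega>)
    let ?T = "PiE {..<n} (\<lambda>l. {k. X k \<omega> \<in> B l})"
    have finT: "finite ?T" using finB[OF elim(2)] by (intro finite_PiE) auto
    have "(\<lambda>N. H N \<omega>) \<longlonglongrightarrow> (\<Sum>t\<in>?T. of_bool (inj_on t {..<n}))"
      unfolding H_def
    proof (intro tendsto_sum)
      fix t
      show "(\<lambda>N. of_bool (inj_on (\<lambda>l. cell N (X (t l) \<omega>)) {..<n}) :: ennreal) \<longlonglongrightarrow> of_bool (inj_on t {..<n})"
      proof (cases "inj_on t {..<n}")
        case True
        have "inj_on (\<lambda>l. X (t l) \<omega>) {..<n}" using True elim(1) by (auto simp: inj_on_def inj_def)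
        from inj_on_cell_eventually[OF finite_lessThan this] show ?thesis
          by (intro tendsto_eventually) (rule eventually_mono, use True in simp_all)
      next
        case False
        then have "\<not> inj_on (\<lambda>l. cell N (X (t l) \<omega>)) {..<n}" for N
          unfolding inj_on_def by metis
        then show ?thesis using False by simp
      qed
    qed
    also have "(\<Sum>t\<in>?T. of_bool (inj_on t {..<n}) :: ennreal) = of_nat (tuple_count X n B \<omega>)"
      using finT by (simp add: tuple_count_def sum_of_bool_eq Int_def)
    finally show ?case using FH[OF elim(2)] by simp
  qed
  have Finc: "AE \<omega> in M. incseq (\<lambda>N. F N \<omega>)"
    using fin
  proof eventually_elim
    case (elim \<omega>)
    then show ?case unfolding incseq_def FH[OF elim] H_def
      using inj_on_cell_mono by (auto intro!: sum_mono)
  qed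
  have "(\<lambda>N. \<integral>\<^sup>+\<omega>. F N \<omega> \<partial>M) \<longlonglongrightarrow> (\<integral>\<^sup>+\<omega>. of_nat (tuple_count X n B \<omega>) \<partial>M)"
  proof -
    have "(\<integral>\<^sup>+\<omega>. (SUP N. F N \<omega>) \<partial>M) = (SUP N. \<integral>\<^sup>+\<omega>. F N \<omega> \<partial>M)"
      using Finc Fm by (intro nn_integral_monotone_convergence_SUP_AE) (auto simp: incseq_def elim!: eventually_mono)
    moreover have "(\<integral>\<^sup>+\<omega>. (SUP N. F N \<omega>) \<partial>M) = (\<integral>\<^sup>+\<omega>. of_nat (tuple_count X n B \<omega>) \<partial>M)"
    proof (rule nn_integral_cong_AE, use Finc Flim in eventually_elim)
      case (elim \<omega>)
      show ?case by (rule LIMSEQ_unique[OF LIMSEQ_SUP[OF elim(1)] elim(2)])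
    qed
    moreover have "incseq (\<lambda>N. \<integral>\<^sup>+\<omega>. F N \<omega> \<partial>M)"
    proof (rule incseq_SucI)
      fix N show "(\<integral>\<^sup>+\<omega>. F N \<omega> \<partial>M) \<le> (\<integral>\<^sup>+\<omega>. F (Suc N) \<omega> \<partial>M)"
        using Finc by (intro nn_integral_mono_AE) (auto simp: incseq_def elim!: eventually_mono)
    qed
    ultimately show ?thesis using LIMSEQ_SUP[of "\<lambda>N. \<integral>\<^sup>+\<omega>. F N \<omega> \<partial>M"] by simp
  qed
  then show ?thesis using Glim unfolding FG by (rule LIMSEQ_unique)
qed

section \<open>Sums over injective tuples of length at most four, and falling factorials\<close>

lemma sum_inj_PiE_Suc:
  fixes f :: "(nat \<Rightarrow> 'b) \<Rightarrow> 'c :: comm_monoid_add"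
  assumes fin: "\<And>l. l \<le> n \<Longrightarrow> finite (A l)"
  shows "(\<Sum>k | k \<in> PiE {..<Suc n} A \<and> inj_on k {..<Suc n}. f k)
    = (\<Sum>k | k \<in> PiE {..<n} A \<and> inj_on k {..<n}. \<Sum>j\<in>A n - k ` {..<n}. f (k(n := j)))"
proof -
  let ?S = "{k. k \<in> PiE {..<n} A \<and> inj_on k {..<n}}"
  have finS: "finite ?S" using finite_PiE[of "{..<n}" A] fin by auto
  have "(\<Sum>k\<in>?S. \<Sum>j\<in>A n - k ` {..<n}. f (k(n := j))) = (\<Sum>(k, j)\<in>Sigma ?S (\<lambda>k. A n - k ` {..<n}). f (k(n := j)))"
    using finS fin by (intro sum.Sigma) auto
  also have "\<dots> = (\<Sum>k | k \<in> PiE {..<Suc n} A \<and> inj_on k {..<Suc n}. f k)"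
  proof (rule sum.reindex_bij_witness[where i="\<lambda>k. (restrict k {..<n}, k n)" and j="\<lambda>(k, j). k(n := j)"])
    fix x assume "x \<in> Sigma ?S (\<lambda>k. A n - k ` {..<n})"
    then obtain k j where x: "x = (k, j)" "k \<in> PiE {..<n} A" "inj_on k {..<n}" "j \<in> A n" "j \<notin> k ` {..<n}" by auto
    show "(\<lambda>k. (restrict k {..<n}, k n)) ((\<lambda>(k, j). k(n := j)) x) = x"
      using x by (auto simp: fun_eq_iff PiE_iff extensional_def restrict_def)
    show "(\<lambda>(k, j). k(n := j)) x \<in> {k. k \<in> PiE {..<Suc n} A \<and> inj_on k {..<Suc n}}"
      using x by (auto simp: PiE_iff extensional_def lessThan_Suc inj_on_def less_Suc_eq)
    show "f ((\<lambda>(k, j). k(n := j)) x) = (case x of (k, j) \<Rightarrow> f (k(n := j)))" by (simp add: x)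
  next
    fix k assume "k \<in> {k. k \<in> PiE {..<Suc n} A \<and> inj_on k {..<Suc n}}"
    then have k: "k \<in> PiE {..<Suc n} A" "inj_on k {..<Suc n}" by auto
    show "(\<lambda>(k, j). k(n := j)) (restrict k {..<n}, k n) = k"
      using k by (auto simp: fun_eq_iff PiE_iff extensional_def restrict_def)
    have "inj_on (restrict k {..<n}) {..<n}" using k(2) by (auto simp: inj_on_def)
    moreover have "k n \<notin> restrict k {..<n} ` {..<n}"
    proof
      assume "k n \<in> restrict k {..<n} ` {..<n}"
      then obtain l where "l < n" "k n = k l" by auto
      then show False using inj_onD[OF k(2), of n l] by simp
    qed
    moreover have "restrict k {..<n} \<in> PiE {..<n} A" "k n \<in> A n" using k(1) by (auto simp: PiE_iff)
    ultimately show "(restrict k {..<n}, k n) \<in> Sigma ?S (\<lambda>k. A n - k ` {..<n})" by simp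
  qed
  finally show ?thesis by simp
qed

lemma sum_inj_PiE_0:
  "(\<Sum>k | k \<in> PiE {..<0::nat} A \<and> inj_on k {..<0}. f k) = (f (\<lambda>_. undefined) :: 'c :: comm_monoid_add)"
  by (simp add: PiE_empty_domain)

lemma sum_inj_1:
  fixes f :: "nat \<Rightarrow> 'b \<Rightarrow> 'c :: comm_semiring_1"
  assumes "\<And>l. finite (A l)"
  shows "(\<Sum>k | k \<in> PiE {..<Suc 0} A \<and> inj_on k {..<Suc 0}. \<Prod>l<Suc 0. f l (k l)) = (\<Sum>i\<in>A 0. f 0 i)"
  by (subst sum_inj_PiE_Suc[OF assms], subst sum_inj_PiE_0) simp

lemma sum_inj_2:
  fixes f :: "nat \<Rightarrow> 'b \<Rightarrow> 'c :: comm_semiring_1"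
  assumes "\<And>l. finite (A l)"
  shows "(\<Sum>k | k \<in> PiE {..<Suc (Suc 0)} A \<and> inj_on k {..<Suc (Suc 0)}. \<Prod>l<Suc (Suc 0). f l (k l))
    = (\<Sum>i\<in>A 0. \<Sum>j\<in>A 1 - {i}. f 0 i * f 1 j)"
  by (subst sum_inj_PiE_Suc[OF assms], subst sum_inj_PiE_Suc[OF assms], subst sum_inj_PiE_0) (simp add: lessThan_Suc insert_commute mult_ac)

lemma sum_inj_3:
  fixes f :: "nat \<Rightarrow> 'b \<Rightarrow> 'c :: comm_semiring_1"
  assumes "\<And>l. finite (A l)"
  shows "(\<Sum>k | k \<in> PiE {..<Suc (Suc (Suc 0))} A \<and> inj_on k {..<Suc (Suc (Suc 0))}. \<Prod>l<Suc (Suc (Suc 0)). f l (k l))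
    = (\<Sum>i\<in>A 0. \<Sum>j\<in>A 1 - {i}. \<Sum>k\<in>A 2 - {i, j}. f 0 i * f 1 j * f 2 k)"
  by (subst sum_inj_PiE_Suc[OF assms], subst sum_inj_PiE_Suc[OF assms], subst sum_inj_PiE_Suc[OF assms], subst sum_inj_PiE_0)
     (simp add: lessThan_Suc insert_commute mult_ac numeral_2_eq_2)

lemma sum_inj_4:
  fixes f :: "nat \<Rightarrow> 'b \<Rightarrow> 'c :: comm_semiring_1"
  assumes "\<And>l. finite (A l)"
  shows "(\<Sum>k | k \<in> PiE {..<Suc (Suc (Suc (Suc 0)))} A \<and> inj_on k {..<Suc (Suc (Suc (Suc 0)))}. \<Prod>l<Suc (Suc (Suc (Suc 0))). f l (k l))
    = (\<Sum>i\<in>A 0. \<Sum>j\<in>A 1 - {i}. \<Sum>k\<in>A 2 - {i, j}. \<Sum>l\<in>A 3 - {i, j, k}. f 0 i * f 1 j * f 2 k * f 3 l)"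
  by (subst sum_inj_PiE_Suc[OF assms], subst sum_inj_PiE_Suc[OF assms], subst sum_inj_PiE_Suc[OF assms], subst sum_inj_PiE_Suc[OF assms], subst sum_inj_PiE_0)
     (simp add: lessThan_Suc insert_commute mult_ac numeral_2_eq_2 numeral_3_eq_3)

lemma card_inj_sum:
  assumes "\<And>l. finite (T l)"
  shows "real (card {t \<in> PiE {..<n} T. inj_on t {..<n}}) = (\<Sum>t | t \<in> PiE {..<n} T \<and> inj_on t {..<n}. \<Prod>l<n. 1)"
  using finite_PiE[of "{..<n}" T] assms by simp

lemma sum_const_Diff: "finite T \<Longrightarrow> i \<in> T \<Longrightarrow> (\<Sum>j\<in>T - {i}. x) = (real (card T) - 1) * x"
  by (cases "card T") (auto simp: card_Diff_singleton of_nat_diff)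

lemma card_inj_2:
  assumes "finite T"
  shows "real (card {t \<in> PiE {..<Suc (Suc 0)} (\<lambda>_. T). inj_on t {..<Suc (Suc 0)}}) = real (card T) * (real (card T) - 1)"
  unfolding card_inj_sum[OF assms] sum_inj_2[where f="\<lambda>_ _. 1" and A="\<lambda>_. T", OF assms]
  using assms by (simp add: sum_const_Diff[OF assms] del: sum_constant cong: sum.cong) simp

lemma sum_const_Diff2: "finite T \<Longrightarrow> i \<in> T \<Longrightarrow> j \<in> T - {i} \<Longrightarrow> (\<Sum>k\<in>T - {i, j}. x) = (real (card T) - 2) * x"
proof -
  assume a: "finite T" "i \<in> T" "j \<in> T - {i}"
  then have "card (T - {i, j}) = card T - 2" by (subst card_Diff_subset) auto
  moreover have "card {i, j} \<le> card T" using a by (intro card_mono) auto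
  moreover have "card {i, j} = 2" using a by auto
  ultimately show ?thesis using a by (simp add: of_nat_diff)
qed

lemma sum_const_Diff3:
  "finite T \<Longrightarrow> i \<in> T \<Longrightarrow> j \<in> T - {i} \<Longrightarrow> k \<in> T - {i, j} \<Longrightarrow> (\<Sum>l\<in>T - {i, j, k}. x) = (real (card T) - 3) * x"
proof -
  assume a: "finite T" "i \<in> T" "j \<in> T - {i}" "k \<in> T - {i, j}"
  then have "card (T - {i, j, k}) = card T - 3" by (subst card_Diff_subset) auto
  moreover have "card {i, j, k} \<le> card T" using a by (intro card_mono) auto
  moreover have "card {i, j, k} = 3" using a by auto
  ultimately show ?thesis using a by (simp add: of_nat_diff)
qed

lemma card_inj_3:
  assumes "finite T"
  shows "real (card {t \<in> PiE {..<Suc (Suc (Suc 0))} (\<lambda>_. T). inj_on t {..<Suc (Suc (Suc 0))}})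
    = real (card T) * (real (card T) - 1) * (real (card T) - 2)"
proof -
  have "real (card {t \<in> PiE {..<Suc (Suc (Suc 0))} (\<lambda>_. T). inj_on t {..<Suc (Suc (Suc 0))}})
    = (\<Sum>i\<in>T. \<Sum>j\<in>T - {i}. \<Sum>k\<in>T - {i, j}. 1 * 1 * 1)"
    unfolding card_inj_sum[OF assms] by (rule sum_inj_3[where f="\<lambda>_ _. 1" and A="\<lambda>_. T", OF assms])
  also have "\<dots> = (\<Sum>i\<in>T. \<Sum>j\<in>T - {i}. real (card T) - 2)"
    by (intro sum.cong refl) (subst sum_const_Diff2[OF assms], auto)
  also have "\<dots> = (\<Sum>i\<in>T. (real (card T) - 1) * (real (card T) - 2))"
    by (intro sum.cong refl sum_const_Diff[OF assms])
  finally show ?thesis by simp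
qed

lemma card_inj_4:
  assumes "finite T"
  shows "real (card {t \<in> PiE {..<Suc (Suc (Suc (Suc 0)))} (\<lambda>_. T). inj_on t {..<Suc (Suc (Suc (Suc 0)))}})
    = real (card T) * (real (card T) - 1) * (real (card T) - 2) * (real (card T) - 3)"
proof -
  have "real (card {t \<in> PiE {..<Suc (Suc (Suc (Suc 0)))} (\<lambda>_. T). inj_on t {..<Suc (Suc (Suc (Suc 0)))}})
    = (\<Sum>i\<in>T. \<Sum>j\<in>T - {i}. \<Sum>k\<in>T - {i, j}. \<Sum>l\<in>T - {i, j, k}. 1 * 1 * 1 * 1)"
    unfolding card_inj_sum[OF assms] by (rule sum_inj_4[where f="\<lambda>_ _. 1" and A="\<lambda>_. T", OF assms])
  also have "\<dots> = (\<Sum>i\<in>T. \<Sum>j\<in>T - {i}. \<Sum>k\<in>T - {i, j}. real (card T) - 3)"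
    by (intro sum.cong refl) (subst sum_const_Diff3[OF assms], auto)
  also have "\<dots> = (\<Sum>i\<in>T. \<Sum>j\<in>T - {i}. (real (card T) - 2) * (real (card T) - 3))"
    by (intro sum.cong refl sum_const_Diff2[OF assms])
  also have "\<dots> = (\<Sum>i\<in>T. (real (card T) - 1) * ((real (card T) - 2) * (real (card T) - 3)))"
    by (intro sum.cong refl sum_const_Diff[OF assms])
  finally show ?thesis by (simp add: mult.assoc)
qed

text \<open>Two places for each set: for disjoint sets the tuple count of order four is then the
  product of the two numbers of ordered pairs.\<close>

definition pair_bins :: "'b \<Rightarrow> 'b \<Rightarrow> nat \<Rightarrow> 'b" where "pair_bins B B' l = (if l < 2 then B else B')"

lemma pair_bins_simps: "pair_bins B B' 0 = B" "pair_bins B B' 1 = B" "pair_bins B B' 2 = B'" "pair_bins B B' 3 = B'"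
  by (simp_all add: pair_bins_def)

lemma card_inj_pairs:
  assumes "finite T" "finite T'" "T \<inter> T' = {}"
  shows "real (card {t \<in> PiE {..<Suc (Suc (Suc (Suc 0)))} (pair_bins T T'). inj_on t {..<Suc (Suc (Suc (Suc 0)))}})
    = (real (card T) * (real (card T) - 1)) * (real (card T') * (real (card T') - 1))"
proof -
  have fin: "finite (pair_bins T T' l)" for l using assms by (simp add: pair_bins_def)
  have "real (card {t \<in> PiE {..<Suc (Suc (Suc (Suc 0)))} (pair_bins T T'). inj_on t {..<Suc (Suc (Suc (Suc 0)))}})
    = (\<Sum>i\<in>T. \<Sum>j\<in>T - {i}. \<Sum>k\<in>T' - {i, j}. \<Sum>l\<in>T' - {i, j, k}. 1 * 1 * 1 * 1)"
    unfolding card_inj_sum[OF fin] using sum_inj_4[where f="\<lambda>_ _. 1 :: real" and A="pair_bins T T'", OF fin]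
    by (simp only: pair_bins_simps)
  also have "\<dots> = (\<Sum>i\<in>T. \<Sum>j\<in>T - {i}. \<Sum>k\<in>T'. \<Sum>l\<in>T' - {k}. 1)"
  proof (intro sum.cong refl)
    fix i j assume "i \<in> T" "j \<in> T - {i}"
    then show "T' - {i, j} = T'" using assms(3) by auto
    fix k show "T' - {i, j, k} = T' - {k}" using \<open>i \<in> T\<close> \<open>j \<in> T - {i}\<close> assms(3) by auto
  qed simp
  also have "\<dots> = (\<Sum>i\<in>T. \<Sum>j\<in>T - {i}. real (card T') * (real (card T') - 1))"
  proof (intro sum.cong refl)
    have "(\<Sum>k\<in>T'. \<Sum>l\<in>T' - {k}. 1) = (\<Sum>k\<in>T'. (real (card T') - 1) * 1)"
      by (intro sum.cong refl sum_const_Diff[OF assms(2)])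
    then show "(\<Sum>k\<in>T'. \<Sum>l\<in>T' - {k}. 1) = real (card T') * (real (card T') - 1)" by simp
  qed
  also have "\<dots> = (\<Sum>i\<in>T. (real (card T) - 1) * (real (card T') * (real (card T') - 1)))"
    by (intro sum.cong refl sum_const_Diff[OF assms(1)])
  finally show ?thesis by (simp add: mult.assoc)
qed

section \<open>Factorial moments of the determinantal process and inequalities between them\<close>

locale determinantal_moments = radial_moments +
  fixes K :: "complex \<Rightarrow> complex \<Rightarrow> complex" and M :: "'a measure" and X :: "nat \<Rightarrow> 'a \<Rightarrow> complex"
  assumes K: "reproducing_kernel (fock_space \<mu>) \<mu> K"
    and prob_M: "prob_space M"
    and process: "determinantal_process M X K \<mu>"
begin

sublocale M: prob_space M by (rule prob_M)

lemma X_measurable[measurable]: "X k \<in> borel_measurable M"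
  using process by (simp add: determinantal_process_def)

lemma X_inj: "AE \<omega> in M. inj (\<lambda>k. X k \<omega>)"
  using process by (simp add: determinantal_process_def)

lemma process_identity:
  assumes "\<And>l. l < n \<Longrightarrow> A l \<in> sets borel \<and> bounded (A l)" "disjoint_family_on A {..<n}"
  shows "(\<integral>\<^sup>+\<omega>. (\<Prod>l<n. num_points X (A l) \<omega>) \<partial>M) = (\<integral>\<^sup>+z\<in>PiE {..<n} A. ennreal (Re (det_kernel K n z)) \<partial>PiM {..<n} (\<lambda>_. \<mu>))"
  using process assms unfolding determinantal_process_def det_kernel_def by blast

text \<open>The first moment of the count in a disk is finite, by the case n = 1.\<close>

lemma finite_points: "AE \<omega> in M. finite {k. X k \<omega> \<in> ball 0 r}"
proof -
  obtain L where L: "(\<integral>\<^sup>+z\<in>PiE {..<1} (\<lambda>_. ball 0 r). ennreal (Re (det_kernel K 1 z)) \<partial>PiM {..<1} (\<lambda>_. \<mu>)) = ennreal L"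
    using det_integral_limit[OF K, of 1 "\<lambda>_. ball 0 r" r] circled_ball by blast
  have "(\<integral>\<^sup>+\<omega>. num_points X (ball 0 r) \<omega> \<partial>M) = ennreal L"
    using process_identity[of 1 "\<lambda>_. ball 0 r"] L by (simp add: disjoint_family_on_def)
  then have "AE \<omega> in M. num_points X (ball 0 r) \<omega> \<noteq> \<infinity>"
    by (intro nn_integral_PInf_AE num_points_measurable) auto
  then show ?thesis
    by eventually_elim (auto simp: num_points_def emeasure_count_space split: if_splits)
qed

lemma finite_points_subset: "B \<subseteq> ball 0 r \<Longrightarrow> AE \<omega> in M. finite {k. X k \<omega> \<in> B}"
  using finite_points[of r] by (rule eventually_mono) (auto elim!: finite_subset[rotated])

lemma tuple_moment:
  assumes B: "\<And>l. l < n \<Longrightarrow> circled (B l)" "\<And>l. l < n \<Longrightarrow> B l \<subseteq> ball 0 r"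
  obtains L where "L \<ge> 0" "(\<integral>\<^sup>+\<omega>. of_nat (tuple_count X n B \<omega>) \<partial>M) = ennreal L"
    "(\<lambda>m. \<Sum>k | k \<in> PiE {..<n} (\<lambda>_. {..<m}) \<and> inj_on k {..<n}. \<Prod>l<n. a (k l) (B l)) \<longlonglongrightarrow> L"
proof -
  obtain L where L: "(\<integral>\<^sup>+z\<in>PiE {..<n} B. ennreal (Re (det_kernel K n z)) \<partial>PiM {..<n} (\<lambda>_. \<mu>)) = ennreal L"
    "(\<lambda>m. \<Sum>k | k \<in> PiE {..<n} (\<lambda>_. {..<m}) \<and> inj_on k {..<n}. \<Prod>i<n. a (k i) (B i)) \<longlonglongrightarrow> L"
    by (rule det_integral_limit[OF K, of n B r]) (use B in auto)
  have "(\<integral>\<^sup>+\<omega>. of_nat (tuple_count X n B \<omega>) \<partial>M) = (\<integral>\<^sup>+z\<in>PiE {..<n} B. ennreal (Re (det_kernel K n z)) \<partial>PiM {..<n} (\<lambda>_. \<mu>))"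
  proof (rule tuple_count_expectation[OF X_measurable X_inj sets_\<mu>, where r=r])
    show "(\<lambda>z. ennreal (Re (det_kernel K n z))) \<in> borel_measurable (PiM {..<n} (\<lambda>_. \<mu>))"
      using det_kernel_measurable[OF K, of n] by measurable
    show "ennreal (Re (det_kernel K n z)) = 0" if "\<not> inj_on z {..<n}" for z
      using det_kernel_not_inj[OF K that] by simp
    show "B l \<in> sets borel" if "l < n" for l using circled_borel[OF B(1)[OF that]] .
    show "B l \<subseteq> ball 0 r" if "l < n" for l using B(2)[OF that] .
    show "AE \<omega> in M. finite {k. X k \<omega> \<in> ball 0 r}" by (rule finite_points)
  qed (auto intro!: process_identity)
  moreover have "0 \<le> L"
    by (rule LIMSEQ_le_const[OF L(2)]) (auto intro!: sum_nonneg prod_nonneg a_nonneg)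
  ultimately show thesis using L that by simp
qed

definition N :: "complex set \<Rightarrow> 'a \<Rightarrow> real" where "N B \<omega> = real (card {k. X k \<omega> \<in> B})"

lemma N_measurable: "B \<in> sets borel \<Longrightarrow> N B \<in> borel_measurable M"
proof -
  assume "B \<in> sets borel"
  then have "(\<lambda>\<omega>. enn2real (num_points X B \<omega>)) \<in> borel_measurable M"
    using num_points_measurable[of X M B] by measurable
  \<comment> \<open>This includes infinite counts: \<open>enn2real\<close> of top and
    \<open>card\<close> of an infinite set are both 0.\<close>
  moreover have "enn2real (num_points X B \<omega>) = N B \<omega>" for \<omega>
    by (cases "finite {k. X k \<omega> \<in> B}") (auto simp: num_points_def N_def)
  ultimately show ?thesis by simp
qed

definition mean :: "complex set \<Rightarrow> real" where "mean B = (LINT \<omega>|M. N B \<omega>)"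
definition pair_mean :: "complex set \<Rightarrow> real" where "pair_mean B = (LINT \<omega>|M. N B \<omega> * (N B \<omega> - 1))"

lemma moment_transfer:
  assumes f: "f \<in> borel_measurable M" "AE \<omega> in M. f \<omega> = real (tuple_count X n B \<omega>)"
    and L: "(\<integral>\<^sup>+\<omega>. of_nat (tuple_count X n B \<omega>) \<partial>M) = ennreal L" "L \<ge> 0"
  shows "integrable M f" "(LINT \<omega>|M. f \<omega>) = L"
proof -
  have n: "(\<integral>\<^sup>+\<omega>. ennreal (f \<omega>) \<partial>M) = ennreal L"
    unfolding L(1)[symmetric] using f(2) by (intro nn_integral_cong_AE) (auto elim!: eventually_mono simp: ennreal_of_nat_eq_real_of_nat)
  have pos: "AE \<omega> in M. 0 \<le> f \<omega>" using f(2) by eventually_elim simp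
  show "integrable M f" using f(1) pos n by (intro integrableI_nn_integral_finite[where x=L]) auto
  show "(LINT \<omega>|M. f \<omega>) = L" using integral_eq_nn_integral[OF f(1) pos] n L(2) by simp
qed

context
  fixes B r assumes B: "circled B" "B \<subseteq> ball 0 r"
begin

lemma finite_bin: "AE \<omega> in M. finite {k. X k \<omega> \<in> B}"
  by (rule finite_points_subset[OF B(2)])

lemma mean_limit: "integrable M (N B)" "(\<lambda>m. \<Sum>k<m. a k B) \<longlonglongrightarrow> mean B"
proof -
  obtain L where L: "L \<ge> 0" "(\<integral>\<^sup>+\<omega>. of_nat (tuple_count X (Suc 0) (\<lambda>_. B) \<omega>) \<partial>M) = ennreal L"
    "(\<lambda>m. \<Sum>k | k \<in> PiE {..<Suc 0} (\<lambda>_. {..<m}) \<and> inj_on k {..<Suc 0}. \<Prod>l<Suc 0. a (k l) B) \<longlonglongrightarrow> L"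
    using tuple_moment[of "Suc 0" "\<lambda>_. B" r] B by blast
  have "AE \<omega> in M. N B \<omega> = real (tuple_count X (Suc 0) (\<lambda>_. B) \<omega>)"
    using finite_bin
  proof eventually_elim
    case (elim \<omega>)
    show ?case unfolding tuple_count_def card_inj_sum[OF elim]
      using sum_inj_1[of "\<lambda>_. {k. X k \<omega> \<in> B}" "\<lambda>_ _. 1::real"] elim by (simp add: N_def)
  qed
  from moment_transfer[OF N_measurable[OF circled_borel[OF B(1)]] this L(2,1)]
  have i: "integrable M (N B)" "L = mean B" by (auto simp: mean_def)
  then show "integrable M (N B)" by simp
  have "(\<Sum>k | k \<in> PiE {..<Suc 0} (\<lambda>_. {..<m}) \<and> inj_on k {..<Suc 0}. \<Prod>l<Suc 0. a (k l) B) = (\<Sum>k<m. a k B)" for m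
    by (rule sum_inj_1[of "\<lambda>_. {..<m}" "\<lambda>_ k. a k B"]) simp
  then show "(\<lambda>m. \<Sum>k<m. a k B) \<longlonglongrightarrow> mean B" using L(3) i(2) by simp
qed

lemma pair_limit:
  "integrable M (\<lambda>\<omega>. N B \<omega> * (N B \<omega> - 1))"
  "(\<lambda>m. \<Sum>i<m. \<Sum>j\<in>{..<m} - {i}. a i B * a j B) \<longlonglongrightarrow> pair_mean B"
proof -
  obtain L where L: "L \<ge> 0" "(\<integral>\<^sup>+\<omega>. of_nat (tuple_count X (Suc (Suc 0)) (\<lambda>_. B) \<omega>) \<partial>M) = ennreal L"
    "(\<lambda>m. \<Sum>k | k \<in> PiE {..<Suc (Suc 0)} (\<lambda>_. {..<m}) \<and> inj_on k {..<Suc (Suc 0)}. \<Prod>l<Suc (Suc 0). a (k l) B) \<longlonglongrightarrow> L"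
    using tuple_moment[of "Suc (Suc 0)" "\<lambda>_. B" r] B by blast
  note [measurable] = N_measurable[OF circled_borel[OF B(1)]]
  have m: "(\<lambda>\<omega>. N B \<omega> * (N B \<omega> - 1)) \<in> borel_measurable M" by measurable
  have "AE \<omega> in M. N B \<omega> * (N B \<omega> - 1) = real (tuple_count X (Suc (Suc 0)) (\<lambda>_. B) \<omega>)"
    using finite_bin by eventually_elim (simp add: tuple_count_def card_inj_2 N_def)
  from moment_transfer[OF m this L(2,1)]
  have i: "integrable M (\<lambda>\<omega>. N B \<omega> * (N B \<omega> - 1))" "L = pair_mean B" by (auto simp: pair_mean_def)
  then show "integrable M (\<lambda>\<omega>. N B \<omega> * (N B \<omega> - 1))" by simp
  have "(\<Sum>k | k \<in> PiE {..<Suc (Suc 0)} (\<lambda>_. {..<m}) \<and> inj_on k {..<Suc (Suc 0)}. \<Prod>l<Suc (Suc 0). a (k l) B)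
     = (\<Sum>i<m. \<Sum>j\<in>{..<m} - {i}. a i B * a j B)" for m
    by (rule sum_inj_2[of "\<lambda>_. {..<m}" "\<lambda>_ k. a k B"]) simp
  then show "(\<lambda>m. \<Sum>i<m. \<Sum>j\<in>{..<m} - {i}. a i B * a j B) \<longlonglongrightarrow> pair_mean B" using L(3) i(2) by simp
qed

lemma pair_mean_nonneg: "0 \<le> pair_mean B"
  by (rule LIMSEQ_le_const[OF pair_limit(2)]) (auto intro!: sum_nonneg mult_nonneg_nonneg a_nonneg)

lemma pair_mean_le: "pair_mean B \<le> (mean B)\<^sup>2"
proof (rule LIMSEQ_le[OF pair_limit(2)])
  show "(\<lambda>m. (\<Sum>k<m. a k B)\<^sup>2) \<longlonglongrightarrow> (mean B)\<^sup>2" by (intro tendsto_intros mean_limit)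
  have "(\<Sum>i<m. \<Sum>j\<in>{..<m} - {i}. a i B * a j B) \<le> (\<Sum>i<m. \<Sum>j<m. a i B * a j B)" for m
    by (intro sum_mono sum_mono2) (auto intro!: mult_nonneg_nonneg a_nonneg)
  then show "\<exists>N. \<forall>m\<ge>N. (\<Sum>i<m. \<Sum>j\<in>{..<m} - {i}. a i B * a j B) \<le> (\<Sum>k<m. a k B)\<^sup>2"
    by (simp add: power2_eq_square sum_product)
qed

text \<open>Compared with the squared mean, only the diagonal sum of (a k B)^2 is missing, and it is
  at most the largest eigenvalue times the mean. If no single mode favours B, ordered pairs are
  about as frequent as for independent points.\<close>

lemma pair_mean_ge:
  assumes "\<And>k. a k B \<le> \<alpha>" shows "(mean B)\<^sup>2 - \<alpha> * mean B \<le> pair_mean B"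
proof (rule LIMSEQ_le)
  show "(\<lambda>m. (\<Sum>k<m. a k B)\<^sup>2 - \<alpha> * (\<Sum>k<m. a k B)) \<longlonglongrightarrow> (mean B)\<^sup>2 - \<alpha> * mean B"
    by (intro tendsto_intros mean_limit)
  show "(\<lambda>m. \<Sum>i<m. \<Sum>j\<in>{..<m} - {i}. a i B * a j B) \<longlonglongrightarrow> pair_mean B" by (rule pair_limit)
  have "(\<Sum>k<m. a k B)\<^sup>2 - \<alpha> * (\<Sum>k<m. a k B) \<le> (\<Sum>i<m. \<Sum>j\<in>{..<m} - {i}. a i B * a j B)" for m
  proof -
    have "(\<Sum>k<m. a k B)\<^sup>2 = (\<Sum>i<m. a i B * a i B + (\<Sum>j\<in>{..<m} - {i}. a i B * a j B))"
      unfolding power2_eq_square sum_product by (intro sum.cong refl sum.remove) auto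
    also have "\<dots> = (\<Sum>i<m. a i B * a i B) + (\<Sum>i<m. \<Sum>j\<in>{..<m} - {i}. a i B * a j B)" by (rule sum.distrib)
    also have "(\<Sum>i<m. a i B * a i B) \<le> (\<Sum>i<m. \<alpha> * a i B)"
      using assms a_nonneg by (intro sum_mono mult_right_mono) auto
    finally show ?thesis by (simp add: sum_distrib_left)
  qed
  then show "\<exists>N. \<forall>m\<ge>N. (\<Sum>k<m. a k B)\<^sup>2 - \<alpha> * (\<Sum>k<m. a k B) \<le> (\<Sum>i<m. \<Sum>j\<in>{..<m} - {i}. a i B * a j B)" by blast
qed

lemma mean_nonneg: "0 \<le> mean B"
  by (rule LIMSEQ_le_const[OF mean_limit(2)]) (auto intro!: sum_nonneg a_nonneg)

end

text \<open>Nonnegativity allows dropping the constraints between the first two and the last two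
  indices; the sum then factorises.\<close>

lemma four_sum_le:
  assumes "\<And>k. 0 \<le> x k" "\<And>k. 0 \<le> (y :: nat \<Rightarrow> real) k"
  shows "(\<Sum>i<m. \<Sum>j\<in>{..<m} - {i}. \<Sum>k\<in>{..<m} - {i, j}. \<Sum>l\<in>{..<m} - {i, j, k}. x i * x j * y k * y l)
     \<le> (\<Sum>i<m. \<Sum>j\<in>{..<m} - {i}. x i * x j) * (\<Sum>k<m. \<Sum>l\<in>{..<m} - {k}. y k * y l)"
proof -
  have "(\<Sum>i<m. \<Sum>j\<in>{..<m} - {i}. \<Sum>k\<in>{..<m} - {i, j}. \<Sum>l\<in>{..<m} - {i, j, k}. x i * x j * y k * y l)
    \<le> (\<Sum>i<m. \<Sum>j\<in>{..<m} - {i}. \<Sum>k<m. \<Sum>l\<in>{..<m} - {k}. x i * x j * y k * y l)"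
  proof (intro sum_mono)
    fix i j
    have "(\<Sum>k\<in>{..<m} - {i, j}. \<Sum>l\<in>{..<m} - {i, j, k}. x i * x j * y k * y l) \<le> (\<Sum>k\<in>{..<m} - {i, j}. \<Sum>l\<in>{..<m} - {k}. x i * x j * y k * y l)"
      using assms by (intro sum_mono sum_mono2) (auto intro!: mult_nonneg_nonneg)
    also have "\<dots> \<le> (\<Sum>k<m. \<Sum>l\<in>{..<m} - {k}. x i * x j * y k * y l)"
      using assms by (intro sum_mono2) (auto intro!: sum_nonneg mult_nonneg_nonneg)
    finally show "(\<Sum>k\<in>{..<m} - {i, j}. \<Sum>l\<in>{..<m} - {i, j, k}. x i * x j * y k * y l) \<le> (\<Sum>k<m. \<Sum>l\<in>{..<m} - {k}. x i * x j * y k * y l)" .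
  qed
  also have "\<dots> = (\<Sum>i<m. \<Sum>j\<in>{..<m} - {i}. x i * x j * (\<Sum>k<m. \<Sum>l\<in>{..<m} - {k}. y k * y l))"
    by (simp only: sum_distrib_left mult.assoc)
  also have "\<dots> = (\<Sum>i<m. \<Sum>j\<in>{..<m} - {i}. x i * x j) * (\<Sum>k<m. \<Sum>l\<in>{..<m} - {k}. y k * y l)"
    by (simp only: sum_distrib_right)
  finally show ?thesis .
qed

lemma triple_bound:
  assumes B: "circled B" "B \<subseteq> ball 0 r"
  shows "integrable M (\<lambda>\<omega>. N B \<omega> * (N B \<omega> - 1) * (N B \<omega> - 2))"
    "(LINT \<omega>|M. N B \<omega> * (N B \<omega> - 1) * (N B \<omega> - 2)) \<le> pair_mean B * mean B"
proof -
  let ?n = "Suc (Suc (Suc 0))"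
  obtain L where L: "L \<ge> 0" "(\<integral>\<^sup>+\<omega>. of_nat (tuple_count X ?n (\<lambda>_. B) \<omega>) \<partial>M) = ennreal L"
    "(\<lambda>m. \<Sum>k | k \<in> PiE {..<?n} (\<lambda>_. {..<m}) \<and> inj_on k {..<?n}. \<Prod>l<?n. a (k l) B) \<longlonglongrightarrow> L"
    using tuple_moment[of ?n "\<lambda>_. B" r] B by blast
  note [measurable] = N_measurable[OF circled_borel[OF B(1)]]
  have m: "(\<lambda>\<omega>. N B \<omega> * (N B \<omega> - 1) * (N B \<omega> - 2)) \<in> borel_measurable M" by measurable
  have "AE \<omega> in M. N B \<omega> * (N B \<omega> - 1) * (N B \<omega> - 2) = real (tuple_count X ?n (\<lambda>_. B) \<omega>)"
    using finite_bin[OF B] by eventually_elim (simp add: tuple_count_def card_inj_3 N_def)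
  note t = moment_transfer[OF m this L(2,1)]
  show "integrable M (\<lambda>\<omega>. N B \<omega> * (N B \<omega> - 1) * (N B \<omega> - 2))" by (rule t)
  have "L \<le> pair_mean B * mean B"
  proof (rule LIMSEQ_le[OF L(3)])
    show "(\<lambda>m. (\<Sum>i<m. \<Sum>j\<in>{..<m} - {i}. a i B * a j B) * (\<Sum>k<m. a k B)) \<longlonglongrightarrow> pair_mean B * mean B"
      by (intro tendsto_mult pair_limit[OF B] mean_limit[OF B])
    have "(\<Sum>i<m. \<Sum>j\<in>{..<m} - {i}. \<Sum>k\<in>{..<m} - {i, j}. a i B * a j B * a k B) \<le> (\<Sum>i<m. \<Sum>j\<in>{..<m} - {i}. a i B * a j B) * (\<Sum>k<m. a k B)" for m
    proof -
      have "(\<Sum>i<m. \<Sum>j\<in>{..<m} - {i}. \<Sum>k\<in>{..<m} - {i, j}. a i B * a j B * a k B) \<le> (\<Sum>i<m. \<Sum>j\<in>{..<m} - {i}. \<Sum>k<m. a i B * a j B * a k B)"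
        by (intro sum_mono sum_mono2) (auto intro!: mult_nonneg_nonneg a_nonneg)
      also have "\<dots> = (\<Sum>i<m. \<Sum>j\<in>{..<m} - {i}. a i B * a j B * (\<Sum>k<m. a k B))" by (simp only: sum_distrib_left)
      also have "\<dots> = (\<Sum>i<m. \<Sum>j\<in>{..<m} - {i}. a i B * a j B) * (\<Sum>k<m. a k B)" by (simp only: sum_distrib_right)
      finally show ?thesis .
    qed
    then show "\<exists>N. \<forall>m\<ge>N. (\<Sum>k | k \<in> PiE {..<?n} (\<lambda>_. {..<m}) \<and> inj_on k {..<?n}. \<Prod>l<?n. a (k l) B) \<le> (\<Sum>i<m. \<Sum>j\<in>{..<m} - {i}. a i B * a j B) * (\<Sum>k<m. a k B)"
      using sum_inj_3[of "\<lambda>_. {..<m}" "\<lambda>_ k. a k B" for m] by simp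
  qed
  then show "(LINT \<omega>|M. N B \<omega> * (N B \<omega> - 1) * (N B \<omega> - 2)) \<le> pair_mean B * mean B" using t(2) by simp
qed

text \<open>The count f is a parameter because it is a different polynomial in the two uses: a
  product of pair counts for disjoint sets, a falling factorial of order four for equal
  ones.\<close>

lemma quad_bound:
  assumes B: "circled B" "B \<subseteq> ball 0 r" and B': "circled B'" "B' \<subseteq> ball 0 r"
    and f: "f \<in> borel_measurable M"
      "AE \<omega> in M. f \<omega> = real (tuple_count X (Suc (Suc (Suc (Suc 0)))) (pair_bins B B') \<omega>)"
  shows "integrable M f" "(LINT \<omega>|M. f \<omega>) \<le> pair_mean B * pair_mean B'"
proof -
  let ?n = "Suc (Suc (Suc (Suc 0)))"
  have P: "circled (pair_bins B B' l)" "pair_bins B B' l \<subseteq> ball 0 r" for l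
    using B B' by (auto simp: pair_bins_def)
  obtain L where L: "L \<ge> 0" "(\<integral>\<^sup>+\<omega>. of_nat (tuple_count X ?n (pair_bins B B') \<omega>) \<partial>M) = ennreal L"
    "(\<lambda>m. \<Sum>k | k \<in> PiE {..<?n} (\<lambda>_. {..<m}) \<and> inj_on k {..<?n}. \<Prod>l<?n. a (k l) (pair_bins B B' l)) \<longlonglongrightarrow> L"
    using tuple_moment[of ?n "pair_bins B B'" r] P by blast
  note t = moment_transfer[OF f L(2,1)]
  show "integrable M f" by (rule t)
  have "L \<le> pair_mean B * pair_mean B'"
  proof (rule LIMSEQ_le[OF L(3)])
    show "(\<lambda>m. (\<Sum>i<m. \<Sum>j\<in>{..<m} - {i}. a i B * a j B) * (\<Sum>i<m. \<Sum>j\<in>{..<m} - {i}. a i B' * a j B')) \<longlonglongrightarrow> pair_mean B * pair_mean B'"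
      by (intro tendsto_mult pair_limit[OF B] pair_limit[OF B'])
    have "(\<Sum>k | k \<in> PiE {..<?n} (\<lambda>_. {..<m}) \<and> inj_on k {..<?n}. \<Prod>l<?n. a (k l) (pair_bins B B' l))
      = (\<Sum>i<m. \<Sum>j\<in>{..<m} - {i}. \<Sum>k\<in>{..<m} - {i, j}. \<Sum>l\<in>{..<m} - {i, j, k}. a i B * a j B * a k B' * a l B')" for m
      using sum_inj_4[of "\<lambda>_. {..<m}" "\<lambda>l k. a k (pair_bins B B' l)"] by (simp only: pair_bins_simps finite_lessThan)
    then show "\<exists>N. \<forall>m\<ge>N. (\<Sum>k | k \<in> PiE {..<?n} (\<lambda>_. {..<m}) \<and> inj_on k {..<?n}. \<Prod>l<?n. a (k l) (pair_bins B B' l))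
        \<le> (\<Sum>i<m. \<Sum>j\<in>{..<m} - {i}. a i B * a j B) * (\<Sum>i<m. \<Sum>j\<in>{..<m} - {i}. a i B' * a j B')"
      using four_sum_le[of "\<lambda>k. a k B" "\<lambda>k. a k B'"] a_nonneg by simp
  qed
  then show "(LINT \<omega>|M. f \<omega>) \<le> pair_mean B * pair_mean B'" using t(2) by simp
qed

end

section \<open>Uniform angles\<close>

definition arc :: "nat \<Rightarrow> real \<Rightarrow> int" where "arc Q t = \<lfloor>t * real Q / (2 * pi)\<rfloor>"

lemma arc_measurable: "arc Q \<in> borel \<rightarrow>\<^sub>M count_space UNIV"
  unfolding arc_def by measurable

lemma arc_eq_iff:
  assumes "0 < Q" shows "arc Q t = i \<longleftrightarrow> 2 * pi * of_int i / Q \<le> t \<and> t < 2 * pi * (of_int i + 1) / Q"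
  using assms by (simp add: arc_def floor_eq_iff field_simps)

lemma arc_range:
  assumes "0 < Q" "t \<in> {0..<2 * pi}" shows "arc Q t \<in> {0..<int Q}"
proof -
  have "0 \<le> t * real Q / (2 * pi)" "t * real Q / (2 * pi) < real Q"
    using assms by (auto simp: field_simps)
  then show ?thesis by (simp add: arc_def floor_less_iff)
qed

lemma arc_uniform:
  assumes "0 < Q" "i \<in> {0..<int Q}"
  shows "measure (uniform_measure lborel {0..<2 * pi}) {t. arc Q t = i} = 1 / Q"
proof -
  have e: "{t. arc Q t = i} = {2 * pi * of_int i / Q..<2 * pi * (of_int i + 1) / Q}"
    using arc_eq_iff[OF assms(1)] by auto
  have "2 * pi * (of_int i + 1) / Q \<le> 2 * pi * Q / Q"
  proof (intro divide_right_mono mult_left_mono)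
    show "of_int i + 1 \<le> real Q" using assms by (metis add1_zle_eq atLeastLessThan_iff of_int_1 of_int_add of_int_le_iff of_int_of_nat_eq)
  qed auto
  then have s: "{0..<2 * pi} \<inter> {2 * pi * of_int i / Q..<2 * pi * (of_int i + 1) / Q} = {2 * pi * of_int i / Q..<2 * pi * (of_int i + 1) / Q}"
    using assms by (auto intro: order_trans[rotated])
  have "2 * pi * of_int i / Q \<le> 2 * pi * (of_int i + 1) / Q"
    by (intro divide_right_mono mult_left_mono) auto
  then have "measure lborel {2 * pi * of_int i / Q..<2 * pi * (of_int i + 1) / Q} = 2 * pi / Q"
    by (simp add: measure_def diff_divide_distrib[symmetric] algebra_simps)
  then show ?thesis unfolding e
    by (subst measure_uniform_measure) (simp_all del: Int_atLeastLessThan add: s)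
qed

lemma half_le_sin:
  fixes y :: real assumes "0 \<le> y" "y \<le> pi / 2" shows "y / 2 \<le> sin y"
proof -
  have "\<bar>sin y - (\<Sum>m<3. sin_coeff m * y ^ m)\<bar> \<le> inverse (fact 3) * \<bar>y\<bar> ^ 3" by (rule Maclaurin_sin_bound)
  then have "y - y ^ 3 / 6 \<le> sin y"
    using assms by (simp add: eval_nat_numeral sin_coeff_def) (simp add: abs_if field_simps split: if_splits)
  moreover have "y ^ 3 \<le> 3 * y"
  proof -
    have "y \<le> 1.6" using assms pi_less_4 pi_approx by simp
    then have "y * y \<le> 1.6 * 1.6" using assms by (intro mult_mono) auto
    then have "y * y * y \<le> 3 * y" using assms by (intro mult_right_mono) auto
    then show ?thesis by (simp add: power3_eq_cube)
  qed
  ultimately show ?thesis by simp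
qed

text \<open>Same or cyclically adjacent arcs, a discrete event containing angular closeness;
  \<open>mod\<close> joins the last arc to the first.\<close>

definition near :: "nat \<Rightarrow> real \<Rightarrow> real \<Rightarrow> bool" where
  "near Q s t \<longleftrightarrow> (\<exists>i\<in>{0..<int Q}. \<exists>d\<in>{-1, 0, 1}. arc Q s = i \<and> arc Q t = (i + d) mod int Q)"

text \<open>With y half the distance of the angles, 1 - cos(s - t) = 2 sin(y)^2, so sin y < 1/(2Q).
  As sin y dominates y/2 on [0, pi/2], either y or pi - y is below 1/Q; in units of arcs the angles
  differ by less than 1, or by more than Q - 1, which is adjacency across 0.\<close>

lemma near_if_cos:
  assumes Q: "0 < Q" and st: "s \<in> {0..<2 * pi}" "t \<in> {0..<2 * pi}" and c: "1 - cos (s - t) < 1 / (2 * (real Q)\<^sup>2)"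
  shows "near Q s t"
proof -
  define y where "y = \<bar>s - t\<bar> / 2"
  have y: "0 \<le> y" "y < pi" using st by (auto simp: y_def)
  have "cos (s - t) = cos (2 * y)" by (simp add: y_def abs_if) (metis cos_minus minus_diff_eq)
  also have "\<dots> = 1 - 2 * (sin y)\<^sup>2" by (simp add: cos_double_sin)
  finally have "(sin y)\<^sup>2 < (1 / (2 * real Q))\<^sup>2" using c by (simp add: power2_eq_square field_simps)
  then have siny: "sin y < 1 / (2 * real Q)" by (rule power2_less_imp_less) auto
  define S T where "S = s * real Q / (2 * pi)" and "T = t * real Q / (2 * pi)"
  have ST: "\<bar>S - T\<bar> = y * real Q / pi"
  proof -
    have "S - T = (s - t) * real Q / (2 * pi)" by (simp add: S_def T_def algebra_simps diff_divide_distrib)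
    then show ?thesis by (simp add: y_def abs_mult)
  qed
  have r: "\<lfloor>S\<rfloor> \<in> {0..<int Q}" "\<lfloor>T\<rfloor> \<in> {0..<int Q}"
    using arc_range[OF Q st(1)] arc_range[OF Q st(2)] by (simp_all add: arc_def S_def T_def)
  have pi1: "real Q * (1 / real Q) / pi < 1" using Q pi_gt3 by simp
  have "\<exists>d\<in>{-1, 0, 1}. \<lfloor>T\<rfloor> = (\<lfloor>S\<rfloor> + d) mod int Q"
  proof (cases "y \<le> pi / 2")
    case True
    then have "y < 1 / real Q" using half_le_sin[OF y(1)] siny by simp
    then have "y * real Q < 1" using Q by (simp add: field_simps)
    then have "y * real Q / pi < 1" using pi_gt3 by (simp add: field_simps)
    then have "\<bar>\<lfloor>S\<rfloor> - \<lfloor>T\<rfloor>\<bar> \<le> 1" using ST by linarith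
    then have "\<lfloor>T\<rfloor> - \<lfloor>S\<rfloor> \<in> {-1, 0, 1}" by auto
    moreover have "\<lfloor>T\<rfloor> = (\<lfloor>S\<rfloor> + (\<lfloor>T\<rfloor> - \<lfloor>S\<rfloor>)) mod int Q" using r by simp
    ultimately show ?thesis by blast
  next
    case False
    have "(pi - y) / 2 \<le> sin (pi - y)" using False y by (intro half_le_sin) auto
    then have "pi - y < 1 / real Q" using siny by simp
    then have "(pi - y) * real Q < 1" using Q by (simp add: field_simps)
    then have "real Q - y * real Q / pi < 1" using pi_gt3 by (simp add: field_simps)
    then have "\<bar>S - T\<bar> > real Q - 1" using ST by simp
    then consider "S - T > real Q - 1" | "T - S > real Q - 1" by linarith
    then show ?thesis
    proof cases
      case 1
      then have "\<lfloor>S\<rfloor> - \<lfloor>T\<rfloor> \<ge> int Q - 1" by linarith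
      then have "\<lfloor>S\<rfloor> = int Q - 1" "\<lfloor>T\<rfloor> = 0" using r unfolding atLeastLessThan_iff by linarith+
      then show ?thesis by (intro bexI[of _ 1]) auto
    next
      case 2
      then have "\<lfloor>T\<rfloor> - \<lfloor>S\<rfloor> \<ge> int Q - 1" by linarith
      then have *: "\<lfloor>T\<rfloor> = int Q - 1" "\<lfloor>S\<rfloor> = 0" using r unfolding atLeastLessThan_iff by linarith+
      have "(-1) mod int Q = int Q - 1" using Q by (simp add: zmod_minus1)
      then show ?thesis using * by (intro bexI[of _ "-1"]) auto
    qed
  qed
  then show ?thesis using r(1) by (auto simp: near_def arc_def S_def T_def)
qed

locale uniform_angles =
  fixes M :: "'a measure" and \<theta> :: "nat \<Rightarrow> 'a \<Rightarrow> real"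
  assumes prob_\<theta>: "prob_space M" and iid: "iid_uniform_angles M \<theta>"
begin

sublocale \<Theta>: prob_space M by (rule prob_\<theta>)

lemma indep_\<theta>: "\<Theta>.indep_vars (\<lambda>_. borel) \<theta> UNIV"
  using iid by (simp add: iid_uniform_angles_def)

lemma \<theta>_measurable[measurable]: "\<theta> k \<in> borel_measurable M"
  using indep_\<theta> by (simp add: \<Theta>.indep_vars_def)

lemma arc_\<theta>_measurable[measurable]: "(\<lambda>\<omega>. arc Q (\<theta> k \<omega>)) \<in> M \<rightarrow>\<^sub>M count_space UNIV"
  by (rule measurable_compose[OF \<theta>_measurable arc_measurable])

lemma distr_\<theta>: "distr M borel (\<theta> k) = uniform_measure lborel {0..<2 * pi}"
  using iid by (simp add: iid_uniform_angles_def)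

lemma prob_arc:
  assumes "0 < Q" "i \<in> {0..<int Q}" shows "\<Theta>.prob {\<omega> \<in> space M. arc Q (\<theta> k \<omega>) = i} = 1 / Q"
proof -
  have "{t. arc Q t = i} \<in> sets borel" using arc_measurable[of Q] by measurable
  then have "measure (distr M borel (\<theta> k)) {t. arc Q t = i} = \<Theta>.prob (\<theta> k -` {t. arc Q t = i} \<inter> space M)"
    by (intro measure_distr) auto
  also have "\<theta> k -` {t. arc Q t = i} \<inter> space M = {\<omega> \<in> space M. arc Q (\<theta> k \<omega>) = i}" by auto
  finally show ?thesis unfolding distr_\<theta> using arc_uniform[OF assms] by simp
qed

lemma prob_arcs:
  assumes "finite J" "\<And>k. k \<in> J \<Longrightarrow> 0 < Q k" "\<And>k. k \<in> J \<Longrightarrow> i k \<in> {0..<int (Q k)}"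
  shows "\<Theta>.prob {\<omega> \<in> space M. \<forall>k\<in>J. arc (Q k) (\<theta> k \<omega>) = i k} = (\<Prod>k\<in>J. 1 / Q k)"
proof (cases "J = {}")
  case True
  then show ?thesis using \<Theta>.prob_space by simp
next
  case False
  have m: "{t. arc (Q k) t = i k} \<in> sets borel" for k using arc_measurable[of "Q k"] by measurable
  have "\<Theta>.prob (\<Inter>k\<in>J. \<theta> k -` {t. arc (Q k) t = i k} \<inter> space M) = (\<Prod>k\<in>J. \<Theta>.prob (\<theta> k -` {t. arc (Q k) t = i k} \<inter> space M))"
    using m False assms(1) by (intro \<Theta>.indep_varsD[OF indep_\<theta>]) auto
  also have "(\<Inter>k\<in>J. \<theta> k -` {t. arc (Q k) t = i k} \<inter> space M) = {\<omega> \<in> space M. \<forall>k\<in>J. arc (Q k) (\<theta> k \<omega>) = i k}" using False by auto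
  also have "(\<Prod>k\<in>J. \<Theta>.prob (\<theta> k -` {t. arc (Q k) t = i k} \<inter> space M)) = (\<Prod>k\<in>J. 1 / Q k)"
  proof (intro prod.cong refl)
    fix k assume "k \<in> J"
    have "\<theta> k -` {t. arc (Q k) t = i k} \<inter> space M = {\<omega> \<in> space M. arc (Q k) (\<theta> k \<omega>) = i k}" by auto
    then show "\<Theta>.prob (\<theta> k -` {t. arc (Q k) t = i k} \<inter> space M) = 1 / Q k"
      using prob_arc[OF assms(2,3)[OF \<open>k \<in> J\<close>]] by simp
  qed
  finally show ?thesis .
qed

text \<open>A common arc rather than mere closeness: the probability is exact and depends only on
  the number of indices, which yields independence of distinct pairs.\<close>

definition same_arc :: "nat \<Rightarrow> nat set \<Rightarrow> 'a set" where
  "same_arc Q J = {\<omega> \<in> space M. \<exists>i\<in>{0..<int Q}. \<forall>k\<in>J. arc Q (\<theta> k \<omega>) = i}"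

lemma same_arc_sets: "finite J \<Longrightarrow> same_arc Q J \<in> \<Theta>.events"
  unfolding same_arc_def by measurable

lemma prob_same_arc:
  assumes "finite J" "J \<noteq> {}" "0 < Q" shows "\<Theta>.prob (same_arc Q J) = Q * (1 / Q) ^ card J"
proof -
  have "same_arc Q J = (\<Union>i\<in>{0..<int Q}. {\<omega> \<in> space M. \<forall>k\<in>J. arc Q (\<theta> k \<omega>) = i})"
    by (auto simp: same_arc_def)
  moreover have "\<Theta>.prob (\<Union>i\<in>{0..<int Q}. {\<omega> \<in> space M. \<forall>k\<in>J. arc Q (\<theta> k \<omega>) = i})
    = (\<Sum>i\<in>{0..<int Q}. \<Theta>.prob {\<omega> \<in> space M. \<forall>k\<in>J. arc Q (\<theta> k \<omega>) = i})"
  proof (rule \<Theta>.finite_measure_finite_Union)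
    show "(\<lambda>i. {\<omega> \<in> space M. \<forall>k\<in>J. arc Q (\<theta> k \<omega>) = i}) ` {0..<int Q} \<subseteq> \<Theta>.events"
      using assms(1) by auto
    show "disjoint_family_on (\<lambda>i. {\<omega> \<in> space M. \<forall>k\<in>J. arc Q (\<theta> k \<omega>) = i}) {0..<int Q}"
      using assms(2) by (auto simp: disjoint_family_on_def)
  qed simp
  ultimately show ?thesis using assms prob_arcs[of J "\<lambda>_. Q" "\<lambda>_. i" for i] by simp
qed

text \<open>Two different pairs with a common index form a triple, and three angles share an arc
  with probability Q (1/Q)^3. This is the product of the two pair probabilities, so sharing a point
  does not destroy independence.\<close>

lemma prob_same_arc_Int_overlap:
  assumes "card A = 2" "card B = 2" "A \<noteq> B" "A \<inter> B \<noteq> {}" "0 < Q"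
  shows "\<Theta>.prob (same_arc Q A \<inter> same_arc Q B) = 1 / Q * (1 / Q)"
proof -
  have fin: "finite A" "finite B" using assms by (auto intro: card_ge_0_finite)
  have "same_arc Q A \<inter> same_arc Q B = same_arc Q (A \<union> B)"
  proof
    obtain l where "l \<in> A" "l \<in> B" using assms(4) by blast
    show "same_arc Q A \<inter> same_arc Q B \<subseteq> same_arc Q (A \<union> B)"
    proof
      fix \<omega> assume "\<omega> \<in> same_arc Q A \<inter> same_arc Q B"
      then obtain i i' where i: "\<omega> \<in> space M" "i \<in> {0..<int Q}" "\<forall>k\<in>A. arc Q (\<theta> k \<omega>) = i" "\<forall>k\<in>B. arc Q (\<theta> k \<omega>) = i'"
        unfolding same_arc_def by blast
      then have "i' = i" using \<open>l \<in> A\<close> \<open>l \<in> B\<close> by metis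
      then show "\<omega> \<in> same_arc Q (A \<union> B)" using i unfolding same_arc_def by blast
    qed
  qed (auto simp: same_arc_def)
  moreover have "card (A \<union> B) = 3"
  proof -
    have "card (A \<inter> B) < card A"
    proof (rule psubset_card_mono[OF fin(1)])
      show "A \<inter> B \<subset> A" using assms card_subset_eq[OF fin(2), of A] by auto
    qed
    moreover have "card (A \<inter> B) > 0" using assms fin by (simp add: card_gt_0_iff)
    ultimately show ?thesis using card_Un_Int[OF fin] assms by simp
  qed
  ultimately show ?thesis using prob_same_arc[of "A \<union> B" Q] fin assms by (auto simp: eval_nat_numeral)
qed

lemma prob_same_arc_Int_disjoint:
  assumes "card A = 2" "card B = 2" "A \<inter> B = {}" "0 < Q" "0 < Q'"
  shows "\<Theta>.prob (same_arc Q A \<inter> same_arc Q' B) = 1 / Q * (1 / Q')"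
proof -
  have fin: "finite A" "finite B" using assms by (auto intro: card_ge_0_finite)
  have ne: "A \<noteq> {}" "B \<noteq> {}" using assms by auto
  define q where "q k = (if k \<in> A then Q else Q')" for k
  define v where "v p k = (if k \<in> A then fst p else snd p)" for p :: "int \<times> int" and k :: nat
  let ?E = "\<lambda>p. {\<omega> \<in> space M. \<forall>k\<in>A \<union> B. arc (q k) (\<theta> k \<omega>) = v p k}"
  have dj: "k \<notin> A" if "k \<in> B" for k using assms(3) that by auto
  have "same_arc Q A \<inter> same_arc Q' B = (\<Union>p\<in>{0..<int Q} \<times> {0..<int Q'}. ?E p)"
  proof (intro equalityI subsetI)
    fix \<omega> assume "\<omega> \<in> same_arc Q A \<inter> same_arc Q' B"
    then obtain i i' where "\<omega> \<in> space M" "i \<in> {0..<int Q}" "i' \<in> {0..<int Q'}"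
      "\<forall>k\<in>A. arc Q (\<theta> k \<omega>) = i" "\<forall>k\<in>B. arc Q' (\<theta> k \<omega>) = i'"
      unfolding same_arc_def by blast
    then show "\<omega> \<in> (\<Union>p\<in>{0..<int Q} \<times> {0..<int Q'}. ?E p)"
      using dj by (intro UN_I[of "(i, i')"]) (auto simp: q_def v_def)
  next
    fix \<omega> assume "\<omega> \<in> (\<Union>p\<in>{0..<int Q} \<times> {0..<int Q'}. ?E p)"
    then obtain i i' where *: "i \<in> {0..<int Q}" "i' \<in> {0..<int Q'}" "\<omega> \<in> ?E (i, i')" by blast
    have **: "arc (q k) (\<theta> k \<omega>) = v (i, i') k" if "k \<in> A \<union> B" for k using * that by blast
    have "arc Q (\<theta> k \<omega>) = i" if "k \<in> A" for k using **[of k] that by (simp add: q_def v_def)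
    moreover have "arc Q' (\<theta> k \<omega>) = i'" if "k \<in> B" for k using **[of k] that dj by (simp add: q_def v_def)
    moreover have "\<omega> \<in> space M" using * by blast
    ultimately have "\<forall>k\<in>A. arc Q (\<theta> k \<omega>) = i" "\<forall>k\<in>B. arc Q' (\<theta> k \<omega>) = i'" "\<omega> \<in> space M"
      by blast+
    with * show "\<omega> \<in> same_arc Q A \<inter> same_arc Q' B" unfolding same_arc_def by blast
  qed
  moreover have "\<Theta>.prob (\<Union>p\<in>{0..<int Q} \<times> {0..<int Q'}. ?E p) = (\<Sum>p\<in>{0..<int Q} \<times> {0..<int Q'}. \<Theta>.prob (?E p))"
  proof (rule \<Theta>.finite_measure_finite_Union)
    show "?E ` ({0..<int Q} \<times> {0..<int Q'}) \<subseteq> \<Theta>.events"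
      using fin by auto
    show "disjoint_family_on ?E ({0..<int Q} \<times> {0..<int Q'})"
    proof (unfold disjoint_family_on_def, intro ballI impI)
      fix p p' :: "int \<times> int" assume "p \<noteq> p'"
      obtain i j where ij: "i \<in> A" "j \<in> B" using ne by blast
      have "p = p'" if "\<omega> \<in> ?E p" "\<omega> \<in> ?E p'" for \<omega>
      proof -
        have "v p i = v p' i" "v p j = v p' j" using that ij by force+
        then show ?thesis using ij dj[of j] by (simp add: v_def prod_eq_iff)
      qed
      then show "?E p \<inter> ?E p' = {}" using \<open>p \<noteq> p'\<close> by blast
    qed
  qed simp
  moreover have "\<Theta>.prob (?E p) = (1 / Q)\<^sup>2 * (1 / Q')\<^sup>2" if "p \<in> {0..<int Q} \<times> {0..<int Q'}" for p :: "int \<times> int"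
  proof -
    have "\<Theta>.prob (?E p) = (\<Prod>k\<in>A \<union> B. 1 / q k)"
      using fin that assms by (intro prob_arcs) (auto simp: q_def v_def)
    also have "\<dots> = (\<Prod>k\<in>A. 1 / q k) * (\<Prod>k\<in>B. 1 / q k)" using fin assms(3) by (rule prod.union_disjoint)
    also have "(\<Prod>k\<in>A. 1 / q k) = (\<Prod>k\<in>A. 1 / real Q)" by (intro prod.cong) (auto simp: q_def)
    also have "(\<Prod>k\<in>B. 1 / q k) = (\<Prod>k\<in>B. 1 / real Q')" using dj by (intro prod.cong) (auto simp: q_def)
    finally show ?thesis using assms by simp
  qed
  ultimately have "\<Theta>.prob (same_arc Q A \<inter> same_arc Q' B) = real (card ({0..<int Q} \<times> {0..<int Q'})) * ((1 / Q)\<^sup>2 * (1 / Q')\<^sup>2)"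
    by simp
  also have "\<dots> = 1 / Q * (1 / Q')" using assms by (simp add: card_cartesian_product power2_eq_square)
  finally show ?thesis .
qed

lemma near_sets: "{\<omega> \<in> space M. near Q (\<theta> j \<omega>) (\<theta> k \<omega>)} \<in> \<Theta>.events"
  unfolding near_def by measurable

text \<open>Q choices of the first arc, three shifts for the second, each combination of probability
  1/Q^2.\<close>

lemma prob_near:
  assumes "j \<noteq> k" "0 < Q" shows "\<Theta>.prob {\<omega> \<in> space M. near Q (\<theta> j \<omega>) (\<theta> k \<omega>)} \<le> 3 / Q"
proof -
  let ?v = "\<lambda>(p :: int \<times> int) l. if l = j then fst p else (fst p + snd p) mod int Q"
  let ?P = "{0..<int Q} \<times> {-1, 0, 1 :: int}"
  let ?E = "\<lambda>p. {\<omega> \<in> space M. \<forall>l\<in>{j, k}. arc Q (\<theta> l \<omega>) = ?v p l}"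
  have "{\<omega> \<in> space M. near Q (\<theta> j \<omega>) (\<theta> k \<omega>)} = (\<Union>p\<in>?P. ?E p)"
    using assms(1) by (auto simp: near_def)
  then have "\<Theta>.prob {\<omega> \<in> space M. near Q (\<theta> j \<omega>) (\<theta> k \<omega>)} \<le> (\<Sum>p\<in>?P. \<Theta>.prob (?E p))"
    using assms(1) by (simp only:) (intro \<Theta>.finite_measure_subadditive_finite, auto)
  also have "\<dots> = (\<Sum>p\<in>?P. (1 / Q)\<^sup>2)"
  proof (rule sum.cong[OF refl])
    fix p assume "p \<in> ?P"
    then have "\<Theta>.prob (?E p) = (\<Prod>l\<in>{j, k}. 1 / real Q)" using assms by (intro prob_arcs) auto
    also have "\<dots> = (1 / Q)\<^sup>2" using assms(1) by (simp add: power2_eq_square)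
    finally show "\<Theta>.prob (?E p) = (1 / Q)\<^sup>2" .
  qed
  also have "\<dots> = 3 / Q" using assms by (simp add: card_cartesian_product power2_eq_square)
  finally show ?thesis by simp
qed

lemma AE_\<theta>_range: "AE \<omega> in M. \<forall>k. \<theta> k \<omega> \<in> {0..<2 * pi}"
proof (unfold AE_all_countable, intro allI)
  fix k
  have "AE t in distr M borel (\<theta> k). t \<in> {0..<2 * pi}"
    unfolding distr_\<theta> by (rule AE_uniform_measureI) auto
  then show "AE \<omega> in M. \<theta> k \<omega> \<in> {0..<2 * pi}"
    by (subst (asm) AE_distr_iff) auto
qed

end

text \<open>The second moment method in the form: the indicator of W = 0 is at most (1 - W/c)^2. The
  centre c is kept apart from the mean V because V will be a random variable depending on the
  moduli, whereas c will be its expectation; the bound is then polynomial in V with constant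
  coefficients.\<close>

lemma (in prob_space) prob_no_event_le:
  assumes fin: "finite S" and E: "\<And>s. s \<in> S \<Longrightarrow> E s \<in> events"
    and p: "\<And>s s'. s \<in> S \<Longrightarrow> s' \<in> S \<Longrightarrow> s \<noteq> s' \<Longrightarrow> prob (E s \<inter> E s') \<le> prob (E s) * prob (E s')"
    and c: "c > 0" and V: "V = (\<Sum>s\<in>S. prob (E s))"
  shows "prob (space M - (\<Union>s\<in>S. E s)) \<le> 1 - 2 * V / c + (V\<^sup>2 + V) / c\<^sup>2"
proof -
  define W where "W \<omega> = (\<Sum>s\<in>S. indicator (E s) \<omega> :: real)" for \<omega>
  have iE: "integrable M (indicator (E s) :: _ \<Rightarrow> real)" if "s \<in> S" for s using E[OF that] by (simp add: emeasure_eq_measure)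
  have iEE: "integrable M (indicator (E s \<inter> E s') :: _ \<Rightarrow> real)" if "s \<in> S" "s' \<in> S" for s s'
    using E[OF that(1)] E[OF that(2)] by (simp add: emeasure_eq_measure)
  have iW: "integrable M W" unfolding W_def[abs_def] using iE by auto
  have W2: "(W \<omega>)\<^sup>2 = (\<Sum>s\<in>S. \<Sum>s'\<in>S. indicator (E s \<inter> E s') \<omega>)" for \<omega>
    by (simp add: W_def power2_eq_square sum_product indicator_inter_arith)
  have iW2: "integrable M (\<lambda>\<omega>. (W \<omega>)\<^sup>2)" unfolding W2 using iEE by auto
  have EW: "expectation W = V" unfolding W_def[abs_def] V
    using E iE by (subst Bochner_Integration.integral_sum) (auto intro!: sum.cong simp: Int_absorb2 sets.sets_into_space)
  have "expectation (\<lambda>\<omega>. (W \<omega>)\<^sup>2) = (\<Sum>s\<in>S. \<Sum>s'\<in>S. prob (E s \<inter> E s'))"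
  proof -
    have "expectation (\<lambda>\<omega>. (W \<omega>)\<^sup>2) = (\<Sum>s\<in>S. expectation (\<lambda>\<omega>. \<Sum>s'\<in>S. indicator (E s \<inter> E s') \<omega>))"
      unfolding W2 using iEE by (intro Bochner_Integration.integral_sum Bochner_Integration.integrable_sum) auto
    also have "\<dots> = (\<Sum>s\<in>S. \<Sum>s'\<in>S. expectation (indicator (E s \<inter> E s')))"
      using iEE by (intro sum.cong refl Bochner_Integration.integral_sum) auto
    also have "\<dots> = (\<Sum>s\<in>S. \<Sum>s'\<in>S. prob (E s \<inter> E s'))"
      using E by (intro sum.cong refl) (auto simp: Int_absorb2 sets.sets_into_space le_infI1)
    finally show ?thesis .
  qed
  also have "\<dots> \<le> (\<Sum>s\<in>S. prob (E s) + prob (E s) * V)"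
  proof (intro sum_mono)
    fix s assume s: "s \<in> S"
    have "(\<Sum>s'\<in>S. prob (E s \<inter> E s')) = prob (E s) + (\<Sum>s'\<in>S - {s}. prob (E s \<inter> E s'))"
      using fin s by (subst sum.remove[of _ s]) auto
    also have "(\<Sum>s'\<in>S - {s}. prob (E s \<inter> E s')) \<le> (\<Sum>s'\<in>S - {s}. prob (E s) * prob (E s'))"
      using p s by (intro sum_mono) auto
    also have "\<dots> \<le> (\<Sum>s'\<in>S. prob (E s) * prob (E s'))" using fin by (intro sum_mono2) auto
    also have "\<dots> = prob (E s) * V" by (simp add: V sum_distrib_left)
    finally show "(\<Sum>s'\<in>S. prob (E s \<inter> E s')) \<le> prob (E s) + prob (E s) * V" by simp
  qed
  also have "\<dots> = V\<^sup>2 + V" by (simp add: sum.distrib sum_distrib_right[symmetric] V[symmetric] power2_eq_square)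
  finally have EW2: "expectation (\<lambda>\<omega>. (W \<omega>)\<^sup>2) \<le> V\<^sup>2 + V" .
  let ?N = "space M - (\<Union>s\<in>S. E s)"
  have N: "?N \<in> events" using fin E by auto
  have i: "integrable M (\<lambda>\<omega>. 1 - 2 / c * W \<omega> + (W \<omega>)\<^sup>2 / c\<^sup>2)" using iW iW2 by auto
  have "prob ?N = expectation (indicator ?N)" using N by (simp add: Int_absorb2)
  also have "\<dots> \<le> expectation (\<lambda>\<omega>. 1 - 2 / c * W \<omega> + (W \<omega>)\<^sup>2 / c\<^sup>2)"
  proof (rule integral_mono[OF _ i])
    show "integrable M (indicator ?N :: _ \<Rightarrow> real)" using N by (simp add: emeasure_eq_measure)
    fix \<omega>
    have "1 - 2 / c * W \<omega> + (W \<omega>)\<^sup>2 / c\<^sup>2 = (1 - W \<omega> / c)\<^sup>2" by (simp add: power2_diff power_divide)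
    moreover have "W \<omega> = 0" if "\<omega> \<in> ?N" using that by (auto simp: W_def indicator_def)
    ultimately show "indicator ?N \<omega> \<le> 1 - 2 / c * W \<omega> + (W \<omega>)\<^sup>2 / c\<^sup>2"
      by (auto simp: indicator_def)
  qed
  also have "\<dots> = 1 - 2 / c * V + expectation (\<lambda>\<omega>. (W \<omega>)\<^sup>2) / c\<^sup>2"
    using iW iW2 by (simp add: EW prob_space)
  also have "\<dots> \<le> 1 - 2 / c * V + (V\<^sup>2 + V) / c\<^sup>2" using EW2 by (intro add_left_mono divide_right_mono) auto
  finally show ?thesis by simp
qed

text \<open>The events are indexed by a bin together with a two-element subset of its indices. Pairs
  from different bins are disjoint and pairs within a bin may overlap, but both intersections have
  product probability. V is the expected number of coincident unordered pairs.\<close>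

lemma (in uniform_angles) prob_no_same_arc:
  assumes I: "finite I" "disjoint_family_on T I" "\<And>b. b \<in> I \<Longrightarrow> finite (T b)" "\<And>b. b \<in> I \<Longrightarrow> 0 < Q b"
    and c: "c > 0" and V: "V = (\<Sum>b\<in>I. real (card (T b)) * (real (card (T b)) - 1) / (2 * real (Q b)))"
  shows "measure M {\<omega> \<in> space M. \<forall>b\<in>I. \<forall>i j. i \<noteq> j \<longrightarrow> i \<in> T b \<longrightarrow> j \<in> T b \<longrightarrow> arc (Q b) (\<theta> i \<omega>) \<noteq> arc (Q b) (\<theta> j \<omega>)}
    \<le> 1 - 2 * V / c + (V\<^sup>2 + V) / c\<^sup>2"
proof -
  define S where "S = (SIGMA b:I. {A. A \<subseteq> T b \<and> card A = 2})"
  define E where "E s = same_arc (Q (fst s)) (snd s)" for s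
  have finS: "finite S" unfolding S_def using I by (intro finite_SigmaI) auto
  have fin: "finite (snd s)" if "s \<in> S" for s
    using that by (auto simp: S_def intro: card_ge_0_finite)
  have ES: "E s \<in> sets M" if "s \<in> S" for s using same_arc_sets fin[OF that] by (simp add: E_def)
  have PE: "measure M (E s) = 1 / Q (fst s)" if "s \<in> S" for s
  proof -
    have "snd s \<noteq> {}" "card (snd s) = 2" "0 < Q (fst s)" using that I(4) by (auto simp: S_def)
    then show ?thesis unfolding E_def using prob_same_arc[of "snd s" "Q (fst s)"] fin[OF that]
      by (simp add: power2_eq_square)
  qed
  have "measure M (E s \<inter> E s') \<le> measure M (E s) * measure M (E s')" if s: "s \<in> S" "s' \<in> S" "s \<noteq> s'" for s s'
  proof -
    obtain b A b' A' where bA: "s = (b, A)" "s' = (b', A')" by (cases s, cases s') auto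
    have *: "b \<in> I" "b' \<in> I" "A \<subseteq> T b" "A' \<subseteq> T b'" "card A = 2" "card A' = 2" using s bA by (auto simp: S_def)
    have "measure M (E s \<inter> E s') = 1 / Q b * (1 / Q b')"
    proof (cases "A \<inter> A' = {}")
      case True
      then show ?thesis using prob_same_arc_Int_disjoint[of A A' "Q b" "Q b'"] * I(4) by (simp add: E_def bA)
    next
      case False
      then have "T b \<inter> T b' \<noteq> {}" using * by blast
      then have "b = b'" using * I(2) unfolding disjoint_family_on_def by blast
      then show ?thesis using prob_same_arc_Int_overlap[of A A' "Q b"] * I(4) False s(3) by (simp add: E_def bA)
    qed
    then show ?thesis using PE[OF s(1)] PE[OF s(2)] by (simp add: bA)
  qed
  moreover have "V = (\<Sum>s\<in>S. measure M (E s))"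
  proof -
    have "(\<Sum>s\<in>S. measure M (E s)) = (\<Sum>(b, A)\<in>S. 1 / real (Q b))"
      by (intro sum.cong refl) (auto simp: PE)
    also have "\<dots> = (\<Sum>b\<in>I. \<Sum>A | A \<subseteq> T b \<and> card A = 2. 1 / real (Q b))"
      unfolding S_def using I by (subst sum.Sigma) auto
    also have "\<dots> = V" unfolding V
    proof (intro sum.cong refl)
      fix b assume "b \<in> I"
      have "real (card {A. A \<subseteq> T b \<and> card A = 2}) = real (card (T b) choose 2)"
        using n_subsets[OF I(3)[OF \<open>b \<in> I\<close>], of 2] by simp
      also have "\<dots> = real (card (T b)) * (real (card (T b)) - 1) / 2"
      proof (cases "card (T b)")
        case (Suc n)
        have "even (Suc n * n)" by simp
        then show ?thesis using Suc by (simp add: choose_two real_of_nat_div algebra_simps)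
      qed (simp add: numeral_2_eq_2)
      finally have e: "real (card {A. A \<subseteq> T b \<and> card A = 2}) = real (card (T b)) * (real (card (T b)) - 1) / 2" .
      show "(\<Sum>A | A \<subseteq> T b \<and> card A = 2. 1 / real (Q b)) = real (card (T b)) * (real (card (T b)) - 1) / (2 * real (Q b))"
        unfolding sum_constant e by simp
    qed
    finally show ?thesis by simp
  qed
  ultimately have "measure M (space M - (\<Union>s\<in>S. E s)) \<le> 1 - 2 * V / c + (V\<^sup>2 + V) / c\<^sup>2"
    using \<Theta>.prob_no_event_le[OF finS, of E c V] ES c by blast
  moreover have "{\<omega> \<in> space M. \<forall>b\<in>I. \<forall>i j. i \<noteq> j \<longrightarrow> i \<in> T b \<longrightarrow> j \<in> T b \<longrightarrow> arc (Q b) (\<theta> i \<omega>) \<noteq> arc (Q b) (\<theta> j \<omega>)} \<subseteq> space M - (\<Union>s\<in>S. E s)" (is "?L \<subseteq> _")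
  proof
    fix \<omega> assume \<omega>: "\<omega> \<in> ?L"
    have False if s: "s \<in> S" "\<omega> \<in> E s" for s
    proof -
      obtain b A where bA: "s = (b, A)" by (cases s)
      obtain i j where "A = {i, j}" "i \<noteq> j" using s(1) bA unfolding S_def card_2_iff by blast
      moreover have "b \<in> I" "A \<subseteq> T b" using that(1) bA by (auto simp: S_def)
      ultimately have "arc (Q b) (\<theta> i \<omega>) \<noteq> arc (Q b) (\<theta> j \<omega>)" "i \<in> A" "j \<in> A" using \<omega> by auto
      then show False using that(2) by (auto simp: E_def bA same_arc_def)
    qed
    then show "\<omega> \<in> space M - (\<Union>s\<in>S. E s)" using \<omega> by blast
  qed
  then have "measure M ?L \<le> measure M (space M - (\<Union>s\<in>S. E s))"
    using finS ES by (intro \<Theta>.finite_measure_mono sets.compl_sets sets.finite_UN) simp_all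
  ultimately show ?thesis by simp
qed

context determinantal_moments begin

lemma pair_product:
  assumes B: "circled B" "B \<subseteq> ball 0 r" and B': "circled B'" "B' \<subseteq> ball 0 r" and dj: "B \<inter> B' = {}"
  shows "integrable M (\<lambda>\<omega>. (N B \<omega> * (N B \<omega> - 1)) * (N B' \<omega> * (N B' \<omega> - 1)))"
    "(LINT \<omega>|M. (N B \<omega> * (N B \<omega> - 1)) * (N B' \<omega> * (N B' \<omega> - 1))) \<le> pair_mean B * pair_mean B'"
proof -
  note [measurable] = N_measurable[OF circled_borel[OF B(1)]] N_measurable[OF circled_borel[OF B'(1)]]
  have m: "(\<lambda>\<omega>. (N B \<omega> * (N B \<omega> - 1)) * (N B' \<omega> * (N B' \<omega> - 1))) \<in> borel_measurable M" by measurable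
  have a: "AE \<omega> in M. (N B \<omega> * (N B \<omega> - 1)) * (N B' \<omega> * (N B' \<omega> - 1)) = real (tuple_count X (Suc (Suc (Suc (Suc 0)))) (pair_bins B B') \<omega>)"
    using finite_bin[OF B] finite_bin[OF B']
  proof eventually_elim
    case (elim \<omega>)
    have "(\<lambda>l. {k. X k \<omega> \<in> pair_bins B B' l}) = pair_bins {k. X k \<omega> \<in> B} {k. X k \<omega> \<in> B'}"
      by (auto simp: pair_bins_def fun_eq_iff)
    moreover have "{k. X k \<omega> \<in> B} \<inter> {k. X k \<omega> \<in> B'} = {}" using dj by auto
    ultimately show ?case unfolding tuple_count_def using card_inj_pairs[OF elim] by (simp only: N_def)
  qed
  show "integrable M (\<lambda>\<omega>. (N B \<omega> * (N B \<omega> - 1)) * (N B' \<omega> * (N B' \<omega> - 1)))"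
    "(LINT \<omega>|M. (N B \<omega> * (N B \<omega> - 1)) * (N B' \<omega> * (N B' \<omega> - 1))) \<le> pair_mean B * pair_mean B'"
    by (rule quad_bound[OF B B' m a])+
qed

text \<open>In falling factorials the square of x(x-1) is the fourth one plus 4 times the third plus
  2 times the second: two ordered pairs share no point, one point or both.\<close>

lemma pair_square:
  assumes B: "circled B" "B \<subseteq> ball 0 r"
  shows "integrable M (\<lambda>\<omega>. (N B \<omega> * (N B \<omega> - 1)) * (N B \<omega> * (N B \<omega> - 1)))"
    "(LINT \<omega>|M. (N B \<omega> * (N B \<omega> - 1)) * (N B \<omega> * (N B \<omega> - 1)))
      \<le> pair_mean B * pair_mean B + pair_mean B * (4 * mean B + 2)"
proof -
  note [measurable] = N_measurable[OF circled_borel[OF B(1)]]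
  define f4 where "f4 \<omega> = N B \<omega> * (N B \<omega> - 1) * (N B \<omega> - 2) * (N B \<omega> - 3)" for \<omega>
  define f3 where "f3 \<omega> = N B \<omega> * (N B \<omega> - 1) * (N B \<omega> - 2)" for \<omega>
  define f2 where "f2 \<omega> = N B \<omega> * (N B \<omega> - 1)" for \<omega>
  have m: "f4 \<in> borel_measurable M" unfolding f4_def[abs_def] by measurable
  have a: "AE \<omega> in M. f4 \<omega> = real (tuple_count X (Suc (Suc (Suc (Suc 0)))) (pair_bins B B) \<omega>)"
    using finite_bin[OF B]
  proof eventually_elim
    case (elim \<omega>)
    have "pair_bins B B = (\<lambda>_. B)" by (simp add: pair_bins_def fun_eq_iff)
    then show ?case unfolding tuple_count_def f4_def using card_inj_4[OF elim] by (simp only: N_def)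
  qed
  note q = quad_bound[OF B B m a]
  have t: "integrable M f3" "(LINT \<omega>|M. f3 \<omega>) \<le> pair_mean B * mean B"
    using triple_bound[OF B] by (simp_all add: f3_def[abs_def])
  have p: "integrable M f2" "(LINT \<omega>|M. f2 \<omega>) = pair_mean B"
    using pair_limit[OF B] by (simp_all add: f2_def[abs_def] pair_mean_def)
  have e: "(N B \<omega> * (N B \<omega> - 1)) * (N B \<omega> * (N B \<omega> - 1)) = f4 \<omega> + 4 * f3 \<omega> + 2 * f2 \<omega>" for \<omega>
    by (simp add: f4_def f3_def f2_def algebra_simps)
  show "integrable M (\<lambda>\<omega>. (N B \<omega> * (N B \<omega> - 1)) * (N B \<omega> * (N B \<omega> - 1)))"
    unfolding e using q t p by auto
  have "(LINT \<omega>|M. f4 \<omega> + 4 * f3 \<omega> + 2 * f2 \<omega>) = (LINT \<omega>|M. f4 \<omega>) + 4 * (LINT \<omega>|M. f3 \<omega>) + 2 * (LINT \<omega>|M. f2 \<omega>)"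
    using q t p by simp
  then show "(LINT \<omega>|M. (N B \<omega> * (N B \<omega> - 1)) * (N B \<omega> * (N B \<omega> - 1)))
      \<le> pair_mean B * pair_mean B + pair_mean B * (4 * mean B + 2)"
    unfolding e using q(2) t(2) p(2) by (simp add: algebra_simps)
qed

end

section \<open>Decoupling of the points from the angles\<close>

locale hybrid_process = determinantal_moments +
  fixes \<theta> :: "nat \<Rightarrow> 'a \<Rightarrow> real"
  assumes iid: "iid_uniform_angles M \<theta>" and independent: "independent_sequences M X \<theta>"
begin

sublocale uniform_angles M \<theta> by unfold_locales (rule iid)

abbreviation "points \<equiv> (PiM UNIV (\<lambda>_. borel) :: (nat \<Rightarrow> complex) measure)"
abbreviation "angles \<equiv> (PiM UNIV (\<lambda>_. borel) :: (nat \<Rightarrow> real) measure)"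

text \<open>Fubini for the product law: the configuration is frozen at \<omega> while the angles run
  over an independent copy \<omega>'. A bound for almost every frozen configuration can therefore be
  integrated.\<close>

lemma decoupled_prob_le:
  assumes P: "Measurable.pred (points \<Otimes>\<^sub>M angles) (\<lambda>p. P (fst p) (snd p))"
    and f: "integrable M f" and le: "AE \<omega> in M. measure M {\<omega>' \<in> space M. P (\<lambda>k. X k \<omega>) (\<lambda>k. \<theta> k \<omega>')} \<le> f \<omega>"
  shows "{\<omega> \<in> space M. P (\<lambda>k. X k \<omega>) (\<lambda>k. \<theta> k \<omega>)} \<in> sets M"
    "measure M {\<omega> \<in> space M. P (\<lambda>k. X k \<omega>) (\<lambda>k. \<theta> k \<omega>)} \<le> (LINT \<omega>|M. f \<omega>)"
proof -
  \<comment> \<open>Both sides of \<open>indep_var\<close> have one value type, so in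
    \<open>independent_sequences\<close> the angles occur coerced to complex numbers. They are
    carried as such and read back through real parts in P'.\<close>
  let ?X = "\<lambda>\<omega> k. X k \<omega>" and ?T = "\<lambda>\<omega> k. complex_of_real (\<theta> k \<omega>)"
  have [measurable]: "?X \<in> M \<rightarrow>\<^sub>M points" "?T \<in> M \<rightarrow>\<^sub>M points"
    by (intro measurable_PiM_single' X_measurable borel_measurable_of_real \<theta>_measurable; auto)+
  have law: "distr M points ?X \<Otimes>\<^sub>M distr M points ?T = distr M (points \<Otimes>\<^sub>M points) (\<lambda>\<omega>. (?X \<omega>, ?T \<omega>))"
    using independent unfolding independent_sequences_def M.indep_var_distribution_eq by blast
  interpret T: prob_space "distr M points ?T" by (rule M.prob_space_distr) measurable
  define P' where "P' x s = P x (\<lambda>k. Re (s k))" for x and s :: "nat \<Rightarrow> complex"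
  have P': "Measurable.pred (points \<Otimes>\<^sub>M points) (\<lambda>p. P' (fst p) (snd p))"
  proof -
    have re: "(\<lambda>p k. Re (snd p k)) \<in> points \<Otimes>\<^sub>M points \<rightarrow>\<^sub>M angles"
      by (intro measurable_PiM_single' borel_measurable_Re measurable_compose[OF measurable_snd measurable_component_singleton]) auto
    have "Measurable.pred (points \<Otimes>\<^sub>M points) ((\<lambda>p. P (fst p) (snd p)) \<circ> (\<lambda>p. (fst p, \<lambda>k. Re (snd p k))))"
      by (rule measurable_comp[OF _ P]) (intro measurable_Pair measurable_fst re)
    then show ?thesis by (simp add: o_def P'_def)
  qed
  define F where "F = (\<lambda>p. indicator {p \<in> space (points \<Otimes>\<^sub>M points). P' (fst p) (snd p)} p :: ennreal)"
  have F: "F \<in> borel_measurable (points \<Otimes>\<^sub>M points)" unfolding F_def using P' by (intro borel_measurable_indicator) (simp add: pred_def)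
  have Fe: "F (x, t) = indicator {p. P' (fst p) (snd p)} (x, t)" for x t
    by (simp add: F_def space_pair_measure space_PiM indicator_def)
  have meas: "{\<omega> \<in> space M. P' (?X \<omega>) (?T \<omega>)} \<in> sets M"
  proof -
    have "Measurable.pred M ((\<lambda>p. P' (fst p) (snd p)) \<circ> (\<lambda>\<omega>. (?X \<omega>, ?T \<omega>)))"
      by (rule measurable_comp[OF _ P']) measurable
    then show ?thesis by (simp add: pred_def o_def)
  qed
  have meas': "{\<omega>' \<in> space M. P' x (?T \<omega>')} \<in> sets M" for x
  proof -
    have "Measurable.pred M ((\<lambda>p. P' (fst p) (snd p)) \<circ> (\<lambda>\<omega>'. (x, ?T \<omega>')))"
      by (rule measurable_comp[OF _ P']) (intro measurable_Pair, auto simp: space_PiM)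
    then show ?thesis by (simp add: pred_def o_def)
  qed
  show "{\<omega> \<in> space M. P (\<lambda>k. X k \<omega>) (\<lambda>k. \<theta> k \<omega>)} \<in> sets M" using meas by (simp add: P'_def)
  have "emeasure M {\<omega> \<in> space M. P' (?X \<omega>) (?T \<omega>)} = (\<integral>\<^sup>+\<omega>. F (?X \<omega>, ?T \<omega>) \<partial>M)"
    unfolding nn_integral_indicator[OF meas, symmetric] by (intro nn_integral_cong) (simp add: Fe indicator_def)
  also have "\<dots> = (\<integral>\<^sup>+p. F p \<partial>distr M (points \<Otimes>\<^sub>M points) (\<lambda>\<omega>. (?X \<omega>, ?T \<omega>)))"
    using F by (subst nn_integral_distr) auto
  also have "\<dots> = (\<integral>\<^sup>+x. \<integral>\<^sup>+t. F (x, t) \<partial>distr M points ?T \<partial>distr M points ?X)"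
    unfolding law[symmetric] using F by (intro T.nn_integral_fst[symmetric]) (simp cong: measurable_cong_sets)
  also have "\<dots> = (\<integral>\<^sup>+x. \<integral>\<^sup>+\<omega>'. F (x, ?T \<omega>') \<partial>M \<partial>distr M points ?X)"
    using F by (intro nn_integral_cong nn_integral_distr) (auto simp: space_PiM)
  also have "\<dots> = (\<integral>\<^sup>+\<omega>. \<integral>\<^sup>+\<omega>'. F (?X \<omega>, ?T \<omega>') \<partial>M \<partial>M)"
    using F by (intro nn_integral_distr) (measurable, auto)
  also have "\<dots> \<le> (\<integral>\<^sup>+\<omega>. ennreal (f \<omega>) \<partial>M)"
  proof (rule nn_integral_mono_AE, use le in eventually_elim)
    case (elim \<omega>)
    have "(\<integral>\<^sup>+\<omega>'. F (?X \<omega>, ?T \<omega>') \<partial>M) = emeasure M {\<omega>' \<in> space M. P' (?X \<omega>) (?T \<omega>')}"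
      unfolding nn_integral_indicator[OF meas', symmetric] by (intro nn_integral_cong) (simp add: Fe indicator_def)
    then show ?case using elim by (simp add: M.emeasure_eq_measure ennreal_leI P'_def)
  qed
  also have "\<dots> = ennreal (LINT \<omega>|M. f \<omega>)"
    using le by (intro nn_integral_eq_integral f) (auto elim!: eventually_mono intro: order_trans[OF measure_nonneg])
  finally have "ennreal (measure M {\<omega> \<in> space M. P' (?X \<omega>) (?T \<omega>)}) \<le> ennreal (LINT \<omega>|M. f \<omega>)"
    by (simp add: M.emeasure_eq_measure)
  moreover have "0 \<le> (LINT \<omega>|M. f \<omega>)"
    using le by (intro integral_nonneg_AE) (auto elim!: eventually_mono intro: order_trans[OF measure_nonneg])
  ultimately show "measure M {\<omega> \<in> space M. P (\<lambda>k. X k \<omega>) (\<lambda>k. \<theta> k \<omega>)} \<le> (LINT \<omega>|M. f \<omega>)" by (simp add: P'_def)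
qed

lemma point_component[measurable]: "(\<lambda>p. fst p i) \<in> points \<Otimes>\<^sub>M angles \<rightarrow>\<^sub>M borel"
  by (rule measurable_compose[OF measurable_fst measurable_component_singleton]) simp

lemma angle_component[measurable]: "(\<lambda>p. snd p i) \<in> points \<Otimes>\<^sub>M angles \<rightarrow>\<^sub>M borel"
  by (rule measurable_compose[OF measurable_snd measurable_component_singleton]) simp

lemma arc_component[measurable]: "(\<lambda>p. arc Q (snd p i)) \<in> points \<Otimes>\<^sub>M angles \<rightarrow>\<^sub>M count_space UNIV"
  by (rule measurable_compose[OF angle_component arc_measurable])

text \<open>Given the points, \<open>prob_no_same_arc\<close> applies with random V and with centre
  m, the expectation of V. Integrating needs the second moment of V: its off-diagonal terms are at
  most products of pair means, adding up to at most m^2 together with the leading diagonal terms,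
  and the remaining diagonal terms cost m (2C + 1). What is left of 1 - 2 + (m^2 + m (2C + 1) + m) /
  m^2 is the bound.\<close>

lemma prob_no_collision:
  fixes Q :: "'b \<Rightarrow> nat" and C m :: real
  assumes I: "finite I" "disjoint_family_on B I" "\<And>b. b \<in> I \<Longrightarrow> circled (B b)" "\<And>b. b \<in> I \<Longrightarrow> B b \<subseteq> ball 0 r"
      "\<And>b. b \<in> I \<Longrightarrow> 0 < Q b" "\<And>b. b \<in> I \<Longrightarrow> mean (B b) \<le> C * Q b"
    and m: "m = (\<Sum>b\<in>I. pair_mean (B b) / (2 * Q b))" "m > 0"
  shows "{\<omega> \<in> space M. \<forall>b\<in>I. \<forall>i j. i \<noteq> j \<longrightarrow> X i \<omega> \<in> B b \<longrightarrow> X j \<omega> \<in> B b \<longrightarrow> arc (Q b) (\<theta> i \<omega>) \<noteq> arc (Q b) (\<theta> j \<omega>)} \<in> sets M"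
    "measure M {\<omega> \<in> space M. \<forall>b\<in>I. \<forall>i j. i \<noteq> j \<longrightarrow> X i \<omega> \<in> B b \<longrightarrow> X j \<omega> \<in> B b \<longrightarrow> arc (Q b) (\<theta> i \<omega>) \<noteq> arc (Q b) (\<theta> j \<omega>)} \<le> (2 * C + 2) / m"
proof -
  let ?P = "\<lambda>x t. \<forall>b\<in>I. \<forall>i j. i \<noteq> j \<longrightarrow> x i \<in> B b \<longrightarrow> x j \<in> B b \<longrightarrow> arc (Q b) (t i) \<noteq> arc (Q b) (t j)"
  define n where "n b \<omega> = N (B b) \<omega> * (N (B b) \<omega> - 1)" for b \<omega>
  define q where "q b = 1 / (2 * real (Q b))" for b
  define V where "V \<omega> = (\<Sum>b\<in>I. n b \<omega> * q b)" for \<omega>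
  have q0: "0 \<le> q b" for b by (simp add: q_def)
  have iN: "integrable M (n b)" "(LINT \<omega>|M. n b \<omega>) = pair_mean (B b)" if "b \<in> I" for b
    using pair_limit(1)[OF I(3,4)[OF that]] by (simp_all add: n_def[abs_def] pair_mean_def)
  have iNN: "integrable M (\<lambda>\<omega>. n b \<omega> * n b' \<omega>)" if "b \<in> I" "b' \<in> I" for b b'
  proof (cases "b = b'")
    case True
    then show ?thesis using pair_square(1)[OF I(3,4)[OF that(1)]] by (simp add: n_def)
  next
    case False
    then have "B b \<inter> B b' = {}" using I(2) that by (auto simp: disjoint_family_on_def)
    then show ?thesis using pair_product(1)[OF I(3,4)[OF that(1)] I(3,4)[OF that(2)]] by (simp add: n_def)
  qed
  have leNN: "(LINT \<omega>|M. n b \<omega> * n b' \<omega>) \<le> pair_mean (B b) * pair_mean (B b') + (if b = b' then pair_mean (B b) * (4 * mean (B b) + 2) else 0)"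
    if "b \<in> I" "b' \<in> I" for b b'
  proof (cases "b = b'")
    case True
    then show ?thesis using pair_square(2)[OF I(3,4)[OF that(1)]] by (simp add: n_def)
  next
    case False
    then have "B b \<inter> B b' = {}" using I(2) that by (auto simp: disjoint_family_on_def)
    then show ?thesis using False pair_product(2)[OF I(3,4)[OF that(1)] I(3,4)[OF that(2)]] by (simp add: n_def)
  qed
  have iV: "integrable M V" unfolding V_def[abs_def] using iN by auto
  have EV: "(LINT \<omega>|M. V \<omega>) = m"
    unfolding V_def m using iN by (subst Bochner_Integration.integral_sum) (auto simp: q_def intro!: sum.cong)
  have V2: "(V \<omega>)\<^sup>2 = (\<Sum>b\<in>I. \<Sum>b'\<in>I. (n b \<omega> * n b' \<omega>) * (q b * q b'))" for \<omega>
    by (simp add: V_def power2_eq_square sum_product mult_ac)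
  have iV2: "integrable M (\<lambda>\<omega>. (V \<omega>)\<^sup>2)" unfolding V2 using iNN by (intro Bochner_Integration.integrable_sum) auto
  have "(LINT \<omega>|M. (V \<omega>)\<^sup>2) = (\<Sum>b\<in>I. (LINT \<omega>|M. (\<Sum>b'\<in>I. (n b \<omega> * n b' \<omega>) * (q b * q b'))))"
    unfolding V2 using iNN by (intro Bochner_Integration.integral_sum Bochner_Integration.integrable_sum) auto
  also have "\<dots> = (\<Sum>b\<in>I. \<Sum>b'\<in>I. (LINT \<omega>|M. (n b \<omega> * n b' \<omega>) * (q b * q b')))"
    using iNN by (intro sum.cong refl Bochner_Integration.integral_sum) auto
  also have "\<dots> = (\<Sum>b\<in>I. \<Sum>b'\<in>I. (LINT \<omega>|M. n b \<omega> * n b' \<omega>) * (q b * q b'))" by simp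
  also have "\<dots> \<le> (\<Sum>b\<in>I. \<Sum>b'\<in>I. (pair_mean (B b) * pair_mean (B b') + (if b = b' then pair_mean (B b) * (4 * mean (B b) + 2) else 0)) * (q b * q b'))"
    using leNN q0 by (intro sum_mono mult_right_mono) auto
  also have "\<dots> = (\<Sum>b\<in>I. \<Sum>b'\<in>I. (pair_mean (B b) * q b) * (pair_mean (B b') * q b') + (if b = b' then pair_mean (B b) * (4 * mean (B b) + 2) * (q b * q b) else 0))"
    by (intro sum.cong refl) (simp add: algebra_simps)
  also have "\<dots> = (\<Sum>b\<in>I. pair_mean (B b) * q b)\<^sup>2 + (\<Sum>b\<in>I. pair_mean (B b) * (4 * mean (B b) + 2) * (q b * q b))"
    using I(1) by (simp add: sum.distrib power2_eq_square sum_product)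
  also have "(\<Sum>b\<in>I. pair_mean (B b) * q b) = m" unfolding m by (intro sum.cong) (auto simp: q_def)
  also have "(\<Sum>b\<in>I. pair_mean (B b) * (4 * mean (B b) + 2) * (q b * q b)) \<le> (\<Sum>b\<in>I. pair_mean (B b) / (2 * Q b) * (2 * C + 1))"
  proof (rule sum_mono)
    fix b assume b: "b \<in> I"
    \<comment> \<open>With at most C Q points expected per bin this is at most 2C + 1/Q; a bin must
      not be so crowded that its own fluctuations dominate.\<close>
    have "(4 * mean (B b) + 2) * q b \<le> 2 * C + 1" using I(5,6)[OF b] by (simp add: q_def field_simps)
    then have "(pair_mean (B b) * q b) * ((4 * mean (B b) + 2) * q b) \<le> (pair_mean (B b) * q b) * (2 * C + 1)"
      using pair_mean_nonneg[OF I(3,4)[OF b]] q0 by (intro mult_left_mono) auto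
    then show "pair_mean (B b) * (4 * mean (B b) + 2) * (q b * q b) \<le> pair_mean (B b) / (2 * Q b) * (2 * C + 1)"
      by (simp add: q_def mult_ac)
  qed
  also have "\<dots> = m * (2 * C + 1)" unfolding m by (simp add: sum_distrib_right)
  finally have EV2: "(LINT \<omega>|M. (V \<omega>)\<^sup>2) \<le> m\<^sup>2 + m * (2 * C + 1)" by simp
  have P: "Measurable.pred (points \<Otimes>\<^sub>M angles) (\<lambda>p. ?P (fst p) (snd p))"
  proof -
    have [measurable]: "Measurable.pred (points \<Otimes>\<^sub>M angles) (\<lambda>p. fst p i \<in> B b)" if "b \<in> I" for i b
      using circled_borel[OF I(3)[OF that]] by measurable
    show ?thesis using I(1) by measurable
  qed
  have i: "integrable M (\<lambda>\<omega>. 1 - 2 * V \<omega> / m + ((V \<omega>)\<^sup>2 + V \<omega>) / m\<^sup>2)" using iV iV2 by auto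
  have "AE \<omega> in M. \<forall>b\<in>I. finite {k. X k \<omega> \<in> B b}"
    using I(1) finite_bin[OF I(3,4)] by (auto intro!: AE_finite_allI)
  then have le: "AE \<omega> in M. measure M {\<omega>' \<in> space M. ?P (\<lambda>k. X k \<omega>) (\<lambda>k. \<theta> k \<omega>')} \<le> 1 - 2 * V \<omega> / m + ((V \<omega>)\<^sup>2 + V \<omega>) / m\<^sup>2"
  proof eventually_elim
    case (elim \<omega>)
    have "disjoint_family_on (\<lambda>b. {k. X k \<omega> \<in> B b}) I" using I(2) by (auto simp: disjoint_family_on_def)
    from prob_no_same_arc[OF I(1) this _ I(5) m(2), where V="V \<omega>"] elim
    show ?case by (simp add: V_def n_def q_def N_def)
  qed
  note d = decoupled_prob_le[OF P i le]
  show "{\<omega> \<in> space M. \<forall>b\<in>I. \<forall>i j. i \<noteq> j \<longrightarrow> X i \<omega> \<in> B b \<longrightarrow> X j \<omega> \<in> B b \<longrightarrow> arc (Q b) (\<theta> i \<omega>) \<noteq> arc (Q b) (\<theta> j \<omega>)} \<in> sets M"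
    by (rule d)
  have "(LINT \<omega>|M. 1 - 2 * V \<omega> / m + ((V \<omega>)\<^sup>2 + V \<omega>) / m\<^sup>2) = 1 - 2 * m / m + ((LINT \<omega>|M. (V \<omega>)\<^sup>2) + m) / m\<^sup>2"
    using iV iV2 by (simp add: EV M.prob_space)
  also have "\<dots> \<le> 1 - 2 * m / m + ((m\<^sup>2 + m * (2 * C + 1)) + m) / m\<^sup>2"
    using EV2 by (intro add_left_mono divide_right_mono add_right_mono) auto
  also have "\<dots> = (2 * C + 2) / m" using m(2) by (simp add: field_simps power2_eq_square)
  finally show "measure M {\<omega> \<in> space M. \<forall>b\<in>I. \<forall>i j. i \<noteq> j \<longrightarrow> X i \<omega> \<in> B b \<longrightarrow> X j \<omega> \<in> B b \<longrightarrow> arc (Q b) (\<theta> i \<omega>) \<noteq> arc (Q b) (\<theta> j \<omega>)} \<le> (2 * C + 2) / m"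
    using d(2) by simp
qed

text \<open>Given the points, a union bound over ordered pairs of distinct indices with
  \<open>prob_near\<close>; the number of such pairs has expectation
  \<open>pair_mean\<close>.\<close>

lemma prob_near_pair:
  assumes B: "circled B" "B \<subseteq> ball 0 r" and Q: "0 < Q"
  shows "{\<omega> \<in> space M. \<exists>i j. i \<noteq> j \<and> X i \<omega> \<in> B \<and> X j \<omega> \<in> B \<and> near Q (\<theta> i \<omega>) (\<theta> j \<omega>)} \<in> sets M"
    "measure M {\<omega> \<in> space M. \<exists>i j. i \<noteq> j \<and> X i \<omega> \<in> B \<and> X j \<omega> \<in> B \<and> near Q (\<theta> i \<omega>) (\<theta> j \<omega>)} \<le> 3 / Q * pair_mean B"
proof -
  let ?P = "\<lambda>x t. \<exists>i j. i \<noteq> j \<and> x i \<in> B \<and> x j \<in> B \<and> near Q (t i) (t j)"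
  have P: "Measurable.pred (points \<Otimes>\<^sub>M angles) (\<lambda>p. ?P (fst p) (snd p))"
  proof -
    have [measurable]: "Measurable.pred (points \<Otimes>\<^sub>M angles) (\<lambda>p. fst p i \<in> B)" for i
      using circled_borel[OF B(1)] by measurable
    have [measurable]: "Measurable.pred (points \<Otimes>\<^sub>M angles) (\<lambda>p. near Q (snd p i) (snd p j))" for i j
      unfolding near_def by measurable
    show ?thesis by measurable
  qed
  have i: "integrable M (\<lambda>\<omega>. 3 / Q * (N B \<omega> * (N B \<omega> - 1)))" using pair_limit(1)[OF B] by auto
  have le: "AE \<omega> in M. measure M {\<omega>' \<in> space M. ?P (\<lambda>k. X k \<omega>) (\<lambda>k. \<theta> k \<omega>')} \<le> 3 / Q * (N B \<omega> * (N B \<omega> - 1))"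
    using finite_bin[OF B]
  proof eventually_elim
    case (elim \<omega>)
    let ?T = "{k. X k \<omega> \<in> B}"
    let ?S = "SIGMA i:?T. ?T - {i}"
    let ?E = "\<lambda>p. {\<omega>' \<in> space M. near Q (\<theta> (fst p) \<omega>') (\<theta> (snd p) \<omega>')}"
    have "{\<omega>' \<in> space M. ?P (\<lambda>k. X k \<omega>) (\<lambda>k. \<theta> k \<omega>')} = (\<Union>p\<in>?S. ?E p)" by (auto; metis)
    also have "measure M (\<Union>p\<in>?S. ?E p) \<le> (\<Sum>p\<in>?S. measure M (?E p))"
      using elim near_sets by (intro M.finite_measure_subadditive_finite) auto
    also have "\<dots> \<le> (\<Sum>p\<in>?S. 3 / Q)"
    proof (rule sum_mono)
      fix p assume "p \<in> ?S"
      then have "fst p \<noteq> snd p" by auto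
      then show "measure M (?E p) \<le> 3 / Q" by (rule prob_near[OF _ Q])
    qed
    also have "\<dots> = real (\<Sum>i\<in>?T. card (?T - {i})) * (3 / Q)" using elim by (simp add: card_SigmaI)
    also have "real (\<Sum>i\<in>?T. card (?T - {i})) = (\<Sum>i\<in>?T. N B \<omega> - 1)"
      unfolding of_nat_sum N_def using sum_const_Diff[OF elim, of _ "1::real"] by (intro sum.cong refl) simp
    finally show ?case by (simp add: N_def mult_ac)
  qed
  note d = decoupled_prob_le[OF P i le]
  show "{\<omega> \<in> space M. \<exists>i j. i \<noteq> j \<and> X i \<omega> \<in> B \<and> X j \<omega> \<in> B \<and> near Q (\<theta> i \<omega>) (\<theta> j \<omega>)} \<in> sets M"
    by (rule d)
  show "measure M {\<omega> \<in> space M. \<exists>i j. i \<noteq> j \<and> X i \<omega> \<in> B \<and> X j \<omega> \<in> B \<and> near Q (\<theta> i \<omega>) (\<theta> j \<omega>)} \<le> 3 / Q * pair_mean B"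
    using d(2) by (simp add: pair_mean_def)
qed

end

section \<open>Close pairs in annuli\<close>

context fock_radial begin

text \<open>The Fock measure with \<phi> replaced by the real-valued radial U, which agrees with it
  almost everywhere.\<close>

definition weight :: "complex measure" where
  "weight = density lborel (\<lambda>z. ennreal (exp (- 2 * U (cmod z)) / (R (cmod z))\<^sup>2))"

lemma nn_integral_weight:
  assumes [measurable]: "f \<in> borel_measurable borel"
  shows "(\<integral>\<^sup>+z. f (cmod z) \<partial>weight) = (\<integral>\<^sup>+r. ennreal (2 * pi * r * (exp (- 2 * U r) / (R r)\<^sup>2)) * indicator {0<..} r * f r \<partial>lborel)"
proof -
  have "(\<integral>\<^sup>+z. f (cmod z) \<partial>weight) = (\<integral>\<^sup>+z. ennreal (exp (- 2 * U (cmod z)) / (R (cmod z))\<^sup>2) * f (cmod z) \<partial>lborel)"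
    unfolding weight_def by (subst nn_integral_density) auto
  also have "\<dots> = (\<integral>\<^sup>+r. ennreal (2 * pi * r) * indicator {0<..} r * (ennreal (exp (- 2 * U r) / (R r)\<^sup>2) * f r) \<partial>lborel)"
    by (rule nn_integral_radial) measurable
  also have "\<dots> = (\<integral>\<^sup>+r. ennreal (2 * pi * r * (exp (- 2 * U r) / (R r)\<^sup>2)) * indicator {0<..} r * f r \<partial>lborel)"
    by (intro nn_integral_cong, subst ennreal_mult'', simp, simp only: mult_ac)
  finally show ?thesis .
qed

lemma radial_moments_weight: "radial_moments weight c"
proof
  show "sets weight = sets borel" by (simp add: weight_def)
  show "0 < c k" for k by (rule c_pos)
  show "(\<integral>\<^sup>+z. ennreal (cmod z ^ (2 * k)) \<partial>weight) = ennreal (c k)" for k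
  proof -
    have "(\<integral>\<^sup>+z. ennreal (cmod z ^ (2 * k)) \<partial>weight) = cc k"
      unfolding cc_def
      by (subst nn_integral_weight, measurable, intro nn_integral_cong) (auto simp: indicator_def ennreal_mult' [symmetric] mult_ac)
    then show ?thesis by (simp add: cc_eq)
  qed
  show "distr weight borel (\<lambda>z. cis t * z) = weight" for t
  proof (rule measure_eqI)
    fix A assume "A \<in> sets (distr weight borel (\<lambda>z. cis t * z))"
    then have A[measurable]: "A \<in> sets borel" by simp
    let ?w = "\<lambda>z. ennreal (exp (- 2 * U (cmod z)) / (R (cmod z))\<^sup>2)"
    have vim: "(\<lambda>z. cis t * z) -` A \<in> sets borel" by (rule measurable_sets_borel[OF _ A]) measurable
    have "emeasure (distr weight borel (\<lambda>z. cis t * z)) A = emeasure weight ((\<lambda>z. cis t * z) -` A)"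
      by (subst emeasure_distr) (auto simp: weight_def)
    also have "\<dots> = (\<integral>\<^sup>+z. ?w z * indicator ((\<lambda>z. cis t * z) -` A) z \<partial>lborel)"
      unfolding weight_def using vim by (intro emeasure_density) simp_all
    also have "\<dots> = (\<integral>\<^sup>+z. ?w (cis t * z) * indicator A (cis t * z) \<partial>lborel)"
      by (intro nn_integral_cong) (simp add: norm_mult indicator_def)
    also have "\<dots> = (\<integral>\<^sup>+z. ?w z * indicator A z \<partial>lborel)"
      by (rule nn_integral_rotation[of "\<lambda>z. ?w z * indicator A z"]) measurable
    also have "\<dots> = emeasure weight A"
      unfolding weight_def by (rule emeasure_density[symmetric]) auto
    finally show "emeasure (distr weight borel (\<lambda>z. cis t * z)) A = emeasure weight A" .
  qed (simp add: weight_def)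
qed

end

locale fock_process = fock_radial +
  fixes K :: "complex \<Rightarrow> complex \<Rightarrow> complex" and M :: "'a measure"
    and X :: "nat \<Rightarrow> 'a \<Rightarrow> complex" and \<theta> :: "nat \<Rightarrow> 'a \<Rightarrow> real"
  assumes hybrid_weight: "hybrid_process weight c K M X \<theta>"
begin

sublocale D: hybrid_process weight c K M X \<theta> by (rule hybrid_weight)

lemma a_radial:
  assumes I[measurable]: "I \<in> sets borel" and pos: "I \<subseteq> {0<..}"
  shows "ennreal (D.a k {z. cmod z \<in> I}) = (\<integral>\<^sup>+r\<in>I. ennreal (2 * pi * r / (R r)\<^sup>2 * \<kappa> k r) \<partial>lborel)"
proof -
  have m: "{z. cmod z \<in> I} \<in> sets borel" using circledI[OF I] by (rule circled_borel)
  have int: "integrable weight (\<lambda>z. indicator {z. cmod z \<in> I} z *\<^sub>R cmod z ^ (2 * k))"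
    by (intro integrable_mult_indicator D.integrable_even_power) (use m in simp)
  have "ennreal (D.a k {z. cmod z \<in> I}) = ennreal (LINT z|weight. indicator {z. cmod z \<in> I} z * cmod z ^ (2 * k)) * ennreal (1 / c k)"
    using c_pos[of k] unfolding D.a_def by (subst ennreal_mult[symmetric]) (auto intro!: Bochner_Integration.integral_nonneg)
  also have "ennreal (LINT z|weight. indicator {z. cmod z \<in> I} z * cmod z ^ (2 * k)) = (\<integral>\<^sup>+z. ennreal (indicator {z. cmod z \<in> I} z * cmod z ^ (2 * k)) \<partial>weight)"
    using int by (intro nn_integral_eq_integral[symmetric]) auto
  also have "\<dots> = (\<integral>\<^sup>+z. ennreal (indicator I (cmod z) * cmod z ^ (2 * k)) \<partial>weight)"
    by (intro nn_integral_cong) (simp add: indicator_def)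
  also have "\<dots> = (\<integral>\<^sup>+r. ennreal (2 * pi * r * (exp (- 2 * U r) / (R r)\<^sup>2)) * indicator {0<..} r * ennreal (indicator I r * r ^ (2 * k)) \<partial>lborel)"
    by (rule nn_integral_weight[of "\<lambda>r. ennreal (indicator I r * r ^ (2 * k))"]) measurable
  also have "\<dots> * ennreal (1 / c k) = (\<integral>\<^sup>+r. ennreal (2 * pi * r * (exp (- 2 * U r) / (R r)\<^sup>2)) * indicator {0<..} r * ennreal (indicator I r * r ^ (2 * k)) * ennreal (1 / c k) \<partial>lborel)"
    by (rule nn_integral_multc[symmetric]) measurable
  also have "\<dots> = (\<integral>\<^sup>+r\<in>I. ennreal (2 * pi * r / (R r)\<^sup>2 * \<kappa> k r) \<partial>lborel)"
  proof (intro nn_integral_cong)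
    fix r
    show "ennreal (2 * pi * r * (exp (- 2 * U r) / (R r)\<^sup>2)) * indicator {0<..} r * ennreal (indicator I r * r ^ (2 * k)) * ennreal (1 / c k)
      = ennreal (2 * pi * r / (R r)\<^sup>2 * \<kappa> k r) * indicator I r"
    proof (cases "r \<in> I")
      case True
      then have "0 < r" using pos by auto
      then have "ennreal (2 * pi * r * (exp (- 2 * U r) / (R r)\<^sup>2)) * ennreal (r ^ (2 * k)) * ennreal (1 / c k)
        = ennreal (2 * pi * r * (exp (- 2 * U r) / (R r)\<^sup>2) * r ^ (2 * k) * (1 / c k))"
        using c_pos[of k] by (simp add: ennreal_mult'[symmetric] ennreal_mult''[symmetric])
      then show ?thesis using True \<open>0 < r\<close> by (simp add: \<kappa>_def mult_ac)
    qed simp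
  qed
  finally show ?thesis .
qed

lemma \<kappa>_measurable[measurable]: "\<kappa> k \<in> borel_measurable borel"
  unfolding \<kappa>_def[abs_def] by measurable

lemma sum_a_radial:
  assumes I[measurable]: "I \<in> sets borel" and pos: "I \<subseteq> {0<..}"
  shows "ennreal (\<Sum>k<n. D.a k {z. cmod z \<in> I}) = (\<integral>\<^sup>+r\<in>I. ennreal (2 * pi * r / (R r)\<^sup>2 * (\<Sum>k<n. \<kappa> k r)) \<partial>lborel)"
proof -
  have "ennreal (\<Sum>k<n. D.a k {z. cmod z \<in> I}) = (\<Sum>k<n. ennreal (D.a k {z. cmod z \<in> I}))"
    by (rule sum_ennreal[symmetric]) (rule D.a_nonneg)
  also have "\<dots> = (\<Sum>k<n. (\<integral>\<^sup>+r\<in>I. ennreal (2 * pi * r / (R r)\<^sup>2 * \<kappa> k r) \<partial>lborel))"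
    by (simp add: a_radial[OF assms])
  also have "\<dots> = (\<integral>\<^sup>+r. (\<Sum>k<n. ennreal (2 * pi * r / (R r)\<^sup>2 * \<kappa> k r) * indicator I r) \<partial>lborel)"
    by (rule nn_integral_sum[symmetric]) measurable
  also have "\<dots> = (\<integral>\<^sup>+r\<in>I. ennreal (2 * pi * r / (R r)\<^sup>2 * (\<Sum>k<n. \<kappa> k r)) \<partial>lborel)"
  proof (intro nn_integral_cong)
    fix r
    show "(\<Sum>k<n. ennreal (2 * pi * r / (R r)\<^sup>2 * \<kappa> k r) * indicator I r) = ennreal (2 * pi * r / (R r)\<^sup>2 * (\<Sum>k<n. \<kappa> k r)) * indicator I r"
    proof (cases "r \<in> I")
      case True
      then have "0 < r" using pos by auto
      then show ?thesis using True \<kappa>_nonneg by (simp add: sum_distrib_left)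
    qed simp
  qed
  finally show ?thesis .
qed

lemma mean_radial_le:
  assumes I: "I \<in> sets borel" "\<And>r. r \<in> I \<Longrightarrow> 0 < r \<and> r < s \<and> R r \<le> r / 2"
  shows "ennreal (D.mean {z. cmod z \<in> I}) \<le> ennreal (10 * KU) * (\<integral>\<^sup>+r\<in>I. ennreal (2 * pi * r / (R r)\<^sup>2) \<partial>lborel)"
proof (rule LIMSEQ_le_const2)
  note [measurable] = I(1)
  have B: "circled {z. cmod z \<in> I}" "{z. cmod z \<in> I} \<subseteq> ball 0 s" using circledI[OF I(1)] I(2) by auto
  show "(\<lambda>n. ennreal (\<Sum>k<n. D.a k {z. cmod z \<in> I})) \<longlonglongrightarrow> ennreal (D.mean {z. cmod z \<in> I})"
    by (intro tendsto_ennrealI D.mean_limit[OF B])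
  have "ennreal (\<Sum>k<n. D.a k {z. cmod z \<in> I}) \<le> ennreal (10 * KU) * (\<integral>\<^sup>+r\<in>I. ennreal (2 * pi * r / (R r)\<^sup>2) \<partial>lborel)" for n
  proof -
    have "ennreal (\<Sum>k<n. D.a k {z. cmod z \<in> I}) = (\<integral>\<^sup>+r\<in>I. ennreal (2 * pi * r / (R r)\<^sup>2 * (\<Sum>k<n. \<kappa> k r)) \<partial>lborel)"
      using I by (intro sum_a_radial) auto
    also have "\<dots> \<le> (\<integral>\<^sup>+r. ennreal (10 * KU) * (ennreal (2 * pi * r / (R r)\<^sup>2) * indicator I r) \<partial>lborel)"
    proof (intro nn_integral_mono)
      fix r
      show "ennreal (2 * pi * r / (R r)\<^sup>2 * (\<Sum>k<n. \<kappa> k r)) * indicator I r \<le> ennreal (10 * KU) * (ennreal (2 * pi * r / (R r)\<^sup>2) * indicator I r)"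
      proof (cases "r \<in> I")
        case True
        then have "2 * pi * r / (R r)\<^sup>2 * (\<Sum>k<n. \<kappa> k r) \<le> 2 * pi * r / (R r)\<^sup>2 * (10 * KU)"
          using I(2) \<kappa>_sum_upper by (intro mult_left_mono) (auto simp: less_imp_le)
        then show ?thesis using True KU_pos I(2) by (simp add: ennreal_mult'[symmetric] mult.commute ennreal_leI)
      qed simp
    qed
    also have "\<dots> = ennreal (10 * KU) * (\<integral>\<^sup>+r\<in>I. ennreal (2 * pi * r / (R r)\<^sup>2) \<partial>lborel)"
      by (intro nn_integral_cmult) measurable
    finally show ?thesis .
  qed
  then show "\<exists>N. \<forall>n\<ge>N. ennreal (\<Sum>k<n. D.a k {z. cmod z \<in> I}) \<le> ennreal (10 * KU) * (\<integral>\<^sup>+r\<in>I. ennreal (2 * pi * r / (R r)\<^sup>2) \<partial>lborel)" by blast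
qed

text \<open>The number of modes after which the lower bound \<alpha> holds depends on r, so no
  single partial sum works on all of I. The increasing partial sums pass to their supremum under the
  integral instead.\<close>

lemma mean_radial_ge:
  assumes I: "I \<in> sets borel" "\<And>r. r \<in> I \<Longrightarrow> 0 < r \<and> r < s" and \<alpha>: "\<alpha> \<ge> 0"
    "\<And>r. r \<in> I \<Longrightarrow> \<exists>n0. \<forall>n\<ge>n0. \<alpha> \<le> (\<Sum>k<n. \<kappa> k r)"
  shows "ennreal \<alpha> * (\<integral>\<^sup>+r\<in>I. ennreal (2 * pi * r / (R r)\<^sup>2) \<partial>lborel) \<le> ennreal (D.mean {z. cmod z \<in> I})"
proof -
  note [measurable] = I(1)
  have B: "circled {z. cmod z \<in> I}" "{z. cmod z \<in> I} \<subseteq> ball 0 s" using circledI[OF I(1)] I(2) by auto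
  let ?f = "\<lambda>n r. ennreal (2 * pi * r / (R r)\<^sup>2 * (\<Sum>k<n. \<kappa> k r)) * indicator I r"
  have "ennreal \<alpha> * (\<integral>\<^sup>+r\<in>I. ennreal (2 * pi * r / (R r)\<^sup>2) \<partial>lborel) = (\<integral>\<^sup>+r. ennreal \<alpha> * (ennreal (2 * pi * r / (R r)\<^sup>2) * indicator I r) \<partial>lborel)"
    by (intro nn_integral_cmult[symmetric]) measurable
  also have "\<dots> \<le> (\<integral>\<^sup>+r. (SUP n. ?f n r) \<partial>lborel)"
  proof (intro nn_integral_mono)
    fix r
    show "ennreal \<alpha> * (ennreal (2 * pi * r / (R r)\<^sup>2) * indicator I r) \<le> (SUP n. ?f n r)"
    proof (cases "r \<in> I")
      case True
      then obtain n where n: "\<alpha> \<le> (\<Sum>k<n. \<kappa> k r)" using \<alpha>(2) by blast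
      have "2 * pi * r / (R r)\<^sup>2 * \<alpha> \<le> 2 * pi * r / (R r)\<^sup>2 * (\<Sum>k<n. \<kappa> k r)"
        using n I(2)[OF True] by (intro mult_left_mono) auto
      then have "ennreal \<alpha> * (ennreal (2 * pi * r / (R r)\<^sup>2) * indicator I r) \<le> ?f n r"
        using True \<alpha>(1) I(2) by (simp add: ennreal_mult'[symmetric] mult.commute ennreal_leI)
      also have "\<dots> \<le> (SUP n. ?f n r)" by (rule SUP_upper) simp
      finally show ?thesis .
    qed simp
  qed
  also have "\<dots> = (SUP n. \<integral>\<^sup>+r. ?f n r \<partial>lborel)"
  proof (rule nn_integral_monotone_convergence_SUP)
    show "incseq ?f"
    proof (rule incseq_SucI, rule le_funI)
      fix n r
      show "?f n r \<le> ?f (Suc n) r"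
      proof (cases "r \<in> I")
        case True
        then have "2 * pi * r / (R r)\<^sup>2 * (\<Sum>k<n. \<kappa> k r) \<le> 2 * pi * r / (R r)\<^sup>2 * (\<Sum>k<Suc n. \<kappa> k r)"
          using I(2)[of r] \<kappa>_nonneg[of n r] by (intro mult_left_mono) auto
        then show ?thesis using True by (simp add: ennreal_leI)
      qed simp
    qed
  qed measurable
  also have "\<dots> \<le> ennreal (D.mean {z. cmod z \<in> I})"
  proof (rule SUP_least)
    fix n
    have "(\<integral>\<^sup>+r. ?f n r \<partial>lborel) = ennreal (\<Sum>k<n. D.a k {z. cmod z \<in> I})"
      using I by (intro sum_a_radial[symmetric]) auto
    also have "\<dots> \<le> ennreal (D.mean {z. cmod z \<in> I})"
    proof (intro ennreal_leI incseq_le[OF incseq_SucI D.mean_limit(2)[OF B]])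
      show "(\<Sum>k<n. D.a k {z. cmod z \<in> I}) \<le> (\<Sum>k<Suc n. D.a k {z. cmod z \<in> I})" for n using D.a_nonneg by simp
    qed
    finally show "(\<integral>\<^sup>+r. ?f n r \<partial>lborel) \<le> ennreal (D.mean {z. cmod z \<in> I})" .
  qed
  finally show ?thesis .
qed

abbreviation "annulus b w \<equiv> {z :: complex. cmod z \<in> {b..<b + w}}"

lemma R_comparable: "r \<in> {b..<b + w} \<Longrightarrow> w \<le> R b / 2 \<Longrightarrow> R b / 2 \<le> R r \<and> R r \<le> 3 / 2 * R b"
  using R_lipschitz[of r b] by (auto simp: abs_if split: if_splits)

lemma nn_integral_bin_le:
  assumes "\<And>r. r \<in> {b..<b + w} \<Longrightarrow> f r \<le> x" "0 \<le> w" "0 \<le> x"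
  shows "(\<integral>\<^sup>+r\<in>{b..<b + w}. ennreal (f r) \<partial>lborel) \<le> ennreal (x * w)"
proof -
  have "(\<integral>\<^sup>+r\<in>{b..<b + w}. ennreal (f r) \<partial>lborel) \<le> (\<integral>\<^sup>+r. ennreal x * indicator {b..<b + w} r \<partial>lborel)"
    using assms by (intro nn_integral_mono) (auto simp: indicator_def intro!: ennreal_leI)
  also have "\<dots> = ennreal (x * w)" using assms by (simp add: nn_integral_cmult_indicator ennreal_mult)
  finally show ?thesis .
qed

lemma nn_integral_bin_ge:
  assumes "\<And>r. r \<in> {b..<b + w} \<Longrightarrow> x \<le> f r" "0 \<le> w" "0 \<le> x"
  shows "ennreal (x * w) \<le> (\<integral>\<^sup>+r\<in>{b..<b + w}. ennreal (f r) \<partial>lborel)"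
proof -
  have "ennreal (x * w) = (\<integral>\<^sup>+r. ennreal x * indicator {b..<b + w} r \<partial>lborel)"
    using assms by (simp add: nn_integral_cmult_indicator ennreal_mult)
  also have "\<dots> \<le> (\<integral>\<^sup>+r\<in>{b..<b + w}. ennreal (f r) \<partial>lborel)"
    using assms by (intro nn_integral_mono) (auto simp: indicator_def intro!: ennreal_leI)
  finally show ?thesis .
qed

text \<open>On an annulus of width at most \<open>R b / 2\<close> the function R is comparable to R
  b, so the mean count is of order w b / (R b)^2. Each eigenvalue is at most of order w / R b, small
  against the mean far out, hence \<open>pair_mean\<close> is at least half the squared mean.
  Cutting into ceiling(b/w) arcs makes cells of diameter about w, and dividing by their number gives
  w^3 b / (R b)^4.\<close>

lemma bin_estimates:
  obtains R1 C1 c1 :: real where "R1 > 0" "C1 > 0" "c1 > 0"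
    "\<And>b w. R1 \<le> b \<Longrightarrow> 0 < w \<Longrightarrow> w \<le> R b / 2 \<Longrightarrow> w \<le> b \<and> 0 < nat \<lceil>b / w\<rceil> \<and>
      D.mean (annulus b w) \<le> C1 * nat \<lceil>b / w\<rceil> \<and> c1 * (w ^ 3 * b / R b ^ 4) \<le> D.pair_mean (annulus b w) / (2 * nat \<lceil>b / w\<rceil>)"
proof -
  obtain R2 \<alpha> where \<alpha>: "R2 > 0" "\<alpha> > 0" "\<And>r. r \<ge> R2 \<Longrightarrow> \<exists>n0. \<forall>n\<ge>n0. \<alpha> \<le> (\<Sum>k<n. \<kappa> k r)"
    by (rule \<kappa>_sum_lower) blast
  define c2 where "c2 = \<alpha> * (8 * pi / 9)"
  have c2: "c2 > 0" using \<alpha> by (simp add: c2_def)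
  \<comment> \<open>The second bound makes every eigenvalue at most half the mean of its annulus;
    the first ensures R r \<le> r / 2.\<close>
  define \<epsilon> where "\<epsilon> = min (1 / 2) (c2 / (8 * pi * KU))"
  have \<epsilon>: "\<epsilon> > 0" using c2 KU_pos by (simp add: \<epsilon>_def)
  obtain R3 where R3: "R3 > 0" "\<And>r. r \<ge> R3 \<Longrightarrow> R r \<le> \<epsilon> * r" by (rule R_sublinear[OF \<epsilon>]) blast
  show thesis
  proof (rule that[of "max R2 R3" "40 * pi * KU" "c2\<^sup>2 / 8"])
    fix b w assume b: "max R2 R3 \<le> b" and w: "0 < w" "w \<le> R b / 2"
    let ?Q = "nat \<lceil>b / w\<rceil>" and ?I = "{b..<b + w}"
    have b0: "0 < b" using b R3 by linarith
    have half: "R r \<le> r / 2" if "r \<ge> R3" for r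
    proof -
      have "\<epsilon> * r \<le> 1 / 2 * r" using that R3(1) by (intro mult_right_mono) (auto simp: \<epsilon>_def)
      then show ?thesis using R3(2)[OF that] by simp
    qed
    have wb: "w \<le> b / 4" using half[of b] b w by simp
    have Q: "b / w \<le> real ?Q" "real ?Q \<le> 2 * (b / w)"
    proof -
      have "1 \<le> b / w" using wb w b0 by (simp add: field_simps)
      then show "b / w \<le> real ?Q" "real ?Q \<le> 2 * (b / w)" by linarith+
    qed
    have Q0: "0 < ?Q" using Q(1) b0 w by (metis divide_pos_pos less_le_trans of_nat_0_less_iff)
    have I: "0 < r \<and> r < b + w \<and> R r \<le> r / 2" if "r \<in> ?I" for r using that b b0 half[of r] by auto
    have cmp: "R b / 2 \<le> R r" "R r \<le> 3 / 2 * R b" if "r \<in> ?I" for r using R_comparable[OF that w(2)] by auto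
    note Rb = R_pos[of b]
    have B: "circled (annulus b w)" "annulus b w \<subseteq> ball 0 (b + w)" using circledI[of ?I] by auto
    have up: "(\<integral>\<^sup>+r\<in>?I. ennreal (2 * pi * r / (R r)\<^sup>2) \<partial>lborel) \<le> ennreal (2 * pi * (2 * b) / (R b / 2)\<^sup>2 * w)"
    proof (rule nn_integral_bin_le)
      fix r assume r: "r \<in> ?I"
      show "2 * pi * r / (R r)\<^sup>2 \<le> 2 * pi * (2 * b) / (R b / 2)\<^sup>2"
        using r cmp[OF r] Rb b0 wb by (intro frac_le power_mono mult_left_mono) auto
    qed (use w b0 in auto)
    have lo: "ennreal (2 * pi * b / (3 / 2 * R b)\<^sup>2 * w) \<le> (\<integral>\<^sup>+r\<in>?I. ennreal (2 * pi * r / (R r)\<^sup>2) \<partial>lborel)"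
    proof (rule nn_integral_bin_ge)
      fix r assume r: "r \<in> ?I"
      show "2 * pi * b / (3 / 2 * R b)\<^sup>2 \<le> 2 * pi * r / (R r)\<^sup>2"
        using r cmp[OF r] Rb b0 R_pos[of r] by (intro frac_le power_mono mult_left_mono) auto
    qed (use w b0 in auto)
    have "ennreal (D.mean (annulus b w)) \<le> ennreal (10 * KU) * ennreal (2 * pi * (2 * b) / (R b / 2)\<^sup>2 * w)"
      by (rule order_trans[OF mean_radial_le[of ?I "b + w"] mult_left_mono[OF up]]) (use I in auto)
    then have "D.mean (annulus b w) \<le> 10 * KU * (2 * pi * (2 * b) / (R b / 2)\<^sup>2 * w)"
      using KU_pos b0 w by (subst (asm) ennreal_mult[symmetric]) (auto simp: ennreal_le_iff)
    also have "\<dots> = 40 * pi * KU * (b / w) * (w / (R b / 2))\<^sup>2"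
      using w Rb by (simp add: field_simps power2_eq_square)
    also have "\<dots> \<le> 40 * pi * KU * (b / w) * 1"
      using w Rb KU_pos b0 by (intro mult_left_mono power_le_one) auto
    also have "\<dots> \<le> 40 * pi * KU * ?Q"
      unfolding mult_1_right by (rule mult_left_mono[OF Q(1)]) (use KU_pos in simp)
    finally have mean: "D.mean (annulus b w) \<le> 40 * pi * KU * ?Q" .
    have "ennreal \<alpha> * ennreal (2 * pi * b / (3 / 2 * R b)\<^sup>2 * w) \<le> ennreal (D.mean (annulus b w))"
      by (rule order_trans[OF mult_left_mono[OF lo] mean_radial_ge[of ?I "b + w"]]) (use I \<alpha> b in auto)
    then have "\<alpha> * (2 * pi * b / (3 / 2 * R b)\<^sup>2 * w) \<le> D.mean (annulus b w)"
      using \<alpha> b0 w D.mean_nonneg[OF B] by (subst (asm) ennreal_mult[symmetric]) (auto simp: ennreal_le_iff)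
    then have mean_ge: "c2 * (w * b / (R b)\<^sup>2) \<le> D.mean (annulus b w)"
      by (simp add: c2_def power_mult_distrib power_divide mult_ac)
    have ak: "D.a k (annulus b w) \<le> 4 * pi * KU * w / R b" for k
    proof -
      have "ennreal (D.a k (annulus b w)) = (\<integral>\<^sup>+r\<in>?I. ennreal (2 * pi * r / (R r)\<^sup>2 * \<kappa> k r) \<partial>lborel)"
        using I by (intro a_radial) auto
      also have "\<dots> \<le> ennreal (4 * pi * KU / R b * w)"
      proof (rule nn_integral_bin_le)
        fix r assume r: "r \<in> ?I"
        have "2 * pi * r / (R r)\<^sup>2 * \<kappa> k r \<le> 2 * pi * r / (R r)\<^sup>2 * (KU * (R r / r))"
          using I[OF r] by (intro mult_left_mono \<kappa>_le) auto
        also have "\<dots> = 2 * pi * KU / R r" using I[OF r] R_pos[of r] by (simp add: power2_eq_square)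
        also have "\<dots> \<le> 2 * pi * KU / (R b / 2)" using cmp[OF r] Rb KU_pos by (intro divide_left_mono) auto
        finally show "2 * pi * r / (R r)\<^sup>2 * \<kappa> k r \<le> 4 * pi * KU / R b" by simp
      qed (use w Rb KU_pos in auto)
      finally show ?thesis using w Rb KU_pos by (simp add: ennreal_le_iff)
    qed
    have half_mean: "4 * pi * KU * w / R b \<le> D.mean (annulus b w) / 2"
    proof -
      have "R b \<le> c2 / (8 * pi * KU) * b"
      proof -
        have "\<epsilon> * b \<le> c2 / (8 * pi * KU) * b" using b0 by (intro mult_right_mono) (auto simp: \<epsilon>_def)
        then show ?thesis using R3(2)[of b] b by simp
      qed
      then have "8 * pi * KU * R b \<le> c2 * b" using KU_pos by (simp add: field_simps)
      then have "8 * pi * KU * R b * (w / (R b)\<^sup>2) \<le> c2 * b * (w / (R b)\<^sup>2)"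
        using w by (intro mult_right_mono) auto
      moreover have "8 * pi * KU * R b * (w / (R b)\<^sup>2) = 2 * (4 * pi * KU * w / R b)" using Rb by (simp add: power2_eq_square)
      moreover have "c2 * b * (w / (R b)\<^sup>2) = c2 * (w * b / (R b)\<^sup>2)" by simp
      ultimately show ?thesis using mean_ge by linarith
    qed
    let ?m = "D.mean (annulus b w)"
    have m0: "0 \<le> c2 * (w * b / (R b)\<^sup>2)" using c2 w b0 by simp
    have "(c2 * (w * b / (R b)\<^sup>2))\<^sup>2 / 2 \<le> ?m\<^sup>2 / 2" using mean_ge m0 by (intro divide_right_mono power_mono) auto
    also have "\<dots> = ?m * ?m - ?m / 2 * ?m" by (simp add: power2_eq_square)
    also have "\<dots> \<le> ?m\<^sup>2 - 4 * pi * KU * w / R b * ?m"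
      unfolding power2_eq_square using half_mean D.mean_nonneg[OF B] by (intro diff_left_mono mult_right_mono) auto
    also have "\<dots> \<le> D.pair_mean (annulus b w)" by (rule D.pair_mean_ge[OF B ak])
    finally have pm: "(c2 * (w * b / (R b)\<^sup>2))\<^sup>2 / 2 \<le> D.pair_mean (annulus b w)" .
    \<comment> \<open>The factor 8 consists of 2 from halving the squared mean, 2 from unordered
      pairs, and 2 from ceiling(b/w) \<le> 2 b/w.\<close>
    have "c2\<^sup>2 / 8 * (w ^ 3 * b / R b ^ 4) = (c2 * (w * b / (R b)\<^sup>2))\<^sup>2 / 2 / (2 * (2 * (b / w)))"
      using w b0 Rb by (simp add: field_simps power2_eq_square eval_nat_numeral)
    also have "\<dots> \<le> D.pair_mean (annulus b w) / (2 * ?Q)"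
      using pm Q Q0 w b0 D.pair_mean_nonneg[OF B] by (intro frac_le) auto
    finally have "c2\<^sup>2 / 8 * (w ^ 3 * b / R b ^ 4) \<le> D.pair_mean (annulus b w) / (2 * ?Q)" .
    then show "w \<le> b \<and> 0 < ?Q \<and> ?m \<le> 40 * pi * KU * ?Q \<and> c2\<^sup>2 / 8 * (w ^ 3 * b / R b ^ 4) \<le> D.pair_mean (annulus b w) / (2 * ?Q)"
      using Q0 mean wb w by auto
  qed (use c2 KU_pos R3 in auto)
qed

end

text \<open>Countably many thresholds in place of an infimum: the event becomes measurable, and
  non-separation may be shown one scale at a time.\<close>

lemma separated_iff:
  "separated s \<longleftrightarrow> (\<exists>n. \<forall>j k. j \<noteq> k \<longrightarrow> 1 / real (Suc n) \<le> cmod (s k - s j))"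
proof
  assume "separated s"
  then have pos: "0 < (INF (j, k)\<in>{(j, k). j \<noteq> k}. cmod (s k - s j))" (is "0 < ?I") by (simp add: separated_def)
  obtain n where n: "1 / real (Suc n) < ?I" using pos reals_Archimedean[of ?I] by (auto simp: inverse_eq_divide)
  have "?I \<le> cmod (s k - s j)" if "j \<noteq> k" for j k
  proof -
    have "bdd_below ((\<lambda>(j, k). cmod (s k - s j)) ` {(j, k). j \<noteq> k})" by (intro bdd_belowI2[of _ 0]) auto
    from cINF_lower[OF this, of "(j, k)"] that show ?thesis by auto
  qed
  then show "\<exists>n. \<forall>j k. j \<noteq> k \<longrightarrow> 1 / real (Suc n) \<le> cmod (s k - s j)"
    using n by (intro exI[of _ n]) (meson less_imp_le order_trans)
next
  assume "\<exists>n. \<forall>j k. j \<noteq> k \<longrightarrow> 1 / real (Suc n) \<le> cmod (s k - s j)"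
  then obtain n where n: "\<And>j k. j \<noteq> k \<Longrightarrow> 1 / real (Suc n) \<le> cmod (s k - s j)" by blast
  have "1 / real (Suc n) \<le> (INF (j, k)\<in>{(j, k). j \<noteq> k}. cmod (s k - s j))"
  proof (rule cINF_greatest)
    show "{(j, k :: nat). j \<noteq> k} \<noteq> {}" by (auto intro: exI[of _ 0] exI[of _ 1])
  qed (use n in auto)
  moreover have "0 < 1 / real (Suc n)" by simp
  ultimately show "separated s" unfolding separated_def by linarith
qed

lemma polar_distance:
  "(cmod (of_real r * cis \<alpha> - of_real s * cis \<beta>))\<^sup>2 = (r - s)\<^sup>2 + 2 * r * s * (1 - cos (\<alpha> - \<beta>))"
proof -
  have *: "(r * c - s * d)\<^sup>2 + (r * a - s * b)\<^sup>2 = r\<^sup>2 * (a\<^sup>2 + c\<^sup>2) + s\<^sup>2 * (b\<^sup>2 + d\<^sup>2) - 2 * r * s * (c * d + a * b)"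
    for a b c d :: real by (simp add: power2_eq_square algebra_simps)
  have "(cmod (of_real r * cis \<alpha> - of_real s * cis \<beta>))\<^sup>2 = (r * cos \<alpha> - s * cos \<beta>)\<^sup>2 + (r * sin \<alpha> - s * sin \<beta>)\<^sup>2"
    by (simp add: cmod_power2)
  also have "\<dots> = r\<^sup>2 * ((sin \<alpha>)\<^sup>2 + (cos \<alpha>)\<^sup>2) + s\<^sup>2 * ((sin \<beta>)\<^sup>2 + (cos \<beta>)\<^sup>2) - 2 * r * s * (cos \<alpha> * cos \<beta> + sin \<alpha> * sin \<beta>)"
    by (rule *)
  also have "\<dots> = (r - s)\<^sup>2 + 2 * r * s * (1 - cos (\<alpha> - \<beta>))"
    unfolding sin_cos_squared_add mult_1_right cos_diff by (simp add: power2_eq_square algebra_simps)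
  finally show ?thesis .
qed

text \<open>Two points closer than 1 have moduli differing by less than 1, so both lie in [m, m + 2)
  with m the integer part of the smaller modulus, and \<open>polar_distance\<close> bounds 1 - cos
  of the angle difference by 1/(2 m^2): the pair is \<open>near m\<close>. Hence closeness below 1
  occurs only within the disk of radius m0 + 3, among finitely many points, whose least distance is
  positive once the points are distinct.\<close>

lemma separated_polar:
  fixes x :: "nat \<Rightarrow> complex" and t :: "nat \<Rightarrow> real"
  assumes fin: "\<And>n::nat. finite {k. x k \<in> ball 0 (real n)}" and inj: "inj x"
    and range: "\<And>k. t k \<in> {0..<2 * pi}" and apart: "\<And>i j. i \<noteq> j \<Longrightarrow> \<exists>Q>0. \<not> near Q (t i) (t j)"
    and far: "\<And>m i j. m \<ge> m0 \<Longrightarrow> i \<noteq> j \<Longrightarrow> cmod (x i) \<in> {real m..<real m + 2} \<Longrightarrow> cmod (x j) \<in> {real m..<real m + 2}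
      \<Longrightarrow> \<not> near m (t i) (t j)"
  shows "separated (\<lambda>k. of_real (cmod (x k)) * cis (t k))"
proof -
  define h where "h k = of_real (cmod (x k)) * cis (t k)" for k
  have h_dist: "(cmod (h i - h j))\<^sup>2 = (cmod (x i) - cmod (x j))\<^sup>2 + 2 * cmod (x i) * cmod (x j) * (1 - cos (t i - t j))" for i j
    unfolding h_def by (rule polar_distance)
  have h_ne: "h i \<noteq> h j" if ij: "i \<noteq> j" for i j
  proof
    assume "h i = h j"
    then have z: "(cmod (x i) - cmod (x j))\<^sup>2 + 2 * cmod (x i) * cmod (x j) * (1 - cos (t i - t j)) = 0" using h_dist[of i j] by simp
    have "0 \<le> 2 * cmod (x i) * cmod (x j) * (1 - cos (t i - t j))" by simp
    then have "(cmod (x i) - cmod (x j))\<^sup>2 = 0" and z2: "2 * cmod (x i) * cmod (x j) * (1 - cos (t i - t j)) = 0"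
      using z zero_le_power2[of "cmod (x i) - cmod (x j)"] by linarith+
    then have eq: "cmod (x i) = cmod (x j)" by simp
    from z2 have "cmod (x j) = 0 \<or> 1 - cos (t i - t j) = 0" unfolding eq by auto
    then consider "x i = 0" "x j = 0" | "1 - cos (t i - t j) = 0" using eq by auto
    then show False
    proof cases
      case 1
      then show False using inj ij by (simp add: inj_def)
    next
      case 2
      \<comment> \<open>Equal angles would be near for every Q, against \<open>apart\<close>;
        injectivity of x was needed only for two points at the origin, where angles say
        nothing.\<close>
      obtain Q where "Q > 0" "\<not> near Q (t i) (t j)" using apart[OF ij] by blast
      moreover have "near Q (t i) (t j)" using \<open>Q > 0\<close> range 2 by (intro near_if_cos) auto
      ultimately show False by simp
    qed
  qed
  define T where "T = {k. x k \<in> ball 0 (real (m0 + 3))}"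
  define D where "D = insert 1 ((\<lambda>(i, j). cmod (h i - h j)) ` {p \<in> T \<times> T. fst p \<noteq> snd p})"
  have finT: "finite T" unfolding T_def by (rule fin)
  have finD: "finite D" unfolding D_def using finT by auto
  have Dpos: "0 < Min D" using finD h_ne by (subst Min_gr_iff) (auto simp: D_def)
  have "Min D \<le> cmod (h j - h i)" if "i \<noteq> j" for i j
  proof (cases "i \<in> T \<and> j \<in> T")
    case True
    then have "cmod (h j - h i) \<in> D" using that by (force simp: D_def)
    then show ?thesis using finD by simp
  next
    case False
    have "1 \<le> cmod (h j - h i)"
    proof (rule ccontr)
      assume lt: "\<not> 1 \<le> cmod (h j - h i)"
      then have sq: "(cmod (x j) - cmod (x i))\<^sup>2 + 2 * cmod (x j) * cmod (x i) * (1 - cos (t j - t i)) < 1"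
        using h_dist[of j i] power_strict_mono[of "cmod (h j - h i)" 1 2] by simp
      have nn: "0 \<le> 2 * cmod (x j) * cmod (x i) * (1 - cos (t j - t i))" by simp
      have "(cmod (x j) - cmod (x i))\<^sup>2 < 1" using sq nn by linarith
      then have d: "\<bar>cmod (x j) - cmod (x i)\<bar> < 1" by (simp add: abs_square_less_1)
      define r where "r = min (cmod (x i)) (cmod (x j))"
      define m where "m = nat \<lfloor>r\<rfloor>"
      have "real m0 + 3 \<le> cmod (x i) \<or> real m0 + 3 \<le> cmod (x j)" using False by (auto simp: T_def)
      then have r: "real m0 + 2 < r" using d by (auto simp: r_def)
      then have m: "real m \<le> r" "r < real m + 1" by (simp_all add: m_def)
      then have "m \<ge> m0" "m > 0" using r by linarith+
      have xi: "cmod (x i) \<in> {real m..<real m + 2}" "cmod (x j) \<in> {real m..<real m + 2}"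
        using m d by (auto simp: r_def min_def split: if_splits)
      have "real m * real m \<le> cmod (x j) * cmod (x i)" using xi by (intro mult_mono) auto
      then have "2 * (real m * real m) * (1 - cos (t j - t i)) \<le> 2 * (cmod (x j) * cmod (x i)) * (1 - cos (t j - t i))"
        by (intro mult_right_mono mult_left_mono) auto
      also have "\<dots> < 1" using sq zero_le_power2[of "cmod (x j) - cmod (x i)"] unfolding mult.assoc by linarith
      finally have "1 - cos (t j - t i) < 1 / (2 * (real m)\<^sup>2)" using \<open>m > 0\<close> by (simp add: field_simps power2_eq_square)
      then have "near m (t j) (t i)" using \<open>m > 0\<close> range by (intro near_if_cos) auto
      then show False using far[OF \<open>m \<ge> m0\<close> _ xi(2) xi(1)] that by simp
    qed
    moreover have "Min D \<le> 1" using finD by (simp add: D_def)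
    ultimately show ?thesis by simp
  qed
  moreover obtain n where "1 / real (Suc n) < Min D" using Dpos reals_Archimedean[of "Min D"] by (auto simp: inverse_eq_divide)
  ultimately show ?thesis unfolding separated_iff h_def by (meson less_imp_le order_trans)
qed

context hybrid_process begin

lemma hybrid_measurable[measurable]: "hybrid X \<theta> k \<in> borel_measurable M"
proof -
  have [measurable]: "cis \<in> borel_measurable borel" by (intro borel_measurable_continuous_onI continuous_intros)
  show ?thesis unfolding hybrid_def[abs_def] by measurable
qed

lemma separated_sets: "{\<omega> \<in> space M. separated (\<lambda>k. hybrid X \<theta> k \<omega>)} \<in> sets M"
  unfolding separated_iff by measurable

text \<open>For a fixed pair the probability of being near is at most 3/Q for every Q. This excludes
  coinciding angles for all pairs at once.\<close>

lemma AE_not_near: "AE \<omega> in M. \<forall>i j. i \<noteq> j \<longrightarrow> (\<exists>Q>0. \<not> near Q (\<theta> i \<omega>) (\<theta> j \<omega>))"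
proof (unfold AE_all_countable, intro allI)
  fix i j
  show "AE \<omega> in M. i \<noteq> j \<longrightarrow> (\<exists>Q>0. \<not> near Q (\<theta> i \<omega>) (\<theta> j \<omega>))"
  proof (cases "i = j")
    case False
    have s[measurable]: "{\<omega> \<in> space M. near Q (\<theta> i \<omega>) (\<theta> j \<omega>)} \<in> sets M" for Q by (rule near_sets)
    let ?S = "{\<omega> \<in> space M. \<forall>Q>0. near Q (\<theta> i \<omega>) (\<theta> j \<omega>)}"
    have S: "?S \<in> sets M" by measurable
    have "measure M ?S = 0"
    proof (rule ccontr)
      assume "measure M ?S \<noteq> 0"
      then have pos: "measure M ?S > 0" by (simp add: zero_less_measure_iff)
      obtain n where n: "3 / measure M ?S < real n" using reals_Archimedean2 by blast
      have "0 < 3 / measure M ?S" using pos by simp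
      then have "0 < real n" using n by linarith
      then have n0: "0 < n" by simp
      have "measure M ?S \<le> measure M {\<omega> \<in> space M. near n (\<theta> i \<omega>) (\<theta> j \<omega>)}"
        using n0 s by (intro M.finite_measure_mono) auto
      also have "\<dots> \<le> 3 / n" using False n0 by (rule prob_near)
      finally show False using n pos n0 by (simp add: field_simps)
    qed
    then have "emeasure M ?S = 0" by (simp add: M.emeasure_eq_measure)
    then show ?thesis using S by (intro AE_I[of _ _ ?S]) blast+
  qed simp
qed

end

section \<open>The divergent case: collisions at every scale\<close>

context fock_process begin

lemma nn_integral_\<rho>:
  "(\<integral>\<^sup>+z. ennreal (1 / \<rho> z ^ 4) \<partial>lborel) = (\<integral>\<^sup>+r\<in>{0<..}. ennreal (2 * pi * r / R r ^ 4) \<partial>lborel)"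
proof -
  have "(\<integral>\<^sup>+z. ennreal (1 / \<rho> z ^ 4) \<partial>lborel) = (\<integral>\<^sup>+z. ennreal (1 / R (cmod z) ^ 4) \<partial>lborel)" by (simp add: R_cmod)
  also have "\<dots> = (\<integral>\<^sup>+r. ennreal (2 * pi * r) * indicator {0<..} r * ennreal (1 / R r ^ 4) \<partial>lborel)"
    by (rule nn_integral_radial) measurable
  also have "\<dots> = (\<integral>\<^sup>+r\<in>{0<..}. ennreal (2 * pi * r / R r ^ 4) \<partial>lborel)"
    by (intro nn_integral_cong) (auto simp: indicator_def ennreal_mult''[symmetric])
  finally show ?thesis .
qed

text \<open>If R stays above some \<delta> far out, annuli of one fixed width w tile a neighbourhood
  of infinity, and their sum is comparable to w^2 times the divergent integral of r / R^4. Otherwise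
  R is arbitrarily small at arbitrarily large b, and the one annulus of width R b / 2 contributes b
  / (8 R b), as large as desired.\<close>

lemma many_bins:
  fixes L \<epsilon> R1 :: real
  assumes inf: "(\<integral>\<^sup>+z. ennreal (1 / \<rho> z ^ 4) \<partial>lborel) = \<infinity>" and \<epsilon>: "0 < \<epsilon>" and R1: "0 < R1"
  obtains w I where "0 < w" "w \<le> \<epsilon>" "finite I" "\<And>b. b \<in> I \<Longrightarrow> R1 \<le> b \<and> w \<le> R b / 2"
    "\<And>b b'. b \<in> I \<Longrightarrow> b' \<in> I \<Longrightarrow> b < b' \<Longrightarrow> b + w \<le> b'" "L \<le> (\<Sum>b\<in>I. w ^ 3 * b / R b ^ 4)"
proof (cases "\<exists>\<delta>>0. \<exists>R2. \<forall>b\<ge>R2. \<delta> \<le> R b")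
  case True
  then obtain \<delta> R2 where \<delta>: "\<delta> > 0" "\<And>b. b \<ge> R2 \<Longrightarrow> \<delta> \<le> R b" by blast
  define w where "w = min \<epsilon> (\<delta> / 2)"
  have w: "0 < w" "w \<le> \<epsilon>" "w \<le> \<delta> / 2" using \<epsilon> \<delta> by (auto simp: w_def)
  define B0 where "B0 = max R1 (max R2 w)"
  define b where "b k = B0 + real k * w" for k
  have b: "B0 \<le> b k" for k using w by (simp add: b_def)
  have B0: "0 < B0" "w \<le> B0" "R1 \<le> B0" "R2 \<le> B0" using R1 by (auto simp: B0_def)
  have bw: "R1 \<le> b k" "w \<le> R (b k) / 2" "w \<le> b k" "0 < b k" for k
    using \<delta>(2)[of "b k"] b[of k] B0 w by linarith+
  have "\<exists>P. L \<le> (\<Sum>k<P. w ^ 3 * b k / R (b k) ^ 4)"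
  proof (rule ccontr)
    assume "\<nexists>P. L \<le> (\<Sum>k<P. w ^ 3 * b k / R (b k) ^ 4)"
    then have L: "(\<Sum>k<P. w ^ 3 * b k / R (b k) ^ 4) \<le> L" for P by (meson linear)
    let ?F = "\<lambda>r. ennreal (2 * pi * r / R r ^ 4)"
    \<comment> \<open>The inner disk contributes only a finite amount, as R attains a positive
      minimum there; so a bound on the sums over annuli would make the whole integral
      finite.\<close>
    have "continuous_on {0..B0} (\<lambda>r. R r)"
      unfolding R_def by (intro continuous_on_compose2[OF continuous_\<rho>[of UNIV]] continuous_intros) auto
    then obtain r0 where r0: "\<And>r. r \<in> {0..B0} \<Longrightarrow> R r0 \<le> R r"
      using continuous_attains_inf[of "{0..B0}" R] B0 by fastforce
    have bins: "(\<integral>\<^sup>+r\<in>{b k..<b k + w}. ?F r \<partial>lborel) \<le> ennreal (64 * pi / w\<^sup>2 * (w ^ 3 * b k / R (b k) ^ 4))" for k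
    proof -
      have "(\<integral>\<^sup>+r\<in>{b k..<b k + w}. ?F r \<partial>lborel) \<le> ennreal (2 * pi * (2 * b k) / (R (b k) / 2) ^ 4 * w)"
      proof (rule nn_integral_bin_le)
        fix r assume r: "r \<in> {b k..<b k + w}"
        have "R (b k) / 2 \<le> R r" using R_comparable[OF r bw(2)] by simp
        then show "2 * pi * r / R r ^ 4 \<le> 2 * pi * (2 * b k) / (R (b k) / 2) ^ 4"
          using r bw[of k] R_pos[of "b k"] by (intro frac_le power_mono mult_left_mono) auto
      qed (use w bw[of k] in auto)
      also have "2 * pi * (2 * b k) / (R (b k) / 2) ^ 4 * w = 64 * pi / w\<^sup>2 * (w ^ 3 * b k / R (b k) ^ 4)"
        using w R_pos[of "b k"] by (simp add: field_simps eval_nat_numeral)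
      finally show ?thesis .
    qed
    have "(\<integral>\<^sup>+r\<in>{0<..}. ?F r \<partial>lborel) \<le> (\<integral>\<^sup>+r. ?F r * indicator {0..<0 + B0} r + (\<Sum>k. ?F r * indicator {b k..<b k + w} r) \<partial>lborel)"
    proof (intro nn_integral_mono)
      fix r
      show "?F r * indicator {0<..} r \<le> ?F r * indicator {0..<0 + B0} r + (\<Sum>k. ?F r * indicator {b k..<b k + w} r)"
      proof (cases "r < B0")
        case True
        then show ?thesis by (auto simp: indicator_def)
      next
        case False
        define k where "k = nat \<lfloor>(r - B0) / w\<rfloor>"
        have "0 \<le> (r - B0) / w" using False w by simp
        then have "real k \<le> (r - B0) / w" "(r - B0) / w < real k + 1" unfolding k_def by linarith+
        then have "r \<in> {b k..<b k + w}" using w by (auto simp: b_def field_simps)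
        then have "?F r * indicator {0<..} r \<le> (\<Sum>k\<in>{k}. ?F r * indicator {b k..<b k + w} r)" by (simp add: indicator_def)
        also have "\<dots> \<le> (\<Sum>k. ?F r * indicator {b k..<b k + w} r)" by (rule sum_le_suminf) auto
        finally show ?thesis by (rule order_trans) simp
      qed
    qed
    also have "\<dots> = (\<integral>\<^sup>+r\<in>{0..<0 + B0}. ?F r \<partial>lborel) + (\<integral>\<^sup>+r. (\<Sum>k. ?F r * indicator {b k..<b k + w} r) \<partial>lborel)"
      by (rule nn_integral_add) measurable
    also have "(\<integral>\<^sup>+r. (\<Sum>k. ?F r * indicator {b k..<b k + w} r) \<partial>lborel) = (\<Sum>k. (\<integral>\<^sup>+r\<in>{b k..<b k + w}. ?F r \<partial>lborel))"
      by (rule nn_integral_suminf) measurable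
    also have "\<dots> \<le> (\<Sum>k. ennreal (64 * pi / w\<^sup>2 * (w ^ 3 * b k / R (b k) ^ 4)))"
      by (intro suminf_le bins summableI)
    also have "\<dots> \<le> ennreal (64 * pi / w\<^sup>2 * L)"
      unfolding suminf_eq_SUP
    proof (rule SUP_least)
      fix P
      have "(\<Sum>k<P. ennreal (64 * pi / w\<^sup>2 * (w ^ 3 * b k / R (b k) ^ 4))) = ennreal (\<Sum>k<P. 64 * pi / w\<^sup>2 * (w ^ 3 * b k / R (b k) ^ 4))"
        using w bw R_pos by (intro sum_ennreal) (auto simp: less_imp_le)
      also have "\<dots> = ennreal (64 * pi / w\<^sup>2 * (\<Sum>k<P. w ^ 3 * b k / R (b k) ^ 4))" by (simp only: sum_distrib_left)
      also have "\<dots> \<le> ennreal (64 * pi / w\<^sup>2 * L)" by (intro ennreal_leI mult_left_mono L) auto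
      finally show "(\<Sum>k<P. ennreal (64 * pi / w\<^sup>2 * (w ^ 3 * b k / R (b k) ^ 4))) \<le> ennreal (64 * pi / w\<^sup>2 * L)" .
    qed
    also have "(\<integral>\<^sup>+r\<in>{0..<0 + B0}. ?F r \<partial>lborel) \<le> ennreal (2 * pi * B0 / R r0 ^ 4 * B0)"
    proof (rule nn_integral_bin_le)
      fix r assume "r \<in> {0..<0 + B0}"
      then show "2 * pi * r / R r ^ 4 \<le> 2 * pi * B0 / R r0 ^ 4"
        using r0[of r] R_pos[of r0] by (intro frac_le power_mono mult_left_mono) auto
    qed (use B0 R_pos[of r0] in auto)
    finally have "(\<integral>\<^sup>+r\<in>{0<..}. ?F r \<partial>lborel) \<le> ennreal (2 * pi * B0 / R r0 ^ 4 * B0) + ennreal (64 * pi / w\<^sup>2 * L)"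
      by (simp add: add_mono)
    then show False using inf unfolding nn_integral_\<rho> by (simp add: top_unique)
  qed
  then obtain P where P: "L \<le> (\<Sum>k<P. w ^ 3 * b k / R (b k) ^ 4)" by blast
  have inj: "inj_on b {..<P}" using w by (auto simp: inj_on_def b_def)
  show thesis
  proof (rule that[of w "b ` {..<P}"])
    fix x y assume "x \<in> b ` {..<P}" "y \<in> b ` {..<P}" "x < y"
    then obtain k l where kl: "x = b k" "y = b l" by auto
    then have "k < l" using \<open>x < y\<close> w by (auto simp: b_def)
    then have "(real k + 1) * w \<le> real l * w" using w by (intro mult_right_mono) auto
    then show "x + w \<le> y" by (simp add: kl b_def algebra_simps)
  next
    show "L \<le> (\<Sum>x\<in>b ` {..<P}. w ^ 3 * x / R x ^ 4)" using P by (simp add: sum.reindex[OF inj])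
  qed (use w bw in auto)
next
  case False
  define L' where "L' = max L 1"
  define \<delta> where "\<delta> = min (2 * \<epsilon>) (1 / (8 * L'))"
  have "\<delta> > 0" using \<epsilon> by (simp add: \<delta>_def L'_def)
  then obtain b where b: "b \<ge> max R1 1" "R b < \<delta>" using False by (meson not_le)
  note Rb = R_pos[of b]
  have "R b < 1 / (8 * L')" using b(2) by (simp add: \<delta>_def)
  then have "L' * (8 * R b) \<le> 1" using Rb by (simp add: L'_def field_simps)
  also have "1 \<le> b" using b by simp
  finally have "L' \<le> b / (8 * R b)" using Rb by (simp add: field_simps)
  also have "\<dots> = (R b / 2) ^ 3 * b / R b ^ 4" using Rb by (simp add: field_simps eval_nat_numeral)
  finally have L': "L' \<le> (R b / 2) ^ 3 * b / R b ^ 4" .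
  show thesis
  proof (rule that[of "R b / 2" "{b}"])
    show "R b / 2 \<le> \<epsilon>" using b(2) by (simp add: \<delta>_def)
    show "L \<le> (\<Sum>x\<in>{b}. (R b / 2) ^ 3 * x / R x ^ 4)" using L' by (simp add: L'_def)
    show "R1 \<le> b' \<and> R b / 2 \<le> R b' / 2" if "b' \<in> {b}" for b' using that b(1) by simp
    show "x + R b / 2 \<le> y" if "x \<in> {b}" "y \<in> {b}" "x < y" for x y using that by simp
    show "0 < R b / 2" using Rb by simp
  qed simp
qed

text \<open>The moduli differ by at most w, the angles by at most 2 pi w / b, and moduli are at most
  2b. Altogether w + 4 pi w, which is below 14 w as pi < 13/4.\<close>

lemma same_bin_close:
  assumes x: "cmod x \<in> {b..<b + w}" "cmod y \<in> {b..<b + w}" and w: "0 < w" "w \<le> b"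
    and arc: "arc (nat \<lceil>b / w\<rceil>) s = arc (nat \<lceil>b / w\<rceil>) t"
  shows "cmod (of_real (cmod x) * cis s - of_real (cmod y) * cis t) < 14 * w"
proof -
  let ?Q = "nat \<lceil>b / w\<rceil>"
  have bw: "1 \<le> b / w" using w by simp
  then have Q: "b / w \<le> real ?Q" by linarith
  then have Q0: "0 < real ?Q" using bw by linarith
  have "\<bar>s * real ?Q / (2 * pi) - t * real ?Q / (2 * pi)\<bar> \<le> 1"
    using arc unfolding arc_def by linarith
  moreover have "s * real ?Q / (2 * pi) - t * real ?Q / (2 * pi) = (s - t) * (real ?Q / (2 * pi))"
    by (simp add: left_diff_distrib diff_divide_distrib)
  ultimately have "\<bar>s - t\<bar> * (real ?Q / (2 * pi)) \<le> 1" by (simp add: abs_mult)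
  then have st: "\<bar>s - t\<bar> \<le> 2 * pi / real ?Q" using Q0 pi_gt_zero by (simp add: field_simps)
  also have "\<dots> \<le> 2 * pi / (b / w)" by (rule frac_le) (use Q bw pi_gt_zero in linarith)+
  finally have st: "\<bar>s - t\<bar> \<le> 2 * pi * w / b" by simp
  have "of_real (cmod x) * cis s - of_real (cmod y) * cis t = of_real (cmod x - cmod y) * cis s + of_real (cmod y) * (cis s - cis t)"
    by (simp add: algebra_simps)
  then have "cmod (of_real (cmod x) * cis s - of_real (cmod y) * cis t) \<le> \<bar>cmod x - cmod y\<bar> + cmod y * cmod (cis s - cis t)"
    using norm_triangle_ineq[of "of_real (cmod x - cmod y) * cis s" "of_real (cmod y) * (cis s - cis t)"]
    by (simp add: norm_mult del: of_real_diff)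
  also have "\<dots> \<le> w + 2 * b * (2 * pi * w / b)"
  proof (rule add_mono)
    show "\<bar>cmod x - cmod y\<bar> \<le> w" using x by auto
    show "cmod y * cmod (cis s - cis t) \<le> 2 * b * (2 * pi * w / b)"
      using x w order_trans[OF norm_cis_diff_le st] by (intro mult_mono) auto
  qed
  also have "\<dots> = w + 4 * pi * w" using w by simp
  also have "\<dots> < 14 * w" using w mult_strict_right_mono[of pi "13 / 4" w] pi_approx by simp
  finally show ?thesis .
qed

text \<open>At a fixed scale, bins of width at most a fourteenth of it turn every collision into a
  pair below the scale, by \<open>same_bin_close\<close>. Separation at that scale thus implies
  absence of collisions, whose probability is below any e once the expected number of collisions is
  large.\<close>

lemma AE_not_separated:
  assumes inf: "(\<integral>\<^sup>+z. ennreal (1 / \<rho> z ^ 4) \<partial>lborel) = \<infinity>"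
  shows "AE \<omega> in M. \<not> separated (\<lambda>k. hybrid X \<theta> k \<omega>)"
proof (rule bin_estimates)
  fix R1 C1 c1 :: real
  assume est: "R1 > 0" "C1 > 0" "c1 > 0"
    "\<And>b w. R1 \<le> b \<Longrightarrow> 0 < w \<Longrightarrow> w \<le> R b / 2 \<Longrightarrow> w \<le> b \<and> 0 < nat \<lceil>b / w\<rceil> \<and>
      D.mean (annulus b w) \<le> C1 * nat \<lceil>b / w\<rceil> \<and> c1 * (w ^ 3 * b / R b ^ 4) \<le> D.pair_mean (annulus b w) / (2 * nat \<lceil>b / w\<rceil>)"
  have "AE \<omega> in M. \<not> (\<forall>j k. j \<noteq> k \<longrightarrow> 1 / real (Suc n) \<le> cmod (hybrid X \<theta> k \<omega> - hybrid X \<theta> j \<omega>))" for n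
  proof -
    let ?S = "{\<omega> \<in> space M. \<forall>j k. j \<noteq> k \<longrightarrow> 1 / real (Suc n) \<le> cmod (hybrid X \<theta> k \<omega> - hybrid X \<theta> j \<omega>)}"
    have S: "?S \<in> sets M" by measurable
    have "measure M ?S \<le> 0"
    proof (rule field_le_epsilon)
      fix e :: real assume e: "0 < e"
      have d14: "14 * x \<le> y" if "x \<le> y / 14" for x y :: real using that by simp
      have e14: "0 < 1 / real (Suc n) / 14" by simp
      \<comment> \<open>The target L is chosen so that the expectation m, which is at least c1 times
        the sum over bins, makes (2 C1 + 2) / m at most e.\<close>
      show "measure M ?S \<le> 0 + e"
      proof (rule many_bins[OF inf e14 est(1), where L="(2 * C1 + 2) / (c1 * e)"])
        fix w I
        assume w: "0 < w" "w \<le> 1 / real (Suc n) / 14" and I: "finite I" "\<And>b. b \<in> I \<Longrightarrow> R1 \<le> b \<and> w \<le> R b / 2"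
          "\<And>b b'. b \<in> I \<Longrightarrow> b' \<in> I \<Longrightarrow> b < b' \<Longrightarrow> b + w \<le> b'"
          and L: "(2 * C1 + 2) / (c1 * e) \<le> (\<Sum>b\<in>I. w ^ 3 * b / R b ^ 4)"
        let ?Q = "\<lambda>b. nat \<lceil>b / w\<rceil>"
        have est': "w \<le> b" "0 < ?Q b" "D.mean (annulus b w) \<le> C1 * ?Q b" "c1 * (w ^ 3 * b / R b ^ 4) \<le> D.pair_mean (annulus b w) / (2 * ?Q b)"
          if "b \<in> I" for b
          using est(4)[of b w] I(2)[OF that] w(1) by auto
        define m where "m = (\<Sum>b\<in>I. D.pair_mean (annulus b w) / (2 * ?Q b))"
        have "(2 * C1 + 2) / e = c1 * ((2 * C1 + 2) / (c1 * e))" using est by simp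
        also have "\<dots> \<le> c1 * (\<Sum>b\<in>I. w ^ 3 * b / R b ^ 4)" using L est by (intro mult_left_mono) auto
        also have "\<dots> \<le> m" unfolding m_def sum_distrib_left by (intro sum_mono est')
        finally have m: "(2 * C1 + 2) / e \<le> m" .
        have m0: "0 < m" by (rule less_le_trans[OF _ m]) (use est e in auto)
        define r where "r = Max (insert 0 I) + w"
        have dj: "disjoint_family_on (\<lambda>b. annulus b w) I"
          unfolding disjoint_family_on_def
        proof (intro ballI impI)
          fix b b' assume "b \<in> I" "b' \<in> I" "b \<noteq> b'"
          then have "b + w \<le> b' \<or> b' + w \<le> b" using I(3) by (metis linorder_neqE)
          then show "annulus b w \<inter> annulus b' w = {}" by auto
        qed
        have circ: "circled (annulus b w)" for b using circledI[of "{b..<b + w}"] by simp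
        have sub: "annulus b w \<subseteq> ball 0 r" if "b \<in> I" for b
        proof -
          have "b \<le> Max (insert 0 I)" using I(1) that by simp
          then show ?thesis by (auto simp: r_def)
        qed
        note nc = D.prob_no_collision[OF I(1) dj circ sub est'(2,3) m_def m0]
        have "measure M ?S \<le> measure M {\<omega> \<in> space M. \<forall>b\<in>I. \<forall>i j. i \<noteq> j \<longrightarrow> X i \<omega> \<in> annulus b w \<longrightarrow> X j \<omega> \<in> annulus b w \<longrightarrow> arc (?Q b) (\<theta> i \<omega>) \<noteq> arc (?Q b) (\<theta> j \<omega>)}"
        proof (intro D.M.finite_measure_mono nc(1) subsetI CollectI conjI ballI allI impI notI)
          fix \<omega> assume "\<omega> \<in> ?S" then show "\<omega> \<in> space M" by simp
        next
          fix \<omega> b i j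
          assume a: "\<omega> \<in> ?S" "b \<in> I" "i \<noteq> j" "X i \<omega> \<in> annulus b w" "X j \<omega> \<in> annulus b w"
            and arc: "arc (?Q b) (\<theta> i \<omega>) = arc (?Q b) (\<theta> j \<omega>)"
          have "cmod (hybrid X \<theta> i \<omega> - hybrid X \<theta> j \<omega>) < 14 * w"
            using same_bin_close[OF _ _ w(1) est'(1)[OF a(2)] arc, of "X i \<omega>" "X j \<omega>"] a(4,5) by (simp add: hybrid_def)
          also have "14 * w \<le> 1 / real (Suc n)"
            by (rule d14[OF w(2)])
          finally have lt: "cmod (hybrid X \<theta> i \<omega> - hybrid X \<theta> j \<omega>) < 1 / real (Suc n)" .
          from a(1) have "\<And>j k. j \<noteq> k \<Longrightarrow> 1 / real (Suc n) \<le> cmod (hybrid X \<theta> k \<omega> - hybrid X \<theta> j \<omega>)" by blast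
          from this[of j i] lt a(3) show False by linarith
        qed
        also have "\<dots> \<le> (2 * C1 + 2) / m" by (rule nc(2))
        also have "\<dots> \<le> e" using m m0 e by (simp add: field_simps)
        finally show "measure M ?S \<le> 0 + e" by simp
      qed
    qed
    then have "emeasure M ?S = 0" by (simp add: D.M.emeasure_eq_measure measure_le_0_iff)
    then show ?thesis using S by (intro AE_I[of _ _ ?S]) blast+
  qed
  then show ?thesis unfolding separated_iff by (simp add: AE_all_countable)
qed

end

section \<open>The convergent case: finitely many close pairs\<close>

lemma suminf_unit_intervals_le:
  fixes f :: "real \<Rightarrow> ennreal"
  assumes [measurable]: "f \<in> borel_measurable borel" and k: "1 \<le> k"
  shows "(\<Sum>n. (\<integral>\<^sup>+r\<in>{real (n + k)..<real (n + k) + 1}. f r \<partial>lborel)) \<le> (\<integral>\<^sup>+r\<in>{0<..}. f r \<partial>lborel)"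
proof -
  let ?A = "\<lambda>n. {real (n + k)..<real (n + k) + 1}"
  have "disjoint_family ?A"
    unfolding disjoint_family_on_def
  proof (intro ballI impI, rule ccontr)
    fix m n :: nat assume "m \<noteq> n" "?A m \<inter> ?A n \<noteq> {}"
    then obtain r where r: "r \<in> ?A m" "r \<in> ?A n" by blast
    have "\<lfloor>r\<rfloor> = int (m + k)" "\<lfloor>r\<rfloor> = int (n + k)" using r unfolding floor_eq_iff by auto
    then show False using \<open>m \<noteq> n\<close> by simp
  qed
  then have "(\<Sum>n. emeasure (density lborel f) (?A n)) = emeasure (density lborel f) (\<Union>n. ?A n)"
    by (intro suminf_emeasure) auto
  also have "\<dots> \<le> emeasure (density lborel f) {0<..}"
    using k by (intro emeasure_mono) auto
  finally show ?thesis by (simp add: emeasure_density)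
qed

context fock_process begin

text \<open>\<open>pair_mean\<close> is at most the squared mean, and the mean is at most 10 KU
  times the integral of 2 pi r / R^2. Cauchy-Schwarz with the factors sqrt(2 pi r) and sqrt(2 pi r)
  / R^2 leaves the integral of 2 pi r / R^4 times at most 4 pi (m + 2); the probability factor 3/m
  cancels the growth, as (m + 2)/m is at most 3.\<close>

lemma pair_mean_annulus_le:
  fixes m :: nat
  assumes m: "1 \<le> m" and half: "\<And>r. real m \<le> r \<Longrightarrow> R r \<le> r / 2"
  shows "ennreal (3 / real m * D.pair_mean (annulus (real m) 2))
    \<le> ennreal (3600 * pi * KU\<^sup>2) * (\<integral>\<^sup>+r\<in>{real m..<real m + 2}. ennreal (2 * pi * r / R r ^ 4) \<partial>lborel)"
proof -
  let ?I = "{real m..<real m + 2}"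
  let ?B = "annulus (real m) 2"
  define T where "T = (\<integral>\<^sup>+r\<in>?I. ennreal (2 * pi * r / (R r)\<^sup>2) \<partial>lborel)"
  define G where "G = (\<integral>\<^sup>+r\<in>?I. ennreal (2 * pi * r / R r ^ 4) \<partial>lborel)"
  define f where "f r = ennreal (sqrt (2 * pi * r)) * indicator ?I r" for r
  define g where "g r = ennreal (sqrt (2 * pi * r) / (R r)\<^sup>2) * indicator ?I r" for r
  have r0: "0 \<le> 2 * pi * r" if "r \<in> ?I" for r using that by simp
  have fm: "f \<in> borel_measurable lborel" unfolding f_def[abs_def] by measurable
  have gm: "g \<in> borel_measurable lborel" unfolding g_def[abs_def] by measurable
  have fg: "f r * g r = ennreal (2 * pi * r / (R r)\<^sup>2) * indicator ?I r" for r
  proof (cases "r \<in> ?I")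
    case True
    have "sqrt (2 * pi * r) * (sqrt (2 * pi * r) / (R r)\<^sup>2) = 2 * pi * r / (R r)\<^sup>2"
      using real_sqrt_mult_self[of "2 * pi * r"] r0[OF True] by (simp only: times_divide_eq_right abs_of_nonneg)
    then show ?thesis using True r0[OF True] by (simp only: f_def g_def indicator_simps mult_1_right ennreal_mult'[OF real_sqrt_ge_zero, symmetric])
  qed (simp add: f_def g_def)
  have ff: "f r ^ 2 = ennreal (2 * pi * r) * indicator ?I r" for r
  proof (cases "r \<in> ?I")
    case True
    then show ?thesis using r0[OF True] by (simp only: f_def indicator_simps mult_1_right ennreal_power real_sqrt_ge_zero real_sqrt_pow2)
  qed (simp add: f_def)
  have gg: "g r ^ 2 = ennreal (2 * pi * r / R r ^ 4) * indicator ?I r" for r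
  proof (cases "r \<in> ?I")
    case True
    have "0 \<le> sqrt (2 * pi * r) / (R r)\<^sup>2" using r0[OF True] by simp
    moreover have "(sqrt (2 * pi * r) / (R r)\<^sup>2)\<^sup>2 = 2 * pi * r / R r ^ 4"
      unfolding power_divide real_sqrt_pow2[OF r0[OF True]] by (simp add: power_mult[symmetric])
    ultimately show ?thesis using True by (simp only: g_def indicator_simps mult_1_right ennreal_power)
  qed (simp add: g_def)
  have "T\<^sup>2 \<le> (\<integral>\<^sup>+r. ennreal (2 * pi * r) * indicator ?I r \<partial>lborel) * G"
    using Cauchy_Schwarz_nn_integral[OF fm gm] unfolding fg ff gg T_def G_def .
  also have "\<dots> \<le> ennreal (2 * pi * (real m + 2) * 2) * G"
    by (intro mult_right_mono nn_integral_bin_le) auto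
  finally have T2: "T\<^sup>2 \<le> ennreal (2 * pi * (real m + 2) * 2) * G" .
  have B: "circled ?B" "?B \<subseteq> ball 0 (real m + 2)" using circledI[of ?I] by auto
  have "ennreal (D.mean ?B) \<le> ennreal (10 * KU) * T"
    unfolding T_def by (rule mean_radial_le[of ?I "real m + 2"]) (use m half in auto)
  then have "(ennreal (D.mean ?B))\<^sup>2 \<le> (ennreal (10 * KU) * T)\<^sup>2" by (rule power_mono) simp
  also have "\<dots> = ennreal ((10 * KU)\<^sup>2) * T\<^sup>2" using KU_pos by (simp only: power_mult_distrib) (simp add: ennreal_power)
  also have "\<dots> \<le> ennreal ((10 * KU)\<^sup>2) * (ennreal (2 * pi * (real m + 2) * 2) * G)" by (intro mult_left_mono T2) simp
  finally have "ennreal ((D.mean ?B)\<^sup>2) \<le> ennreal ((10 * KU)\<^sup>2) * (ennreal (2 * pi * (real m + 2) * 2) * G)"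
    using D.mean_nonneg[OF B] by (simp only: ennreal_power)
  moreover have "ennreal (D.pair_mean ?B) \<le> ennreal ((D.mean ?B)\<^sup>2)" by (intro ennreal_leI D.pair_mean_le[OF B])
  ultimately have pm: "ennreal (D.pair_mean ?B) \<le> ennreal ((10 * KU)\<^sup>2) * (ennreal (2 * pi * (real m + 2) * 2) * G)" by (rule order_trans[rotated])
  have "ennreal (3 / real m * D.pair_mean ?B) = ennreal (3 / real m) * ennreal (D.pair_mean ?B)"
    by (rule ennreal_mult') simp
  also have "\<dots> \<le> ennreal (3 / real m) * (ennreal ((10 * KU)\<^sup>2) * (ennreal (2 * pi * (real m + 2) * 2) * G))"
    by (intro mult_left_mono pm) simp
  also have "\<dots> = ennreal (3 / real m * ((10 * KU)\<^sup>2 * (2 * pi * (real m + 2) * 2))) * G"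
  proof -
    have "ennreal (3 / real m * ((10 * KU)\<^sup>2 * (2 * pi * (real m + 2) * 2))) = ennreal (3 / real m) * (ennreal ((10 * KU)\<^sup>2) * ennreal (2 * pi * (real m + 2) * 2))"
      by (subst ennreal_mult', simp, subst ennreal_mult', simp, rule refl)
    then show ?thesis by (simp only: mult.assoc)
  qed
  also have "\<dots> \<le> ennreal (3600 * pi * KU\<^sup>2) * G"
  proof (intro mult_right_mono ennreal_leI)
    have "(real m + 2) / real m \<le> 3" using m by (simp add: field_simps)
    then have "1200 * pi * KU\<^sup>2 * ((real m + 2) / real m) \<le> 1200 * pi * KU\<^sup>2 * 3" by (intro mult_left_mono) auto
    then show "3 / real m * ((10 * KU)\<^sup>2 * (2 * pi * (real m + 2) * 2)) \<le> 3600 * pi * KU\<^sup>2"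
      by (simp add: power2_eq_square field_simps)
  qed simp
  finally show ?thesis by (simp only: G_def)
qed

text \<open>Borel-Cantelli over integer m. Annuli of width 2 starting at every integer are used so
  that any two points whose moduli differ by less than 1 share one; their overlap only doubles the
  total.\<close>

lemma AE_far:
  assumes fin: "(\<integral>\<^sup>+z. ennreal (1 / \<rho> z ^ 4) \<partial>lborel) < \<infinity>"
  shows "AE \<omega> in M. \<exists>m0. \<forall>m\<ge>m0. \<forall>i j. i \<noteq> j \<longrightarrow> X i \<omega> \<in> annulus (real m) 2 \<longrightarrow> X j \<omega> \<in> annulus (real m) 2 \<longrightarrow> \<not> near m (\<theta> i \<omega>) (\<theta> j \<omega>)"
proof -
  have "(1 :: real) / 2 > 0" by simp
  then obtain R3 where R3: "R3 > 0" "\<And>r. r \<ge> R3 \<Longrightarrow> R r \<le> 1 / 2 * r" by (rule R_sublinear) blast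
  define m1 where "m1 = nat \<lceil>R3\<rceil> + 1"
  have m1: "1 \<le> m1" "R3 \<le> real m1" by (auto simp: m1_def) linarith
  let ?F = "\<lambda>r. ennreal (2 * pi * r / R r ^ 4)"
  let ?C = "ennreal (3600 * pi * KU\<^sup>2)"
  \<comment> \<open>Each annulus of width 2 is split into two unit pieces, so the sum over m is two
    sums over disjoint unit intervals.\<close>
  let ?E = "\<lambda>m. (\<integral>\<^sup>+r\<in>{real m..<real m + 1}. ?F r \<partial>lborel)"
  define A where "A m = {\<omega> \<in> space M. \<exists>i j. i \<noteq> j \<and> X i \<omega> \<in> annulus (real m) 2 \<and> X j \<omega> \<in> annulus (real m) 2 \<and> near m (\<theta> i \<omega>) (\<theta> j \<omega>)}" for m
  have A: "A m \<in> sets M" "ennreal (measure M (A m)) \<le> ?C * (?E m + ?E (m + 1))" if "m1 \<le> m" for m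
  proof -
    have m: "1 \<le> m" "0 < m" using that m1 by auto
    have B: "circled (annulus (real m) 2)" "annulus (real m) 2 \<subseteq> ball 0 (real m + 2)" using circledI[of "{real m..<real m + 2}"] by auto
    show "A m \<in> sets M" unfolding A_def by (rule D.prob_near_pair[OF B m(2)])
    have "ennreal (measure M (A m)) \<le> ennreal (3 / real m * D.pair_mean (annulus (real m) 2))"
      unfolding A_def by (intro ennreal_leI D.prob_near_pair[OF B m(2)])
    also have "\<dots> \<le> ?C * (\<integral>\<^sup>+r\<in>{real m..<real m + 2}. ?F r \<partial>lborel)"
    proof (rule pair_mean_annulus_le[OF m(1)])
      fix r assume "real m \<le> r"
      then have "R3 \<le> r" using m1 that by linarith
      then show "R r \<le> r / 2" using R3(2) by simp
    qed
    also have "(\<integral>\<^sup>+r\<in>{real m..<real m + 2}. ?F r \<partial>lborel) \<le> (\<integral>\<^sup>+r. ?F r * indicator {real m..<real m + 1} r + ?F r * indicator {real (m + 1)..<real (m + 1) + 1} r \<partial>lborel)"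
      by (intro nn_integral_mono) (auto simp: indicator_def)
    also have "\<dots> = ?E m + ?E (m + 1)" by (rule nn_integral_add) measurable
    finally show "ennreal (measure M (A m)) \<le> ?C * (?E m + ?E (m + 1))" by (simp add: mult_left_mono)
  qed
  have "(\<Sum>n. ennreal (measure M (A (n + m1)))) \<le> (\<Sum>n. ?C * (?E (n + m1) + ?E (n + (m1 + 1))))"
  proof (intro suminf_le summableI)
    show "ennreal (measure M (A (n + m1))) \<le> ?C * (?E (n + m1) + ?E (n + (m1 + 1)))" for n
      using A(2)[OF le_add2[of m1 n]] by (simp only: add.assoc)
  qed
  also have "\<dots> = ?C * ((\<Sum>n. ?E (n + m1)) + (\<Sum>n. ?E (n + (m1 + 1))))"
    by (simp only: ennreal_suminf_cmult suminf_add[OF summableI summableI])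
  also have "\<dots> \<le> ?C * ((\<integral>\<^sup>+r\<in>{0<..}. ?F r \<partial>lborel) + (\<integral>\<^sup>+r\<in>{0<..}. ?F r \<partial>lborel))"
    using m1(1) by (intro mult_left_mono add_mono suminf_unit_intervals_le) auto
  also have "\<dots> < \<infinity>" using fin unfolding nn_integral_\<rho> by (simp add: ennreal_mult_less_top)
  finally have "(\<Sum>n. ennreal (measure M (A (n + m1)))) \<noteq> \<top>" by simp
  then have "summable (\<lambda>n. measure M (A (n + m1)))" by (intro summable_suminf_not_top) auto
  then have "AE \<omega> in M. eventually (\<lambda>n. \<omega> \<in> space M - A (n + m1)) sequentially"
    using A(1) by (intro borel_cantelli_AE1) (auto simp: D.M.emeasure_eq_measure)
  then show ?thesis
  proof eventually_elim
    case (elim \<omega>)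
    then obtain n0 where n0: "\<And>n. n \<ge> n0 \<Longrightarrow> \<omega> \<in> space M - A (n + m1)" unfolding eventually_sequentially by blast
    have "\<omega> \<in> space M - A m" if "n0 + m1 \<le> m" for m using n0[of "m - m1"] that by simp
    then show ?case unfolding A_def by (intro exI[of _ "n0 + m1"]) blast
  qed
qed

lemma AE_separated:
  assumes fin: "(\<integral>\<^sup>+z. ennreal (1 / \<rho> z ^ 4) \<partial>lborel) < \<infinity>"
  shows "AE \<omega> in M. separated (\<lambda>k. hybrid X \<theta> k \<omega>)"
proof -
  have "AE \<omega> in M. \<forall>n::nat. finite {k. X k \<omega> \<in> ball 0 (real n)}"
    unfolding AE_all_countable by (intro allI D.finite_points)
  then show ?thesis using D.X_inj D.AE_\<theta>_range D.AE_not_near AE_far[OF fin]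
  proof eventually_elim
    case (elim \<omega>)
    obtain m0 where m0: "\<forall>m\<ge>m0. \<forall>i j. i \<noteq> j \<longrightarrow> X i \<omega> \<in> annulus (real m) 2 \<longrightarrow> X j \<omega> \<in> annulus (real m) 2 \<longrightarrow> \<not> near m (\<theta> i \<omega>) (\<theta> j \<omega>)"
      using elim(5) by blast
    show ?case unfolding hybrid_def
    proof (rule separated_polar[of "\<lambda>k. X k \<omega>" "\<lambda>k. \<theta> k \<omega>" m0])
      show "finite {k. X k \<omega> \<in> ball 0 (real n)}" for n using elim(1) by blast
      show "inj (\<lambda>k. X k \<omega>)" by (rule elim(2))
      show "\<theta> k \<omega> \<in> {0..<2 * pi}" for k using elim(3) by blast
      show "\<exists>Q>0. \<not> near Q (\<theta> i \<omega>) (\<theta> j \<omega>)" if "i \<noteq> j" for i j using elim(4) that by blast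
      show "\<not> near m (\<theta> i \<omega>) (\<theta> j \<omega>)" if "m \<ge> m0" "i \<noteq> j" "cmod (X i \<omega>) \<in> {real m..<real m + 2}" "cmod (X j \<omega>) \<in> {real m..<real m + 2}" for m i j
        using m0 that by blast
    qed
  qed
qed

end

section \<open>From the given potential to its radial representative, and the dichotomy\<close>

lemma (in fock_radial) fock_measure_eq_weight:
  assumes \<phi>[measurable]: "\<phi> \<in> borel_measurable borel" and AE: "AE z in lborel. \<phi> z = ereal (U (cmod z))"
  shows "fock_measure \<phi> \<rho> = weight"
  unfolding fock_measure_def weight_def
proof (rule density_cong)
  show "(\<lambda>z. exp_minus_twice (\<phi> z) * ennreal (1 / (\<rho> z)\<^sup>2)) \<in> borel_measurable lborel"
    unfolding exp_minus_twice_def by measurable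
  show "AE z in lborel. exp_minus_twice (\<phi> z) * ennreal (1 / (\<rho> z)\<^sup>2) = ennreal (exp (- 2 * U (cmod z)) / (R (cmod z))\<^sup>2)"
    using AE
  proof eventually_elim
    case (elim z)
    then have "exp_minus_twice (\<phi> z) = ennreal (exp (- 2 * U (cmod z)))" by (simp add: exp_minus_twice_def)
    then show ?case by (simp add: R_cmod ennreal_mult''[symmetric])
  qed
qed measurable

theorem theorem1p1:
  fixes \<phi> :: "complex \<Rightarrow> ereal"
    and \<nu> :: "complex measure"
    and \<rho> :: "complex \<Rightarrow> real"
    and K :: "complex \<Rightarrow> complex \<Rightarrow> complex"
    and M :: "'a measure"
    and \<Lambda> :: "nat \<Rightarrow> 'a \<Rightarrow> complex"
    and \<theta> :: "nat \<Rightarrow> 'a \<Rightarrow> real"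
  assumes "radial \<phi>" and "subharmonic \<phi>"
    and "distributional_laplacian \<phi> \<nu>" and "doubling \<nu>" and "emeasure \<nu> UNIV = \<infinity>"
    and "\<rho> = radius_function \<nu>"
    and "reproducing_kernel (fock_space (fock_measure \<phi> \<rho>)) (fock_measure \<phi> \<rho>) K"
    and "prob_space M"
    and "determinantal_process M \<Lambda> K (fock_measure \<phi> \<rho>)"
    and "iid_uniform_angles M \<theta>"
    and "independent_sequences M \<Lambda> \<theta>"
  shows "measure M {\<omega> \<in> space M. separated (\<lambda>k. hybrid \<Lambda> \<theta> k \<omega>)} =
    (if (\<integral>\<^sup>+ z. ennreal (1 / \<rho> z ^ 4) \<partial>lborel) < \<infinity> then 1 else 0)"
proof -
  obtain C where C: "C > 0" "\<And>z r. r > 0 \<Longrightarrow> emeasure \<nu> (ball z (2 * r)) \<le> ennreal C * emeasure \<nu> (ball z r)"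
    using assms(4) unfolding doubling_def by blast
  have \<nu>: "sets \<nu> = sets borel" "\<And>A. compact A \<Longrightarrow> emeasure \<nu> A < \<infinity>" "emeasure \<nu> UNIV \<noteq> 0"
    using assms(4) unfolding doubling_def locally_finite_borel_measure_def by blast+
  interpret P: fock_potential \<nu> C \<phi>
    by unfold_locales (use \<nu> C assms(1-5) in auto)
  show ?thesis
  proof (rule P.potential_formula)
    fix U :: "real \<Rightarrow> real"
    assume U: "U \<in> borel_measurable borel" "AE z in lborel. \<phi> z = ereal (U (cmod z))"
      "\<And>r s. 0 < r \<Longrightarrow> r \<le> s \<Longrightarrow> P.m 0 r / (2 * pi) * ln (s / r) \<le> U s - U r"
      "\<And>r s. 0 < r \<Longrightarrow> r \<le> s \<Longrightarrow> U s - U r \<le> P.m 0 s / (2 * pi) * ln (s / r)"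
    interpret F: fock_radial \<nu> C U
      by unfold_locales (fact U)+
    \<comment> \<open>The kernel and the process are given for the measure built from \<phi>;
      equality of measures, not just comparability, lets every hypothesis be restated for
      \<open>F.weight\<close>.\<close>
    have \<mu>: "fock_measure \<phi> \<rho> = F.weight"
      unfolding assms(6) by (rule F.fock_measure_eq_weight[OF subharmonic_measurable[OF assms(2)] U(2)])
    interpret fock_process \<nu> C U K M \<Lambda> \<theta>
    proof (intro fock_process.intro fock_process_axioms.intro F.fock_radial_axioms hybrid_process.intro
        determinantal_moments.intro determinantal_moments_axioms.intro hybrid_process_axioms.intro F.radial_moments_weight)
    qed (use assms(7-11) in \<open>simp_all add: \<mu>\<close>)
    show ?thesis
    proof (cases "(\<integral>\<^sup>+ z. ennreal (1 / \<rho> z ^ 4) \<partial>lborel) < \<infinity>")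
      case True
      then have "AE \<omega> in M. separated (\<lambda>k. hybrid \<Lambda> \<theta> k \<omega>)" unfolding assms(6) by (rule AE_separated)
      then have "measure M {\<omega> \<in> space M. separated (\<lambda>k. hybrid \<Lambda> \<theta> k \<omega>)} = 1"
        using D.M.prob_Collect_eq_1[OF D.separated_sets] by simp
      then show ?thesis using True by simp
    next
      case False
      then have "(\<integral>\<^sup>+ z. ennreal (1 / \<rho> z ^ 4) \<partial>lborel) = \<infinity>" by (simp add: top.not_eq_extremum[symmetric])
      then have "AE \<omega> in M. \<not> separated (\<lambda>k. hybrid \<Lambda> \<theta> k \<omega>)" unfolding assms(6) by (rule AE_not_separated)
      then have "measure M {\<omega> \<in> space M. separated (\<lambda>k. hybrid \<Lambda> \<theta> k \<omega>)} = 0"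
        using D.M.prob_Collect_eq_0[OF D.separated_sets] by simp
      then show ?thesis using False by simp
    qed
  qed
qed

end
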